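(* Let $(u,u_y)\in\mathsf{Pot}$ be given, $M(\lambda)$ the monodromy associated to $(u,u_y)$, $\Delta:=\operatorname{tr}M(\lambda)$, and $(\Sigma,D)$ the spectral data of $(u,u_y)$; assume that the support of $D$ contains only regular points of $\Sigma$. (1) The function $\Delta^2-4$ has asymptotically and totally exactly two zeros in every $S_k$ (counted with multiplicities). These zeros are (the $\lambda$-coordinates of) the branch points, respectively the singularities, of $\Sigma$. It is thus possible to enumerate the zeros of $\Delta^2-4$ by two sequences $(\varkappa_{k,1})_{k\in\mathbb{Z}}$ and $(\varkappa_{k,2})_{k\in\mathbb{Z}}$ such that $\varkappa_{k,\nu}\in S_k$ for $|k|$ large and $\nu\in\{1,2\}$, and then $$(\varkappa_{k,\nu}-\lambda_{k,0})_{k\in\mathbb{Z}}\in\ell^2_{-1,3}\qquad\text{for }\nu\in\{1,2\}.$$ (2) There is asymptotically and totally exactly one point $(\lambda_*,\mu_* )$ in the support of $D$ with $\lambda_*\in S_k$ (counted with multiplicity). It is thus possible to enumerate the support of $D$ by a sequence $(\lambda_k,\mu_k)_{k\in\mathbb{Z}}$ such that $\lambda_k\in S_k$ for $|k|$ large, and then $$(\lambda_k-\lambda_{k,0})_{k\in\mathbb{Z}}\in\ell^2_{-1,3}\quad\text{and}\quad(\mu_k-\mu_{k,0})_{k\in\mathbb{Z}}\in\ell^2 .$$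
   Context: Potentials: $\mathsf{Pot}:=\{(u,u_y)\in W^{1,2}([0,1])\times L^2([0,1]) \mid u(0)=u(1)\}$, complex-valued functions; $u_y$ is an independent function. Monodromy: for $\lambda\in\mathbb{C}^*$ put $$\alpha_\lambda=\frac14\begin{pmatrix} i\,u_y & -e^{u/2}-\lambda^{-1}e^{-u/2}\\ e^{u/2}+\lambda e^{-u/2} & -i\,u_y\end{pmatrix}dx ,$$ let $F_\lambda$ solve $dF_\lambda=\alpha_\lambda F_\lambda$ on $[0,1]$ with $F_\lambda(0)=\mathbf 1$, and $M(\lambda):=F_\lambda(1)=\begin{pmatrix} a(\lambda) & b(\lambda)\\ c(\lambda) & d(\lambda)\end{pmatrix}\in\mathrm{SL}(2,\mathbb{C})$, holomorphic in $\lambda\in\mathbb{C}^*$. Spectral data: the spectral curve is $\Sigma=\{(\lambda,\mu)\in\mathbb{C}^*\times\mathbb{C}\mid \mu^2-\Delta(\lambda)\mu+1=0\}$. It is hyperelliptic over $\mathbb{C}^*$, with branch points at the zeros of $\Delta^2-4$ of odd order and singularities at the zeros of order $\ge2$. The spectral divisor $D$ is the divisor of the eigenline bundle of $M(\lambda)$ on $\Sigma$, i.e. the polar divisor of the meromorphic function $\frac{\mu-d}{c}$ on $\Sigma$; when its support consists of regular points of $\Sigma$, its support consists exactly of the points $(\lambda_*,\mu_* )$ with $c(\lambda_* )=0$ and $\mu_*=a(\lambda_* )$, the multiplicity of such a point being the order of the zero of $c$ at $\lambda_*$. Notation: $\zeta(\lambda):=\frac14(\lambda^{1/2}+\lambda^{-1/2})$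 (up to sign); for $k\in\mathbb{Z}$, $\lambda_{k,0}:=8\pi^2k^2+4\pi k\sqrt{4\pi^2k^2-1}-1$ and $\mu_{k,0}:=(-1)^k$. For $k>0$, $S_k=\{\lambda\in\mathbb{C}^* : (k-\frac12)\pi\le|\zeta(\lambda)|\le(k+\frac12)\pi,\ |\lambda|>1\}$; $S_0=\{\lambda\in\mathbb{C}^*: |\zeta(\lambda)|\le\frac{\pi}{2}\}$; for $k<0$, $S_k=\{\lambda\in\mathbb{C}^*: (-k-\frac12)\pi\le|\zeta(\lambda)|\le(-k+\frac12)\pi,\ |\lambda|<1\}$. $\ell^2_{n,m}$ is the space of complex sequences $(a_k)_{k\in\mathbb{Z}}$ with $\sum_{k<0}|k^m a_k|^2+|a_0|^2+\sum_{k>0}|k^n a_k|^2<\infty$; $\ell^2=\ell^2_{0,0}$. "There exist asymptotically and totally exactly $m$ points in every $S_k$ with a certain property" means: there is $N\in\mathbb{N}$ such that $S_k$ contains exactly $m$ points with the property for every $k\in\mathbb{Z}$ with $|k|>N$, and $\bigcup_{|k|\le N}S_k$ contains exactly $m(2N+1)$ points with the property. *)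

theory Defs
  imports "HOL-Complex_Analysis.Complex_Analysis"
begin

section \<open>Potentials\<close>

text \<open>Elements of $L^2([0,1])$ and $W^{1,2}([0,1])$ are represented by functions on the real line
  whose values outside $[0,1]$ are irrelevant. A function in $W^{1,2}([0,1])$ is represented by its
  continuous representative, that is, by the indefinite integral of its weak derivative.\<close>

definition L2 :: "(real \<Rightarrow> complex) set" where
  "L2 = {f. f \<in> borel_measurable (lebesgue_on {0..1}) \<and>
            integrable (lebesgue_on {0..1}) (\<lambda>x. (cmod (f x))\<^sup>2)}"

definition W12 :: "(real \<Rightarrow> complex) set" where
  "W12 = {u. \<exists>g\<in>L2. \<forall>x\<in>{0..1}. (g has_integral (u x - u 0)) {0..x}}"

definition Pot :: "((real \<Rightarrow> complex) \<times> (real \<Rightarrow> complex)) set" where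
  "Pot = {(u, uy). u \<in> W12 \<and> uy \<in> L2 \<and> u 0 = u 1}"

section \<open>Monodromy\<close>

definition alpha :: "(real \<Rightarrow> complex) \<Rightarrow> (real \<Rightarrow> complex) \<Rightarrow> complex \<Rightarrow> real \<Rightarrow> complex^2^2" where
  "alpha u uy l x = (1/4) *\<^sub>R vector
     [vector [\<i> * uy x, - exp (u x / 2) - inverse l * exp (- u x / 2)],
      vector [exp (u x / 2) + l * exp (- u x / 2), - \<i> * uy x]]"

text \<open>The coefficients of \<open>alpha\<close> are only integrable in \<open>x\<close>, so the initial value problem is
  understood in the sense of Caratheodory, i.e. as the equivalent integral equation for a
  continuous \<open>F\<close>.\<close>

definition is_frame :: "(real \<Rightarrow> complex) \<Rightarrow> (real \<Rightarrow> complex) \<Rightarrow> complex \<Rightarrow> (real \<Rightarrow> complex^2^2) \<Rightarrow> bool" where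
  "is_frame u uy l F \<longleftrightarrow> continuous_on {0..1} F \<and>
     (\<forall>x\<in>{0..1}. ((\<lambda>t. alpha u uy l t ** F t) has_integral (F x - mat 1)) {0..x})"

definition monodromy :: "(real \<Rightarrow> complex) \<Rightarrow> (real \<Rightarrow> complex) \<Rightarrow> complex \<Rightarrow> complex^2^2" where
  "monodromy u uy l = (THE M. \<exists>F. is_frame u uy l F \<and> M = F 1)"

section \<open>Spectral curve\<close>

definition spectral_curve :: "(complex \<Rightarrow> complex) \<Rightarrow> (complex \<times> complex) set" where
  "spectral_curve \<Delta> = {(l, \<mu>). l \<noteq> 0 \<and> \<mu>\<^sup>2 - \<Delta> l * \<mu> + 1 = 0}"

text \<open>Singularities are the points of the curve at which both partial derivatives of its defining
  function vanish.\<close>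

definition singular_points :: "(complex \<Rightarrow> complex) \<Rightarrow> (complex \<times> complex) set" where
  "singular_points \<Delta> = {(l, \<mu>) \<in> spectral_curve \<Delta>.
     deriv (\<lambda>z. \<mu>\<^sup>2 - \<Delta> z * \<mu> + 1) l = 0 \<and> deriv (\<lambda>w. w\<^sup>2 - \<Delta> l * w + 1) \<mu> = 0}"

text \<open>Branch points are the points over which the two-sheeted covering of the punctured plane by the
  normalisation of the curve ramifies, i.e. the points of the curve through which no local
  holomorphic section passes.\<close>

definition branch_points :: "(complex \<Rightarrow> complex) \<Rightarrow> (complex \<times> complex) set" where
  "branch_points \<Delta> = {(l, \<mu>) \<in> spectral_curve \<Delta>.
     \<not> (\<exists>r m. 0 < r \<and> m holomorphic_on ball l r \<and> m l = \<mu> \<and>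
              (\<forall>z\<in>ball l r. (z, m z) \<in> spectral_curve \<Delta>))}"

section \<open>Spectral divisor\<close>

definition eigen_quotient :: "(complex \<Rightarrow> complex^2^2) \<Rightarrow> complex \<times> complex \<Rightarrow> complex" where
  "eigen_quotient M = (\<lambda>(l, \<mu>). (\<mu> - M l $ 2 $ 2) / (M l $ 2 $ 1))"

definition holomorphic2_on :: "(complex \<times> complex \<Rightarrow> complex) \<Rightarrow> (complex \<times> complex) set \<Rightarrow> bool" where
  "holomorphic2_on g U \<longleftrightarrow>
     (\<forall>p\<in>U. \<exists>A B. (g has_derivative (\<lambda>(h, k). A * h + B * k)) (at p))"

text \<open>A point belongs to the support of the polar divisor iff the germ of \<open>eigen_quotient M\<close> there
  does not lie in the local ring of the curve, i.e. is not the restriction of a holomorphic function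
  of two variables. This also makes sense at singular points of the curve, where it is weaker than
  having a pole on the normalisation: at a point where \<open>M\<close> is \<open>\<plusminus>1\<close> the quotient can be bounded
  without being holomorphic on the curve, and such a point belongs to the support.\<close>

definition divisor_support :: "(complex \<Rightarrow> complex^2^2) \<Rightarrow> (complex \<times> complex) set" where
  "divisor_support M = {p \<in> spectral_curve (\<lambda>l. trace (M l)).
     \<not> (\<exists>U g. open U \<and> p \<in> U \<and> holomorphic2_on g U \<and>
              (\<forall>(l, \<mu>) \<in> U \<inter> spectral_curve (\<lambda>l. trace (M l)).
                 M l $ 2 $ 1 \<noteq> 0 \<longrightarrow> g (l, \<mu>) = eigen_quotient M (l, \<mu>)))}"

text \<open>Multiplicity of the polar divisor at a regular point of the curve: the order of the pole of
  \<open>eigen_quotient M\<close> in a local coordinate \<open>t\<close> of the curve centred at that point. The value does not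
  depend on the coordinate; it is meaningless at singular points.\<close>

definition divisor_mult :: "(complex \<Rightarrow> complex^2^2) \<Rightarrow> complex \<times> complex \<Rightarrow> nat" where
  "divisor_mult M p = (THE n. \<exists>r \<phi> \<psi>. 0 < r \<and> \<phi> holomorphic_on ball 0 r \<and> \<psi> holomorphic_on ball 0 r \<and>
     (\<phi> 0, \<psi> 0) = p \<and> (\<forall>t\<in>ball 0 r. (\<phi> t, \<psi> t) \<in> spectral_curve (\<lambda>l. trace (M l))) \<and>
     (deriv \<phi> 0 \<noteq> 0 \<or> deriv \<psi> 0 \<noteq> 0) \<and>
     n = nat (- zorder (\<lambda>t. eigen_quotient M (\<phi> t, \<psi> t)) 0))"

section \<open>Asymptotic domains and sequence spaces\<close>

text \<open>\<open>zeta\<close> is determined by \<open>\<lambda>\<close> only up to sign; only its modulus is used.\<close>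

definition zeta :: "complex \<Rightarrow> complex" where
  "zeta l = (1/4) * (csqrt l + inverse (csqrt l))"

definition S :: "int \<Rightarrow> complex set" where
  "S k = (if k = 0 then {l. l \<noteq> 0 \<and> cmod (zeta l) \<le> pi / 2}
     else if k > 0 then {l. l \<noteq> 0 \<and> (of_int k - 1/2) * pi \<le> cmod (zeta l) \<and>
                            cmod (zeta l) \<le> (of_int k + 1/2) * pi \<and> cmod l > 1}
     else {l. l \<noteq> 0 \<and> (- of_int k - 1/2) * pi \<le> cmod (zeta l) \<and>
              cmod (zeta l) \<le> (- of_int k + 1/2) * pi \<and> cmod l < 1})"

text \<open>For \<open>k = 0\<close> the square root is multiplied by 0, so its value at \<open>-1\<close> plays no role.\<close>

definition lambda0 :: "int \<Rightarrow> complex" where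
  "lambda0 k = complex_of_real
     (8 * pi\<^sup>2 * (of_int k)\<^sup>2 + 4 * pi * of_int k * sqrt (4 * pi\<^sup>2 * (of_int k)\<^sup>2 - 1) - 1)"

definition mu0 :: "int \<Rightarrow> complex" where
  "mu0 k = (-1) powi k"

text \<open>The term at \<open>k = 0\<close> does not affect convergence.\<close>

definition ell2 :: "int \<Rightarrow> int \<Rightarrow> (int \<Rightarrow> complex) set" where
  "ell2 n m = {a. (\<lambda>k. (cmod (of_int k powi m * a k))\<^sup>2) summable_on {..<0} \<and>
                  (\<lambda>k. (cmod (of_int k powi n * a k))\<^sup>2) summable_on {0<..}}"

section \<open>Counting with multiplicities\<close>

definition Cstar_zeros :: "(complex \<Rightarrow> complex) \<Rightarrow> complex set" where
  "Cstar_zeros f = {l. l \<noteq> 0 \<and> f l = 0}"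

definition zero_mult :: "(complex \<Rightarrow> complex) \<Rightarrow> complex \<Rightarrow> nat" where
  "zero_mult f l = nat (zorder f l)"

definition exactly :: "nat \<Rightarrow> 'a set \<Rightarrow> ('a \<Rightarrow> nat) \<Rightarrow> bool" where
  "exactly m Z mlt \<longleftrightarrow> finite Z \<and> (\<Sum>z\<in>Z. mlt z) = m"

text \<open>The points of \<open>Z\<close>, counted with multiplicity \<open>mlt\<close> and located in the plane by \<open>coord\<close>, are
  asymptotically and totally exactly \<open>m\<close> in every \<open>S k\<close>.\<close>

definition asymptotically_and_totally ::
    "nat \<Rightarrow> 'a set \<Rightarrow> ('a \<Rightarrow> nat) \<Rightarrow> ('a \<Rightarrow> complex) \<Rightarrow> bool" where
  "asymptotically_and_totally m Z mlt coord \<longleftrightarrow> (\<exists>N::nat.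
     (\<forall>k::int. \<bar>k\<bar> > int N \<longrightarrow> exactly m {z \<in> Z. coord z \<in> S k} mlt) \<and>
     exactly (m * (2 * N + 1)) {z \<in> Z. coord z \<in> (\<Union>k\<in>{- int N..int N}. S k)} mlt)"

text \<open>The family \<open>x\<close> on \<open>I\<close> lists every point of \<open>Z\<close> as often as its multiplicity, and nothing else.\<close>

definition enumerates :: "'i set \<Rightarrow> ('i \<Rightarrow> 'a) \<Rightarrow> 'a set \<Rightarrow> ('a \<Rightarrow> nat) \<Rightarrow> bool" where
  "enumerates I x Z mlt \<longleftrightarrow> x ` I \<subseteq> Z \<and>
     (\<forall>z\<in>Z. finite {i \<in> I. x i = z} \<and> card {i \<in> I. x i = z} = mlt z)"

definition zeros_enumeration :: "(complex \<Rightarrow> complex) \<Rightarrow> (int \<Rightarrow> nat \<Rightarrow> complex) \<Rightarrow> bool" where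
  "zeros_enumeration f \<kappa> \<longleftrightarrow>
     enumerates (UNIV \<times> {1, 2}) (\<lambda>(k, \<nu>). \<kappa> k \<nu>) (Cstar_zeros f) (zero_mult f) \<and>
     (\<exists>K::nat. \<forall>k. \<bar>k\<bar> > int K \<longrightarrow> (\<forall>\<nu>\<in>{1, 2}. \<kappa> k \<nu> \<in> S k))"

definition divisor_enumeration :: "(complex \<Rightarrow> complex^2^2) \<Rightarrow> (int \<Rightarrow> complex \<times> complex) \<Rightarrow> bool" where
  "divisor_enumeration M p \<longleftrightarrow>
     enumerates UNIV p (divisor_support M) (divisor_mult M) \<and>
     (\<exists>K::nat. \<forall>k. \<bar>k\<bar> > int K \<longrightarrow> fst (p k) \<in> S k)"

end

theory Submission
  imports Defs
begin

text \<open>Write \<open>\<lambda> = s\<^sup>2\<close> and \<open>\<zeta> = (s + 1/s)/4\<close>. A diagonal gauge transformation turns the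
  linear system into an AKNS system with spectral parameter \<open>\<zeta>\<close> and a potential \<open>v\<close> that is merely in
  \<open>L\<^sup>2\<close>, up to a term of order \<open>1/s\<close>. By Gronwall's inequality the deviation of its solutions from those
  for \<open>v = 0\<close> is controlled by the oscillatory integrals of \<open>v(t) exp(-2 \<i> \<zeta> t)\<close>. These tend to
  \<open>0\<close> uniformly as \<open>\<zeta>\<close> tends to infinity, and by Bessel's inequality they are square summable along any
  sequence at bounded distance from \<open>k \<pi>\<close>.

  Hence \<open>c\<close> and \<open>\<Delta>\<^sup>2 - 4\<close> are close to constant multiples of \<open>s sin \<zeta>\<close> and \<open>- 4 sin\<^sup>2 \<zeta>\<close>,
  whose zeros are the points \<open>lambda0 k\<close>. Rouche's theorem on circles between these points gives the
  numbers of zeros, and since \<open>\<bar>sin \<zeta>\<bar>\<close> is small at a zero, the zeros are square summably close to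
  \<open>lambda0 k\<close>. The symmetry \<open>(u, \<lambda>) \<mapsto> (- u, 1/\<lambda>)\<close> reduces small \<open>\<lambda>\<close> to large \<open>\<lambda>\<close>.

  For the divisor, the curve is \<open>(\<mu> - a) (\<mu> - d) = b c\<close>, so the quotient \<open>(\<mu> - d) / c = b / (\<mu> - a)\<close>
  can only be singular where \<open>c = 0\<close> and \<open>\<mu> = a\<close>.\<close>

text \<open>Since \<open>u'\<close> and \<open>uy\<close> are merely square-integrable, the
  oscillatory integrals have no rate of decay in zeta; only their squares are summable over the
  strips. Gronwall is therefore run on squares with square-integrable kernels, and the bounds keep
  an integral over x, to which Bessel's inequality applies. The zeros of Delta^2 - 4 come in pairs:
  an error delta in this function would only confine them to distance sqrt delta, which destroys
  square summability. The determinant gives Delta^2 - 4 = (a - d)^2 + 4 b c, whose distance from -4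
  sin^2 zeta is O(delta^2 + delta |sin zeta|). Zeros accumulate at 0 and at infinity, so they are
  counted in annuli. Near infinity c resembles \<open>exp (- u 0 / 2)\<close> times its vacuum
  value, near 0 \<open>exp (u 0 / 2)\<close> times it, and no single multiple fits both boundary
  circles. The comparison is made for logarithmic derivatives, which ignore constant factors, on
  each circle separately. The domains \<open>S k\<close> are bounded by level curves of |zeta|, not
  by circles. The count passes from annuli to \<open>S k\<close> because each zero far out already
  lies near some \<open>lambda0 k\<close>.\<close>

no_notation fps_nth (infixl "$" 75)

section \<open>Square-integrable and absolutely continuous functions\<close>

lemma L2_square_integrable:
  assumes "f \<in> L2"
  shows "(\<lambda>x. (cmod (f x))\<^sup>2) absolutely_integrable_on {0..1}"
  using assms by (simp add: L2_def integrable_restrict_space set_integrable_def)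

lemma L2_measurable: "f \<in> L2 \<Longrightarrow> f \<in> borel_measurable (lebesgue_on {0..1})"
  by (simp add: L2_def)

lemma absolutely_integrable_mult_L2:
  assumes "f \<in> L2" "g \<in> L2"
  shows "(\<lambda>x. f x * g x) absolutely_integrable_on {0..1}"
proof -
  have "integrable (lebesgue_on {0..1}) (\<lambda>x. f x * g x)"
  proof (rule Bochner_Integration.integrable_bound)
    show "integrable (lebesgue_on {0..1}) (\<lambda>x. (cmod (f x))\<^sup>2 + (cmod (g x))\<^sup>2)"
      using assms by (simp add: L2_def)
    show "(\<lambda>x. f x * g x) \<in> borel_measurable (lebesgue_on {0..1})"
      using assms[THEN L2_measurable] by measurable
    have "2 * (cmod (f x) * cmod (g x)) \<le> (cmod (f x))\<^sup>2 + (cmod (g x))\<^sup>2" for x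
      using zero_le_power2[of "cmod (f x) - cmod (g x)"] by (simp add: power2_diff)
    then have "cmod (f x * g x) \<le> (cmod (f x))\<^sup>2 + (cmod (g x))\<^sup>2" for x
      by (smt (verit, best) mult_nonneg_nonneg norm_ge_zero norm_mult)
    then show "AE x in lebesgue_on {0..1}. norm (f x * g x) \<le> norm ((cmod (f x))\<^sup>2 + (cmod (g x))\<^sup>2)"
      by simp
  qed
  then show ?thesis by (simp add: integrable_restrict_space set_integrable_def)
qed

lemma continuous_in_L2:
  assumes "continuous_on {0..1} f"
  shows "f \<in> L2"
proof -
  have "continuous_on {0..1} (\<lambda>x. (cmod (f x))\<^sup>2)"
    by (intro continuous_intros assms)
  then have "(\<lambda>x. (cmod (f x))\<^sup>2) absolutely_integrable_on {0..1}"
    by (rule absolutely_integrable_continuous_real)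
  then show ?thesis
    using continuous_imp_measurable_on_sets_lebesgue[OF assms]
    by (simp add: L2_def integrable_restrict_space set_integrable_def)
qed

lemma L2_absolutely_integrable:
  assumes "f \<in> L2"
  shows "f absolutely_integrable_on {0..1}"
  using absolutely_integrable_mult_L2[OF assms continuous_in_L2[of "\<lambda>_. 1"]] by simp

lemma L2_mult_continuous:
  assumes "f \<in> L2" and g: "continuous_on {0..1} g"
  shows "(\<lambda>x. f x * g x) \<in> L2"
proof -
  obtain B where B: "\<And>x. x \<in> {0..1} \<Longrightarrow> cmod (g x) \<le> B"
    using compact_continuous_image[OF g compact_Icc] compact_imp_bounded
    by (meson bounded_iff imageI)
  have m: "(\<lambda>x. f x * g x) \<in> borel_measurable (lebesgue_on {0..1})"
    using L2_measurable[OF assms(1)] continuous_imp_measurable_on_sets_lebesgue[OF g] by simp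
  have "integrable (lebesgue_on {0..1}) (\<lambda>x. (cmod (f x * g x))\<^sup>2)"
  proof (rule Bochner_Integration.integrable_bound)
    show "integrable (lebesgue_on {0..1}) (\<lambda>x. B\<^sup>2 * (cmod (f x))\<^sup>2)"
      using assms by (simp add: L2_def)
    show "(\<lambda>x. (cmod (f x * g x))\<^sup>2) \<in> borel_measurable (lebesgue_on {0..1})"
      using m by measurable
    have "(cmod (f x * g x))\<^sup>2 \<le> B\<^sup>2 * (cmod (f x))\<^sup>2" if "x \<in> {0..1}" for x
      using mult_right_mono[OF power_mono[OF B[OF that] norm_ge_zero, of 2], of "(cmod (f x))\<^sup>2"]
      by (simp add: norm_mult power_mult_distrib mult.commute)
    then show "AE x in lebesgue_on {0..1}. norm ((cmod (f x * g x))\<^sup>2) \<le> norm (B\<^sup>2 * (cmod (f x))\<^sup>2)"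
      by (auto intro!: AE_I2 simp: space_restrict_space)
  qed
  with m show ?thesis by (simp add: L2_def)
qed

lemma L2_continuous_mult:
  assumes "continuous_on {0..1} g" "f \<in> L2"
  shows "(\<lambda>x. g x * f x) \<in> L2"
proof -
  have "(\<lambda>x. g x * f x) = (\<lambda>x. f x * g x)" by (rule ext) (rule mult.commute)
  then show ?thesis using L2_mult_continuous[OF assms(2,1)] by metis
qed

lemma L2_cmult: "f \<in> L2 \<Longrightarrow> (\<lambda>x. c * f x) \<in> L2"
  by (rule L2_continuous_mult) auto

lemma L2_add:
  assumes "f \<in> L2" "g \<in> L2"
  shows "(\<lambda>x. f x + g x) \<in> L2"
proof -
  have m: "(\<lambda>x. f x + g x) \<in> borel_measurable (lebesgue_on {0..1})"
    using assms[THEN L2_measurable] by measurable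
  have "integrable (lebesgue_on {0..1}) (\<lambda>x. (cmod (f x + g x))\<^sup>2)"
  proof (rule Bochner_Integration.integrable_bound)
    show "integrable (lebesgue_on {0..1}) (\<lambda>x. 2 * (cmod (f x))\<^sup>2 + 2 * (cmod (g x))\<^sup>2)"
      using assms by (simp add: L2_def)
    show "(\<lambda>x. (cmod (f x + g x))\<^sup>2) \<in> borel_measurable (lebesgue_on {0..1})"
      using m by measurable
    have "(cmod (f x + g x))\<^sup>2 \<le> (cmod (f x) + cmod (g x))\<^sup>2" for x
      by (intro power_mono norm_triangle_ineq) auto
    also have "(cmod (f x) + cmod (g x))\<^sup>2 \<le> 2 * (cmod (f x))\<^sup>2 + 2 * (cmod (g x))\<^sup>2" for x
      using zero_le_power2[of "cmod (f x) - cmod (g x)"] by (simp add: power2_diff power2_sum)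
    finally show "AE x in lebesgue_on {0..1}. norm ((cmod (f x + g x))\<^sup>2)
        \<le> norm (2 * (cmod (f x))\<^sup>2 + 2 * (cmod (g x))\<^sup>2)"
      by simp
  qed
  with m show ?thesis by (simp add: L2_def)
qed

lemma L2_diff:
  assumes "f \<in> L2" "g \<in> L2"
  shows "(\<lambda>x. f x - g x) \<in> L2"
  using L2_add[OF assms(1) L2_cmult[OF assms(2), of "-1"]] by simp

lemma L2_cnj:
  assumes "f \<in> L2"
  shows "(\<lambda>x. cnj (f x)) \<in> L2"
proof -
  have "(\<lambda>x. cnj (f x)) \<in> borel_measurable (lebesgue_on {0..1})"
    using measurable_compose[OF L2_measurable[OF assms] borel_measurable_continuous_onI[OF continuous_on_cnj[OF continuous_on_id]]]
    by simp
  then show ?thesis using assms by (simp add: L2_def)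
qed

lemma L2_indicator:
  assumes "f \<in> L2"
  shows "(\<lambda>t. if t \<le> x then f t else 0) \<in> L2"
proof -
  have "(\<lambda>t. if t \<le> x then f t else 0) \<in> borel_measurable (lebesgue_on {0..1})"
    using L2_measurable[OF assms]
  proof (intro measurable_If)
    have "{t \<in> space (lebesgue_on {0..1}). t \<le> x} = {..x} \<inter> {0..1}"
      by (auto simp: space_restrict_space)
    then show "{t \<in> space (lebesgue_on {0..1}). t \<le> x} \<in> sets (lebesgue_on {0..1})"
      by (auto simp: sets_restrict_space_iff)
  qed auto
  moreover have "integrable (lebesgue_on {0..1}) (\<lambda>t. (cmod (if t \<le> x then f t else 0))\<^sup>2)"
  proof (rule Bochner_Integration.integrable_bound)
    show "integrable (lebesgue_on {0..1}) (\<lambda>x. (cmod (f x))\<^sup>2)"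
      using assms by (simp add: L2_def)
    show "(\<lambda>t. (cmod (if t \<le> x then f t else 0))\<^sup>2) \<in> borel_measurable (lebesgue_on {0..1})"
      using calculation by measurable
  qed auto
  ultimately show ?thesis by (simp add: L2_def)
qed

lemma L2_cmod:
  assumes "f \<in> L2"
  shows "(\<lambda>x. complex_of_real (cmod (f x))) \<in> L2"
  using assms measurable_compose[OF L2_measurable[OF assms], of "\<lambda>z. complex_of_real (cmod z)" borel]
  by (simp add: L2_def)

lemma L2_integrable:
  assumes "f \<in> L2" "0 \<le> a" "b \<le> 1"
  shows "f integrable_on {a..b}" "(\<lambda>x. cmod (f x)) integrable_on {a..b}"
    "(\<lambda>x. (cmod (f x))\<^sup>2) integrable_on {a..b}"
proof -
  have s: "{a..b} \<subseteq> {0..1}" using assms by auto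
  show "f integrable_on {a..b}" "(\<lambda>x. cmod (f x)) integrable_on {a..b}"
    using absolutely_integrable_on_subinterval[OF L2_absolutely_integrable[OF assms(1)] s]
    by (auto simp: absolutely_integrable_on_def)
  show "(\<lambda>x. (cmod (f x))\<^sup>2) integrable_on {a..b}"
    using absolutely_integrable_on_subinterval[OF L2_square_integrable[OF assms(1)] s]
    by (auto simp: absolutely_integrable_on_def)
qed

lemma L2_mult_integrable:
  assumes "f \<in> L2" "g \<in> L2" "0 \<le> a" "b \<le> 1"
  shows "(\<lambda>x. f x * g x) integrable_on {a..b}" "(\<lambda>x. cmod (f x) * cmod (g x)) integrable_on {a..b}"
proof -
  have "{a..b} \<subseteq> {0..1}" using assms by auto
  from absolutely_integrable_on_subinterval[OF absolutely_integrable_mult_L2[OF assms(1,2)] this]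
  show "(\<lambda>x. f x * g x) integrable_on {a..b}" "(\<lambda>x. cmod (f x) * cmod (g x)) integrable_on {a..b}"
    by (auto simp: absolutely_integrable_on_def norm_mult)
qed

text \<open>The polynomial in \<open>r\<close> obtained by integrating
  \<open>(cmod (f t) - r * cmod (g t))\<^sup>2\<close> is nonnegative; its value at the minimum
  \<open>r = H / G\<close> gives the inequality. If \<open>G = 0\<close> it is affine in
  \<open>r\<close>, which forces \<open>H = 0\<close>.\<close>

lemma Cauchy_Schwarz_L2:
  assumes f: "f \<in> L2" and g: "g \<in> L2" and ab: "0 \<le> a" "b \<le> 1"
  shows "(integral {a..b} (\<lambda>t. cmod (f t) * cmod (g t)))\<^sup>2
    \<le> integral {a..b} (\<lambda>t. (cmod (f t))\<^sup>2) * integral {a..b} (\<lambda>t. (cmod (g t))\<^sup>2)"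
proof -
  define F G H where "F = integral {a..b} (\<lambda>t. (cmod (f t))\<^sup>2)"
    and "G = integral {a..b} (\<lambda>t. (cmod (g t))\<^sup>2)"
    and "H = integral {a..b} (\<lambda>t. cmod (f t) * cmod (g t))"
  have q: "0 \<le> F - 2 * r * H + r\<^sup>2 * G" for r
  proof -
    have "((\<lambda>t. (cmod (f t))\<^sup>2 - 2 * r * (cmod (f t) * cmod (g t)) + r\<^sup>2 * (cmod (g t))\<^sup>2)
        has_integral (F - 2 * r * H + r\<^sup>2 * G)) {a..b}"
      unfolding F_def G_def H_def
      by (intro has_integral_add has_integral_diff has_integral_mult_right integrable_integral
          L2_integrable L2_mult_integrable f g ab)
    moreover have "(cmod (f t))\<^sup>2 - 2 * r * (cmod (f t) * cmod (g t)) + r\<^sup>2 * (cmod (g t))\<^sup>2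
        = (cmod (f t) - r * cmod (g t))\<^sup>2" for t
      by (simp add: power2_diff power_mult_distrib)
    ultimately show ?thesis
      using has_integral_nonneg[of "\<lambda>t. (cmod (f t) - r * cmod (g t))\<^sup>2"] by simp
  qed
  have "G \<ge> 0" unfolding G_def by (intro integral_nonneg L2_integrable g ab) auto
  show ?thesis
  proof (cases "G = 0")
    case True
    have "H = 0"
    proof (rule ccontr)
      assume "H \<noteq> 0"
      \<comment> \<open>At this \<open>r\<close> the affine function \<open>F - 2 * r * H\<close>
        takes the value -1.\<close>
      with q[of "(F + 1) / (2 * H)"] True show False by simp
    qed
    then show ?thesis using True by (simp add: F_def[symmetric] G_def[symmetric] H_def[symmetric])
  next
    case False
    with \<open>G \<ge> 0\<close> have "G > 0" by simp
    have "0 \<le> F - H\<^sup>2 / G"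
      using q[of "H / G"] \<open>G > 0\<close> by (simp add: power2_eq_square field_simps)
    then show ?thesis
      using \<open>G > 0\<close> by (simp add: F_def[symmetric] G_def[symmetric] H_def[symmetric] field_simps)
  qed
qed

lemma integral_norm_squared_le_L2:
  assumes f: "f \<in> L2" and ab: "0 \<le> a" "a \<le> b" "b \<le> 1"
  shows "(integral {a..b} (\<lambda>t. cmod (f t)))\<^sup>2 \<le> (b - a) * integral {a..b} (\<lambda>t. (cmod (f t))\<^sup>2)"
  using Cauchy_Schwarz_L2[OF f continuous_in_L2[of "\<lambda>_. 1"], of a b] ab by (simp add: mult.commute)

text \<open>As the interval shrinks to a point, \<open>integral {a..b} h\<close> tends to 0 by
  continuity of the indefinite integral. The increments are thus o(b - a), and the derivative is 0
  at every point, not merely almost everywhere.\<close>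

lemma constant_if_local_increments_small:
  fixes \<Phi> :: "real \<Rightarrow> complex"
  assumes h: "h integrable_on {0..1}"
    and \<Phi>: "\<And>a b. 0 \<le> a \<Longrightarrow> a \<le> b \<Longrightarrow> b \<le> 1 \<Longrightarrow> cmod (\<Phi> b - \<Phi> a) \<le> (b - a) * integral {a..b} h"
    and x: "x \<in> {0..1}"
  shows "\<Phi> x = \<Phi> 0"
proof -
  define H where "H x = integral {0..x} h" for x
  have cH: "continuous_on {0..1} H"
    unfolding H_def by (rule indefinite_integral_continuous_1[OF h])
  have eq: "integral {a..b} h = H b - H a" if "0 \<le> a" "a \<le> b" "b \<le> 1" for a b
    using Henstock_Kurzweil_Integration.integral_combine[of 0 a b h] that
      integrable_on_subinterval[OF h, of 0 b]
    by (simp add: H_def)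
  have inc: "cmod (\<Phi> b - \<Phi> a) \<le> \<bar>b - a\<bar> * \<bar>H b - H a\<bar>" if "a \<in> {0..1}" "b \<in> {0..1}" for a b
  proof (cases "a \<le> b")
    case True
    have "cmod (\<Phi> b - \<Phi> a) \<le> (b - a) * (H b - H a)"
      using \<Phi>[of a b] eq[of a b] that True by simp
    also have "\<dots> \<le> \<bar>b - a\<bar> * \<bar>H b - H a\<bar>" by (metis abs_ge_self abs_mult)
    finally show ?thesis .
  next
    case False
    have "cmod (\<Phi> a - \<Phi> b) \<le> (a - b) * (H a - H b)"
      using \<Phi>[of b a] eq[of b a] that False by simp
    also have "\<dots> \<le> \<bar>a - b\<bar> * \<bar>H a - H b\<bar>" by (metis abs_ge_self abs_mult)
    finally show ?thesis by (simp add: norm_minus_commute abs_minus_commute)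
  qed
  have "(\<Phi> has_derivative (\<lambda>_. 0)) (at a within {0..1})" if a: "a \<in> {0..1}" for a
    unfolding has_derivative_iff_norm
  proof (intro conjI)
    have "((\<lambda>y. \<bar>H y - H a\<bar>) \<longlongrightarrow> \<bar>H a - H a\<bar>) (at a within {0..1})"
      using cH a by (intro tendsto_intros) (auto simp: continuous_on_def)
    then have lim: "((\<lambda>y. \<bar>H y - H a\<bar>) \<longlongrightarrow> 0) (at a within {0..1})" by simp
    show "((\<lambda>y. norm (\<Phi> y - \<Phi> a - 0) / norm (y - a)) \<longlongrightarrow> 0) (at a within {0..1})"
    proof (rule tendsto_sandwich[OF _ _ tendsto_const lim])
      show "\<forall>\<^sub>F y in at a within {0..1}. norm (\<Phi> y - \<Phi> a - 0) / norm (y - a) \<le> \<bar>H y - H a\<bar>"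
        unfolding eventually_at_filter
      proof (rule eventuallyI, intro impI)
        fix y assume "y \<noteq> a" "y \<in> {0..1}"
        then show "norm (\<Phi> y - \<Phi> a - 0) / norm (y - a) \<le> \<bar>H y - H a\<bar>"
          using inc[OF a, of y] by (simp add: divide_le_eq mult.commute)
      qed
    qed simp
  qed simp
  then obtain c where "\<And>y. y \<in> {0..1} \<Longrightarrow> \<Phi> y = c"
    using has_derivative_zero_constant[of "{0..1::real}" \<Phi>] by auto
  then show ?thesis using x by simp
qed

text \<open>The space \<open>W12\<close> with the weak derivative as a visible second argument.
  Square integrability of \<open>g\<close> makes a product of two increments at most the interval
  length times an integral, which drives the calculus rules below.\<close>

definition ac2 :: "(real \<Rightarrow> complex) \<Rightarrow> (real \<Rightarrow> complex) \<Rightarrow> bool" where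
  "ac2 y g \<longleftrightarrow> g \<in> L2 \<and> (\<forall>x\<in>{0..1}. (g has_integral (y x - y 0)) {0..x})"

lemma ac2_L2: "ac2 y g \<Longrightarrow> g \<in> L2"
  by (simp add: ac2_def)

lemma ac2_has_integral:
  assumes "ac2 y g" "0 \<le> a" "a \<le> b" "b \<le> 1"
  shows "(g has_integral (y b - y a)) {a..b}"
proof -
  have g: "g integrable_on {a..b}"
    using L2_integrable(1)[OF ac2_L2[OF assms(1)]] assms by simp
  have i: "integral {0..x} g = y x - y 0" if "x \<in> {0..1}" for x
    using assms(1) that by (auto simp: ac2_def intro: integral_unique)
  have "integral {0..a} g + integral {a..b} g = integral {0..b} g"
    using assms L2_integrable(1)[OF ac2_L2[OF assms(1)]]
    by (intro Henstock_Kurzweil_Integration.integral_combine) auto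
  then have "integral {a..b} g = y b - y a" using i[of a] i[of b] assms by (simp add: algebra_simps)
  then show ?thesis using g by (simp add: has_integral_integrable_integral)
qed

lemma ac2_continuous:
  assumes "ac2 y g" shows "continuous_on {0..1} y"
proof -
  have "continuous_on {0..1} (\<lambda>x. integral {0..x} g)"
    using L2_integrable(1)[OF ac2_L2[OF assms], of 0 1] by (intro indefinite_integral_continuous_1) simp
  then have "continuous_on {0..1} (\<lambda>x. integral {0..x} g + y 0)" by (intro continuous_intros)
  moreover have "integral {0..x} g + y 0 = y x" if "x \<in> {0..1}" for x
    using assms that integral_unique[of g "y x - y 0" "{0..x}"] by (simp add: ac2_def)
  ultimately show ?thesis by (rule continuous_on_eq)
qed

lemma ac2_increment:
  assumes "ac2 y g" "0 \<le> a" "a \<le> b" "b \<le> 1"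
  shows "cmod (y b - y a) \<le> integral {a..b} (\<lambda>t. cmod (g t))"
proof -
  have "integral {a..b} g = y b - y a" using ac2_has_integral[OF assms] by (rule integral_unique)
  moreover have "cmod (integral {a..b} g) \<le> integral {a..b} (\<lambda>t. cmod (g t))"
    using assms by (intro integral_norm_bound_integral L2_integrable ac2_L2[OF assms(1)]) auto
  ultimately show ?thesis by simp
qed

lemma ac2_increment_mono:
  assumes "ac2 y g" "0 \<le> a" "b \<le> 1" "s \<in> {a..b}" "t \<in> {a..b}"
  shows "cmod (y s - y t) \<le> integral {a..b} (\<lambda>t. cmod (g t))"
proof -
  have *: "cmod (y q - y p) \<le> integral {a..b} (\<lambda>t. cmod (g t))" if "a \<le> p" "p \<le> q" "q \<le> b" for p q
  proof -
    have "cmod (y q - y p) \<le> integral {p..q} (\<lambda>t. cmod (g t))"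
      using assms that by (intro ac2_increment) auto
    also have "\<dots> \<le> integral {a..b} (\<lambda>t. cmod (g t))"
      using assms that L2_integrable(2)[OF ac2_L2[OF assms(1)]] by (intro integral_subset_le) auto
    finally show ?thesis .
  qed
  show ?thesis
    using *[of s t] *[of t s] assms by (cases "s \<le> t") (auto simp: norm_minus_commute)
qed

text \<open>The difference of \<open>y\<close> and the primitive of \<open>g\<close> has increments
  covered by \<open>constant_if_local_increments_small\<close>. It thus suffices to control the
  first-order error on short intervals; the product and exponential rules are proved in this
  way.\<close>

lemma ac2I_increments:
  assumes g: "g \<in> L2" and h: "h integrable_on {0..1}"
    and b: "\<And>a b. 0 \<le> a \<Longrightarrow> a \<le> b \<Longrightarrow> b \<le> 1 \<Longrightarrow>
      cmod (y b - y a - integral {a..b} g) \<le> (b - a) * integral {a..b} h"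
  shows "ac2 y g"
proof -
  define \<Phi> where "\<Phi> x = y x - integral {0..x} g" for x
  have "\<Phi> x = \<Phi> 0" if "x \<in> {0..1}" for x
  proof (rule constant_if_local_increments_small[OF h _ that])
    fix a b :: real assume ab: "0 \<le> a" "a \<le> b" "b \<le> 1"
    have "integral {0..a} g + integral {a..b} g = integral {0..b} g"
      using ab L2_integrable(1)[OF g] by (intro Henstock_Kurzweil_Integration.integral_combine) auto
    then have "\<Phi> b - \<Phi> a = y b - y a - integral {a..b} g" by (simp add: \<Phi>_def algebra_simps)
    then show "cmod (\<Phi> b - \<Phi> a) \<le> (b - a) * integral {a..b} h" using b[OF ab] by simp
  qed
  then have *: "y x - integral {0..x} g = y 0 - integral {0..0} g" if "x \<in> {0..1}" for x
    using that unfolding \<Phi>_def by blast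
  have i: "integral {0..x} g = y x - y 0" if "x \<in> {0..1}" for x
    using *[OF that] by (simp add: algebra_simps)
  show ?thesis
    using L2_integrable(1)[OF g] g i by (auto simp: ac2_def has_integral_integrable_integral)
qed

text \<open>The first-order error is the integral of
  \<open>g t * (z b - z t) + (y a - y t) * h t\<close>, hence at most 2 G H \<le> G^2 + H^2 with
  \<open>G\<close>, \<open>H\<close> the integrals of |g|, |h|. By Cauchy-Schwarz each square is at
  most (b - a) times the integral of |g|^2 or |h|^2.\<close>

lemma ac2_mult:
  assumes y: "ac2 y g" and z: "ac2 z h"
  shows "ac2 (\<lambda>x. y x * z x) (\<lambda>x. g x * z x + y x * h x)"
proof (rule ac2I_increments)
  note L = ac2_L2[OF y] ac2_L2[OF z]
  note C = ac2_continuous[OF y] ac2_continuous[OF z]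
  show "(\<lambda>x. g x * z x + y x * h x) \<in> L2"
    by (intro L2_add L2_mult_continuous L2_continuous_mult L C)
  show "(\<lambda>x. (cmod (g x))\<^sup>2 + (cmod (h x))\<^sup>2) integrable_on {0..1}"
    by (intro integrable_add L2_integrable L) auto
  fix a b :: real assume ab: "0 \<le> a" "a \<le> b" "b \<le> 1"
  define G H where "G = integral {a..b} (\<lambda>t. cmod (g t))" and "H = integral {a..b} (\<lambda>t. cmod (h t))"
  have "0 \<le> G" "0 \<le> H"
    unfolding G_def H_def using ab by (auto intro!: integral_nonneg L2_integrable L)
  \<comment> \<open>With \<open>z\<close> frozen at the right end and \<open>y\<close> at the left
    end, the integral is exactly the increment of the product.\<close>
  have i1: "((\<lambda>t. g t * z b + y a * h t) has_integral ((y b - y a) * z b + y a * (z b - z a))) {a..b}"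
    by (intro has_integral_add has_integral_mult_left has_integral_mult_right
        ac2_has_integral[OF y ab] ac2_has_integral[OF z ab])
  have int2: "(\<lambda>x. g x * z x + y x * h x) integrable_on {a..b}"
    using ab by (intro L2_integrable L2_add L2_mult_continuous L2_continuous_mult L C) auto
  have i3: "((\<lambda>t. g t * (z b - z t) + (y a - y t) * h t) has_integral
      (y b * z b - y a * z a - integral {a..b} (\<lambda>x. g x * z x + y x * h x))) {a..b}"
    using has_integral_diff[OF i1 integrable_integral[OF int2]] by (simp add: algebra_simps)
  have "cmod (y b * z b - y a * z a - integral {a..b} (\<lambda>x. g x * z x + y x * h x))
      = cmod (integral {a..b} (\<lambda>t. g t * (z b - z t) + (y a - y t) * h t))"
    using integral_unique[OF i3] by simp
  also have "\<dots> \<le> integral {a..b} (\<lambda>t. cmod (g t) * H + G * cmod (h t))"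
  proof (rule integral_norm_bound_integral)
    show "(\<lambda>t. g t * (z b - z t) + (y a - y t) * h t) integrable_on {a..b}" using i3 by blast
    show "(\<lambda>t. cmod (g t) * H + G * cmod (h t)) integrable_on {a..b}"
      using ab by (intro integrable_add integrable_on_mult_left integrable_on_mult_right L2_integrable(2) L) auto
    fix t assume t: "t \<in> {a..b}"
    have "cmod (z b - z t) \<le> H" "cmod (y a - y t) \<le> G"
      unfolding G_def H_def using ab t by (auto intro!: ac2_increment_mono[OF z] ac2_increment_mono[OF y])
    then show "cmod (g t * (z b - z t) + (y a - y t) * h t) \<le> cmod (g t) * H + G * cmod (h t)"
      by (intro norm_triangle_le add_mono) (auto simp: norm_mult intro: mult_left_mono mult_right_mono)
  qed
  also have "\<dots> = 2 * G * H"
    using ab L2_integrable(2)[OF L(1), of a b] L2_integrable(2)[OF L(2), of a b]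
    by (subst integral_add) (auto simp: G_def H_def intro: integrable_on_mult_left integrable_on_mult_right)
  also have "\<dots> \<le> G\<^sup>2 + H\<^sup>2" using zero_le_power2[of "G - H"] by (simp add: power2_diff)
  also have "\<dots> \<le> (b - a) * integral {a..b} (\<lambda>t. (cmod (g t))\<^sup>2) + (b - a) * integral {a..b} (\<lambda>t. (cmod (h t))\<^sup>2)"
    unfolding G_def H_def by (intro add_mono integral_norm_squared_le_L2 L ab)
  also have "\<dots> = (b - a) * integral {a..b} (\<lambda>x. (cmod (g x))\<^sup>2 + (cmod (h x))\<^sup>2)"
    using ab by (subst integral_add) (auto intro!: L2_integrable L simp: algebra_simps)
  finally show "cmod (y b * z b - y a * z a - integral {a..b} (\<lambda>x. g x * z x + y x * h x))
      \<le> (b - a) * integral {a..b} (\<lambda>x. (cmod (g x))\<^sup>2 + (cmod (h x))\<^sup>2)" .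
qed

lemma norm_exp_diff_le:
  assumes "cmod p \<le> B" "cmod q \<le> B"
  shows "cmod (exp p - exp q) \<le> exp B * cmod (p - q)"
proof (rule field_differentiable_bound[where S = "cball 0 B" and f' = exp])
  show "cmod (exp z) \<le> exp B" if "z \<in> cball 0 B" for z
    using that complex_Re_le_cmod[of z] by (simp add: norm_exp_eq_Re)
qed (use assms in \<open>auto intro!: derivative_eq_intros\<close>)

text \<open>For an increment \<open>w\<close> of \<open>y\<close>, \<open>exp w - 1 - w\<close> is
  quadratic in \<open>w\<close>. Freezing \<open>exp (y t)\<close> at \<open>t = a\<close> under the
  integral costs another quadratic term. Both are bounded by multiples of \<open>G\<^sup>2\<close>,
  hence by the length times the integral of |g|^2.\<close>

lemma ac2_exp:
  assumes y: "ac2 y g"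
  shows "ac2 (\<lambda>x. exp (y x)) (\<lambda>x. g x * exp (y x))"
proof -
  note L = ac2_L2[OF y]
  note C = ac2_continuous[OF y]
  obtain B where B: "\<And>x. x \<in> {0..1} \<Longrightarrow> cmod (y x) \<le> B"
    using compact_continuous_image[OF C compact_Icc] compact_imp_bounded
    by (meson bounded_iff imageI)
  \<comment> \<open>The first summand is the Taylor remainder, with |w| \<le> 2 B, times the bound
    for \<open>exp (y a)\<close>; the second is the Lipschitz constant of \<open>exp\<close> on the
    ball of radius \<open>B\<close>.\<close>
  define K where "K = exp (2 * B) * exp B + exp B"
  show ?thesis
  proof (rule ac2I_increments)
    show "(\<lambda>x. g x * exp (y x)) \<in> L2"
      by (intro L2_mult_continuous L continuous_intros C)
    show "(\<lambda>x. K * (cmod (g x))\<^sup>2) integrable_on {0..1}"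
      by (intro integrable_on_mult_right L2_integrable L) auto
    fix a b :: real assume ab: "0 \<le> a" "a \<le> b" "b \<le> 1"
    define G where "G = integral {a..b} (\<lambda>t. cmod (g t))"
    have "0 \<le> G" unfolding G_def using ab by (auto intro!: integral_nonneg L2_integrable L)
    have Gb: "cmod (y s - y t) \<le> G" if "s \<in> {a..b}" "t \<in> {a..b}" for s t
      unfolding G_def using ab that by (intro ac2_increment_mono[OF y])
    have "0 \<le> B" using order_trans[OF norm_ge_zero B[of 0]] by simp
    define w where "w = y b - y a"
    have w: "cmod w \<le> G" using Gb ab by (simp add: w_def)
    have wB: "cmod w \<le> 2 * B"
      using B[of a] B[of b] ab norm_triangle_ineq4[of "y b" "y a"] by (simp add: w_def)
    have "\<bar>Re w\<bar> \<le> 2 * B" using wB abs_Re_le_cmod[of w] by linarith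
    have "cmod (exp w - (\<Sum>k\<le>1. w ^ k / fact k)) \<le> exp \<bar>Re w\<bar> * cmod w ^ Suc 1 / fact 1"
      by (rule Taylor_exp)
    also have "\<dots> \<le> exp (2 * B) * G\<^sup>2"
      using mult_mono[OF exp_le_cancel_iff[THEN iffD2, OF \<open>\<bar>Re w\<bar> \<le> 2 * B\<close>] power_mono[OF w norm_ge_zero, of 2]]
      by (simp add: power2_eq_square)
    finally have e1: "cmod (exp w - 1 - w) \<le> exp (2 * B) * G\<^sup>2" by (simp add: diff_diff_eq)
    have "a \<in> {0..1}" using ab by simp
    then have e2: "cmod (exp (y a)) \<le> exp B"
      using order_trans[OF complex_Re_le_cmod B[of a]] by simp
    have i1: "((\<lambda>t. g t * exp (y a)) has_integral (w * exp (y a))) {a..b}"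
      unfolding w_def by (intro has_integral_mult_left ac2_has_integral[OF y ab])
    have int2: "(\<lambda>x. g x * exp (y x)) integrable_on {a..b}"
      using ab by (intro L2_integrable L2_mult_continuous L continuous_intros C) auto
    have i3: "((\<lambda>t. g t * (exp (y a) - exp (y t))) has_integral
      (w * exp (y a) - integral {a..b} (\<lambda>x. g x * exp (y x)))) {a..b}"
      using has_integral_diff[OF i1 integrable_integral[OF int2]] by (simp add: algebra_simps)
    have "cmod (integral {a..b} (\<lambda>t. g t * (exp (y a) - exp (y t)))) \<le> integral {a..b} (\<lambda>t. cmod (g t) * (exp B * G))"
    proof (rule integral_norm_bound_integral)
      show "(\<lambda>t. g t * (exp (y a) - exp (y t))) integrable_on {a..b}" using i3 by blast
      show "(\<lambda>t. cmod (g t) * (exp B * G)) integrable_on {a..b}"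
        using ab by (intro integrable_on_mult_left L2_integrable L) auto
      fix t assume t: "t \<in> {a..b}"
      have "cmod (exp (y a) - exp (y t)) \<le> exp B * cmod (y a - y t)"
        using ab t by (intro norm_exp_diff_le B) auto
      also have "\<dots> \<le> exp B * G" using Gb[of a t] ab t by simp
      finally show "cmod (g t * (exp (y a) - exp (y t))) \<le> cmod (g t) * (exp B * G)"
        by (simp add: norm_mult mult_left_mono)
    qed
    also have "\<dots> = exp B * G\<^sup>2" by (simp add: G_def power2_eq_square)
    finally have e3: "cmod (w * exp (y a) - integral {a..b} (\<lambda>x. g x * exp (y x))) \<le> exp B * G\<^sup>2"
      using integral_unique[OF i3] by simp
    have "exp (y b) = exp w * exp (y a)" by (simp add: w_def exp_diff)
    then have "exp (y b) - exp (y a) - integral {a..b} (\<lambda>x. g x * exp (y x))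
        = (exp w - 1 - w) * exp (y a) + (w * exp (y a) - integral {a..b} (\<lambda>x. g x * exp (y x)))"
      by (simp add: algebra_simps)
    also have "cmod \<dots> \<le> (exp (2 * B) * G\<^sup>2) * exp B + exp B * G\<^sup>2"
    proof (intro norm_triangle_le add_mono e3)
      show "cmod ((exp w - 1 - w) * exp (y a)) \<le> (exp (2 * B) * G\<^sup>2) * exp B"
        unfolding norm_mult by (rule mult_mono[OF e1 e2]) auto
    qed
    also have "\<dots> = K * G\<^sup>2" by (simp add: K_def algebra_simps)
    also have "\<dots> \<le> K * ((b - a) * integral {a..b} (\<lambda>t. (cmod (g t))\<^sup>2))"
      unfolding G_def by (intro mult_left_mono integral_norm_squared_le_L2 L ab) (simp add: K_def)
    finally show "cmod (exp (y b) - exp (y a) - integral {a..b} (\<lambda>x. g x * exp (y x)))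
        \<le> (b - a) * integral {a..b} (\<lambda>x. K * (cmod (g x))\<^sup>2)"
      by (simp add: mult.left_commute)
  qed
qed

lemma ac2_C1:
  assumes "\<And>x. x \<in> {0..1} \<Longrightarrow> (y has_vector_derivative g x) (at x within {0..1})"
    and "continuous_on {0..1} g"
  shows "ac2 y g"
  unfolding ac2_def
proof (intro conjI ballI)
  show "g \<in> L2" by (rule continuous_in_L2[OF assms(2)])
  fix x :: real assume x: "x \<in> {0..1}"
  show "(g has_integral (y x - y 0)) {0..x}"
    using x assms(1) has_vector_derivative_within_subset[of y _ _ "{0..1}" "{0..x}"]
    by (intro fundamental_theorem_of_calculus) auto
qed

lemma ac2_cmult: "ac2 y g \<Longrightarrow> ac2 (\<lambda>x. c * y x) (\<lambda>x. c * g x)"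
  by (auto simp: ac2_def L2_cmult right_diff_distrib[symmetric] intro!: has_integral_mult_right)

lemma ac2_add:
  assumes "ac2 y g" "ac2 z h"
  shows "ac2 (\<lambda>x. y x + z x) (\<lambda>x. g x + h x)"
  unfolding ac2_def
proof (intro conjI ballI)
  show "(\<lambda>x. g x + h x) \<in> L2" by (intro L2_add ac2_L2[OF assms(1)] ac2_L2[OF assms(2)])
  fix x :: real assume x: "x \<in> {0..1}"
  have "((\<lambda>x. g x + h x) has_integral (y x - y 0 + (z x - z 0))) {0..x}"
    using assms x unfolding ac2_def by (intro has_integral_add) auto
  then show "((\<lambda>x. g x + h x) has_integral (y x + z x - (y 0 + z 0))) {0..x}"
    by (simp only: add_diff_add)
qed

lemma ac2_diff:
  assumes "ac2 y g" "ac2 z h"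
  shows "ac2 (\<lambda>x. y x - z x) (\<lambda>x. g x - h x)"
proof -
  have "ac2 (\<lambda>x. y x + (- 1) * z x) (\<lambda>x. g x + (- 1) * h x)"
    by (intro ac2_add ac2_cmult assms)
  then show ?thesis by simp
qed

lemma ac2_cong:
  assumes "ac2 y g" "\<And>x. x \<in> {0..1} \<Longrightarrow> y x = y' x" "\<And>x. x \<in> {0..1} \<Longrightarrow> g x = g' x"
  shows "ac2 y' g'"
  unfolding ac2_def
proof (intro conjI ballI)
  have "g \<in> L2" using assms(1) by (rule ac2_L2)
  moreover have "g' \<in> borel_measurable (lebesgue_on {0..1}) \<longleftrightarrow> g \<in> borel_measurable (lebesgue_on {0..1})"
    using assms(3) by (intro measurable_cong) (simp add: space_restrict_space)
  moreover have "integrable (lebesgue_on {0..1}) (\<lambda>x. (cmod (g' x))\<^sup>2)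
      \<longleftrightarrow> integrable (lebesgue_on {0..1}) (\<lambda>x. (cmod (g x))\<^sup>2)"
    using assms(3) by (intro Bochner_Integration.integrable_cong) (auto simp: space_restrict_space)
  ultimately show "g' \<in> L2" by (simp add: L2_def)
  fix x :: real assume x: "x \<in> {0..1}"
  then have "(g has_integral (y x - y 0)) {0..x}" using assms(1) by (simp add: ac2_def)
  then have "(g has_integral (y' x - y' 0)) {0..x}" using assms(2) x by simp
  then show "(g' has_integral (y' x - y' 0)) {0..x}"
    by (rule has_integral_eq[rotated]) (use assms(3) x in auto)
qed

text \<open>The function \<open>exp (- K * t) * Y t - H t\<close> has nonpositive derivative. The
  integral of \<open>h\<close> is kept instead of its supremum because \<open>h\<close> will contain
  squared oscillatory integrals: their integrals over x can be summed by Bessel's inequality,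
  whereas a supremum over x would call for a maximal inequality.\<close>

lemma gronwall:
  fixes y h :: "real \<Rightarrow> real"
  assumes cy: "continuous_on {0..1} y" and ch: "continuous_on {0..1} h"
    and h: "\<And>x. x \<in> {0..1} \<Longrightarrow> 0 \<le> h x" and K: "0 \<le> K"
    and le: "\<And>x. x \<in> {0..1} \<Longrightarrow> y x \<le> h x + K * integral {0..x} y"
    and x: "x \<in> {0..1}"
  shows "y x \<le> h x + K * exp K * integral {0..x} h"
proof -
  define Y H where "Y x = integral {0..x} y" and "H x = integral {0..x} h" for x
  have dY: "(Y has_real_derivative y t) (at t within {0..1})" if "t \<in> {0..1}" for t
    unfolding Y_def using integral_has_real_derivative[OF cy that] .
  have dH: "(H has_real_derivative h t) (at t within {0..1})" if "t \<in> {0..1}" for t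
    unfolding H_def using integral_has_real_derivative[OF ch that] .
  define \<phi> where "\<phi> t = exp (- K * t) * Y t - H t" for t
  have d\<phi>: "(\<phi> has_real_derivative (exp (- K * t) * (y t - K * Y t) - h t)) (at t within {0..1})"
    if "t \<in> {0..1}" for t
    unfolding \<phi>_def by (rule derivative_eq_intros dY dH that refl)+ (simp add: algebra_simps)
  have "\<phi> x \<le> \<phi> 0"
  proof (rule DERIV_nonpos_imp_decreasing_open[of 0 x \<phi>])
    show "0 \<le> x" using x by simp
    show "continuous_on {0..x} \<phi>"
      by (rule continuous_on_subset[of "{0..1}"])
         (use d\<phi> x in \<open>auto simp: continuous_on_eq_continuous_within intro!: DERIV_continuous[OF d\<phi>]\<close>)
    fix t assume t: "0 < t" "t < x"
    then have "at t within {0..1} = at t" using x by (intro at_within_interior) (auto simp: interior_atLeastAtMost_real)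
    moreover have "exp (- K * t) * (y t - K * Y t) \<le> 1 * h t"
    proof (rule order_trans[of _ "exp (- K * t) * h t"])
      show "exp (- K * t) * (y t - K * Y t) \<le> exp (- K * t) * h t"
        using le[of t] t x by (intro mult_left_mono) (auto simp: Y_def)
      show "exp (- K * t) * h t \<le> 1 * h t"
        using h[of t] t x K by (intro mult_right_mono) auto
    qed
    ultimately show "\<exists>y. (\<phi> has_real_derivative y) (at t) \<and> y \<le> 0"
      using d\<phi>[of t] t x by force
  qed
  then have "exp (- K * x) * Y x \<le> H x" by (simp add: \<phi>_def Y_def H_def)
  then have "exp (K * x) * (exp (- K * x) * Y x) \<le> exp (K * x) * H x" by (intro mult_left_mono) auto
  then have "Y x \<le> exp (K * x) * H x"
    by (simp add: mult.assoc[symmetric] exp_add[symmetric] del: exp_minus)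
  also have "\<dots> \<le> exp K * H x"
  proof (rule mult_right_mono)
    show "exp (K * x) \<le> exp K" using x K mult_left_mono[of x 1 K] by simp
    show "0 \<le> H x" unfolding H_def
      using x h by (intro integral_nonneg integrable_continuous_real continuous_on_subset[OF ch]) auto
  qed
  finally have "K * Y x \<le> K * (exp K * H x)" using K by (intro mult_left_mono)
  then show ?thesis using le[OF x] by (simp add: Y_def H_def algebra_simps)
qed

section \<open>Bessel's inequality on subintervals\<close>

lemma integral_exp_int_period:
  fixes k :: int
  shows "integral {0..1} (\<lambda>t. exp (2 * pi * \<i> * of_int k * of_real t)) = (if k = 0 then 1 else 0)"
proof (cases "k = 0")
  case False
  define c where "c = 2 * pi * \<i> * of_int k"
  have c: "c \<noteq> 0" using False by (simp add: c_def)
  have "((\<lambda>t. exp (c * of_real t)) has_integral (exp (c * of_real 1) / c - exp (c * of_real 0) / c)) {0..1}"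
  proof (rule fundamental_theorem_of_calculus)
    fix x :: real
    have "((\<lambda>z. exp (c * z) / c) has_field_derivative exp (c * of_real x)) (at (of_real x))"
      using c by (auto intro!: derivative_eq_intros)
    from has_vector_derivative_real_field[OF this]
    show "((\<lambda>x. exp (c * complex_of_real x) / c) has_vector_derivative exp (c * complex_of_real x))
        (at x within {0..1})"
      by simp
  qed auto
  moreover have "exp c = 1"
    unfolding c_def exp_eq_1 by (auto intro!: exI[of _ k])
  ultimately show ?thesis using False by (simp add: c_def integral_unique)
qed simp

text \<open>The Fourier coefficient of \<open>v\<close> cut off at \<open>x\<close>. The upper limit
  stays variable because the Volterra equations below contain the oscillatory integral over every
  initial interval.\<close>

definition fourier :: "(real \<Rightarrow> complex) \<Rightarrow> int \<Rightarrow> real \<Rightarrow> complex" where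
  "fourier v k x = integral {0..x} (\<lambda>t. v t * exp (- (2 * pi * \<i> * of_int k * of_real t)))"

text \<open>Expansion of the nonnegative integral of |v - p|^2, where \<open>p\<close> is the
  orthogonal projection of \<open>v\<close> to the exponentials indexed by \<open>A\<close>. The two
  mixed terms and the square of \<open>p\<close> all equal the sum on the left.\<close>

lemma bessel_inequality:
  assumes v: "v \<in> L2" and A: "finite A"
  shows "(\<Sum>k\<in>A. (cmod (fourier v k 1))\<^sup>2) \<le> integral {0..1} (\<lambda>t. (cmod (v t))\<^sup>2)"
proof -
  define e where "e k t = exp (2 * pi * \<i> * of_int k * complex_of_real t)" for k :: int and t
  define c where "c k = fourier v k 1" for k
  define p where "p t = (\<Sum>k\<in>A. c k * e k t)" for t
  have ce: "continuous_on {0..1} (e k)" for k unfolding e_def by (intro continuous_intros)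
  have cp: "continuous_on {0..1} p" unfolding p_def by (intro continuous_intros ce)
  have cnje: "cnj (e k t) = e (-k) t" for k t by (simp add: e_def exp_cnj)
  have prod: "e j t * e k t = e (j + k) t" for j k t by (simp add: e_def exp_add[symmetric] algebra_simps)
  have int_e: "integral {0..1} (e k) = (if k = 0 then 1 else 0)" for k
    unfolding e_def by (rule integral_exp_int_period)
  have ie: "(e k has_integral (if k = 0 then 1 else 0)) {0..1}" for k
    using integrable_integral[OF integrable_continuous_real[OF ce[of k]]] by (simp add: int_e)
  have c: "((\<lambda>t. v t * e (-k) t) has_integral c k) {0..1}" for k
  proof -
    have "(\<lambda>t. v t * e (-k) t) integrable_on {0..1}"
      by (intro L2_integrable L2_mult_continuous v ce) auto
    then show ?thesis by (simp add: has_integral_integrable_integral c_def fourier_def e_def)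
  qed
  have "((\<lambda>t. v t * cnj (p t)) has_integral (\<Sum>k\<in>A. cnj (c k) * c k)) {0..1}"
    unfolding p_def cnj_sum complex_cnj_mult cnje sum_distrib_left mult.left_commute[of "v _"]
    by (intro has_integral_sum A has_integral_mult_right c)
  then have 1: "((\<lambda>t. v t * cnj (p t)) has_integral of_real (\<Sum>k\<in>A. (cmod (c k))\<^sup>2)) {0..1}"
    by (simp add: mult.commute[of "cnj _"] complex_norm_square del: of_real_power)
  have 2: "((\<lambda>t. cnj (v t) * p t) has_integral of_real (\<Sum>k\<in>A. (cmod (c k))\<^sup>2)) {0..1}"
    using has_integral_linear[OF 1 bounded_linear_cnj] by (simp add: o_def)
  have "((\<lambda>t. p t * cnj (p t)) has_integral
      (\<Sum>k\<in>A. \<Sum>j\<in>A. (c k * cnj (c j)) * (if k + (-j) = 0 then 1 else 0))) {0..1}"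
  proof -
    have "p t * cnj (p t) = (\<Sum>k\<in>A. \<Sum>j\<in>A. (c k * cnj (c j)) * e (k + (-j)) t)" for t
      unfolding p_def cnj_sum complex_cnj_mult cnje sum_product prod[symmetric] by (simp add: mult_ac)
    moreover have "((\<lambda>t. \<Sum>k\<in>A. \<Sum>j\<in>A. (c k * cnj (c j)) * e (k + (-j)) t) has_integral
      (\<Sum>k\<in>A. \<Sum>j\<in>A. (c k * cnj (c j)) * (if k + (-j) = 0 then 1 else 0))) {0..1}"
      by (intro has_integral_sum A has_integral_mult_right ie)
    ultimately show ?thesis by simp
  qed
  moreover have "(\<Sum>k\<in>A. \<Sum>j\<in>A. (c k * cnj (c j)) * (if k + (-j) = 0 then 1 else 0)) = of_real (\<Sum>k\<in>A. (cmod (c k))\<^sup>2)"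
    using A by (simp add: complex_norm_square if_distrib[of "\<lambda>z. _ * z"] del: of_real_power cong: if_cong)
  ultimately have 3: "((\<lambda>t. p t * cnj (p t)) has_integral of_real (\<Sum>k\<in>A. (cmod (c k))\<^sup>2)) {0..1}"
    by simp
  have "((\<lambda>t. v t * cnj (v t)) has_integral integral {0..1} (\<lambda>t. v t * cnj (v t))) {0..1}"
    using L2_mult_integrable(1)[OF v L2_cnj[OF v]] by auto
  then have 4: "((\<lambda>t. v t * cnj (v t)) has_integral of_real (integral {0..1} (\<lambda>t. (cmod (v t))\<^sup>2))) {0..1}"
    using has_integral_linear[OF integrable_integral[OF L2_integrable(3)[OF v, of 0 1]]
        bounded_linear_of_real[where ?'a = complex]]
    by (simp add: o_def complex_norm_square flip: of_real_power)
  have "((\<lambda>t. v t * cnj (v t) - v t * cnj (p t) - cnj (v t) * p t + p t * cnj (p t)) has_integral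
    (of_real (integral {0..1} (\<lambda>t. (cmod (v t))\<^sup>2)) - of_real (\<Sum>k\<in>A. (cmod (c k))\<^sup>2)
      - of_real (\<Sum>k\<in>A. (cmod (c k))\<^sup>2) + of_real (\<Sum>k\<in>A. (cmod (c k))\<^sup>2))) {0..1}"
    by (intro has_integral_add has_integral_diff 1 2 3 4)
  from has_integral_linear[OF this bounded_linear_Re]
  have "((\<lambda>t. Re (v t * cnj (v t) - v t * cnj (p t) - cnj (v t) * p t + p t * cnj (p t))) has_integral
    (integral {0..1} (\<lambda>t. (cmod (v t))\<^sup>2) - (\<Sum>k\<in>A. (cmod (c k))\<^sup>2))) {0..1}"
    unfolding o_def of_real_diff[symmetric] of_real_add[symmetric] Re_complex_of_real by simp
  moreover have "Re (v t * cnj (v t) - v t * cnj (p t) - cnj (v t) * p t + p t * cnj (p t)) = (cmod (v t - p t))\<^sup>2" for t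
    by (simp only: cmod_power2) (simp add: power2_eq_square algebra_simps)
  ultimately have "((\<lambda>t. (cmod (v t - p t))\<^sup>2) has_integral
    (integral {0..1} (\<lambda>t. (cmod (v t))\<^sup>2) - (\<Sum>k\<in>A. (cmod (c k))\<^sup>2))) {0..1}" by simp
  then have "0 \<le> integral {0..1} (\<lambda>t. (cmod (v t))\<^sup>2) - (\<Sum>k\<in>A. (cmod (c k))\<^sup>2)"
    by (rule has_integral_nonneg) auto
  then show ?thesis by (simp add: c_def)
qed

text \<open>The truncation of \<open>v\<close> at \<open>x\<close> has norm at most that of
  \<open>v\<close>. The right-hand side does not depend on \<open>x\<close>, so the inequality
  survives integration over \<open>x\<close>.\<close>

lemma bessel_inequality_partial:
  assumes v: "v \<in> L2" and A: "finite A" and x: "x \<in> {0..1}"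
  shows "(\<Sum>k\<in>A. (cmod (fourier v k x))\<^sup>2) \<le> integral {0..1} (\<lambda>t. (cmod (v t))\<^sup>2)"
proof -
  define w where "w t = (if t \<le> x then v t else 0)" for t
  have w: "w \<in> L2" unfolding w_def by (rule L2_indicator[OF v])
  have "fourier w k 1 = fourier v k x" for k
  proof -
    have "integral {0..1} (\<lambda>t. if t \<in> {0..x} then v t * exp (- (2 * pi * \<i> * of_int k * of_real t)) else 0)
        = fourier v k x"
      unfolding fourier_def using x
      by (subst integral_restrict_Int) (auto simp: Int_absorb2 Int_absorb1)
    moreover have "integral {0..1} (\<lambda>t. if t \<in> {0..x} then v t * exp (- (2 * pi * \<i> * of_int k * of_real t)) else 0)
       = fourier w k 1"
      unfolding fourier_def w_def by (rule integral_cong) auto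
    ultimately show ?thesis by simp
  qed
  then have "(\<Sum>k\<in>A. (cmod (fourier v k x))\<^sup>2) \<le> integral {0..1} (\<lambda>t. (cmod (w t))\<^sup>2)"
    using bessel_inequality[OF w A] by simp
  also have "\<dots> \<le> integral {0..1} (\<lambda>t. (cmod (v t))\<^sup>2)"
    by (intro integral_le L2_integrable w v) (auto simp: w_def)
  finally show ?thesis .
qed

lemma fourier_continuous:
  assumes "v \<in> L2"
  shows "continuous_on {0..1} (fourier v k)"
  unfolding fourier_def
  by (intro indefinite_integral_continuous_1 L2_integrable(1)[where a=0 and b=1] L2_mult_continuous assms continuous_intros) auto

text \<open>As \<open>v\<close> has no derivative, it is replaced by its oscillatory primitive
  \<open>fourier v k\<close>, and the derivative falls on the smooth factor
  \<open>e\<close>.\<close>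

lemma integral_fourier_by_parts:
  assumes v: "v \<in> L2" and e: "\<And>t. t \<in> {0..1} \<Longrightarrow> (e has_vector_derivative e' t) (at t within {0..1})"
    and e': "continuous_on {0..1} e'" and x: "x \<in> {0..1}"
  shows "integral {0..x} (\<lambda>t. v t * exp (- (2 * pi * \<i> * of_int k * of_real t)) * e t)
    = fourier v k x * e x - integral {0..x} (\<lambda>t. fourier v k t * e' t)"
proof -
  define g where "g t = v t * exp (- (2 * pi * \<i> * of_int k * complex_of_real t))" for t
  have g: "g \<in> L2" unfolding g_def by (intro L2_mult_continuous v continuous_intros)
  have F: "ac2 (fourier v k) g"
    unfolding ac2_def using g L2_integrable(1)[OF g]
    by (auto simp: fourier_def g_def[abs_def] has_integral_integrable_integral)
  have E: "ac2 e e'" by (rule ac2_C1[OF e e'])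
  have "((\<lambda>t. g t * e t + fourier v k t * e' t) has_integral (fourier v k x * e x - fourier v k 0 * e 0)) {0..x}"
    using ac2_has_integral[OF ac2_mult[OF F E], of 0 x] x by simp
  moreover have "((\<lambda>t. fourier v k t * e' t) has_integral integral {0..x} (\<lambda>t. fourier v k t * e' t)) {0..x}"
    using x by (intro integrable_integral integrable_continuous_real continuous_intros
        continuous_on_subset[OF fourier_continuous[OF v]] continuous_on_subset[OF e']) auto
  ultimately have "((\<lambda>t. g t * e t + fourier v k t * e' t - fourier v k t * e' t) has_integral
     (fourier v k x * e x - fourier v k 0 * e 0 - integral {0..x} (\<lambda>t. fourier v k t * e' t))) {0..x}"
    by (rule has_integral_diff)
  then show ?thesis by (simp add: integral_unique g_def fourier_def)
qed

text \<open>At k pi + epsilon the exponentials are no longer orthogonal. Splitting off the slow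
  factor exp (-2 i epsilon t) and integrating by parts leaves coefficients at the integer frequency
  \<open>k\<close> only, once at the endpoint and once averaged over the interval; Bessel's
  inequality controls both.\<close>

lemma fourier_perturbed_bound:
  fixes \<epsilon> :: complex
  assumes v: "v \<in> L2" and x: "x \<in> {0..1}" and \<epsilon>: "cmod \<epsilon> \<le> C"
  shows "(cmod (integral {0..x} (\<lambda>t. v t * exp (- (2 * \<i> * (of_int k * pi + \<epsilon>) * of_real t)))))\<^sup>2
    \<le> 2 * exp (4 * C) * ((cmod (fourier v k x))\<^sup>2 + 4 * C\<^sup>2 * integral {0..1} (\<lambda>t. (cmod (fourier v k t))\<^sup>2))"
proof -
  define e e' where "e t = exp (- (2 * \<i> * \<epsilon> * complex_of_real t))"
    and "e' t = - (2 * \<i> * \<epsilon>) * exp (- (2 * \<i> * \<epsilon> * complex_of_real t))" for t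
  define J where "J = integral {0..1} (\<lambda>t. cmod (fourier v k t))"
  note cf = fourier_continuous[OF v]
  have C: "0 \<le> C" using \<epsilon> norm_ge_zero order_trans by blast
  have ce': "continuous_on {0..1} e'" unfolding e'_def by (intro continuous_intros)
  have de: "(e has_vector_derivative e' t) (at t within {0..1})" for t
  proof -
    have "((\<lambda>z. exp (- (2 * \<i> * \<epsilon> * z))) has_field_derivative e' t) (at (of_real t))"
      unfolding e'_def by (auto intro!: derivative_eq_intros)
    from has_vector_derivative_real_field[OF this] show ?thesis
      unfolding e_def .
  qed
  have ne: "cmod (e t) \<le> exp (2 * C)" if "t \<in> {0..1}" for t
  proof -
    have "Re (- (2 * \<i> * \<epsilon> * complex_of_real t)) \<le> cmod (- (2 * \<i> * \<epsilon> * complex_of_real t))"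
      by (rule complex_Re_le_cmod)
    also have "\<dots> = 2 * (cmod \<epsilon> * t)" using that by (simp add: norm_mult)
    also have "\<dots> \<le> 2 * (C * 1)" using that \<epsilon> C by (intro mult_left_mono mult_mono) auto
    finally show ?thesis by (simp add: e_def norm_exp_eq_Re del: Re_divide_numeral)
  qed
  have ne': "cmod (e' t) \<le> 2 * C * exp (2 * C)" if "t \<in> {0..1}" for t
  proof -
    have "cmod (e' t) = 2 * cmod \<epsilon> * cmod (e t)" by (simp add: e'_def e_def norm_mult)
    also have "\<dots> \<le> 2 * C * exp (2 * C)" using ne[OF that] \<epsilon> C by (intro mult_mono) auto
    finally show ?thesis .
  qed
  have J: "integral {0..x} (\<lambda>t. cmod (fourier v k t)) \<le> J" unfolding J_def
    using x by (intro integral_subset_le integrable_continuous_real continuous_intros continuous_on_subset[OF cf]) auto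
  have "cmod (integral {0..x} (\<lambda>t. fourier v k t * e' t)) \<le> integral {0..x} (\<lambda>t. cmod (fourier v k t) * (2 * C * exp (2 * C)))"
    using x ne' by (intro integral_norm_bound_integral integrable_continuous_real continuous_intros
        continuous_on_subset[OF cf] continuous_on_subset[OF ce']) (auto simp: norm_mult intro!: mult_left_mono)
  also have "\<dots> \<le> J * (2 * C * exp (2 * C))"
    using J C by (simp add: mult_right_mono)
  finally have b2: "cmod (integral {0..x} (\<lambda>t. fourier v k t * e' t)) \<le> J * (2 * C * exp (2 * C))" .
  have "exp (- (2 * \<i> * (of_int k * pi + \<epsilon>) * complex_of_real t))
    = exp (- (2 * pi * \<i> * of_int k * of_real t)) * e t" for t
    unfolding e_def exp_add[symmetric] by (simp add: algebra_simps)
  then have "integral {0..x} (\<lambda>t. v t * exp (- (2 * \<i> * (of_int k * pi + \<epsilon>) * of_real t)))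
     = fourier v k x * e x - integral {0..x} (\<lambda>t. fourier v k t * e' t)"
    using integral_fourier_by_parts[OF v de ce' x, of k] by (simp add: mult.assoc)
  also have "cmod \<dots> \<le> cmod (fourier v k x) * exp (2 * C) + J * (2 * C * exp (2 * C))"
    using ne[OF x] b2 by (intro norm_triangle_le_diff add_mono) (auto simp: norm_mult intro: mult_left_mono)
  finally have b: "cmod (integral {0..x} (\<lambda>t. v t * exp (- (2 * \<i> * (of_int k * pi + \<epsilon>) * of_real t))))
    \<le> exp (2 * C) * (cmod (fourier v k x) + 2 * C * J)" by (simp add: algebra_simps)
  have "J\<^sup>2 \<le> integral {0..1} (\<lambda>t. (cmod (fourier v k t))\<^sup>2)"
    unfolding J_def using integral_norm_squared_le_L2[OF continuous_in_L2[OF cf], of 0 1 k] by simp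
  then have J2: "4 * C\<^sup>2 * J\<^sup>2 \<le> 4 * C\<^sup>2 * integral {0..1} (\<lambda>t. (cmod (fourier v k t))\<^sup>2)"
    by (intro mult_left_mono) auto
  have "(cmod (integral {0..x} (\<lambda>t. v t * exp (- (2 * \<i> * (of_int k * pi + \<epsilon>) * of_real t)))))\<^sup>2
     \<le> (exp (2 * C) * (cmod (fourier v k x) + 2 * C * J))\<^sup>2"
    by (intro power_mono b) auto
  also have "\<dots> = exp (4 * C) * (cmod (fourier v k x) + 2 * C * J)\<^sup>2"
    by (simp add: power_mult_distrib exp_double[symmetric])
  also have "\<dots> \<le> exp (4 * C) * (2 * ((cmod (fourier v k x))\<^sup>2 + 4 * C\<^sup>2 * J\<^sup>2))"
    using zero_le_power2[of "cmod (fourier v k x) - 2 * C * J"]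
    by (intro mult_left_mono) (auto simp: power2_sum power2_diff power_mult_distrib)
  also have "\<dots> \<le> 2 * exp (4 * C) * ((cmod (fourier v k x))\<^sup>2 + 4 * C\<^sup>2 * integral {0..1} (\<lambda>t. (cmod (fourier v k t))\<^sup>2))"
    using J2 by simp
  finally show ?thesis .
qed

section \<open>AKNS systems with a large spectral parameter\<close>

lemma ac2_exp_linear: "ac2 (\<lambda>x. exp (c * of_real x)) (\<lambda>x. c * exp (c * of_real x))"
proof (rule ac2_C1)
  fix x :: real
  have "((\<lambda>z. exp (c * z)) has_field_derivative c * exp (c * of_real x)) (at (of_real x))"
    by (auto intro!: derivative_eq_intros)
  from has_vector_derivative_real_field[OF this]
  show "((\<lambda>x. exp (c * complex_of_real x)) has_vector_derivative c * exp (c * complex_of_real x)) (at x within {0..1})" .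
qed (intro continuous_intros)

text \<open>Modulus of the first Volterra iterate: the solution of z' = i zeta z + v w with z(0) = 0
  for the free w(t) = exp (-i zeta t), divided by the maximal growth exp (|Im zeta| x).\<close>

definition osc :: "(real \<Rightarrow> complex) \<Rightarrow> complex \<Rightarrow> real \<Rightarrow> real" where
  "osc v \<zeta> x = exp (- \<bar>Im \<zeta>\<bar> * x) * cmod (exp (\<i> * \<zeta> * of_real x)) *
     cmod (integral {0..x} (\<lambda>t. v t * exp (- (2 * \<i> * \<zeta> * of_real t))))"

lemma osc_nonneg: "0 \<le> osc v \<zeta> x"
  by (simp add: osc_def)

lemma osc_continuous:
  assumes "v \<in> L2"
  shows "continuous_on {0..1} (osc v \<zeta>)"
  unfolding osc_def
  by (intro continuous_intros indefinite_integral_continuous_1 L2_integrable(1)[where a=0 and b=1]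
      L2_mult_continuous assms) auto

lemma osc_strip:
  fixes \<zeta> :: complex
  assumes v: "v \<in> L2" and x: "x \<in> {0..1}" and C: "cmod (\<zeta> - of_int k * pi) \<le> C"
  shows "(osc v \<zeta> x)\<^sup>2 \<le> 2 * exp (4 * C) *
    ((cmod (fourier v k x))\<^sup>2 + 4 * C\<^sup>2 * integral {0..1} (\<lambda>t. (cmod (fourier v k t))\<^sup>2))"
proof -
  define I where "I = cmod (integral {0..x} (\<lambda>t. v t * exp (- (2 * \<i> * \<zeta> * of_real t))))"
  have "exp (- \<bar>Im \<zeta>\<bar> * x) * cmod (exp (\<i> * \<zeta> * of_real x)) = exp (- (\<bar>Im \<zeta>\<bar> * x + Im \<zeta> * x))"
    by (simp add: norm_exp_eq_Re exp_add[symmetric])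
  also have "\<dots> \<le> 1"
  proof -
    have "0 \<le> (\<bar>Im \<zeta>\<bar> + Im \<zeta>) * x" using x by (intro mult_nonneg_nonneg) auto
    then show ?thesis by (simp add: algebra_simps)
  qed
  finally have "osc v \<zeta> x \<le> 1 * I"
    unfolding osc_def I_def by (intro mult_right_mono) auto
  then have "(osc v \<zeta> x)\<^sup>2 \<le> I\<^sup>2" by (intro power_mono osc_nonneg) simp
  also have "\<dots> \<le> 2 * exp (4 * C) *
    ((cmod (fourier v k x))\<^sup>2 + 4 * C\<^sup>2 * integral {0..1} (\<lambda>t. (cmod (fourier v k t))\<^sup>2))"
    using fourier_perturbed_bound[OF v x C, of k] by (simp add: I_def)
  finally show ?thesis .
qed

lemma integral_exp_decay:
  fixes c x :: real
  assumes "0 < c" "0 \<le> x"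
  shows "integral {0..x} (\<lambda>t. exp (- c * t)) \<le> 1 / c" "integral {0..x} (\<lambda>t. exp (- c * (x - t))) \<le> 1 / c"
proof -
  have "((\<lambda>t. exp (- c * t)) has_integral (- exp (- c * x) / c - (- exp (- c * 0) / c))) {0..x}"
    using assms by (intro fundamental_theorem_of_calculus[where f = "\<lambda>t. - exp (- c * t) / c"])
      (auto intro!: derivative_eq_intros simp: has_real_derivative_iff_has_vector_derivative[symmetric])
  then show "integral {0..x} (\<lambda>t. exp (- c * t)) \<le> 1 / c"
    using assms by (simp add: integral_unique divide_right_mono)
  have "((\<lambda>t. exp (- c * (x - t))) has_integral (exp (- c * (x - x)) / c - (exp (- c * (x - 0)) / c))) {0..x}"
    using assms by (intro fundamental_theorem_of_calculus[where f = "\<lambda>t. exp (- c * (x - t)) / c"])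
      (auto intro!: derivative_eq_intros simp: has_real_derivative_iff_has_vector_derivative[symmetric])
  then show "integral {0..x} (\<lambda>t. exp (- c * (x - t))) \<le> 1 / c"
    using assms by (simp add: integral_unique divide_right_mono)
qed

text \<open>With the exponential weights moved under the integral, the kernel decays at rate 2 |Im
  zeta| away from one end of the interval. The integral of its square is at most 1 / (4 |Im zeta|),
  and Cauchy-Schwarz concludes.\<close>

lemma osc_half_plane:
  assumes v: "v \<in> L2" and x: "x \<in> {0..1}" and Y: "Im \<zeta> \<noteq> 0"
  shows "(osc v \<zeta> x)\<^sup>2 \<le> integral {0..1} (\<lambda>t. (cmod (v t))\<^sup>2) / \<bar>Im \<zeta>\<bar>"
proof -
  define y where "y = \<bar>Im \<zeta>\<bar>"
  have y: "y > 0" using Y by (simp add: y_def)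
  \<comment> \<open>The kernel concentrates at \<open>t = x\<close> in the upper half-plane and at
    \<open>t = 0\<close> in the lower one.\<close>
  define w where "w t = (if Im \<zeta> > 0 then exp (- (2 * y) * (x - t)) else exp (- (2 * y) * t))" for t
  have cw: "continuous_on A w" for A
    unfolding w_def by (cases "Im \<zeta> > 0") (auto intro!: continuous_intros)
  have w0: "0 \<le> w t" for t by (simp add: w_def)
  have wL: "(\<lambda>t. complex_of_real (w t)) \<in> L2" by (intro continuous_in_L2 continuous_intros cw)
  have "cmod (exp (of_real (- y * x) + \<i> * \<zeta> * of_real x)) = exp (- y * x) * cmod (exp (\<i> * \<zeta> * of_real x))"
    by (simp only: exp_add norm_mult norm_exp_eq_Re) simp
  then have "osc v \<zeta> x = cmod (exp (of_real (- y * x) + \<i> * \<zeta> * of_real x) *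
      integral {0..x} (\<lambda>t. v t * exp (- (2 * \<i> * \<zeta> * of_real t))))"
    unfolding osc_def norm_mult y_def by simp
  also have "\<dots> = cmod (integral {0..x} (\<lambda>t. exp (of_real (- y * x) + \<i> * \<zeta> * of_real x) *
      (v t * exp (- (2 * \<i> * \<zeta> * of_real t)))))"
    by simp
  also have "\<dots> \<le> integral {0..x} (\<lambda>t. cmod (v t) * cmod (complex_of_real (w t)))"
  proof (rule integral_norm_bound_integral)
    show "(\<lambda>t. exp (of_real (- y * x) + \<i> * \<zeta> * of_real x) * (v t * exp (- (2 * \<i> * \<zeta> * of_real t)))) integrable_on {0..x}"
      using x by (intro L2_integrable L2_cmult L2_mult_continuous v continuous_intros) auto
    show "(\<lambda>t. cmod (v t) * cmod (complex_of_real (w t))) integrable_on {0..x}"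
      using x by (intro L2_mult_integrable v wL) auto
    fix t assume "t \<in> {0..x}"
    have "cmod (exp (of_real (- y * x) + \<i> * \<zeta> * of_real x) * (v t * exp (- (2 * \<i> * \<zeta> * of_real t))))
      = cmod (v t) * exp (- y * x - Im \<zeta> * x + 2 * Im \<zeta> * t)"
    proof -
      have "cmod (exp (of_real (- y * x) + \<i> * \<zeta> * of_real x) * (v t * exp (- (2 * \<i> * \<zeta> * of_real t))))
        = cmod (v t) * (exp (Re (of_real (- y * x) + \<i> * \<zeta> * of_real x)) * exp (Re (- (2 * \<i> * \<zeta> * of_real t))))"
        by (simp only: norm_mult norm_exp_eq_Re mult_ac)
      then show ?thesis unfolding exp_add[symmetric] by (simp add: algebra_simps)
    qed
    also have "- y * x - Im \<zeta> * x + 2 * Im \<zeta> * t = (if Im \<zeta> > 0 then - (2 * y) * (x - t) else - (2 * y) * t)"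
      by (simp add: y_def algebra_simps)
    finally show "cmod (exp (of_real (- y * x) + \<i> * \<zeta> * of_real x) * (v t * exp (- (2 * \<i> * \<zeta> * of_real t))))
       \<le> cmod (v t) * cmod (complex_of_real (w t))"
      by (simp add: w_def split: if_splits)
  qed
  finally have "(osc v \<zeta> x)\<^sup>2 \<le> (integral {0..x} (\<lambda>t. cmod (v t) * cmod (complex_of_real (w t))))\<^sup>2"
    by (intro power_mono osc_nonneg)
  also have "\<dots> \<le> integral {0..x} (\<lambda>t. (cmod (v t))\<^sup>2) * integral {0..x} (\<lambda>t. (cmod (complex_of_real (w t)))\<^sup>2)"
    using x by (intro Cauchy_Schwarz_L2 v wL) auto
  also have "\<dots> \<le> integral {0..1} (\<lambda>t. (cmod (v t))\<^sup>2) * (1 / (4 * y))"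
  proof (intro mult_mono)
    show "integral {0..x} (\<lambda>t. (cmod (v t))\<^sup>2) \<le> integral {0..1} (\<lambda>t. (cmod (v t))\<^sup>2)"
      using x by (intro integral_subset_le L2_integrable v) auto
    have "(cmod (complex_of_real (w t)))\<^sup>2 = (if Im \<zeta> > 0 then exp (- (4 * y) * (x - t)) else exp (- (4 * y) * t))" for t
      unfolding norm_of_real w_def power2_eq_square by (simp add: exp_add[symmetric])
    then show "integral {0..x} (\<lambda>t. (cmod (complex_of_real (w t)))\<^sup>2) \<le> 1 / (4 * y)"
      using integral_exp_decay[of "4 * y" x] y x by (cases "Im \<zeta> > 0") simp_all
  qed (use x integrable_continuous_real[OF continuous_on_power[OF cw]] in
      \<open>auto intro!: integral_nonneg L2_integrable v\<close>)
  also have "\<dots> \<le> integral {0..1} (\<lambda>t. (cmod (v t))\<^sup>2) / y"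
  proof -
    have "0 \<le> integral {0..1} (\<lambda>t. (cmod (v t))\<^sup>2)" by (intro integral_nonneg L2_integrable v) auto
    then show ?thesis using y by (simp add: field_simps)
  qed
  finally show ?thesis by (simp add: y_def)
qed

text \<open>Distance from the free solution with the same initial value, in units of the maximal
  growth. This normalisation makes the estimates uniform over all complex zeta.\<close>

definition deviation :: "complex \<Rightarrow> (real \<Rightarrow> complex) \<Rightarrow> real \<Rightarrow> real" where
  "deviation \<zeta> z x = exp (- \<bar>Im \<zeta>\<bar> * x) * cmod (z x - exp (\<i> * \<zeta> * of_real x) * z 0)"

lemma deviation_continuous:
  "continuous_on {0..1} z \<Longrightarrow> continuous_on {0..1} (deviation \<zeta> z)"
  unfolding deviation_def by (intro continuous_intros)

lemma deviation_nonneg: "0 \<le> deviation \<zeta> z x"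
  by (simp add: deviation_def)

text \<open>Variation of constants: after multiplication with exp (-i zeta t), \<open>z\<close> and
  \<open>w\<close> are split into free solution and deviation. The free part of \<open>v * w\<close>
  produces \<open>osc\<close>, the free parts of the remainder produce
  \<open>2 * P * cmod r\<close>, and every other term contains a deviation and stays under the
  integral.\<close>

lemma deviation_half:
  assumes v: "v \<in> L2" and cp: "continuous_on {0..1} p" and cq: "continuous_on {0..1} q"
    and P: "\<And>t. t \<in> {0..1} \<Longrightarrow> cmod (p t) \<le> P" "\<And>t. t \<in> {0..1} \<Longrightarrow> cmod (q t) \<le> P"
    and z: "ac2 z (\<lambda>t. \<i> * \<zeta> * z t + v t * w t + r * (p t * z t + q t * w t))"
    and cw: "continuous_on {0..1} w"
    and z0: "cmod (z 0) \<le> 1" and w0: "cmod (w 0) \<le> 1" and x: "x \<in> {0..1}"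
  shows "deviation \<zeta> z x \<le> osc v \<zeta> x + 2 * P * cmod r +
    integral {0..x} (\<lambda>t. cmod (v t) * deviation (- \<zeta>) w t
       + cmod r * P * (deviation \<zeta> z t + deviation (- \<zeta>) w t))"
proof -
  define y where "y = \<bar>Im \<zeta>\<bar>"
  have cz: "continuous_on {0..1} z" by (rule ac2_continuous[OF z])
  define D E where "D t = z t - exp (\<i> * \<zeta> * of_real t) * z 0"
    and "E t = w t - exp (- (\<i> * \<zeta> * of_real t)) * w 0" for t
  have cD: "continuous_on {0..1} D" unfolding D_def by (intro continuous_intros cz)
  have cE: "continuous_on {0..1} E" unfolding E_def by (intro continuous_intros cw)
  \<comment> \<open>\<open>g1\<close> collects the terms with a deviation, \<open>g2\<close> the
    free part of the remainder. The free part of \<open>v * w\<close> is kept apart, since an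
    absolute value under its integral would lose the oscillation.\<close>
  define g1 g2 where "g1 t = exp (- (\<i> * \<zeta> * of_real t)) * (v t * E t + r * (p t * D t + q t * E t))"
    and "g2 t = exp (- (\<i> * \<zeta> * of_real t)) *
       (r * (p t * (exp (\<i> * \<zeta> * of_real t) * z 0) + q t * (exp (- (\<i> * \<zeta> * of_real t)) * w 0)))" for t
  have g1: "g1 \<in> L2" unfolding g1_def
    by (intro L2_continuous_mult L2_add L2_mult_continuous L2_cmult v continuous_intros cD cE cp cq continuous_in_L2)
  have cg2: "continuous_on {0..1} g2" unfolding g2_def by (intro continuous_intros cp cq)
  define G0 where "G0 = integral {0..x} (\<lambda>t. v t * exp (- (2 * \<i> * \<zeta> * of_real t)))"
  have "ac2 (\<lambda>t. exp ((- (\<i> * \<zeta>)) * of_real t) * z t)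
     (\<lambda>t. (- (\<i> * \<zeta>)) * exp ((- (\<i> * \<zeta>)) * of_real t) * z t + exp ((- (\<i> * \<zeta>)) * of_real t) *
       (\<i> * \<zeta> * z t + v t * w t + r * (p t * z t + q t * w t)))"
    by (rule ac2_mult[OF ac2_exp_linear z])
  then have "((\<lambda>t. (- (\<i> * \<zeta>)) * exp ((- (\<i> * \<zeta>)) * of_real t) * z t + exp ((- (\<i> * \<zeta>)) * of_real t) *
       (\<i> * \<zeta> * z t + v t * w t + r * (p t * z t + q t * w t))) has_integral
      (exp (- (\<i> * \<zeta> * of_real x)) * z x - z 0)) {0..x}"
    using ac2_has_integral[of _ _ 0 x] x by fastforce
  moreover have "(- (\<i> * \<zeta>)) * exp ((- (\<i> * \<zeta>)) * of_real t) * z t + exp ((- (\<i> * \<zeta>)) * of_real t) *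
       (\<i> * \<zeta> * z t + v t * w t + r * (p t * z t + q t * w t))
     = w 0 * (v t * exp (- (2 * \<i> * \<zeta> * of_real t))) + g1 t + g2 t" for t
  proof -
    have e: "exp (- (2 * \<i> * \<zeta> * of_real t)) = exp (- (\<i> * \<zeta> * of_real t)) * exp (- (\<i> * \<zeta> * of_real t))"
      by (simp add: exp_add[symmetric] mult.assoc)
    show ?thesis unfolding e g1_def g2_def D_def E_def by (simp add: algebra_simps)
  qed
  ultimately have "((\<lambda>t. w 0 * (v t * exp (- (2 * \<i> * \<zeta> * of_real t))) + g1 t + g2 t) has_integral
      (exp (- (\<i> * \<zeta> * of_real x)) * z x - z 0)) {0..x}" by simp
  moreover have "((\<lambda>t. w 0 * (v t * exp (- (2 * \<i> * \<zeta> * of_real t))) + g1 t + g2 t) has_integral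
      (w 0 * G0 + integral {0..x} g1 + integral {0..x} g2)) {0..x}"
    unfolding G0_def using x
    by (intro has_integral_add has_integral_mult_right integrable_integral L2_integrable(1) g1
        continuous_in_L2[OF cg2] L2_mult_continuous v continuous_intros) auto
  ultimately have eq: "exp (- (\<i> * \<zeta> * of_real x)) * z x - z 0 = w 0 * G0 + integral {0..x} g1 + integral {0..x} g2"
    by (rule has_integral_unique)
  define c where "c = exp (of_real (- y * x) + \<i> * \<zeta> * of_real x)"
  have "exp (\<i> * \<zeta> * of_real x) * (exp (- (\<i> * \<zeta> * of_real x)) * z x - z 0) = D x"
    unfolding right_diff_distrib mult.assoc[symmetric] exp_minus_inverse D_def by simp
  then have "c * (exp (- (\<i> * \<zeta> * of_real x)) * z x - z 0) = exp (of_real (- y * x)) * D x"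
    by (simp only: c_def exp_add mult.assoc)
  then have "deviation \<zeta> z x = cmod (c * (w 0 * G0 + integral {0..x} g1 + integral {0..x} g2))"
    unfolding eq[symmetric] by (simp add: deviation_def D_def y_def norm_mult)
  also have "\<dots> \<le> cmod (c * (w 0 * G0)) + cmod (c * integral {0..x} g1) + cmod (c * integral {0..x} g2)"
    unfolding distrib_left by (intro norm_triangle_le add_mono norm_triangle_ineq order_refl)
  also have "\<dots> \<le> osc v \<zeta> x + integral {0..x} (\<lambda>t. cmod (v t) * deviation (- \<zeta>) w t
       + cmod r * P * (deviation \<zeta> z t + deviation (- \<zeta>) w t)) + 2 * P * cmod r"
  proof (intro add_mono)
    have "cmod (c * (w 0 * G0)) = osc v \<zeta> x * cmod (w 0)"
    proof -
      have "cmod c = exp (- y * x) * cmod (exp (\<i> * \<zeta> * of_real x))"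
        by (simp only: c_def exp_add norm_mult norm_exp_eq_Re) simp
      then show ?thesis unfolding norm_mult osc_def G0_def y_def by simp
    qed
    also have "\<dots> \<le> osc v \<zeta> x" using w0 osc_nonneg by (intro mult_left_le) auto
    finally show "cmod (c * (w 0 * G0)) \<le> osc v \<zeta> x" .
    \<comment> \<open>Transport from \<open>t\<close> to \<open>x\<close> multiplies by exp (i zeta
      (x - t)), of modulus at most exp (|Im zeta| (x - t)); so the weight at \<open>x\<close>
      becomes the weight at \<open>t\<close>.\<close>
    have nc: "cmod c * cmod (exp (- (\<i> * \<zeta> * of_real t))) \<le> exp (- y * t)" if "t \<in> {0..x}" for t
    proof -
      have "0 \<le> (y + Im \<zeta>) * (x - t)" using that by (intro mult_nonneg_nonneg) (auto simp: y_def)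
      then have "- y * x - Im \<zeta> * x + Im \<zeta> * t \<le> - y * t" by (simp add: algebra_simps)
      moreover have "cmod c * cmod (exp (- (\<i> * \<zeta> * of_real t))) = exp (- y * x - Im \<zeta> * x + Im \<zeta> * t)"
        unfolding c_def norm_exp_eq_Re exp_add[symmetric] by (simp add: algebra_simps)
      ultimately show ?thesis by simp
    qed
    have dz: "exp (- y * t) * cmod (D t) = deviation \<zeta> z t" for t
      by (simp add: deviation_def D_def y_def)
    have dw: "exp (- y * t) * cmod (E t) = deviation (- \<zeta>) w t" for t
      by (simp add: deviation_def E_def y_def)
    have "cmod (integral {0..x} (\<lambda>t. c * g1 t)) \<le> integral {0..x} (\<lambda>t. cmod (v t) * deviation (- \<zeta>) w t
       + cmod r * P * (deviation \<zeta> z t + deviation (- \<zeta>) w t))"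
    proof (rule integral_norm_bound_integral)
      show "(\<lambda>t. c * g1 t) integrable_on {0..x}" using x by (intro L2_integrable L2_cmult g1) auto
      have "(\<lambda>t. cmod (v t) * cmod (complex_of_real (deviation (- \<zeta>) w t))) integrable_on {0..x}"
        using x by (intro L2_mult_integrable v continuous_in_L2 continuous_intros deviation_continuous cw) auto
      then have "(\<lambda>t. cmod (v t) * deviation (- \<zeta>) w t) integrable_on {0..x}"
        by (simp add: deviation_nonneg)
      moreover have "(\<lambda>t. cmod r * P * (deviation \<zeta> z t + deviation (- \<zeta>) w t)) integrable_on {0..x}"
        using x by (intro integrable_continuous_real continuous_on_subset[of "{0..1}" _ "{0..x}"]
            continuous_intros deviation_continuous cw cz) auto
      ultimately show "(\<lambda>t. cmod (v t) * deviation (- \<zeta>) w t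
         + cmod r * P * (deviation \<zeta> z t + deviation (- \<zeta>) w t)) integrable_on {0..x}"
        by (rule integrable_add)
      fix t assume t: "t \<in> {0..x}"
      then have t1: "t \<in> {0..1}" using x by auto
      have "cmod (c * g1 t) = (cmod c * cmod (exp (- (\<i> * \<zeta> * of_real t)))) * cmod (v t * E t + r * (p t * D t + q t * E t))"
        by (simp add: g1_def norm_mult)
      also have "\<dots> \<le> exp (- y * t) * (cmod (v t) * cmod (E t) + cmod r * (P * cmod (D t) + P * cmod (E t)))"
      proof (intro mult_mono nc[OF t])
        show "cmod (v t * E t + r * (p t * D t + q t * E t))
          \<le> cmod (v t) * cmod (E t) + cmod r * (P * cmod (D t) + P * cmod (E t))"
          unfolding norm_mult[symmetric]
          by (intro norm_triangle_le add_mono) (auto simp: norm_mult intro!: mult_left_mono norm_triangle_le add_mono mult_right_mono P t1)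
      qed auto
      also have "\<dots> = cmod (v t) * (exp (- y * t) * cmod (E t)) + cmod r * P * (exp (- y * t) * cmod (D t) + exp (- y * t) * cmod (E t))"
        by (simp add: algebra_simps)
      also have "\<dots> = cmod (v t) * deviation (- \<zeta>) w t + cmod r * P * (deviation \<zeta> z t + deviation (- \<zeta>) w t)"
        unfolding dz dw ..
      finally show "cmod (c * g1 t) \<le> cmod (v t) * deviation (- \<zeta>) w t + cmod r * P * (deviation \<zeta> z t + deviation (- \<zeta>) w t)" .
    qed
    then show "cmod (c * integral {0..x} g1) \<le> integral {0..x} (\<lambda>t. cmod (v t) * deviation (- \<zeta>) w t
       + cmod r * P * (deviation \<zeta> z t + deviation (- \<zeta>) w t))" by simp
    have P0: "0 \<le> P" using order_trans[OF norm_ge_zero P(1)[of 0]] by simp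
    have "cmod (integral {0..x} (\<lambda>t. c * g2 t)) \<le> integral {0..x} (\<lambda>t. 2 * P * cmod r)"
    proof (rule integral_norm_bound_integral)
      show "(\<lambda>t. c * g2 t) integrable_on {0..x}" using x by (intro L2_integrable L2_cmult continuous_in_L2[OF cg2]) auto
      fix t assume t: "t \<in> {0..x}"
      then have t1: "t \<in> {0..1}" using x by auto
      have e: "cmod (exp (\<i> * \<zeta> * of_real t)) \<le> exp (y * t)" "cmod (exp (- (\<i> * \<zeta> * of_real t))) \<le> exp (y * t)"
        using t mult_right_mono[of "- Im \<zeta>" y t] mult_right_mono[of "Im \<zeta>" y t]
        by (auto simp: norm_exp_eq_Re y_def)
      have "cmod (c * g2 t) = (cmod c * cmod (exp (- (\<i> * \<zeta> * of_real t)))) *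
          (cmod r * cmod (p t * (exp (\<i> * \<zeta> * of_real t) * z 0) + q t * (exp (- (\<i> * \<zeta> * of_real t)) * w 0)))"
        by (simp add: g2_def norm_mult)
      also have "\<dots> \<le> exp (- y * t) * (cmod r * (P * (exp (y * t) * 1) + P * (exp (y * t) * 1)))"
      proof (intro mult_mono[OF nc[OF t]] mult_left_mono norm_triangle_le add_mono)
        show "cmod (p t * (exp (\<i> * \<zeta> * of_real t) * z 0)) \<le> P * (exp (y * t) * 1)"
          unfolding norm_mult by (rule mult_mono[OF P(1)[OF t1] mult_mono[OF e(1) z0]]) (use P0 in auto)
        show "cmod (q t * (exp (- (\<i> * \<zeta> * of_real t)) * w 0)) \<le> P * (exp (y * t) * 1)"
          unfolding norm_mult by (rule mult_mono[OF P(2)[OF t1] mult_mono[OF e(2) w0]]) (use P0 in auto)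
      qed auto
      also have "\<dots> = (exp (- y * t) * exp (y * t)) * (2 * P * cmod r)" by (simp add: algebra_simps)
      also have "exp (- y * t) * exp (y * t) = 1" by (simp add: exp_add[symmetric])
      finally show "cmod (c * g2 t) \<le> 2 * P * cmod r" by simp
    qed (intro integrable_continuous_real continuous_intros)
    also have "\<dots> \<le> 2 * P * cmod r" using x P0 mult_left_mono[of x 1 "2 * P * cmod r"] by (simp add: mult_ac)
    finally show "cmod (c * integral {0..x} g2) \<le> 2 * P * cmod r" by simp
  qed
  finally show ?thesis by simp
qed

text \<open>The coefficients of the remainder are quantified away and enter the estimates only
  through the bound \<open>P\<close>. The resulting constants therefore depend on \<open>v\<close>
  and \<open>P\<close> alone and are uniform in the spectral parameter.\<close>

definition akns :: "(real \<Rightarrow> complex) \<Rightarrow> real \<Rightarrow> complex \<Rightarrow> complex \<Rightarrow> (real \<Rightarrow> complex) \<Rightarrow> (real \<Rightarrow> complex) \<Rightarrow> bool" where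
  "akns v P \<zeta> r z w \<longleftrightarrow> cmod r \<le> 1 \<and> cmod (z 0) \<le> 1 \<and> cmod (w 0) \<le> 1 \<and>
    (\<exists>p q p' q'. (\<forall>h\<in>{p, q, p', q'}. continuous_on {0..1} h \<and> (\<forall>t\<in>{0..1}. cmod (h t) \<le> P)) \<and>
      ac2 z (\<lambda>t. \<i> * \<zeta> * z t + v t * w t + r * (p t * z t + q t * w t)) \<and>
      ac2 w (\<lambda>t. \<i> * (- \<zeta>) * w t + v t * z t + r * (p' t * w t + q' t * z t)))"

definition total_deviation :: "complex \<Rightarrow> (real \<Rightarrow> complex) \<Rightarrow> (real \<Rightarrow> complex) \<Rightarrow> real" where
  "total_deviation \<zeta> z w = deviation \<zeta> z 1 + deviation (- \<zeta>) w 1"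

text \<open>The two halves add up to a Volterra inequality for \<open>D\<close> with the
  square-integrable kernel |v| + 2 P. Squaring it and applying Cauchy-Schwarz leaves only the norm
  of the kernel, so Gronwall's inequality applies to \<open>D\<^sup>2\<close>.\<close>

lemma akns_deviation_bound:
  assumes v: "v \<in> L2" and P: "0 \<le> P"
  obtains B where "0 < B" "\<And>\<zeta> r z w. akns v P \<zeta> r z w \<Longrightarrow>
     (total_deviation \<zeta> z w)\<^sup>2 \<le> B * ((osc v \<zeta> 1)\<^sup>2 + (osc v (- \<zeta>) 1)\<^sup>2
        + integral {0..1} (\<lambda>x. (osc v \<zeta> x)\<^sup>2 + (osc v (- \<zeta>) x)\<^sup>2) + (cmod r)\<^sup>2)"
proof -
  define V where "V t = complex_of_real (cmod (v t)) + of_real (2 * P)" for t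
  have V: "V \<in> L2" unfolding V_def by (intro L2_add L2_cmod v continuous_in_L2 continuous_intros)
  have nV: "cmod (V t) = cmod (v t) + 2 * P" for t
    unfolding V_def of_real_add[symmetric] norm_of_real using P by simp
  \<comment> \<open>The factor 2 comes from (H + I)^2 \<le> 2 H^2 + 2 I^2 for the inhomogeneity H
    and the integral I.\<close>
  define K where "K = 2 * integral {0..1} (\<lambda>t. (cmod (V t))\<^sup>2)"
  have K: "0 \<le> K" unfolding K_def by (auto intro!: integral_nonneg L2_integrable V)
  \<comment> \<open>The square of a sum of three terms gives 6 = 2 * 3 for the two oscillatory terms
    and 96 = 2 * 3 * 16 for \<open>4 * P * cmod r\<close>; the second factor comes from
    Gronwall.\<close>
  define B where "B = (6 + 96 * P\<^sup>2) * (1 + K * exp K)"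
  have "B > 0" unfolding B_def using K by (intro mult_pos_pos add_pos_nonneg) auto
  moreover have "(total_deviation \<zeta> z w)\<^sup>2 \<le> B * ((osc v \<zeta> 1)\<^sup>2 + (osc v (- \<zeta>) 1)\<^sup>2
        + integral {0..1} (\<lambda>x. (osc v \<zeta> x)\<^sup>2 + (osc v (- \<zeta>) x)\<^sup>2) + (cmod r)\<^sup>2)"
    if "akns v P \<zeta> r z w" for \<zeta> r z w
  proof -
    from that obtain p q p' q' where r: "cmod r \<le> 1" and z0: "cmod (z 0) \<le> 1" and w0: "cmod (w 0) \<le> 1"
      and c: "\<forall>h\<in>{p, q, p', q'}. continuous_on {0..1} h \<and> (\<forall>t\<in>{0..1}. cmod (h t) \<le> P)"
      and z: "ac2 z (\<lambda>t. \<i> * \<zeta> * z t + v t * w t + r * (p t * z t + q t * w t))"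
      and w: "ac2 w (\<lambda>t. \<i> * (- \<zeta>) * w t + v t * z t + r * (p' t * w t + q' t * z t))"
      unfolding akns_def by blast
    note cz = ac2_continuous[OF z] and cw = ac2_continuous[OF w]
    define D where "D t = deviation \<zeta> z t + deviation (- \<zeta>) w t" for t
    have cD: "continuous_on {0..1} D" unfolding D_def by (intro continuous_intros deviation_continuous cz cw)
    have D0: "0 \<le> D t" for t by (simp add: D_def deviation_nonneg)
    define Q where "Q x = (osc v \<zeta> x)\<^sup>2 + (osc v (- \<zeta>) x)\<^sup>2" for x
    have cO: "continuous_on {0..1} Q" unfolding Q_def by (intro continuous_intros osc_continuous v)
    define h where "h x = 6 * Q x + 96 * P\<^sup>2 * (cmod r)\<^sup>2" for x
    have ch: "continuous_on {0..1} h" unfolding h_def by (intro continuous_intros cO)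
    have DL: "(\<lambda>t. complex_of_real (D t)) \<in> L2" by (intro continuous_in_L2 continuous_intros cD)
    have "(D x)\<^sup>2 \<le> h x + K * integral {0..x} (\<lambda>t. (D t)\<^sup>2)" if x: "x \<in> {0..1}" for x
    proof -
      have i1: "(\<lambda>t. cmod (v t) * deviation (- \<zeta>) w t + cmod r * P * (deviation \<zeta> z t + deviation (- \<zeta>) w t)) integrable_on {0..x}"
        (is "?f integrable_on _")
      proof -
        have "(\<lambda>t. cmod (v t) * cmod (complex_of_real (deviation (- \<zeta>) w t))) integrable_on {0..x}"
          using x by (intro L2_mult_integrable v continuous_in_L2 continuous_intros deviation_continuous cw) auto
        moreover have "(\<lambda>t. cmod r * P * (deviation \<zeta> z t + deviation (- \<zeta>) w t)) integrable_on {0..x}"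
          using x by (intro integrable_continuous_real continuous_on_subset[of "{0..1}" _ "{0..x}"]
              continuous_intros deviation_continuous cw cz) auto
        ultimately show ?thesis by (intro integrable_add) (simp_all add: deviation_nonneg)
      qed
      have i2: "(\<lambda>t. cmod (v t) * deviation \<zeta> z t + cmod r * P * (deviation (- \<zeta>) w t + deviation \<zeta> z t)) integrable_on {0..x}"
        (is "?g integrable_on _")
      proof -
        have "(\<lambda>t. cmod (v t) * cmod (complex_of_real (deviation \<zeta> z t))) integrable_on {0..x}"
          using x by (intro L2_mult_integrable v continuous_in_L2 continuous_intros deviation_continuous cz) auto
        moreover have "(\<lambda>t. cmod r * P * (deviation (- \<zeta>) w t + deviation \<zeta> z t)) integrable_on {0..x}"
          using x by (intro integrable_continuous_real continuous_on_subset[of "{0..1}" _ "{0..x}"]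
              continuous_intros deviation_continuous cw cz) auto
        ultimately show ?thesis by (intro integrable_add) (simp_all add: deviation_nonneg)
      qed
      have "deviation \<zeta> z x \<le> osc v \<zeta> x + 2 * P * cmod r + integral {0..x} ?f"
        using c by (intro deviation_half[OF v _ _ _ _ z cw z0 w0 x]) auto
      moreover have "deviation (- \<zeta>) w x \<le> osc v (- \<zeta>) x + 2 * P * cmod r + integral {0..x} ?g"
        using c deviation_half[OF v _ _ _ _ w cz w0 z0 x, of P] by auto
      ultimately have "D x \<le> osc v \<zeta> x + osc v (- \<zeta>) x + 4 * P * cmod r + integral {0..x} (\<lambda>t. ?f t + ?g t)"
        unfolding integral_add[OF i1 i2] D_def by simp
      also have "integral {0..x} (\<lambda>t. ?f t + ?g t) \<le> integral {0..x} (\<lambda>t. cmod (V t) * cmod (complex_of_real (D t)))"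
      proof (rule integral_le[OF integrable_add[OF i1 i2]])
        show "(\<lambda>t. cmod (V t) * cmod (complex_of_real (D t))) integrable_on {0..x}"
          using x by (intro L2_mult_integrable V DL) auto
        fix t assume "t \<in> {0..x}"
        have "?f t + ?g t = (cmod (v t) + 2 * (cmod r * P)) * D t" by (simp add: D_def algebra_simps)
        also have "\<dots> \<le> (cmod (v t) + 2 * (1 * P)) * D t"
          using r P D0 by (intro mult_right_mono add_left_mono mult_left_mono) auto
        finally show "?f t + ?g t \<le> cmod (V t) * cmod (complex_of_real (D t))"
          using D0[of t] by (simp add: nV)
      qed
      finally have Dx: "D x \<le> (osc v \<zeta> x + osc v (- \<zeta>) x + 4 * P * cmod r) + integral {0..x} (\<lambda>t. cmod (V t) * cmod (complex_of_real (D t)))"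
        (is "_ \<le> ?H + ?I") by simp
      have sq2: "(a + b)\<^sup>2 \<le> 2 * a\<^sup>2 + 2 * b\<^sup>2" for a b :: real
        using zero_le_power2[of "a - b"] by (simp add: power2_sum power2_diff)
      have sq3: "(a + b + c)\<^sup>2 \<le> 3 * a\<^sup>2 + 3 * b\<^sup>2 + 3 * c\<^sup>2" for a b c :: real
        using zero_le_power2[of "a - b"] zero_le_power2[of "a - c"] zero_le_power2[of "b - c"]
        by (simp add: power2_eq_square algebra_simps)
      have "(D x)\<^sup>2 \<le> (?H + ?I)\<^sup>2" using Dx D0 by (intro power_mono)
      also have "\<dots> \<le> 2 * ?H\<^sup>2 + 2 * ?I\<^sup>2" by (rule sq2)
      also have "\<dots> \<le> h x + K * integral {0..x} (\<lambda>t. (D t)\<^sup>2)"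
      proof (rule add_mono)
        have "2 * ?H\<^sup>2 \<le> 2 * (3 * (osc v \<zeta> x)\<^sup>2 + 3 * (osc v (- \<zeta>) x)\<^sup>2 + 3 * (4 * P * cmod r)\<^sup>2)"
          by (intro mult_left_mono sq3) auto
        then show "2 * ?H\<^sup>2 \<le> h x" by (simp add: h_def Q_def power_mult_distrib)
        have "?I\<^sup>2 \<le> integral {0..x} (\<lambda>t. (cmod (V t))\<^sup>2) * integral {0..x} (\<lambda>t. (cmod (complex_of_real (D t)))\<^sup>2)"
          using x by (intro Cauchy_Schwarz_L2 V DL) auto
        also have "\<dots> \<le> integral {0..1} (\<lambda>t. (cmod (V t))\<^sup>2) * integral {0..x} (\<lambda>t. (cmod (complex_of_real (D t)))\<^sup>2)"
          using x by (intro mult_right_mono integral_subset_le integral_nonneg L2_integrable V DL) auto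
        finally show "2 * ?I\<^sup>2 \<le> K * integral {0..x} (\<lambda>t. (D t)\<^sup>2)" by (simp add: K_def)
      qed
      finally show ?thesis .
    qed
    then have "(D 1)\<^sup>2 \<le> h 1 + K * exp K * integral {0..1} h"
      by (intro gronwall[OF _ ch _ K]) (auto intro!: continuous_intros cD simp: h_def Q_def)
    also have "integral {0..1} h = 6 * integral {0..1} Q + 96 * P\<^sup>2 * (cmod r)\<^sup>2"
      unfolding h_def using integrable_continuous_real[OF cO] by (subst integral_add) auto
    also have "h 1 + K * exp K * (6 * integral {0..1} Q + 96 * P\<^sup>2 * (cmod r)\<^sup>2)
       \<le> B * (Q 1 + integral {0..1} Q + (cmod r)\<^sup>2)"
    proof -
      have IO: "0 \<le> integral {0..1} Q"
        using integrable_continuous_real[OF cO] by (intro integral_nonneg) (auto simp: Q_def)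
      have O1: "0 \<le> Q 1" by (simp add: Q_def)
      define L where "L = K * exp K"
      have "0 \<le> L" using K by (simp add: L_def)
      have "h 1 + L * (6 * integral {0..1} Q + 96 * P\<^sup>2 * (cmod r)\<^sup>2)
        \<le> (6 + 96 * P\<^sup>2) * (Q 1 + integral {0..1} Q + (cmod r)\<^sup>2) + L * ((6 + 96 * P\<^sup>2) * (Q 1 + integral {0..1} Q + (cmod r)\<^sup>2))"
        using IO O1 by (intro add_mono mult_left_mono[OF _ \<open>0 \<le> L\<close>]) (auto simp: h_def algebra_simps)
      also have "\<dots> = B * (Q 1 + integral {0..1} Q + (cmod r)\<^sup>2)" by (simp add: B_def L_def algebra_simps)
      finally show ?thesis by (simp add: L_def)
    qed
    finally show ?thesis by (simp add: D_def total_deviation_def Q_def[abs_def])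
  qed
  ultimately show ?thesis by (rule that)
qed

section \<open>Square summability in strips and uniform smallness of the deviation\<close>

lemma summable_on_int_bounded:
  fixes q :: "int \<Rightarrow> real"
  assumes "\<And>k. 0 \<le> q k" "\<And>A. finite A \<Longrightarrow> sum q A \<le> M"
  shows "q summable_on UNIV"
  by (rule nonneg_bdd_above_summable_on) (use assms in \<open>auto intro!: bdd_aboveI[of _ M]\<close>)

lemma finite_large_terms:
  fixes q :: "int \<Rightarrow> real"
  assumes q: "\<And>k. 0 \<le> q k" "q summable_on UNIV" and e: "0 < e"
  shows "finite {k. e \<le> q k}"
proof (rule ccontr)
  assume inf: "infinite {k. e \<le> q k}"
  define n where "n = nat \<lceil>infsum q UNIV / e\<rceil> + 1"
  obtain A where A: "finite A" "card A = n" "A \<subseteq> {k. e \<le> q k}"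
    using infinite_arbitrarily_large[OF inf] by metis
  have "of_nat n * e \<le> sum q A"
    using sum_mono[of A "\<lambda>_. e" q] A by auto
  also have "\<dots> \<le> infsum q UNIV" using A q by (intro finite_sum_le_infsum) auto
  finally have "of_nat n \<le> infsum q UNIV / e" using e by (simp add: field_simps)
  moreover have "infsum q UNIV / e < of_nat n"
    unfolding n_def by linarith
  ultimately show False by simp
qed

text \<open>Bessel's inequality is applied at the endpoint 1 and, under the integral, at every x.
  Both \<open>k\<close> and \<open>- k\<close> occur because the equation for \<open>w\<close> has
  the spectral parameter - zeta.\<close>

lemma akns_strip:
  assumes v: "v \<in> L2" and P: "0 \<le> P" and C: "0 \<le> C"
  obtains q B where "\<And>k :: int. 0 \<le> q k" "q summable_on UNIV" "0 < B"
    "\<And>k \<zeta> r z w. akns v P \<zeta> r z w \<Longrightarrow> cmod (\<zeta> - of_int k * pi) \<le> C \<Longrightarrow>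
      (total_deviation \<zeta> z w)\<^sup>2 \<le> q k + B * (cmod r)\<^sup>2"
proof -
  obtain B where B: "0 < B" "\<And>\<zeta> r z w. akns v P \<zeta> r z w \<Longrightarrow>
     (total_deviation \<zeta> z w)\<^sup>2 \<le> B * ((osc v \<zeta> 1)\<^sup>2 + (osc v (- \<zeta>) 1)\<^sup>2
        + integral {0..1} (\<lambda>x. (osc v \<zeta> x)\<^sup>2 + (osc v (- \<zeta>) x)\<^sup>2) + (cmod r)\<^sup>2)"
    by (rule akns_deviation_bound[OF v P]) (rule that)
  define g where "g k x = (cmod (fourier v k x))\<^sup>2 + (cmod (fourier v (- k) x))\<^sup>2" for k x
  have cg: "continuous_on {0..1} (g k)" for k
    unfolding g_def by (intro continuous_intros fourier_continuous v)
  have ig: "g k integrable_on {0..1}" for k by (rule integrable_continuous_real[OF cg])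
  define E where "E = 2 * exp (4 * C)"
  \<comment> \<open>The endpoint contributes \<open>g k 1\<close> and 8 C^2 times the integral of
    \<open>g k\<close>; the integral over x contributes 1 + 8 C^2 times it.\<close>
  define q where "q k = B * (E * (g k 1 + (16 * C\<^sup>2 + 1) * integral {0..1} (g k)))" for k
  define N where "N = integral {0..1} (\<lambda>t. (cmod (v t))\<^sup>2)"
  have N: "0 \<le> N" unfolding N_def by (auto intro!: integral_nonneg L2_integrable v)
  have g0: "0 \<le> g k x" for k x by (simp add: g_def)
  have Ig0: "0 \<le> integral {0..1} (g k)" for k by (intro integral_nonneg ig) (simp add: g0)
  have sg: "(\<Sum>k\<in>A. g k x) \<le> 2 * N" if "finite A" "x \<in> {0..1}" for A x
  proof -
    have "(\<Sum>k\<in>A. (cmod (fourier v (- k) x))\<^sup>2) = (\<Sum>k\<in>uminus ` A. (cmod (fourier v k x))\<^sup>2)"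
      by (subst sum.reindex) (auto simp: o_def)
    then have "(\<Sum>k\<in>A. (cmod (fourier v (- k) x))\<^sup>2) \<le> N"
      using bessel_inequality_partial[OF v, of "uminus ` A" x] that by (simp add: N_def)
    moreover have "(\<Sum>k\<in>A. (cmod (fourier v k x))\<^sup>2) \<le> N"
      using bessel_inequality_partial[OF v, of A x] that by (simp add: N_def)
    ultimately show ?thesis by (simp add: g_def sum.distrib)
  qed
  have sIg: "(\<Sum>k\<in>A. integral {0..1} (g k)) \<le> 2 * N" if "finite A" for A
  proof -
    have "(\<Sum>k\<in>A. integral {0..1} (g k)) = integral {0..1} (\<lambda>x. \<Sum>k\<in>A. g k x)"
      using that ig by (simp add: integral_sum)
    also have "\<dots> \<le> integral {0..1} (\<lambda>x :: real. 2 * N)"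
      using sg[OF that] that ig by (intro integral_le integrable_sum) auto
    finally show ?thesis by simp
  qed
  have "0 \<le> q k" for k unfolding q_def E_def using B(1) C g0[of k 1] Ig0[of k] by simp
  moreover have "q summable_on UNIV"
  proof (rule summable_on_int_bounded[where M = "B * (E * (2 * N + (16 * C\<^sup>2 + 1) * (2 * N)))"])
    fix A :: "int set" assume A: "finite A"
    have "sum q A = B * (E * ((\<Sum>k\<in>A. g k 1) + (16 * C\<^sup>2 + 1) * (\<Sum>k\<in>A. integral {0..1} (g k))))"
      using A by (induction A rule: finite_induct) (simp_all add: q_def algebra_simps)
    also have "\<dots> \<le> B * (E * (2 * N + (16 * C\<^sup>2 + 1) * (2 * N)))"
      using B(1) C by (intro mult_left_mono add_mono sg[OF A] sIg[OF A]) (auto simp: E_def)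
    finally show "sum q A \<le> \<dots>" .
  qed fact
  moreover note B(1)
  moreover have "(total_deviation \<zeta> z w)\<^sup>2 \<le> q k + B * (cmod r)\<^sup>2"
    if a: "akns v P \<zeta> r z w" and k: "cmod (\<zeta> - of_int k * pi) \<le> C" for k \<zeta> r z w
  proof -
    have k': "cmod (- \<zeta> - of_int (- k) * pi) \<le> C" using k by (simp add: norm_minus_commute)
    define G where "G = integral {0..1} (g k)"
    have If: "integral {0..1} (\<lambda>t. (cmod (fourier v j t))\<^sup>2) \<le> G" if "j \<in> {k, - k}" for j
      unfolding G_def using that
      by (intro integral_le ig integrable_continuous_real continuous_intros fourier_continuous v) (auto simp: g_def)
    have Q: "(osc v \<zeta> x)\<^sup>2 + (osc v (- \<zeta>) x)\<^sup>2 \<le> E * (g k x + 8 * C\<^sup>2 * G)" if x: "x \<in> {0..1}" for x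
    proof -
      have "(osc v \<zeta> x)\<^sup>2 + (osc v (- \<zeta>) x)\<^sup>2 \<le> E * ((cmod (fourier v k x))\<^sup>2 + 4 * C\<^sup>2 * G)
         + E * ((cmod (fourier v (- k) x))\<^sup>2 + 4 * C\<^sup>2 * G)"
        unfolding E_def
        by (intro add_mono order_trans[OF osc_strip[OF v x k]] order_trans[OF osc_strip[OF v x k']]
            mult_left_mono order_refl If) auto
      then show ?thesis by (simp add: g_def algebra_simps)
    qed
    have "integral {0..1} (\<lambda>x. (osc v \<zeta> x)\<^sup>2 + (osc v (- \<zeta>) x)\<^sup>2) \<le> integral {0..1} (\<lambda>x. E * (g k x + 8 * C\<^sup>2 * G))"
      by (intro integral_le integrable_continuous_real continuous_intros osc_continuous v cg Q)
    moreover have "integral {0..1} (\<lambda>x. g k x + 8 * C\<^sup>2 * G) = G + 8 * C\<^sup>2 * G"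
      using ig by (subst integral_add) (auto simp: G_def)
    ultimately have "integral {0..1} (\<lambda>x. (osc v \<zeta> x)\<^sup>2 + (osc v (- \<zeta>) x)\<^sup>2) \<le> E * (G + 8 * C\<^sup>2 * G)" by simp
    then have "(osc v \<zeta> 1)\<^sup>2 + (osc v (- \<zeta>) 1)\<^sup>2 + integral {0..1} (\<lambda>x. (osc v \<zeta> x)\<^sup>2 + (osc v (- \<zeta>) x)\<^sup>2)
       \<le> E * (g k 1 + 8 * C\<^sup>2 * G) + E * (G + 8 * C\<^sup>2 * G)"
      using Q[of 1] by simp
    also have "\<dots> = E * (g k 1 + (16 * C\<^sup>2 + 1) * G)" by (simp add: algebra_simps)
    finally have "(total_deviation \<zeta> z w)\<^sup>2 \<le> B * (E * (g k 1 + (16 * C\<^sup>2 + 1) * G) + (cmod r)\<^sup>2)"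
      using B(1) by (intro order_trans[OF B(2)[OF a]] mult_left_mono) auto
    then show ?thesis by (simp add: q_def G_def algebra_simps)
  qed
  ultimately show ?thesis by (rule that)
qed

text \<open>There are two regimes. If |Im zeta| is at least a height \<open>Y\<close>,
  \<open>osc_half_plane\<close> suffices. In the remaining strip zeta is within Y + pi of a multiple
  k pi, and only finitely many of the summable \<open>q k\<close> exceed the tolerance; a large
  modulus of zeta excludes those.\<close>

lemma akns_uniform:
  assumes v: "v \<in> L2" and P: "0 \<le> P" and \<epsilon>: "0 < \<epsilon>"
  obtains R d where "0 < d" "\<And>\<zeta> r z w. akns v P \<zeta> r z w \<Longrightarrow> R \<le> cmod \<zeta> \<Longrightarrow> cmod r \<le> d \<Longrightarrow>
    total_deviation \<zeta> z w \<le> \<epsilon>"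
proof -
  obtain B where B: "0 < B" "\<And>\<zeta> r z w. akns v P \<zeta> r z w \<Longrightarrow>
     (total_deviation \<zeta> z w)\<^sup>2 \<le> B * ((osc v \<zeta> 1)\<^sup>2 + (osc v (- \<zeta>) 1)\<^sup>2
        + integral {0..1} (\<lambda>x. (osc v \<zeta> x)\<^sup>2 + (osc v (- \<zeta>) x)\<^sup>2) + (cmod r)\<^sup>2)"
    by (rule akns_deviation_bound[OF v P]) (rule that)
  define N where "N = integral {0..1} (\<lambda>t. (cmod (v t))\<^sup>2)"
  have N: "0 \<le> N" unfolding N_def by (auto intro!: integral_nonneg L2_integrable v)
  \<comment> \<open>This makes 4 B N / Y at most half of epsilon^2; the summand 1 keeps
    \<open>Y\<close> positive when \<open>N = 0\<close>.\<close>
  define Y where "Y = (8 * B * N + 1) / \<epsilon>\<^sup>2"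
  have Y: "0 < Y" unfolding Y_def using B(1) N \<epsilon> by (intro divide_pos_pos add_nonneg_pos) auto
  have YC: "0 \<le> Y + pi" using Y pi_gt_zero by simp
  obtain q B' where q: "\<And>k :: int. 0 \<le> q k" "q summable_on UNIV" "0 < B'"
    and qB: "\<And>k \<zeta> r z w. akns v P \<zeta> r z w \<Longrightarrow> cmod (\<zeta> - of_int k * pi) \<le> Y + pi \<Longrightarrow>
      (total_deviation \<zeta> z w)\<^sup>2 \<le> q k + B' * (cmod r)\<^sup>2"
    by (rule akns_strip[OF v P YC]) (rule that)
  define F where "F = {k. \<epsilon>\<^sup>2 / 2 \<le> q k}"
  have "finite F" unfolding F_def using q(1,2) \<epsilon> by (intro finite_large_terms) auto
  \<comment> \<open>The sum serves as an upper bound for |k| on the finite exceptional set.\<close>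
  define K where "K = (\<Sum>k\<in>F. \<bar>k\<bar>)"
  have K: "q k < \<epsilon>\<^sup>2 / 2" if "\<bar>k\<bar> > K" for k
  proof (rule ccontr)
    assume "\<not> q k < \<epsilon>\<^sup>2 / 2"
    then have "k \<in> F" by (simp add: F_def)
    then have "\<bar>k\<bar> \<le> K" unfolding K_def by (rule member_le_sum) (use \<open>finite F\<close> in auto)
    with that show False by simp
  qed
  define d where "d = \<epsilon> / (2 * sqrt (B + B'))"
  have "0 < d" unfolding d_def using \<epsilon> B(1) q(3) by simp
  moreover have "total_deviation \<zeta> z w \<le> \<epsilon>"
    \<comment> \<open>In the strip, zeta has distance at most pi / 2 + Y from its nearest multiple k
      pi, so this lower bound for |zeta| forces |k| > K.\<close>
    if a: "akns v P \<zeta> r z w" and \<zeta>: "of_int (K + 2) * pi + Y \<le> cmod \<zeta>" and r: "cmod r \<le> d" for \<zeta> r z w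
  proof -
    have "(cmod r)\<^sup>2 \<le> d\<^sup>2" using r by (intro power_mono) auto
    also have "d\<^sup>2 = \<epsilon>\<^sup>2 / (4 * (B + B'))" using B(1) q(3) by (simp add: d_def power_divide power_mult_distrib)
    finally have rr: "(B + B') * (cmod r)\<^sup>2 \<le> \<epsilon>\<^sup>2 / 4"
      using B(1) q(3) by (simp add: field_simps)
    have "B * (cmod r)\<^sup>2 \<le> (B + B') * (cmod r)\<^sup>2" "B' * (cmod r)\<^sup>2 \<le> (B + B') * (cmod r)\<^sup>2"
      using B(1) q(3) by (auto intro!: mult_right_mono)
    note rB = this[THEN order_trans, OF rr]
    have "(total_deviation \<zeta> z w)\<^sup>2 \<le> \<epsilon>\<^sup>2"
    proof (cases "\<bar>Im \<zeta>\<bar> \<ge> Y")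
      case True
      with Y have im: "Im \<zeta> \<noteq> 0" by auto
      have "N / \<bar>Im \<zeta>\<bar> \<le> N / Y" using True Y N by (intro divide_left_mono) auto
      then have o: "(osc v \<zeta> x)\<^sup>2 \<le> N / Y" "(osc v (- \<zeta>) x)\<^sup>2 \<le> N / Y" if "x \<in> {0..1}" for x
        using osc_half_plane[OF v that, of \<zeta>] osc_half_plane[OF v that, of "- \<zeta>"] im
        by (auto simp: N_def)
      have "integral {0..1} (\<lambda>x. (osc v \<zeta> x)\<^sup>2 + (osc v (- \<zeta>) x)\<^sup>2) \<le> integral {0..1} (\<lambda>x :: real. N / Y + N / Y)"
        by (intro integral_le integrable_continuous_real continuous_intros osc_continuous v add_mono o)
      then have "(osc v \<zeta> 1)\<^sup>2 + (osc v (- \<zeta>) 1)\<^sup>2 + integral {0..1} (\<lambda>x. (osc v \<zeta> x)\<^sup>2 + (osc v (- \<zeta>) x)\<^sup>2)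
          \<le> 4 * (N / Y)"
        using o[of 1] by simp
      then have "(total_deviation \<zeta> z w)\<^sup>2 \<le> B * (4 * (N / Y) + (cmod r)\<^sup>2)"
        using B(1) by (intro order_trans[OF B(2)[OF a]] mult_left_mono) auto
      also have "\<dots> = (4 * B * N) / Y + B * (cmod r)\<^sup>2" by (simp add: algebra_simps)
      also have "(4 * B * N) / Y \<le> \<epsilon>\<^sup>2 / 2"
      proof -
        have "8 * B * N * \<epsilon>\<^sup>2 \<le> \<epsilon>\<^sup>2 * (8 * B * N + 1)" by (simp add: algebra_simps)
        moreover have "0 < 8 * B * N + 1" using B(1) N by (intro add_nonneg_pos) auto
        ultimately show ?thesis by (simp add: Y_def field_simps)
      qed
      also have "\<epsilon>\<^sup>2 / 2 + B * (cmod r)\<^sup>2 \<le> \<epsilon>\<^sup>2" using rB(1) zero_le_power2[of \<epsilon>] by linarith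
      finally show ?thesis by simp
    next
      case False
      define k where "k = round (Re \<zeta> / pi)"
      have "\<bar>of_int k - Re \<zeta> / pi\<bar> \<le> 1 / 2" unfolding k_def by (rule of_int_round_abs_le)
      then have "\<bar>of_int k - Re \<zeta> / pi\<bar> * pi \<le> 1 / 2 * pi" by (intro mult_right_mono) auto
      moreover have "of_int k * pi - Re \<zeta> = (of_int k - Re \<zeta> / pi) * pi" by (simp add: field_simps)
      ultimately have "\<bar>of_int k * pi - Re \<zeta>\<bar> \<le> pi / 2" by (simp add: abs_mult)
      then have re: "\<bar>Re \<zeta> - of_int k * pi\<bar> \<le> pi / 2" by (simp add: abs_minus_commute)
      have "cmod (\<zeta> - of_int k * pi) \<le> \<bar>Re \<zeta> - of_int k * pi\<bar> + \<bar>Im \<zeta>\<bar>"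
        using cmod_le[of "\<zeta> - of_int k * pi"] by simp
      also have "\<dots> \<le> pi / 2 + Y" using re False by simp
      finally have b: "cmod (\<zeta> - of_int k * pi) \<le> pi / 2 + Y" .
      have "cmod \<zeta> \<le> cmod (\<zeta> - of_int k * pi) + cmod (complex_of_real (of_int k * pi))"
        using norm_triangle_sub[of \<zeta> "complex_of_real (of_int k * pi)"] by simp
      also have "\<dots> \<le> pi / 2 + Y + \<bar>of_int k\<bar> * pi" using b by (simp add: norm_mult abs_mult)
      finally have "(of_int K + 2) * pi < (\<bar>of_int k\<bar> + 1) * pi"
        using \<zeta> by (simp add: algebra_simps) (insert pi_gt_zero, linarith)
      then have "of_int K + 2 < \<bar>of_int k :: real\<bar> + 1" using mult_less_cancel_right_pos[OF pi_gt_zero] by blast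
      then have "K < \<bar>k\<bar>" by linarith
      have "(total_deviation \<zeta> z w)\<^sup>2 \<le> q k + B' * (cmod r)\<^sup>2" using b pi_gt_zero by (intro qB[OF a]) linarith
      also have "\<dots> \<le> \<epsilon>\<^sup>2" using K[OF \<open>K < \<bar>k\<bar>\<close>] rB(2) zero_le_power2[of \<epsilon>] by linarith
      finally show ?thesis .
    qed
    then show ?thesis using \<epsilon> by (auto intro: power2_le_imp_le)
  qed
  ultimately show ?thesis by (rule that)
qed

section \<open>The initial value problem\<close>

lemma has_integral_matrix_iff:
  fixes f :: "real \<Rightarrow> complex^2^2"
  shows "(f has_integral I) X \<longleftrightarrow> (\<forall>i j. ((\<lambda>x. f x $ i $ j) has_integral I $ i $ j) X)"
proof
  assume f: "(f has_integral I) X"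
  show "\<forall>i j. ((\<lambda>x. f x $ i $ j) has_integral I $ i $ j) X"
    using has_integral_linear[OF f bounded_linear_compose[OF bounded_linear_vec_nth bounded_linear_vec_nth]]
    by (simp add: o_def)
next
  assume f: "\<forall>i j. ((\<lambda>x. f x $ i $ j) has_integral I $ i $ j) X"
  have lin: "bounded_linear (\<lambda>z. axis i (axis j z) :: complex^2^2)" for i j
    by (rule linear_conv_bounded_linear[THEN iffD1])
       (auto intro!: linearI simp: vec_eq_iff axis_def)
  have eq: "(\<Sum>i\<in>UNIV. \<Sum>j\<in>UNIV. axis i (axis j (A $ i $ j))) = A" for A :: "complex^2^2"
    by (simp add: vec_eq_iff axis_def sum_2 forall_2)
  have "((\<lambda>x. axis i (axis j (f x $ i $ j)) :: complex^2^2) has_integral axis i (axis j (I $ i $ j))) X" for i j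
    using has_integral_linear[OF f[rule_format, of i j] lin] by (simp add: o_def)
  then have "((\<lambda>x. \<Sum>i\<in>UNIV. \<Sum>j\<in>UNIV. axis i (axis j (f x $ i $ j)) :: complex^2^2)
      has_integral (\<Sum>i\<in>UNIV. \<Sum>j\<in>UNIV. axis i (axis j (I $ i $ j)))) X"
    by (intro has_integral_sum) auto
  then show "(f has_integral I) X" by (simp only: eq)
qed

definition alpha_diag :: "(real \<Rightarrow> complex) \<Rightarrow> real \<Rightarrow> complex" where
  "alpha_diag uy x = \<i> * uy x / 4"

definition alpha_upper :: "(real \<Rightarrow> complex) \<Rightarrow> complex \<Rightarrow> real \<Rightarrow> complex" where
  "alpha_upper u l x = - (exp (u x / 2) + inverse l * exp (- u x / 2)) / 4"

definition alpha_lower :: "(real \<Rightarrow> complex) \<Rightarrow> complex \<Rightarrow> real \<Rightarrow> complex" where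
  "alpha_lower u l x = (exp (u x / 2) + l * exp (- u x / 2)) / 4"

lemma alpha_nth:
  "alpha u uy l x $ 1 $ 1 = alpha_diag uy x"
  "alpha u uy l x $ 1 $ 2 = alpha_upper u l x"
  "alpha u uy l x $ 2 $ 1 = alpha_lower u l x"
  "alpha u uy l x $ 2 $ 2 = - alpha_diag uy x"
  unfolding alpha_def vector_scaleR_component vector_2
  unfolding alpha_diag_def alpha_upper_def alpha_lower_def scaleR_conv_of_real
  by (simp_all add: field_simps)

definition solves :: "(real \<Rightarrow> complex) \<Rightarrow> (real \<Rightarrow> complex) \<Rightarrow> complex \<Rightarrow> (real \<Rightarrow> complex) \<Rightarrow> (real \<Rightarrow> complex) \<Rightarrow> bool" where
  "solves u uy l y1 y2 \<longleftrightarrow>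
     ac2 y1 (\<lambda>x. alpha_diag uy x * y1 x + alpha_upper u l x * y2 x) \<and>
     ac2 y2 (\<lambda>x. alpha_lower u l x * y1 x - alpha_diag uy x * y2 x)"

lemma PotE:
  assumes "(u, uy) \<in> Pot"
  obtains u' where "ac2 u u'" "uy \<in> L2" "u 0 = u 1"
  using assms by (auto simp: Pot_def W12_def ac2_def)

lemma Pot_continuous: "(u, uy) \<in> Pot \<Longrightarrow> continuous_on {0..1} u"
  by (meson PotE ac2_continuous)

lemma Pot_L2: "(u, uy) \<in> Pot \<Longrightarrow> uy \<in> L2"
  by (meson PotE)

lemma alpha_diag_L2: "(u, uy) \<in> Pot \<Longrightarrow> alpha_diag uy \<in> L2"
  using L2_cmult[OF Pot_L2, of u uy "\<i> / 4"] by (simp add: alpha_diag_def[abs_def])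

lemma alpha_upper_continuous: "(u, uy) \<in> Pot \<Longrightarrow> continuous_on {0..1} (alpha_upper u l)"
  unfolding alpha_upper_def by (intro continuous_intros Pot_continuous) auto

lemma alpha_lower_continuous: "(u, uy) \<in> Pot \<Longrightarrow> continuous_on {0..1} (alpha_lower u l)"
  unfolding alpha_lower_def by (intro continuous_intros Pot_continuous) auto

lemma alpha_product_nth:
  "(alpha u uy l x ** F) $ 1 $ j = alpha_diag uy x * F $ 1 $ j + alpha_upper u l x * F $ 2 $ j"
  "(alpha u uy l x ** F) $ 2 $ j = alpha_lower u l x * F $ 1 $ j - alpha_diag uy x * F $ 2 $ j"
  by (simp_all add: matrix_matrix_mult_def sum_2 alpha_nth)

text \<open>The columns decouple. The initial value comes from the integral equation on the
  degenerate interval at \<open>x = 0\<close>.\<close>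

lemma is_frame_iff:
  assumes P: "(u, uy) \<in> Pot"
  shows "is_frame u uy l F \<longleftrightarrow> F 0 = mat 1 \<and> (\<forall>j. solves u uy l (\<lambda>x. F x $ 1 $ j) (\<lambda>x. F x $ 2 $ j))"
proof
  assume F: "is_frame u uy l F"
  have i: "((\<lambda>t. alpha u uy l t ** F t) has_integral (F x - mat 1)) {0..x}" if "x \<in> {0..1}" for x
    using F that by (simp add: is_frame_def)
  have "((\<lambda>t. alpha u uy l t ** F t) has_integral (F 0 - mat 1)) {0..0}"
    by (rule i) simp
  then have "((\<lambda>t. alpha u uy l t ** F t) has_integral (F 0 - mat 1)) {0}" by simp
  then have "F 0 - mat 1 = 0" by (rule has_integral_unique) (rule has_integral_refl(2))
  then have F0: "F 0 = mat 1" by simp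
  have c: "continuous_on {0..1} (\<lambda>x. F x $ i $ j)" for i j
    using F unfolding is_frame_def by (intro bounded_linear.continuous_on[OF bounded_linear_vec_nth]) auto
  have I: "((\<lambda>t. (alpha u uy l t ** F t) $ i $ j) has_integral (F x $ i $ j - F 0 $ i $ j)) {0..x}"
    if "x \<in> {0..1}" for x i j
    using F that unfolding is_frame_def has_integral_matrix_iff F0 by simp
  have "solves u uy l (\<lambda>x. F x $ 1 $ j) (\<lambda>x. F x $ 2 $ j)" for j
    unfolding solves_def ac2_def
  proof (intro conjI ballI)
    show "(\<lambda>x. alpha_diag uy x * F x $ 1 $ j + alpha_upper u l x * F x $ 2 $ j) \<in> L2"
      by (intro L2_add L2_mult_continuous alpha_diag_L2[OF P] c continuous_in_L2[OF alpha_upper_continuous[OF P]])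
    show "(\<lambda>x. alpha_lower u l x * F x $ 1 $ j - alpha_diag uy x * F x $ 2 $ j) \<in> L2"
      by (intro L2_diff L2_mult_continuous alpha_diag_L2[OF P] c continuous_in_L2[OF alpha_lower_continuous[OF P]])
  qed (use I[of _ 1 j] I[of _ 2 j] in \<open>simp_all add: alpha_product_nth\<close>)
  with F0 show "F 0 = mat 1 \<and> (\<forall>j. solves u uy l (\<lambda>x. F x $ 1 $ j) (\<lambda>x. F x $ 2 $ j))" by simp
next
  assume F: "F 0 = mat 1 \<and> (\<forall>j. solves u uy l (\<lambda>x. F x $ 1 $ j) (\<lambda>x. F x $ 2 $ j))"
  have c0: "\<forall>i. continuous_on {0..1} (\<lambda>x. F x $ i $ j)" for j
    unfolding forall_2 using F ac2_continuous unfolding solves_def by blast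
  have "continuous_on {0..1} (\<lambda>x. \<chi> i. \<chi> j. F x $ i $ j)"
    by (intro continuous_on_vec_lambda c0[rule_format])
  then have c: "continuous_on {0..1} F" by simp
  have "((\<lambda>t. alpha u uy l t ** F t) has_integral (F x - mat 1)) {0..x}" if "x \<in> {0..1}" for x
    unfolding has_integral_matrix_iff forall_2[where P = "\<lambda>i. \<forall>j. _ i j"] alpha_product_nth
    using F that by (auto simp: solves_def ac2_def)
  with c show "is_frame u uy l F" by (simp add: is_frame_def)
qed

text \<open>Cauchy-Schwarz trades the square-integrable kernel for its norm. With
  \<open>h = d\<close> this prepares Gronwall for uniqueness; with consecutive Picard terms it is
  the induction step for convergence.\<close>

lemma square_gronwall_system:
  assumes V: "V \<in> L2" and cd: "continuous_on {0..1} d" and ch: "continuous_on {0..1} h"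
    and d: "\<And>x. x \<in> {0..1} \<Longrightarrow> 0 \<le> d x" and h: "\<And>x. x \<in> {0..1} \<Longrightarrow> 0 \<le> h x"
    and le: "\<And>x. x \<in> {0..1} \<Longrightarrow> h x \<le> integral {0..x} (\<lambda>t. cmod (V t) * d t)" and x: "x \<in> {0..1}"
  shows "(h x)\<^sup>2 \<le> integral {0..1} (\<lambda>t. (cmod (V t))\<^sup>2) * integral {0..x} (\<lambda>t. (d t)\<^sup>2)"
proof -
  have DL: "(\<lambda>t. complex_of_real (d t)) \<in> L2" by (intro continuous_in_L2 continuous_intros cd)
  have "integral {0..x} (\<lambda>t. cmod (V t) * d t) = integral {0..x} (\<lambda>t. cmod (V t) * cmod (complex_of_real (d t)))"
    using d x by (intro integral_cong) auto
  then have "h x \<le> integral {0..x} (\<lambda>t. cmod (V t) * cmod (complex_of_real (d t)))" using le[OF x] by simp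
  then have "(h x)\<^sup>2 \<le> (integral {0..x} (\<lambda>t. cmod (V t) * cmod (complex_of_real (d t))))\<^sup>2"
    by (intro power_mono h x)
  also have "\<dots> \<le> integral {0..x} (\<lambda>t. (cmod (V t))\<^sup>2) * integral {0..x} (\<lambda>t. (cmod (complex_of_real (d t)))\<^sup>2)"
    using x by (intro Cauchy_Schwarz_L2 V DL) auto
  also have "\<dots> \<le> integral {0..1} (\<lambda>t. (cmod (V t))\<^sup>2) * integral {0..x} (\<lambda>t. (cmod (complex_of_real (d t)))\<^sup>2)"
    using x by (intro mult_right_mono integral_subset_le integral_nonneg L2_integrable V DL) auto
  finally show ?thesis by simp
qed

text \<open>A majorant of the coefficients that is uniform for \<open>l\<close> and \<open>inverse l\<close> of modulus at most \<open>\<rho>\<close>.\<close>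

definition majorant :: "(real \<Rightarrow> complex) \<Rightarrow> (real \<Rightarrow> complex) \<Rightarrow> real \<Rightarrow> real \<Rightarrow> complex" where
  "majorant u uy \<rho> x = of_real (cmod (alpha_diag uy x) * 2 + (1 + \<rho>) * (cmod (exp (u x / 2)) + cmod (exp (- u x / 2))))"

lemma majorant_L2:
  assumes "(u, uy) \<in> Pot"
  shows "majorant u uy \<rho> \<in> L2"
  unfolding majorant_def of_real_add of_real_mult[of _ 2]
  by (intro L2_add L2_mult_continuous L2_cmod alpha_diag_L2[OF assms] continuous_in_L2 continuous_intros Pot_continuous[OF assms]) auto

lemma coefficient_bound:
  assumes l: "cmod l \<le> \<rho>" "cmod (inverse l) \<le> \<rho>"
  shows "cmod (alpha_diag uy x * a + alpha_upper u l x * b) + cmod (alpha_lower u l x * a - alpha_diag uy x * b)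
    \<le> cmod (majorant u uy \<rho> x) * (cmod a + cmod b)"
proof -
  have \<rho>: "0 \<le> \<rho>" using l(1) norm_ge_zero order_trans by blast
  define A E1 E2 where "A = cmod (alpha_diag uy x)" and "E1 = cmod (exp (u x / 2))" and "E2 = cmod (exp (- u x / 2))"
  have nn: "0 \<le> A" "0 \<le> E1" "0 \<le> E2" by (simp_all add: A_def E1_def E2_def)
  have m: "cmod (majorant u uy \<rho> x) = A * 2 + (1 + \<rho>) * (E1 + E2)"
    unfolding majorant_def norm_of_real A_def[symmetric] E1_def[symmetric] E2_def[symmetric] using \<rho> nn by simp
  have "cmod (alpha_upper u l x) = cmod (exp (u x / 2) + inverse l * exp (- u x / 2)) / 4"
    by (simp only: alpha_upper_def norm_divide norm_minus_cancel) simp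
  also have "\<dots> \<le> (E1 + \<rho> * E2) / 4"
    unfolding E1_def E2_def
    by (intro divide_right_mono norm_triangle_le add_mono order_refl)
       (unfold norm_mult, rule mult_right_mono[OF l(2)], simp_all)
  also have "\<dots> \<le> (1 + \<rho>) * (E1 + E2)" using nn \<rho> by (simp add: algebra_simps)
  finally have up: "cmod (alpha_upper u l x) \<le> (1 + \<rho>) * (E1 + E2)" .
  have "cmod (alpha_lower u l x) = cmod (exp (u x / 2) + l * exp (- u x / 2)) / 4"
    by (simp only: alpha_lower_def norm_divide) simp
  also have "\<dots> \<le> (E1 + \<rho> * E2) / 4"
    unfolding E1_def E2_def
    by (intro divide_right_mono norm_triangle_le add_mono order_refl)
       (unfold norm_mult, rule mult_right_mono[OF l(1)], simp_all)
  also have "\<dots> \<le> (1 + \<rho>) * (E1 + E2)" using nn \<rho> by (simp add: algebra_simps)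
  finally have lo: "cmod (alpha_lower u l x) \<le> (1 + \<rho>) * (E1 + E2)" .
  have "cmod (alpha_diag uy x * a + alpha_upper u l x * b) + cmod (alpha_lower u l x * a - alpha_diag uy x * b)
    \<le> (A * cmod a + (1 + \<rho>) * (E1 + E2) * cmod b) + ((1 + \<rho>) * (E1 + E2) * cmod a + A * cmod b)"
    using up lo by (intro add_mono norm_triangle_le norm_triangle_le_diff) (auto simp: norm_mult A_def intro: mult_right_mono)
  also have "\<dots> \<le> (A * 2 + (1 + \<rho>) * (E1 + E2)) * (cmod a + cmod b)"
    using nn by (simp add: algebra_simps)
  finally show ?thesis by (simp add: m)
qed

lemma solves_unique:
  assumes P: "(u, uy) \<in> Pot" and y: "solves u uy l y1 y2" and z: "solves u uy l z1 z2"
    and 0: "y1 0 = z1 0" "y2 0 = z2 0" and x: "x \<in> {0..1}"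
  shows "y1 x = z1 x \<and> y2 x = z2 x"
proof -
  define \<rho> where "\<rho> = cmod l + cmod (inverse l)"
  define V where "V = majorant u uy \<rho>"
  have V: "V \<in> L2" unfolding V_def by (rule majorant_L2[OF P])
  define d1 d2 where "d1 t = y1 t - z1 t" and "d2 t = y2 t - z2 t" for t
  have a1: "ac2 d1 (\<lambda>x. alpha_diag uy x * d1 x + alpha_upper u l x * d2 x)"
    by (rule ac2_cong[OF ac2_diff[OF conjunct1[OF y[unfolded solves_def]] conjunct1[OF z[unfolded solves_def]]]])
       (simp_all add: d1_def d2_def algebra_simps)
  have a2: "ac2 d2 (\<lambda>x. alpha_lower u l x * d1 x - alpha_diag uy x * d2 x)"
    by (rule ac2_cong[OF ac2_diff[OF conjunct2[OF y[unfolded solves_def]] conjunct2[OF z[unfolded solves_def]]]])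
       (simp_all add: d1_def d2_def algebra_simps)
  define D where "D t = cmod (d1 t) + cmod (d2 t)" for t
  have cD: "continuous_on {0..1} D"
    unfolding D_def by (intro continuous_intros ac2_continuous[OF a1] ac2_continuous[OF a2])
  have d0: "d1 0 = 0" "d2 0 = 0" using 0 by (auto simp: d1_def d2_def)
  have DL: "(\<lambda>t. complex_of_real (D t)) \<in> L2" by (intro continuous_in_L2 continuous_intros cD)
  have le: "D x \<le> integral {0..x} (\<lambda>t. cmod (V t) * D t)" if x: "x \<in> {0..1}" for x
  proof -
    have i: "(\<lambda>t. cmod (alpha_diag uy t * d1 t + alpha_upper u l t * d2 t)) integrable_on {0..x}"
      "(\<lambda>t. cmod (alpha_lower u l t * d1 t - alpha_diag uy t * d2 t)) integrable_on {0..x}"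
      using x by (auto intro!: L2_integrable(2) ac2_L2[OF a1] ac2_L2[OF a2])
    have "D x \<le> integral {0..x} (\<lambda>t. cmod (alpha_diag uy t * d1 t + alpha_upper u l t * d2 t))
        + integral {0..x} (\<lambda>t. cmod (alpha_lower u l t * d1 t - alpha_diag uy t * d2 t))"
      using ac2_increment[OF a1, of 0 x] ac2_increment[OF a2, of 0 x] x by (simp add: D_def d0)
    also have "\<dots> \<le> integral {0..x} (\<lambda>t. cmod (V t) * cmod (complex_of_real (D t)))"
      unfolding integral_add[OF i, symmetric]
      using x coefficient_bound[of l \<rho> uy _ _ u]
      by (intro integral_le integrable_add i L2_mult_integrable V DL)
         (auto simp: V_def D_def \<rho>_def simp flip: of_real_add)
    also have "\<dots> = integral {0..x} (\<lambda>t. cmod (V t) * D t)" by (simp add: D_def flip: of_real_add)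
    finally show ?thesis .
  qed
  have "(D x)\<^sup>2 \<le> 0 + integral {0..1} (\<lambda>t. (cmod (V t))\<^sup>2) * exp (integral {0..1} (\<lambda>t. (cmod (V t))\<^sup>2)) * integral {0..x} (\<lambda>t. 0)"
  proof (rule gronwall[where y = "\<lambda>x. (D x)\<^sup>2", OF _ _ _ _ _ x])
    show "continuous_on {0..1} (\<lambda>x. (D x)\<^sup>2)" by (intro continuous_intros cD)
    show "0 \<le> integral {0..1} (\<lambda>t. (cmod (V t))\<^sup>2)" by (auto intro!: integral_nonneg L2_integrable V)
    fix x :: real assume "x \<in> {0..1}"
    then show "(D x)\<^sup>2 \<le> 0 + integral {0..1} (\<lambda>t. (cmod (V t))\<^sup>2) * integral {0..x} (\<lambda>t. (D t)\<^sup>2)"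
      using square_gronwall_system[OF V cD cD _ _ le] by (simp add: D_def)
  qed auto
  then have "D x = 0" by simp
  then show ?thesis
    using norm_ge_zero[of "d1 x"] norm_ge_zero[of "d2 x"] by (simp add: D_def d1_def d2_def add_nonneg_eq_0_iff)
qed

text \<open>Uniqueness of the frame makes the definite description meaningful, so any explicitly
  given frame computes the monodromy.\<close>

lemma monodromy_eq:
  assumes P: "(u, uy) \<in> Pot" and F: "is_frame u uy l F"
  shows "monodromy u uy l = F 1"
  unfolding monodromy_def
proof (rule the_equality)
  show "\<exists>Fa. is_frame u uy l Fa \<and> F 1 = Fa 1" using F by blast
  fix M assume "\<exists>F. is_frame u uy l F \<and> M = F 1"
  then obtain G where G: "is_frame u uy l G" "M = G 1" by blast
  have "G 1 $ 1 $ j = F 1 $ 1 $ j \<and> G 1 $ 2 $ j = F 1 $ 2 $ j" for j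
    using F G(1) unfolding is_frame_iff[OF P] by (intro solves_unique[OF P]) auto
  then show "M = F 1" by (simp add: G(2) vec_eq_iff forall_2)
qed

text \<open>Laurent polynomials in \<open>l\<close> with coefficients continuous in
  \<open>x\<close>, given by closure rules. The class is preserved by integration against
  square-integrable functions of \<open>x\<close>, so holomorphy of the Picard terms needs no
  differentiation under the integral. Rule \<open>cong\<close> compares only at
  \<open>l \<noteq> 0\<close> and on the unit interval.\<close>

inductive laurent_family :: "(complex \<Rightarrow> real \<Rightarrow> complex) \<Rightarrow> bool" where
  monomial: "continuous_on {0..1} c \<Longrightarrow> laurent_family (\<lambda>l x. l powi j * c x)"
| add: "laurent_family f \<Longrightarrow> laurent_family g \<Longrightarrow> laurent_family (\<lambda>l x. f l x + g l x)"
| cong: "laurent_family f \<Longrightarrow> (\<And>l x. l \<noteq> 0 \<Longrightarrow> x \<in> {0..1} \<Longrightarrow> g l x = f l x) \<Longrightarrow> laurent_family g"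

lemma laurent_family_continuous:
  assumes "laurent_family f" "l \<noteq> 0"
  shows "continuous_on {0..1} (f l)"
  using assms
proof (induction)
  case (cong f g)
  then show ?case using continuous_on_cong[of "{0..1}" "{0..1}" "g l" "f l"] by auto
qed (auto intro!: continuous_intros)

lemma laurent_family_holomorphic:
  assumes "laurent_family f" "x \<in> {0..1}"
  shows "(\<lambda>l. f l x) holomorphic_on (- {0})"
  using assms
proof (induction)
  case (cong f g)
  then show ?case using holomorphic_cong[of "- {0}" "- {0}" "\<lambda>l. g l x" "\<lambda>l. f l x"] by auto
qed (auto intro!: holomorphic_intros)

lemma laurent_family_shift:
  assumes "laurent_family f"
  shows "laurent_family (\<lambda>l x. l powi k * f l x)"
  using assms
proof (induction)
  case (monomial c j)
  then have "laurent_family (\<lambda>l x. l powi (k + j) * c x)" by (rule laurent_family.monomial)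
  then show ?case by (rule laurent_family.cong) (simp add: power_int_add mult.assoc)
next
  case (add f g)
  from laurent_family.add[OF add.IH] show ?case by (rule laurent_family.cong) (simp add: algebra_simps)
next
  case (cong f g)
  from cong.IH show ?case by (rule laurent_family.cong) (simp add: cong.hyps)
qed

lemma laurent_family_mult_left: "laurent_family f \<Longrightarrow> laurent_family (\<lambda>l x. l * f l x)"
  using laurent_family_shift[of f 1] by simp

lemma laurent_family_mult_inverse: "laurent_family f \<Longrightarrow> laurent_family (\<lambda>l x. inverse l * f l x)"
  using laurent_family_shift[of f "-1"] by simp

lemma laurent_family_integral:
  assumes "laurent_family f" and a: "a \<in> L2"
  shows "laurent_family (\<lambda>l x. integral {0..x} (\<lambda>t. a t * f l t))"
  using assms(1)
proof (induction)
  case (monomial c j)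
  have "continuous_on {0..1} (\<lambda>x. integral {0..x} (\<lambda>t. a t * c t))"
    using monomial by (intro indefinite_integral_continuous_1 L2_integrable L2_mult_continuous a) auto
  then have "laurent_family (\<lambda>l x. l powi j * integral {0..x} (\<lambda>t. a t * c t))" by (rule laurent_family.monomial)
  then show ?case by (rule laurent_family.cong) (simp add: mult.left_commute[of "a _"])
next
  case (add f g)
  from laurent_family.add[OF add.IH] show ?case
  proof (rule laurent_family.cong)
    fix l x assume "l \<noteq> (0 :: complex)" "x \<in> {0..1::real}"
    moreover have "(\<lambda>t. a t * f l t) integrable_on {0..x}" "(\<lambda>t. a t * g l t) integrable_on {0..x}"
      using calculation add.hyps by (auto intro!: L2_integrable(1) L2_mult_continuous a laurent_family_continuous)
    ultimately show "integral {0..x} (\<lambda>t. a t * (f l t + g l t)) =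
        integral {0..x} (\<lambda>t. a t * f l t) + integral {0..x} (\<lambda>t. a t * g l t)"
      by (simp add: distrib_left integral_add)
  qed
next
  case (cong f g)
  from cong.IH show ?case
  proof (rule laurent_family.cong)
    fix l x assume "l \<noteq> (0 :: complex)" "x \<in> {0..1::real}"
    then show "integral {0..x} (\<lambda>t. a t * g l t) = integral {0..x} (\<lambda>t. a t * f l t)"
      using cong.hyps by (intro integral_cong) auto
  qed
qed

text \<open>These are the terms of the Neumann series, not its partial sums: the constant
  \<open>c\<close> occurs only in term 0, and the solution is the sum over \<open>n\<close>.\<close>

primrec picard :: "(real \<Rightarrow> complex) \<Rightarrow> (real \<Rightarrow> complex) \<Rightarrow> complex \<times> complex \<Rightarrow> nat \<Rightarrow> complex \<Rightarrow> real \<Rightarrow> complex \<times> complex" where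
  "picard u uy c 0 l x = c"
| "picard u uy c (Suc n) l x =
    (integral {0..x} (\<lambda>t. alpha_diag uy t * fst (picard u uy c n l t) + alpha_upper u l t * snd (picard u uy c n l t)),
     integral {0..x} (\<lambda>t. alpha_lower u l t * fst (picard u uy c n l t) - alpha_diag uy t * snd (picard u uy c n l t)))"

lemma picard_laurent_family:
  assumes P: "(u, uy) \<in> Pot"
  shows "laurent_family (\<lambda>l x. fst (picard u uy c n l x)) \<and> laurent_family (\<lambda>l x. snd (picard u uy c n l x))"
proof (induction n)
  case 0
  have "laurent_family (\<lambda>l x. l powi 0 * d)" for d by (rule monomial) auto
  then show ?case by simp
next
  case (Suc n)
  define f g where "f l x = fst (picard u uy c n l x)" and "g l x = snd (picard u uy c n l x)" for l x
  have f: "laurent_family f" and g: "laurent_family g" using Suc by (simp_all add: f_def[abs_def] g_def[abs_def])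
  note cu = Pot_continuous[OF P]
  have e: "(\<lambda>t. exp (u t / 2) / 4) \<in> L2" "(\<lambda>t. exp (- u t / 2) / 4) \<in> L2"
    by (auto intro!: continuous_in_L2 continuous_intros cu)
  have fst: "laurent_family (\<lambda>l x. integral {0..x} (\<lambda>t. alpha_diag uy t * f l t) +
     ((- 1) * integral {0..x} (\<lambda>t. exp (u t / 2) / 4 * g l t) +
       inverse l * ((- 1) * integral {0..x} (\<lambda>t. exp (- u t / 2) / 4 * g l t))))"
  proof -
    have m: "laurent_family (\<lambda>l x. (- 1) * h l x)" if "laurent_family h" for h
      using that
    proof induction
      case (monomial c j)
      have "laurent_family (\<lambda>l x. l powi j * (- c x))" by (rule laurent_family.monomial) (intro continuous_intros monomial)
      then show ?case by simp
    next
      case (add f g)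
      from laurent_family.add[OF add.IH] show ?case by simp
    next
      case (cong f g)
      from cong.IH show ?case by (rule laurent_family.cong) (simp add: cong.hyps)
    qed
    show ?thesis
      by (intro laurent_family.add m laurent_family_mult_inverse laurent_family_integral f g e alpha_diag_L2[OF P])
  qed
  have snd: "laurent_family (\<lambda>l x. integral {0..x} (\<lambda>t. exp (u t / 2) / 4 * f l t) +
     (l * integral {0..x} (\<lambda>t. exp (- u t / 2) / 4 * f l t) + integral {0..x} (\<lambda>t. (- 1) * alpha_diag uy t * g l t)))"
    by (intro laurent_family.add laurent_family_mult_left laurent_family_integral f g e L2_cmult alpha_diag_L2[OF P])
  have I: "(\<lambda>t. a t * h l t) integrable_on {0..x}" if "a \<in> L2" "laurent_family h" "l \<noteq> 0" "x \<in> {0..1}" for a h l x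
    using that by (intro L2_integrable(1) L2_mult_continuous laurent_family_continuous) auto
  show ?case
  proof
    show "laurent_family (\<lambda>l x. fst (picard u uy c (Suc n) l x))"
    proof (rule laurent_family.cong[OF fst])
      fix l x assume lx: "l \<noteq> (0 :: complex)" "x \<in> {0..1::real}"
      have "((\<lambda>t. alpha_diag uy t * f l t + ((- 1) * (exp (u t / 2) / 4 * g l t) + inverse l * ((- 1) * (exp (- u t / 2) / 4 * g l t))))
        has_integral (integral {0..x} (\<lambda>t. alpha_diag uy t * f l t) +
         ((- 1) * integral {0..x} (\<lambda>t. exp (u t / 2) / 4 * g l t) +
         inverse l * ((- 1) * integral {0..x} (\<lambda>t. exp (- u t / 2) / 4 * g l t))))) {0..x}"
        by (intro has_integral_add has_integral_mult_right integrable_integral I f g e alpha_diag_L2[OF P] lx)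
      moreover have "alpha_diag uy t * f l t + ((- 1) * (exp (u t / 2) / 4 * g l t) + inverse l * ((- 1) * (exp (- u t / 2) / 4 * g l t)))
        = alpha_diag uy t * f l t + alpha_upper u l t * g l t" for t
        by (simp add: alpha_upper_def field_simps)
      ultimately have "((\<lambda>t. alpha_diag uy t * f l t + alpha_upper u l t * g l t) has_integral
        (integral {0..x} (\<lambda>t. alpha_diag uy t * f l t) +
         ((- 1) * integral {0..x} (\<lambda>t. exp (u t / 2) / 4 * g l t) +
         inverse l * ((- 1) * integral {0..x} (\<lambda>t. exp (- u t / 2) / 4 * g l t))))) {0..x}"
        by (simp only:)
      then show "fst (picard u uy c (Suc n) l x) = integral {0..x} (\<lambda>t. alpha_diag uy t * f l t) +
         ((- 1) * integral {0..x} (\<lambda>t. exp (u t / 2) / 4 * g l t) +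
         inverse l * ((- 1) * integral {0..x} (\<lambda>t. exp (- u t / 2) / 4 * g l t)))"
        unfolding picard.simps fst_conv snd_conv f_def g_def by (rule integral_unique)
    qed
    show "laurent_family (\<lambda>l x. snd (picard u uy c (Suc n) l x))"
    proof (rule laurent_family.cong[OF snd])
      fix l x assume lx: "l \<noteq> (0 :: complex)" "x \<in> {0..1::real}"
      have "((\<lambda>t. exp (u t / 2) / 4 * f l t + (l * (exp (- u t / 2) / 4 * f l t) + (- 1) * alpha_diag uy t * g l t))
        has_integral (integral {0..x} (\<lambda>t. exp (u t / 2) / 4 * f l t) +
     (l * integral {0..x} (\<lambda>t. exp (- u t / 2) / 4 * f l t) + integral {0..x} (\<lambda>t. (- 1) * alpha_diag uy t * g l t)))) {0..x}"
        by (intro has_integral_add has_integral_mult_right integrable_integral I f g e L2_cmult alpha_diag_L2[OF P] lx)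
      moreover have "exp (u t / 2) / 4 * f l t + (l * (exp (- u t / 2) / 4 * f l t) + (- 1) * alpha_diag uy t * g l t)
        = alpha_lower u l t * f l t - alpha_diag uy t * g l t" for t
        by (simp add: alpha_lower_def field_simps)
      ultimately have "((\<lambda>t. alpha_lower u l t * f l t - alpha_diag uy t * g l t) has_integral
        (integral {0..x} (\<lambda>t. exp (u t / 2) / 4 * f l t) +
         (l * integral {0..x} (\<lambda>t. exp (- u t / 2) / 4 * f l t) + integral {0..x} (\<lambda>t. (- 1) * alpha_diag uy t * g l t)))) {0..x}"
        by (simp only:)
      then show "snd (picard u uy c (Suc n) l x) = integral {0..x} (\<lambda>t. exp (u t / 2) / 4 * f l t) +
     (l * integral {0..x} (\<lambda>t. exp (- u t / 2) / 4 * f l t) + integral {0..x} (\<lambda>t. (- 1) * alpha_diag uy t * g l t))"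
        unfolding picard.simps fst_conv snd_conv f_def g_def by (rule integral_unique)
    qed
  qed
qed

lemma picard_continuous:
  assumes "(u, uy) \<in> Pot" "l \<noteq> 0"
  shows "continuous_on {0..1} (\<lambda>x. fst (picard u uy c n l x))" "continuous_on {0..1} (\<lambda>x. snd (picard u uy c n l x))"
  using picard_laurent_family[OF assms(1), of c n] laurent_family_continuous[OF _ assms(2)] by auto

text \<open>By \<open>square_gronwall_system\<close> the square of a term is at most
  \<open>K\<close> times the integral of the square of the previous one, and repeated integration of
  a constant produces the exponential series.\<close>

lemma picard_bound:
  assumes P: "(u, uy) \<in> Pot" and l: "l \<noteq> 0" "cmod l \<le> \<rho>" "cmod (inverse l) \<le> \<rho>" and x: "x \<in> {0..1}"
  defines "K \<equiv> integral {0..1} (\<lambda>t. (cmod (majorant u uy \<rho> t))\<^sup>2)"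
  shows "(cmod (fst (picard u uy c n l x)) + cmod (snd (picard u uy c n l x)))\<^sup>2
    \<le> (cmod (fst c) + cmod (snd c))\<^sup>2 * ((K * x) ^ n / fact n)"
  using x
proof (induction n arbitrary: x)
  case (Suc n)
  define V where "V = majorant u uy \<rho>"
  have V: "V \<in> L2" unfolding V_def by (rule majorant_L2[OF P])
  have K: "0 \<le> K" unfolding K_def by (auto intro!: integral_nonneg L2_integrable majorant_L2[OF P])
  define f g where "f t = fst (picard u uy c n l t)" and "g t = snd (picard u uy c n l t)" for t
  define d where "d t = cmod (f t) + cmod (g t)" for t
  define h where "h t = cmod (fst (picard u uy c (Suc n) l t)) + cmod (snd (picard u uy c (Suc n) l t))" for t
  define C where "C = (cmod (fst c) + cmod (snd c))\<^sup>2"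
  have cf: "continuous_on {0..1} f" and cg: "continuous_on {0..1} g"
    unfolding f_def g_def by (rule picard_continuous[OF P l(1)])+
  have cd: "continuous_on {0..1} d" unfolding d_def by (intro continuous_intros cf cg)
  have ch: "continuous_on {0..1} h"
    unfolding h_def by (intro continuous_on_add continuous_on_norm picard_continuous[OF P l(1)])
  have le: "h x \<le> integral {0..x} (\<lambda>t. cmod (V t) * d t)" if x: "x \<in> {0..1}" for x
  proof -
    have L: "(\<lambda>t. alpha_diag uy t * f t + alpha_upper u l t * g t) \<in> L2"
      "(\<lambda>t. alpha_lower u l t * f t - alpha_diag uy t * g t) \<in> L2"
      by (intro L2_add L2_diff L2_mult_continuous alpha_diag_L2[OF P] cf cg
          continuous_in_L2[OF alpha_upper_continuous[OF P]] continuous_in_L2[OF alpha_lower_continuous[OF P]])+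
    have i: "(\<lambda>t. cmod (alpha_diag uy t * f t + alpha_upper u l t * g t)) integrable_on {0..x}"
      "(\<lambda>t. cmod (alpha_lower u l t * f t - alpha_diag uy t * g t)) integrable_on {0..x}"
      using x L2_integrable(2)[OF L(1), of 0 x] L2_integrable(2)[OF L(2), of 0 x] by auto
    have DL: "(\<lambda>t. complex_of_real (d t)) \<in> L2" by (intro continuous_in_L2 continuous_intros cd)
    have "h x \<le> integral {0..x} (\<lambda>t. cmod (alpha_diag uy t * f t + alpha_upper u l t * g t))
        + integral {0..x} (\<lambda>t. cmod (alpha_lower u l t * f t - alpha_diag uy t * g t))"
      unfolding h_def picard.simps fst_conv snd_conv f_def[symmetric] g_def[symmetric]
      using x L2_integrable(1)[OF L(1), of 0 x] L2_integrable(1)[OF L(2), of 0 x] i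
      by (intro add_mono integral_norm_bound_integral) auto
    also have "\<dots> \<le> integral {0..x} (\<lambda>t. cmod (V t) * cmod (complex_of_real (d t)))"
      unfolding integral_add[OF i, symmetric]
      using x coefficient_bound[OF l(2,3), of uy _ _ u]
      by (intro integral_le integrable_add i L2_mult_integrable V DL)
         (auto simp: V_def d_def simp flip: of_real_add)
    also have "\<dots> = integral {0..x} (\<lambda>t. cmod (V t) * d t)" by (simp add: d_def flip: of_real_add)
    finally show ?thesis .
  qed
  have "(h x)\<^sup>2 \<le> K * integral {0..x} (\<lambda>t. (d t)\<^sup>2)"
    using square_gronwall_system[OF V cd ch _ _ le Suc.prems] by (simp add: d_def h_def K_def V_def)
  also have "\<dots> \<le> K * integral {0..x} (\<lambda>t. C * ((K * t) ^ n / fact n))"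
  proof (intro mult_left_mono[OF _ K] integral_le)
    show "(\<lambda>t. (d t)\<^sup>2) integrable_on {0..x}" "(\<lambda>t. C * ((K * t) ^ n / fact n)) integrable_on {0..x}"
      using Suc.prems by (auto intro!: integrable_continuous_real continuous_intros continuous_on_subset[OF cd])
    show "(d t)\<^sup>2 \<le> C * ((K * t) ^ n / fact n)" if "t \<in> {0..x}" for t
      using Suc.IH[of t] that Suc.prems by (simp add: d_def f_def g_def C_def)
  qed
  also have "integral {0..x} (\<lambda>t. C * ((K * t) ^ n / fact n)) = C * (K ^ n * (x ^ Suc n / fact (Suc n)))"
  proof (rule integral_unique)
    have d: "((\<lambda>t. t ^ Suc n / fact (Suc n)) has_real_derivative t ^ n / fact n) (at t within X)" for t :: real and X
    proof -
      have "((\<lambda>t. t ^ Suc n) has_real_derivative real (Suc n) * t ^ (Suc n - Suc 0)) (at t within X)"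
        by (rule has_field_derivative_at_within[OF DERIV_pow])
      from DERIV_cdivide[OF this, of "fact (Suc n)"] show ?thesis by (simp del: of_nat_Suc power_Suc)
    qed
    have "((\<lambda>t. C * ((K * t) ^ n / fact n)) has_integral
      (C * (K ^ n * (x ^ Suc n / fact (Suc n))) - C * (K ^ n * (0 ^ Suc n / fact (Suc n))))) {0..x}"
      using Suc.prems
    proof (intro fundamental_theorem_of_calculus[where f = "\<lambda>t. C * (K ^ n * (t ^ Suc n / fact (Suc n)))"])
      fix t
      show "((\<lambda>t. C * (K ^ n * (t ^ Suc n / fact (Suc n)))) has_vector_derivative C * ((K * t) ^ n / fact n)) (at t within {0..x})"
        using DERIV_cmult[OF DERIV_cmult[OF d[of t "{0..x}"], of "K ^ n"], of C]
        by (simp add: has_real_derivative_iff_has_vector_derivative power_mult_distrib del: power_Suc fact_Suc)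
    qed auto
    then show "((\<lambda>t. C * ((K * t) ^ n / fact n)) has_integral (C * (K ^ n * (x ^ Suc n / fact (Suc n))))) {0..x}" by simp
  qed
  also have "K * (C * (K ^ n * (x ^ Suc n / fact (Suc n)))) = C * ((K * x) ^ Suc n / fact (Suc n))"
    by (simp add: power_mult_distrib)
  finally show ?case by (simp only: h_def C_def)
qed simp

text \<open>A single term of the series of exp (4 K) is at most its sum, and dividing by 4^n leaves
  the square of (1/2)^n. After taking square roots in \<open>picard_bound\<close> the Picard terms
  thus have a geometric majorant.\<close>

lemma sqrt_exp_terms_bound:
  fixes K :: real
  assumes "0 \<le> K"
  shows "K ^ n / fact n \<le> exp (4 * K) * ((1/2) ^ n)\<^sup>2"
proof -
  have "(4 * K) ^ n / fact n \<le> exp (4 * K)"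
  proof -
    have "(\<Sum>k\<in>{n}. (4 * K) ^ k /\<^sub>R fact k) \<le> (\<Sum>k. (4 * K) ^ k /\<^sub>R fact k)"
      using assms by (intro sum_le_suminf summable_exp_generic) auto
    then show ?thesis by (simp add: exp_def divide_inverse mult.commute)
  qed
  moreover have "(4 * K) ^ n = K ^ n * 4 ^ n" by (simp add: power_mult_distrib mult.commute)
  moreover have "((1/2 :: real) ^ n)\<^sup>2 = 1 / 4 ^ n"
    by (simp add: power_divide power_mult[symmetric] mult.commute[of n]) (simp add: power_mult)
  ultimately show ?thesis by (simp add: field_simps)
qed

lemma picard_geometric_bound:
  assumes P: "(u, uy) \<in> Pot"
  obtains B where "0 \<le> B" "\<And>n l x. l \<noteq> 0 \<Longrightarrow> cmod l \<le> \<rho> \<Longrightarrow> cmod (inverse l) \<le> \<rho> \<Longrightarrow> x \<in> {0..1} \<Longrightarrow>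
     cmod (fst (picard u uy c n l x)) + cmod (snd (picard u uy c n l x)) \<le> B * (1/2) ^ n"
proof -
  define K where "K = integral {0..1} (\<lambda>t. (cmod (majorant u uy \<rho> t))\<^sup>2)"
  have K: "0 \<le> K" unfolding K_def by (auto intro!: integral_nonneg L2_integrable majorant_L2[OF P])
  define B where "B = (cmod (fst c) + cmod (snd c)) * exp (2 * K)"
  have "0 \<le> B" by (simp add: B_def)
  moreover have "cmod (fst (picard u uy c n l x)) + cmod (snd (picard u uy c n l x)) \<le> B * (1/2) ^ n"
    if "l \<noteq> 0" "cmod l \<le> \<rho>" "cmod (inverse l) \<le> \<rho>" "x \<in> {0..1}" for n l x
  proof (rule power2_le_imp_le)
    have "(cmod (fst (picard u uy c n l x)) + cmod (snd (picard u uy c n l x)))\<^sup>2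
      \<le> (cmod (fst c) + cmod (snd c))\<^sup>2 * ((K * x) ^ n / fact n)"
      unfolding K_def by (rule picard_bound[OF P that])
    also have "\<dots> \<le> (cmod (fst c) + cmod (snd c))\<^sup>2 * (K ^ n / fact n)"
      using K that by (intro mult_left_mono divide_right_mono power_mono) (auto intro: mult_left_le)
    also have "\<dots> \<le> (cmod (fst c) + cmod (snd c))\<^sup>2 * (exp (4 * K) * ((1/2) ^ n)\<^sup>2)"
      by (intro mult_left_mono sqrt_exp_terms_bound K) auto
    also have "exp (4 * K) = (exp (2 * K))\<^sup>2" by (simp add: exp_double[symmetric])
    finally show "(cmod (fst (picard u uy c n l x)) + cmod (snd (picard u uy c n l x)))\<^sup>2 \<le> (B * (1/2) ^ n)\<^sup>2"
      by (simp add: B_def power_mult_distrib mult.assoc)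
    show "0 \<le> B * (1/2) ^ n" using \<open>0 \<le> B\<close> by simp
  qed
  ultimately show ?thesis by (rule that)
qed

text \<open>The Neumann series converges uniformly on the unit interval, and at \<open>x = 1\<close>
  locally uniformly in \<open>l \<noteq> 0\<close>. The former with dominated convergence gives the
  integral equation; the latter makes the limit of Laurent polynomials holomorphic.\<close>

lemma solves_exists:
  assumes P: "(u, uy) \<in> Pot"
  obtains y1 y2 where "\<And>l. l \<noteq> 0 \<Longrightarrow> solves u uy l (y1 l) (y2 l)" "\<And>l. l \<noteq> 0 \<Longrightarrow> y1 l 0 = c1" "\<And>l. l \<noteq> 0 \<Longrightarrow> y2 l 0 = c2"
    "(\<lambda>l. y1 l 1) holomorphic_on (- {0})" "(\<lambda>l. y2 l 1) holomorphic_on (- {0})"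
proof -
  define f g where "f n l x = fst (picard u uy (c1, c2) n l x)" and "g n l x = snd (picard u uy (c1, c2) n l x)" for n l x
  define y1 y2 where "y1 l x = (\<Sum>n. f n l x)" and "y2 l x = (\<Sum>n. g n l x)" for l x
  define s1 s2 where "s1 N l x = (\<Sum>n<N. f n l x)" and "s2 N l x = (\<Sum>n<N. g n l x)" for N l x
  have cfg: "continuous_on {0..1} (f n l)" "continuous_on {0..1} (g n l)" if "l \<noteq> 0" for n l
    unfolding f_def g_def by (rule picard_continuous[OF P that])+
  have cs: "continuous_on {0..1} (s1 n l)" "continuous_on {0..1} (s2 n l)" if "l \<noteq> 0" for n l
    unfolding s1_def s2_def by (intro continuous_on_sum cfg that)+
  have unif: "\<exists>B. 0 \<le> B \<and> (\<forall>l x. l \<noteq> 0 \<longrightarrow> cmod l \<le> \<rho> \<longrightarrow> cmod (inverse l) \<le> \<rho> \<longrightarrow> x \<in> {0..1} \<longrightarrow>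
      (\<forall>n. cmod (f n l x) \<le> B * (1/2) ^ n \<and> cmod (g n l x) \<le> B * (1/2) ^ n))" for \<rho>
  proof -
    obtain B where B: "0 \<le> B" "\<And>n l x. l \<noteq> 0 \<Longrightarrow> cmod l \<le> \<rho> \<Longrightarrow> cmod (inverse l) \<le> \<rho> \<Longrightarrow> x \<in> {0..1} \<Longrightarrow>
     cmod (fst (picard u uy (c1, c2) n l x)) + cmod (snd (picard u uy (c1, c2) n l x)) \<le> B * (1/2) ^ n"
      by (rule picard_geometric_bound[OF P]) (rule that)
    show ?thesis
    proof (intro exI[of _ B] conjI allI impI B(1))
      fix l x n assume "l \<noteq> 0" "cmod l \<le> \<rho>" "cmod (inverse l) \<le> \<rho>" "x \<in> {0..1::real}"
      from B(2)[OF this, of n] show "cmod (f n l x) \<le> B * (1/2) ^ n" "cmod (g n l x) \<le> B * (1/2) ^ n"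
        using norm_ge_zero[of "f n l x"] norm_ge_zero[of "g n l x"] unfolding f_def g_def by linarith+
    qed
  qed
  have sumB: "summable (\<lambda>n. B * (1/2 :: real) ^ n)" for B by (intro summable_mult summable_geometric) simp
  have solve: "solves u uy l (y1 l) (y2 l) \<and> y1 l 0 = c1 \<and> y2 l 0 = c2" if l: "l \<noteq> 0" for l
  proof -
    define \<rho> where "\<rho> = cmod l + cmod (inverse l)"
    have \<rho>: "cmod l \<le> \<rho>" "cmod (inverse l) \<le> \<rho>" by (simp_all add: \<rho>_def)
    obtain B where B0: "0 \<le> B" and B: "\<And>x n. x \<in> {0..1} \<Longrightarrow> cmod (f n l x) \<le> B * (1/2) ^ n"
      "\<And>x n. x \<in> {0..1} \<Longrightarrow> cmod (g n l x) \<le> B * (1/2) ^ n"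
      using unif[of \<rho>] l \<rho> by blast
    have u1: "uniform_limit {0..1} (\<lambda>N. s1 N l) (y1 l) sequentially"
      unfolding s1_def y1_def by (rule Weierstrass_m_test[OF B(1) sumB])
    have u2: "uniform_limit {0..1} (\<lambda>N. s2 N l) (y2 l) sequentially"
      unfolding s2_def y2_def by (rule Weierstrass_m_test[OF B(2) sumB])
    have cy: "continuous_on {0..1} (y1 l)" "continuous_on {0..1} (y2 l)"
      using uniform_limit_theorem[OF _ u1] uniform_limit_theorem[OF _ u2] cs[OF l] by auto
    have sb: "cmod (s1 N l x) \<le> 2 * B" "cmod (s2 N l x) \<le> 2 * B" if x: "x \<in> {0..1}" for N x
    proof -
      have "(\<Sum>n<N. B * (1/2) ^ n) \<le> (\<Sum>n. B * (1/2) ^ n)"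
        by (rule sum_le_suminf[OF sumB]) (use B0 in auto)
      also have "\<dots> = 2 * B"
        by (subst suminf_mult) (auto simp: suminf_geometric summable_geometric)
      finally have "(\<Sum>n<N. B * (1/2) ^ n) \<le> 2 * B" .
      moreover have "cmod (s1 N l x) \<le> (\<Sum>n<N. B * (1/2) ^ n)" "cmod (s2 N l x) \<le> (\<Sum>n<N. B * (1/2) ^ n)"
        unfolding s1_def s2_def by (intro sum_norm_le B x)+
      ultimately show "cmod (s1 N l x) \<le> 2 * B" "cmod (s2 N l x) \<le> 2 * B" by linarith+
    qed
    define V where "V = majorant u uy \<rho>"
    have V: "V \<in> L2" unfolding V_def by (rule majorant_L2[OF P])
    define G H where "G a b t = alpha_diag uy t * a t + alpha_upper u l t * b t"
      and "H a b t = alpha_lower u l t * a t - alpha_diag uy t * b t" for a b t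
    have GL: "G a b \<in> L2" "H a b \<in> L2" if "continuous_on {0..1} a" "continuous_on {0..1} b" for a b
      unfolding G_def H_def
      by (intro L2_add L2_diff L2_mult_continuous alpha_diag_L2[OF P] that
          continuous_in_L2[OF alpha_upper_continuous[OF P]] continuous_in_L2[OF alpha_lower_continuous[OF P]])+
    \<comment> \<open>Dominating functions for the passage to the limit. They are not constant
      because the diagonal coefficient is only square-integrable.\<close>
    have bound: "cmod (G (s1 N l) (s2 N l) t) \<le> cmod (V t) * (4 * B)" "cmod (H (s1 N l) (s2 N l) t) \<le> cmod (V t) * (4 * B)"
      if t: "t \<in> {0..1}" for N t
    proof -
      have "cmod (G (s1 N l) (s2 N l) t) + cmod (H (s1 N l) (s2 N l) t) \<le> cmod (V t) * (cmod (s1 N l t) + cmod (s2 N l t))"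
        unfolding G_def H_def V_def by (rule coefficient_bound[OF \<rho>])
      also have "\<dots> \<le> cmod (V t) * (4 * B)" using sb[OF t, of N] by (intro mult_left_mono) auto
      finally show "cmod (G (s1 N l) (s2 N l) t) \<le> cmod (V t) * (4 * B)" "cmod (H (s1 N l) (s2 N l) t) \<le> cmod (V t) * (4 * B)"
        using norm_ge_zero[of "G (s1 N l) (s2 N l) t"] norm_ge_zero[of "H (s1 N l) (s2 N l) t"] by linarith+
    qed
    have step: "s1 (Suc N) l x = c1 + integral {0..x} (G (s1 N l) (s2 N l))"
      "s2 (Suc N) l x = c2 + integral {0..x} (H (s1 N l) (s2 N l))" if x: "x \<in> {0..1}" for N x
    proof -
      have f0: "f 0 l x = c1" and g0: "g 0 l x = c2" by (simp_all add: f_def g_def)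
      have i: "(\<lambda>t. G (f n l) (g n l) t) integrable_on {0..x}" "(\<lambda>t. H (f n l) (g n l) t) integrable_on {0..x}" for n
        using x by (auto intro!: L2_integrable(1) GL cfg l)
      have "(\<Sum>n<N. f (Suc n) l x) = integral {0..x} (\<lambda>t. \<Sum>n<N. G (f n l) (g n l) t)"
      proof -
        have "f (Suc n) l x = integral {0..x} (\<lambda>t. G (f n l) (g n l) t)" for n
          by (simp add: f_def g_def G_def)
        then show ?thesis by (subst integral_sum) (use i in auto)
      qed
      also have "(\<lambda>t. \<Sum>n<N. G (f n l) (g n l) t) = G (s1 N l) (s2 N l)"
        by (simp add: fun_eq_iff G_def s1_def s2_def sum_distrib_left sum.distrib)
      finally show "s1 (Suc N) l x = c1 + integral {0..x} (G (s1 N l) (s2 N l))"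
        unfolding s1_def[of "Suc N"] sum.lessThan_Suc_shift f0 by (simp only:)
      have "(\<Sum>n<N. g (Suc n) l x) = integral {0..x} (\<lambda>t. \<Sum>n<N. H (f n l) (g n l) t)"
      proof -
        have "g (Suc n) l x = integral {0..x} (\<lambda>t. H (f n l) (g n l) t)" for n
          by (simp add: f_def g_def H_def)
        then show ?thesis by (subst integral_sum) (use i in auto)
      qed
      also have "(\<lambda>t. \<Sum>n<N. H (f n l) (g n l) t) = H (s1 N l) (s2 N l)"
        by (simp add: fun_eq_iff H_def s1_def s2_def sum_distrib_left sum_subtractf)
      finally show "s2 (Suc N) l x = c2 + integral {0..x} (H (s1 N l) (s2 N l))"
        unfolding s2_def[of "Suc N"] sum.lessThan_Suc_shift g0 by (simp only:)
    qed
    have lim: "(\<lambda>N. s1 N l t) \<longlonglongrightarrow> y1 l t" "(\<lambda>N. s2 N l t) \<longlonglongrightarrow> y2 l t" if "t \<in> {0..1}" for t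
      using tendsto_uniform_limitI[OF u1 that] tendsto_uniform_limitI[OF u2 that] by auto
    have eq: "y1 l x = c1 + integral {0..x} (G (y1 l) (y2 l)) \<and> y2 l x = c2 + integral {0..x} (H (y1 l) (y2 l))" if x: "x \<in> {0..1}" for x
    proof
      have h: "(\<lambda>t. cmod (V t) * (4 * B)) integrable_on {0..x}"
        using x by (intro integrable_on_mult_left L2_integrable(2) V) auto
      have "(\<lambda>N. integral {0..x} (G (s1 N l) (s2 N l))) \<longlonglongrightarrow> integral {0..x} (G (y1 l) (y2 l))"
      proof (rule dominated_convergence(2)[OF _ h])
        show "G (s1 N l) (s2 N l) integrable_on {0..x}" for N using x by (auto intro!: L2_integrable(1) GL cs l)
        show "cmod (G (s1 N l) (s2 N l) t) \<le> cmod (V t) * (4 * B)" if "t \<in> {0..x}" for N t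
          using bound(1)[of t N] that x by auto
        show "(\<lambda>N. G (s1 N l) (s2 N l) t) \<longlonglongrightarrow> G (y1 l) (y2 l) t" if "t \<in> {0..x}" for t
          unfolding G_def using that x by (intro tendsto_intros lim) auto
      qed
      then have "(\<lambda>N. s1 (Suc N) l x) \<longlonglongrightarrow> c1 + integral {0..x} (G (y1 l) (y2 l))"
        unfolding step(1)[OF x] by (intro tendsto_intros)
      then show "y1 l x = c1 + integral {0..x} (G (y1 l) (y2 l))"
        using LIMSEQ_unique LIMSEQ_Suc[OF lim(1)[OF x]] by blast
      have "(\<lambda>N. integral {0..x} (H (s1 N l) (s2 N l))) \<longlonglongrightarrow> integral {0..x} (H (y1 l) (y2 l))"
      proof (rule dominated_convergence(2)[OF _ h])
        show "H (s1 N l) (s2 N l) integrable_on {0..x}" for N using x by (auto intro!: L2_integrable(1) GL cs l)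
        show "cmod (H (s1 N l) (s2 N l) t) \<le> cmod (V t) * (4 * B)" if "t \<in> {0..x}" for N t
          using bound(2)[of t N] that x by auto
        show "(\<lambda>N. H (s1 N l) (s2 N l) t) \<longlonglongrightarrow> H (y1 l) (y2 l) t" if "t \<in> {0..x}" for t
          unfolding H_def using that x by (intro tendsto_intros lim) auto
      qed
      then have "(\<lambda>N. s2 (Suc N) l x) \<longlonglongrightarrow> c2 + integral {0..x} (H (y1 l) (y2 l))"
        unfolding step(2)[OF x] by (intro tendsto_intros)
      then show "y2 l x = c2 + integral {0..x} (H (y1 l) (y2 l))"
        using LIMSEQ_unique LIMSEQ_Suc[OF lim(2)[OF x]] by blast
    qed
    have y0: "y1 l 0 = c1" "y2 l 0 = c2" using eq[of 0] by simp_all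
    have "ac2 (y1 l) (G (y1 l) (y2 l))" "ac2 (y2 l) (H (y1 l) (y2 l))"
      unfolding ac2_def using GL[OF cy] eq y0 L2_integrable(1)[OF GL(1)[OF cy]] L2_integrable(1)[OF GL(2)[OF cy]]
      by (auto simp: has_integral_integrable_integral)
    then show ?thesis using y0 by (simp add: solves_def G_def[abs_def] H_def[abs_def])
  qed
  have "(\<lambda>l. y1 l 1) holomorphic_on (- {0}) \<and> (\<lambda>l. y2 l 1) holomorphic_on (- {0})"
  proof
    have loc: "\<exists>d. 0 < d \<and> cball l d \<subseteq> - {0} \<and> uniform_limit (cball l d) (\<lambda>N l. s1 N l 1) (\<lambda>l. y1 l 1) sequentially \<and>
        uniform_limit (cball l d) (\<lambda>N l. s2 N l 1) (\<lambda>l. y2 l 1) sequentially" if l: "l \<in> - {0}" for l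
    proof -
      define d where "d = cmod l / 2"
      have d: "0 < d" using l by (simp add: d_def)
      \<comment> \<open>On the disc of radius |l| / 2 around \<open>l\<close>, |z| is at most 2 |l|
        and 1 / |z| at most 2 / |l|.\<close>
      define \<rho> where "\<rho> = 2 * cmod l + 2 / cmod l"
      have b: "z \<noteq> 0 \<and> cmod z \<le> \<rho> \<and> cmod (inverse z) \<le> \<rho>" if z: "z \<in> cball l d" for z
      proof -
        have "cmod (l - z) \<le> cmod l / 2" using z by (simp add: dist_norm d_def)
        then have z1: "cmod l / 2 \<le> cmod z" "cmod z \<le> 2 * cmod l"
          using norm_triangle_sub[of l z] norm_triangle_sub[of z l] by (auto simp: norm_minus_commute)
        then have z0: "0 < cmod z" using d unfolding d_def by linarith
        have "cmod (inverse z) = 1 / cmod z" by (simp add: norm_inverse divide_inverse)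
        also have "\<dots> \<le> 1 / (cmod l / 2)" using z1 d z0 unfolding d_def by (intro divide_left_mono mult_pos_pos) auto
        finally have "cmod (inverse z) \<le> 2 / cmod l" by simp
        moreover have "0 \<le> 2 / cmod l" "0 \<le> 2 * cmod l" by simp_all
        moreover have "z \<noteq> 0" using z0 by auto
        ultimately show ?thesis using z1 unfolding \<rho>_def by (intro conjI) linarith+
      qed
      obtain B where B: "\<forall>l x. l \<noteq> 0 \<longrightarrow> cmod l \<le> \<rho> \<longrightarrow> cmod (inverse l) \<le> \<rho> \<longrightarrow> x \<in> {0..1} \<longrightarrow>
      (\<forall>n. cmod (f n l x) \<le> B * (1/2) ^ n \<and> cmod (g n l x) \<le> B * (1/2) ^ n)"
        using unif[of \<rho>] by blast
      have Bb: "cmod (f n z 1) \<le> B * (1/2) ^ n" "cmod (g n z 1) \<le> B * (1/2) ^ n" if "z \<in> cball l d" for n z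
        using B[rule_format, of z 1 n] b[OF that] by auto
      have "uniform_limit (cball l d) (\<lambda>N l. s1 N l 1) (\<lambda>l. y1 l 1) sequentially"
        unfolding s1_def y1_def by (rule Weierstrass_m_test[OF _ sumB[of B]]) (simp add: Bb)
      moreover have "uniform_limit (cball l d) (\<lambda>N l. s2 N l 1) (\<lambda>l. y2 l 1) sequentially"
        unfolding s2_def y2_def by (rule Weierstrass_m_test[OF _ sumB[of B]]) (simp add: Bb)
      moreover have "cball l d \<subseteq> - {0}" using b by blast
      ultimately show ?thesis using d by blast
    qed
    have hs: "(\<lambda>l. s1 N l 1) holomorphic_on (- {0})" "(\<lambda>l. s2 N l 1) holomorphic_on (- {0})" for N
      unfolding s1_def s2_def f_def g_def using picard_laurent_family[OF P, of "(c1, c2)"]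
      by (auto intro!: holomorphic_on_sum laurent_family_holomorphic)
    show "(\<lambda>l. y1 l 1) holomorphic_on (- {0})"
      by (rule holomorphic_uniform_sequence[where f = "\<lambda>N l. s1 N l 1", OF _ hs(1)]) (simp add: open_Compl, use loc in blast)
    show "(\<lambda>l. y2 l 1) holomorphic_on (- {0})"
      by (rule holomorphic_uniform_sequence[where f = "\<lambda>N l. s2 N l 1", OF _ hs(2)]) (simp add: open_Compl, use loc in blast)
  qed
  with solve show ?thesis by (intro that[of y1 y2]) auto
qed

lemma monodromy_frame:
  assumes P: "(u, uy) \<in> Pot"
  obtains F where "\<And>l. l \<noteq> 0 \<Longrightarrow> is_frame u uy l (F l)" "\<And>l. l \<noteq> 0 \<Longrightarrow> monodromy u uy l = F l 1"
    "\<And>i j. (\<lambda>l. F l 1 $ i $ j) holomorphic_on (- {0})"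
proof -
  obtain a c where ac: "\<And>l. l \<noteq> 0 \<Longrightarrow> solves u uy l (a l) (c l)" "\<And>l. l \<noteq> 0 \<Longrightarrow> a l 0 = 1" "\<And>l. l \<noteq> 0 \<Longrightarrow> c l 0 = 0"
    "(\<lambda>l. a l 1) holomorphic_on (- {0})" "(\<lambda>l. c l 1) holomorphic_on (- {0})"
    by (rule solves_exists[OF P]) (rule that)
  obtain b d where bd: "\<And>l. l \<noteq> 0 \<Longrightarrow> solves u uy l (b l) (d l)" "\<And>l. l \<noteq> 0 \<Longrightarrow> b l 0 = 0" "\<And>l. l \<noteq> 0 \<Longrightarrow> d l 0 = 1"
    "(\<lambda>l. b l 1) holomorphic_on (- {0})" "(\<lambda>l. d l 1) holomorphic_on (- {0})"
    by (rule solves_exists[OF P]) (rule that)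
  define F :: "complex \<Rightarrow> real \<Rightarrow> complex^2^2" where "F l x = vector [vector [a l x, b l x], vector [c l x, d l x]]" for l x
  have fr: "is_frame u uy l (F l)" if "l \<noteq> 0" for l
    unfolding is_frame_iff[OF P] forall_2
    using ac bd that by (simp add: F_def vec_eq_iff forall_2 mat_def)
  moreover have "(\<lambda>l. F l 1 $ i $ j) holomorphic_on (- {0})" for i j
    using ac bd exhaust_2[of i] exhaust_2[of j] by (auto simp: F_def)
  ultimately show ?thesis using monodromy_eq[OF P] by (intro that[of F]) auto
qed

lemma monodromy_holomorphic:
  assumes P: "(u, uy) \<in> Pot"
  shows "(\<lambda>l. monodromy u uy l $ i $ j) holomorphic_on (- {0})"
proof -
  obtain F where F: "\<And>l. l \<noteq> 0 \<Longrightarrow> is_frame u uy l (F l)" "\<And>l. l \<noteq> 0 \<Longrightarrow> monodromy u uy l = F l 1"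
    "\<And>i j. (\<lambda>l. F l 1 $ i $ j) holomorphic_on (- {0})"
    by (rule monodromy_frame[OF P]) (rule that)
  show ?thesis by (rule holomorphic_transform[OF F(3)]) (simp add: F(2))
qed

text \<open>The Wronskian has weak derivative 0 because the coefficient matrix is
  trace-free.\<close>

lemma monodromy_det:
  assumes P: "(u, uy) \<in> Pot" and l: "l \<noteq> 0"
  shows "monodromy u uy l $ 1 $ 1 * monodromy u uy l $ 2 $ 2 - monodromy u uy l $ 1 $ 2 * monodromy u uy l $ 2 $ 1 = 1"
proof -
  obtain F where F: "\<And>l. l \<noteq> 0 \<Longrightarrow> is_frame u uy l (F l)" "\<And>l. l \<noteq> 0 \<Longrightarrow> monodromy u uy l = F l 1"
    by (rule monodromy_frame[OF P]) (rule that)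
  define a b c d where "a x = F l x $ 1 $ 1" and "b x = F l x $ 1 $ 2" and "c x = F l x $ 2 $ 1" and "d x = F l x $ 2 $ 2" for x
  have F0: "F l 0 = mat 1" and s: "\<forall>j. solves u uy l (\<lambda>x. F l x $ 1 $ j) (\<lambda>x. F l x $ 2 $ j)"
    using F(1)[OF l] unfolding is_frame_iff[OF P] by auto
  have ac: "solves u uy l a c" and bd: "solves u uy l b d"
    using s unfolding a_def[abs_def] b_def[abs_def] c_def[abs_def] d_def[abs_def] by auto
  have 0: "a 0 = 1" "b 0 = 0" "c 0 = 0" "d 0 = 1" by (simp_all add: a_def b_def c_def d_def F0 mat_def)
  note A = conjunct1[OF ac[unfolded solves_def]] and C = conjunct2[OF ac[unfolded solves_def]]
    and B = conjunct1[OF bd[unfolded solves_def]] and D = conjunct2[OF bd[unfolded solves_def]]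
  have "ac2 (\<lambda>x. a x * d x - b x * c x) (\<lambda>x. 0)"
    by (rule ac2_cong[OF ac2_diff[OF ac2_mult[OF A D] ac2_mult[OF B C]]]) (simp_all add: algebra_simps)
  from ac2_has_integral[OF this, of 0 1]
  have "((\<lambda>x. 0) has_integral (a 1 * d 1 - b 1 * c 1 - (a 0 * d 0 - b 0 * c 0))) {0..1::real}"
    by simp
  then have "a 1 * d 1 - b 1 * c 1 - (a 0 * d 0 - b 0 * c 0) = 0" by (rule has_integral_unique) simp
  then show ?thesis by (simp add: F(2)[OF l] 0) (simp add: a_def b_def c_def d_def)
qed

section \<open>Comparison with the vacuum\<close>

lemma solves_cmult:
  assumes "solves u uy l y1 y2"
  shows "solves u uy l (\<lambda>x. k * y1 x) (\<lambda>x. k * y2 x)"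
  unfolding solves_def
  by (intro conjI ac2_cong[OF ac2_cmult[OF conjunct1[OF assms[unfolded solves_def]], of k]]
      ac2_cong[OF ac2_cmult[OF conjunct2[OF assms[unfolded solves_def]], of k]])
     (simp_all add: algebra_simps)

text \<open>The coordinates a + i b and a - i b diagonalise the rotation with eigenvalues i zeta and
  - i zeta. A trace-free diagonal matrix interchanges them, which is why \<open>v\<close> ends up as
  the off-diagonal coupling.\<close>

lemma rotation_coordinates:
  fixes v \<zeta> r a b h k :: complex
  shows "v * a + (- \<zeta> + r * h) * b + \<i> * (- v * b + (\<zeta> + r * k) * a) =
      \<i> * \<zeta> * (a + \<i> * b) + v * (a - \<i> * b) + r * (\<i> / 2 * (k - h) * (a + \<i> * b) + \<i> / 2 * (k + h) * (a - \<i> * b))"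
    "v * a + (- \<zeta> + r * h) * b - \<i> * (- v * b + (\<zeta> + r * k) * a) =
      \<i> * (- \<zeta>) * (a - \<i> * b) + v * (a + \<i> * b) +
        r * (- (\<i> / 2 * (k - h)) * (a - \<i> * b) + - (\<i> / 2 * (k + h)) * (a + \<i> * b))"
  by (simp_all add: field_simps)

lemma half_sum_bound:
  fixes a b c d e :: real
  assumes "c \<le> (1 + b) / 4" "d \<le> (a + 1) / 4" "a + b + 2 \<le> e" "0 \<le> a" "0 \<le> b"
  shows "(d + c) / 2 \<le> e"
  using assms by (auto simp: field_simps)

text \<open>The diagonal entry of the system after the gauge transformation: - u' / 4 is the
  logarithmic derivative of \<open>exp (- u / 4)\<close>.\<close>

definition gauge_potential :: "(real \<Rightarrow> complex) \<Rightarrow> (real \<Rightarrow> complex) \<Rightarrow> real \<Rightarrow> complex" where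
  "gauge_potential uy u' x = (\<i> * uy x - u' x) / 4"

text \<open>Conjugation by \<open>diag (exp (u/4)) (s * exp (- u/4))\<close> turns the off-diagonal part of \<open>alpha\<close>
  into \<open>\<zeta>\<close> times a rotation generator up to \<open>O(1/s)\<close>; the coordinates \<open>f\<^sub>1 \<plusminus> \<i> f\<^sub>2\<close> diagonalise
  that generator.\<close>

lemma solves_imp_akns:
  assumes P: "(u, uy) \<in> Pot" and u: "ac2 u u'" and s: "s \<noteq> 0" "cmod (inverse s) \<le> 1"
    and y: "solves u uy (s\<^sup>2) y1 y2"
    and B: "\<And>x. x \<in> {0..1} \<Longrightarrow> cmod (exp (u x)) + cmod (exp (- u x)) + 2 \<le> B"
  defines "z \<equiv> \<lambda>x. exp (- u x / 4) * y1 x + \<i> * (inverse s * (exp (u x / 4) * y2 x))"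
    and "w \<equiv> \<lambda>x. exp (- u x / 4) * y1 x - \<i> * (inverse s * (exp (u x / 4) * y2 x))"
  assumes z0: "cmod (z 0) \<le> 1" and w0: "cmod (w 0) \<le> 1"
  shows "akns (gauge_potential uy u') B ((s + inverse s) / 4) (inverse s) z w"
proof -
  define f1 f2 where "f1 x = exp (- u x / 4) * y1 x" and "f2 x = inverse s * (exp (u x / 4) * y2 x)" for x
  define \<zeta> where "\<zeta> = (s + inverse s) / 4"
  define v where "v = gauge_potential uy u'"
  \<comment> \<open>After conjugation the off-diagonal entries are -(s + exp (- u) / s) / 4 and (s +
    exp u / s) / 4. Splitting off - zeta and zeta leaves these functions times 1 / s.\<close>
  define h12 h21 where "h12 x = (1 - exp (- u x)) / 4" and "h21 x = (exp (u x) - 1) / 4" for x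
  have cu: "continuous_on {0..1} u" by (rule Pot_continuous[OF P])
  have e1: "ac2 (\<lambda>x. exp (- u x / 4)) (\<lambda>x. - (u' x / 4) * exp (- u x / 4))"
    using ac2_exp[OF ac2_cmult[OF u, of "- (1/4)"]] by simp
  have e2: "ac2 (\<lambda>x. exp (u x / 4)) (\<lambda>x. u' x / 4 * exp (u x / 4))"
    using ac2_exp[OF ac2_cmult[OF u, of "1/4"]] by simp
  note Y1 = conjunct1[OF y[unfolded solves_def]] and Y2 = conjunct2[OF y[unfolded solves_def]]
  have exps: "exp (u x / 2) = exp (u x / 4) * exp (u x / 4)" "exp (- u x / 2) = exp (- u x / 4) * exp (- u x / 4)"
    "exp (u x) = exp (u x / 4) * exp (u x / 4) * exp (u x / 4) * exp (u x / 4)"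
    "exp (- u x) = exp (- u x / 4) * exp (- u x / 4) * exp (- u x / 4) * exp (- u x / 4)" for x
    by (simp_all add: exp_add[symmetric])
  have inv: "exp (- u x / 4) * exp (u x / 4) = 1" for x by (simp add: exp_add[symmetric])
  have a1: "ac2 f1 (\<lambda>x. v x * f1 x + (- \<zeta> + inverse s * h12 x) * f2 x)"
    unfolding f1_def
  proof (rule ac2_cong[OF ac2_mult[OF e1 Y1]])
    fix x
    define p q where "p = exp (- u x / 4)" and "q = exp (u x / 4)"
    have pq: "p * q = 1" unfolding p_def q_def by (rule inv)
    have e: "exp (u x / 2) = q * q" "exp (- u x / 2) = p * p" "exp (- u x) = p * p * p * p"
      unfolding p_def q_def by (rule exps)+
    have "p * (- ((q * q + inverse (s\<^sup>2) * (p * p)) / 4) * y2 x)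
      = (- ((s + inverse s) / 4) + inverse s * ((1 - p * p * p * p) / 4)) * (inverse s * (q * y2 x))"
    proof -
      have L: "p * (- ((q * q + inverse (s\<^sup>2) * (p * p)) / 4) * y2 x)
         = - (((p * q) * q + inverse (s\<^sup>2) * (p * p * p)) / 4) * y2 x" by (simp add: algebra_simps)
      have R: "(- ((s + inverse s) / 4) + inverse s * ((1 - p * p * p * p) / 4)) * (inverse s * (q * y2 x))
        = - ((q + inverse s * inverse s * ((p * q) * p * p * p)) / 4) * y2 x"
        using s by (simp add: field_simps)
      have i: "inverse (s\<^sup>2) = inverse s * inverse s" by (simp add: power2_eq_square)
      show ?thesis unfolding L R unfolding pq i mult_1 ..
    qed
    then show "- (u' x / 4) * exp (- u x / 4) * y1 x + exp (- u x / 4) * (alpha_diag uy x * y1 x + alpha_upper u (s\<^sup>2) x * y2 x)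
      = v x * (exp (- u x / 4) * y1 x) + (- \<zeta> + inverse s * h12 x) * f2 x"
      unfolding f2_def alpha_diag_def alpha_upper_def v_def gauge_potential_def \<zeta>_def h12_def e
        p_def[symmetric] q_def[symmetric]
      by (simp add: algebra_simps diff_divide_distrib add_divide_distrib)
  qed simp
  have a2: "ac2 f2 (\<lambda>x. - v x * f2 x + (\<zeta> + inverse s * h21 x) * f1 x)"
    unfolding f2_def
  proof (rule ac2_cong[OF ac2_cmult[OF ac2_mult[OF e2 Y2]]])
    fix x
    define p q where "p = exp (- u x / 4)" and "q = exp (u x / 4)"
    have pq: "p * q = 1" unfolding p_def q_def by (rule inv)
    have e: "exp (u x / 2) = q * q" "exp (- u x / 2) = p * p" "exp (u x) = q * q * q * q"
      unfolding p_def q_def by (rule exps)+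
    have "inverse s * (q * ((q * q + s\<^sup>2 * (p * p)) / 4 * y1 x))
      = ((s + inverse s) / 4 + inverse s * ((q * q * q * q - 1) / 4)) * (p * y1 x)"
    proof -
      have "inverse s * (q * ((q * q + s\<^sup>2 * (p * p)) / 4 * y1 x))
         = (inverse s * (q * q * q) + s * ((p * q) * p)) / 4 * y1 x"
        using s by (simp add: field_simps power2_eq_square)
      moreover have "((s + inverse s) / 4 + inverse s * ((q * q * q * q - 1) / 4)) * (p * y1 x)
        = (s * p + inverse s * ((p * q) * q * q * q)) / 4 * y1 x"
        using s by (simp add: field_simps)
      ultimately show ?thesis by (simp add: pq algebra_simps)
    qed
    then show "inverse s * (u' x / 4 * exp (u x / 4) * y2 x + exp (u x / 4) * (alpha_lower u (s\<^sup>2) x * y1 x - alpha_diag uy x * y2 x))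
      = - v x * (inverse s * (exp (u x / 4) * y2 x)) + (\<zeta> + inverse s * h21 x) * f1 x"
      unfolding f1_def alpha_diag_def alpha_lower_def v_def gauge_potential_def \<zeta>_def h21_def e
        p_def[symmetric] q_def[symmetric]
      by (simp add: algebra_simps diff_divide_distrib add_divide_distrib)
  qed simp
  define p q where "p x = \<i> / 2 * (h21 x - h12 x)" and "q x = \<i> / 2 * (h21 x + h12 x)" for x
  have zf: "z x = f1 x + \<i> * f2 x" and wf: "w x = f1 x - \<i> * f2 x" for x
    by (simp_all add: z_def w_def f1_def f2_def)
  have z: "ac2 z (\<lambda>x. \<i> * \<zeta> * z x + v x * w x + inverse s * (p x * z x + q x * w x))"
    by (rule ac2_cong[OF ac2_add[OF a1 ac2_cmult[OF a2, of \<i>]]]) (simp_all only: zf wf p_def q_def rotation_coordinates)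
  have w: "ac2 w (\<lambda>x. \<i> * (- \<zeta>) * w x + v x * z x + inverse s * (- p x * w x + - q x * z x))"
    by (rule ac2_cong[OF ac2_diff[OF a1 ac2_cmult[OF a2, of \<i>]]]) (simp_all only: zf wf p_def q_def rotation_coordinates)
  have c: "continuous_on {0..1} p" "continuous_on {0..1} q"
    unfolding p_def q_def h12_def h21_def by (auto intro!: continuous_intros cu)
  have pb: "cmod (p x) \<le> B \<and> cmod (q x) \<le> B" if x: "x \<in> {0..1}" for x
  proof -
    have h: "cmod (h12 x) \<le> (1 + cmod (exp (- u x))) / 4" "cmod (h21 x) \<le> (cmod (exp (u x)) + 1) / 4"
      unfolding h12_def h21_def norm_divide using norm_triangle_ineq4[of 1 "exp (- u x)"] norm_triangle_ineq4[of "exp (u x)" 1]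
      by (simp_all only: norm_one) simp_all
    have "cmod (p x) \<le> (cmod (h21 x) + cmod (h12 x)) / 2" "cmod (q x) \<le> (cmod (h21 x) + cmod (h12 x)) / 2"
      unfolding p_def q_def norm_mult using norm_triangle_ineq4[of "h21 x" "h12 x"] norm_triangle_ineq[of "h21 x" "h12 x"]
      by (simp_all add: norm_divide)
    moreover have "(cmod (h21 x) + cmod (h12 x)) / 2 \<le> B"
    proof -
      show ?thesis by (rule half_sum_bound[OF h B[OF x] norm_ge_zero norm_ge_zero])
    qed
    ultimately show ?thesis by linarith
  qed
  show ?thesis
    unfolding akns_def v_def[symmetric] \<zeta>_def[symmetric]
    using s(2) z0 w0 z w c pb
    by (intro conjI exI[of _ p] exI[of _ q] exI[of _ "\<lambda>x. - p x"] exI[of _ "\<lambda>x. - q x"])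
       (auto intro!: continuous_intros)
qed

definition zeta_of :: "complex \<Rightarrow> complex" where
  "zeta_of s = (s + inverse s) / 4"

text \<open>For \<open>u = 0\<close>, \<open>uy = 0\<close> the monodromy has the entries cos zeta,
  - sin zeta / s, s sin zeta, cos zeta. The factors on the off-diagonal entries undo the gauge at
  the endpoints, and errors are measured in units of exp |Im zeta|.\<close>

definition vacuum_close :: "(real \<Rightarrow> complex) \<Rightarrow> (real \<Rightarrow> complex) \<Rightarrow> complex \<Rightarrow> real \<Rightarrow> bool" where
  "vacuum_close u uy s e \<longleftrightarrow>
     cmod (monodromy u uy (s\<^sup>2) $ 1 $ 1 - cos (zeta_of s)) \<le> e * exp \<bar>Im (zeta_of s)\<bar> \<and>
     cmod (monodromy u uy (s\<^sup>2) $ 2 $ 2 - cos (zeta_of s)) \<le> e * exp \<bar>Im (zeta_of s)\<bar> \<and>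
     cmod (exp (u 0 / 2) / s * monodromy u uy (s\<^sup>2) $ 2 $ 1 - sin (zeta_of s)) \<le> e * exp \<bar>Im (zeta_of s)\<bar> \<and>
     cmod (s * exp (- u 0 / 2) * monodromy u uy (s\<^sup>2) $ 1 $ 2 + sin (zeta_of s)) \<le> e * exp \<bar>Im (zeta_of s)\<bar>"

lemma total_deviation_bounds:
  fixes \<zeta> :: complex
  assumes t: "total_deviation \<zeta> z w \<le> e"
  shows "cmod ((z 1 + w 1) / 2 - (exp (\<i> * \<zeta>) * z 0 + exp (- (\<i> * \<zeta>)) * w 0) / 2) \<le> e * exp \<bar>Im \<zeta>\<bar>"
    "cmod ((z 1 - w 1) / (2 * \<i>) - (exp (\<i> * \<zeta>) * z 0 - exp (- (\<i> * \<zeta>)) * w 0) / (2 * \<i>)) \<le> e * exp \<bar>Im \<zeta>\<bar>"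
proof -
  define A B where "A = z 1 - exp (\<i> * \<zeta>) * z 0" and "B = w 1 - exp (- (\<i> * \<zeta>)) * w 0"
  have "exp (- \<bar>Im \<zeta>\<bar>) * (cmod A + cmod B) \<le> e"
    using t by (simp add: total_deviation_def deviation_def A_def B_def algebra_simps)
  then have "exp \<bar>Im \<zeta>\<bar> * (exp (- \<bar>Im \<zeta>\<bar>) * (cmod A + cmod B)) \<le> exp \<bar>Im \<zeta>\<bar> * e" by (intro mult_left_mono) auto
  then have AB: "cmod A + cmod B \<le> e * exp \<bar>Im \<zeta>\<bar>" by (simp add: mult.assoc[symmetric] exp_minus_inverse mult.commute)
  have n: "cmod (A + B) \<le> cmod A + cmod B" "cmod (A - B) \<le> cmod A + cmod B"
    by (rule norm_triangle_ineq, rule norm_triangle_ineq4)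
  have b: "cmod (A + B) \<le> e * exp \<bar>Im \<zeta>\<bar> * 2" "cmod (A - B) \<le> e * exp \<bar>Im \<zeta>\<bar> * 2"
    using n AB norm_ge_zero[of "A + B"] norm_ge_zero[of "A - B"] by linarith+
  have e1: "(z 1 + w 1) / 2 - (exp (\<i> * \<zeta>) * z 0 + exp (- (\<i> * \<zeta>)) * w 0) / 2 = (A + B) / 2"
    unfolding diff_divide_distrib[symmetric] by (simp add: A_def B_def algebra_simps)
  show "cmod ((z 1 + w 1) / 2 - (exp (\<i> * \<zeta>) * z 0 + exp (- (\<i> * \<zeta>)) * w 0) / 2) \<le> e * exp \<bar>Im \<zeta>\<bar>"
    unfolding e1 norm_divide using b(1) by simp
  have e2: "(z 1 - w 1) / (2 * \<i>) - (exp (\<i> * \<zeta>) * z 0 - exp (- (\<i> * \<zeta>)) * w 0) / (2 * \<i>) = (A - B) / (2 * \<i>)"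
    unfolding diff_divide_distrib[symmetric] by (simp add: A_def B_def algebra_simps)
  show "cmod ((z 1 - w 1) / (2 * \<i>) - (exp (\<i> * \<zeta>) * z 0 - exp (- (\<i> * \<zeta>)) * w 0) / (2 * \<i>)) \<le> e * exp \<bar>Im \<zeta>\<bar>"
    unfolding e2 norm_divide norm_mult using b(2) by simp
qed

text \<open>Each column of the frame, suitably scaled, becomes an AKNS solution with initial values
  of modulus 1. Periodicity \<open>u 0 = u 1\<close> makes the gauge at the right end agree with the
  one at the left end, so it can be undone by constant factors.\<close>

lemma vacuum_close_if_akns:
  assumes P: "(u, uy) \<in> Pot" and u: "ac2 u u'" and s: "s \<noteq> 0" "cmod (inverse s) \<le> 1"
    and B: "\<And>x. x \<in> {0..1} \<Longrightarrow> cmod (exp (u x)) + cmod (exp (- u x)) + 2 \<le> B"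
    and e: "\<And>z w. akns (gauge_potential uy u') B (zeta_of s) (inverse s) z w \<Longrightarrow> total_deviation (zeta_of s) z w \<le> e"
  shows "vacuum_close u uy s e"
proof -
  have u01: "u 1 = u 0" using P by (auto simp: Pot_def)
  have s2: "s\<^sup>2 \<noteq> 0" using s by simp
  obtain F where F: "\<And>l. l \<noteq> 0 \<Longrightarrow> is_frame u uy l (F l)" "\<And>l. l \<noteq> 0 \<Longrightarrow> monodromy u uy l = F l 1"
    by (rule monodromy_frame[OF P]) (rule that)
  define G where "G = F (s\<^sup>2)"
  have G0: "G 0 = mat 1" and Gs: "\<And>j. solves u uy (s\<^sup>2) (\<lambda>x. G x $ 1 $ j) (\<lambda>x. G x $ 2 $ j)"
    using F(1)[OF s2] unfolding is_frame_iff[OF P] G_def by auto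
  have M: "monodromy u uy (s\<^sup>2) = G 1" using F(2)[OF s2] by (simp add: G_def)
  define \<zeta> where "\<zeta> = zeta_of s"
  define E where "E = exp \<bar>Im \<zeta>\<bar>"
  define pu qu where "pu x = exp (- u x / 4)" and "qu x = exp (u x / 4)" for x
  have pq: "pu 0 * qu 0 = 1" "qu 0 * pu 0 = 1" unfolding pu_def qu_def by (simp_all add: exp_add[symmetric])
  have pq2: "qu 0 * qu 0 = exp (u 0 / 2)" "pu 0 * pu 0 = exp (- u 0 / 2)" unfolding pu_def qu_def by (simp_all add: exp_add[symmetric])
  have u1: "pu 1 = pu 0" "qu 1 = qu 0" by (simp_all add: pu_def qu_def u01)
  have cs: "cos \<zeta> = (exp (\<i> * \<zeta>) + exp (- (\<i> * \<zeta>))) / 2" "sin \<zeta> = (exp (\<i> * \<zeta>) - exp (- (\<i> * \<zeta>))) / (2 * \<i>)"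
    by (rule cos_exp_eq, rule sin_exp_eq)
  have col: "cmod (k * pu 0 * G 1 $ 1 $ j - (exp (\<i> * \<zeta>) * z0 + exp (- (\<i> * \<zeta>)) * w0) / 2) \<le> e * E \<and>
      cmod (k * inverse s * qu 0 * G 1 $ 2 $ j - (exp (\<i> * \<zeta>) * z0 - exp (- (\<i> * \<zeta>)) * w0) / (2 * \<i>)) \<le> e * E"
    if z0: "z0 = pu 0 * (k * G 0 $ 1 $ j) + \<i> * (inverse s * (qu 0 * (k * G 0 $ 2 $ j)))"
      and w0: "w0 = pu 0 * (k * G 0 $ 1 $ j) - \<i> * (inverse s * (qu 0 * (k * G 0 $ 2 $ j)))"
      and n: "cmod z0 \<le> 1" "cmod w0 \<le> 1" for k j z0 w0
  proof -
    define z w where "z x = exp (- u x / 4) * (k * G x $ 1 $ j) + \<i> * (inverse s * (exp (u x / 4) * (k * G x $ 2 $ j)))"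
      and "w x = exp (- u x / 4) * (k * G x $ 1 $ j) - \<i> * (inverse s * (exp (u x / 4) * (k * G x $ 2 $ j)))" for x
    have zw0: "z 0 = z0" "w 0 = w0" by (simp_all add: z_def w_def z0 w0 pu_def qu_def)
    have "akns (gauge_potential uy u') B (zeta_of s) (inverse s) z w"
      unfolding zeta_of_def z_def[abs_def] w_def[abs_def]
      by (rule solves_imp_akns[OF P u s solves_cmult[OF Gs] B])
         (use n zw0 in \<open>simp_all add: z_def w_def\<close>)
    from total_deviation_bounds[OF e[OF this]]
    have t: "cmod ((z 1 + w 1) / 2 - (exp (\<i> * \<zeta>) * z0 + exp (- (\<i> * \<zeta>)) * w0) / 2) \<le> e * E"
      "cmod ((z 1 - w 1) / (2 * \<i>) - (exp (\<i> * \<zeta>) * z0 - exp (- (\<i> * \<zeta>)) * w0) / (2 * \<i>)) \<le> e * E"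
      unfolding E_def \<zeta>_def zw0 .
    have zw: "z x = pu x * (k * G x $ 1 $ j) + \<i> * (inverse s * (qu x * (k * G x $ 2 $ j)))"
      "w x = pu x * (k * G x $ 1 $ j) - \<i> * (inverse s * (qu x * (k * G x $ 2 $ j)))" for x
      by (simp_all add: z_def w_def pu_def qu_def)
    have "(z 1 + w 1) / 2 = k * pu 0 * G 1 $ 1 $ j" "(z 1 - w 1) / (2 * \<i>) = k * inverse s * qu 0 * G 1 $ 2 $ j"
      unfolding zw u1 by (simp_all add: field_simps)
    then show ?thesis using t by simp
  qed
  \<comment> \<open>Scaled by \<open>qu 0\<close>, the first column has the initial values z(0) =
    w(0) = 1.\<close>
  have c1: "cmod (qu 0 * pu 0 * G 1 $ 1 $ 1 - (exp (\<i> * \<zeta>) * 1 + exp (- (\<i> * \<zeta>)) * 1) / 2) \<le> e * E \<and>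
      cmod (qu 0 * inverse s * qu 0 * G 1 $ 2 $ 1 - (exp (\<i> * \<zeta>) * 1 - exp (- (\<i> * \<zeta>)) * 1) / (2 * \<i>)) \<le> e * E"
    by (rule col) (simp_all add: G0 mat_def pq)
  \<comment> \<open>Scaled by \<open>s * pu 0\<close>, the second column has the initial values z(0)
    = i and w(0) = - i.\<close>
  have c2: "cmod ((s * pu 0) * pu 0 * G 1 $ 1 $ 2 - (exp (\<i> * \<zeta>) * \<i> + exp (- (\<i> * \<zeta>)) * (- \<i>)) / 2) \<le> e * E \<and>
      cmod ((s * pu 0) * inverse s * qu 0 * G 1 $ 2 $ 2 - (exp (\<i> * \<zeta>) * \<i> - exp (- (\<i> * \<zeta>)) * (- \<i>)) / (2 * \<i>)) \<le> e * E"
    by (rule col) (use s pq in \<open>simp_all add: G0 mat_def field_simps\<close>)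
  show ?thesis
    unfolding vacuum_close_def M \<zeta>_def[symmetric] E_def[symmetric]
  proof (intro conjI)
    show "cmod (G 1 $ 1 $ 1 - cos \<zeta>) \<le> e * E" using c1 by (simp add: pq cs)
    have "exp (u 0 / 2) / s * G 1 $ 2 $ 1 = qu 0 * inverse s * qu 0 * G 1 $ 2 $ 1"
      unfolding pq2[symmetric] by (simp add: field_simps)
    then show "cmod (exp (u 0 / 2) / s * G 1 $ 2 $ 1 - sin \<zeta>) \<le> e * E" using c1 unfolding cs by (simp only: mult_1_right)
    have "s * exp (- u 0 / 2) * G 1 $ 1 $ 2 = (s * pu 0) * pu 0 * G 1 $ 1 $ 2"
      unfolding pq2[symmetric] by (simp add: algebra_simps)
    moreover have "- sin \<zeta> = (exp (\<i> * \<zeta>) * \<i> + exp (- (\<i> * \<zeta>)) * (- \<i>)) / 2"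
      unfolding cs by (simp add: field_simps)
    ultimately show "cmod (s * exp (- u 0 / 2) * G 1 $ 1 $ 2 + sin \<zeta>) \<le> e * E"
      using c2 by (metis diff_minus_eq_add minus_minus)
    have "G 1 $ 2 $ 2 = (s * pu 0) * inverse s * qu 0 * G 1 $ 2 $ 2"
      using s pq by (simp add: field_simps)
    moreover have "cos \<zeta> = (exp (\<i> * \<zeta>) * \<i> - exp (- (\<i> * \<zeta>)) * (- \<i>)) / (2 * \<i>)"
      unfolding cs by (simp add: field_simps)
    ultimately show "cmod (G 1 $ 2 $ 2 - cos \<zeta>) \<le> e * E" using c2 by metis
  qed
qed

lemma Pot_exp_bound:
  assumes P: "(u, uy) \<in> Pot"
  obtains B where "0 \<le> B" "\<And>x. x \<in> {0..1} \<Longrightarrow> cmod (exp (u x)) + cmod (exp (- u x)) + 2 \<le> B"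
proof -
  have "continuous_on {0..1} (\<lambda>x. complex_of_real (cmod (exp (u x)) + cmod (exp (- u x)) + 2))"
    by (intro continuous_intros Pot_continuous[OF P])
  from compact_continuous_image[OF this compact_Icc]
  obtain B where B: "\<And>x. x \<in> {0..1} \<Longrightarrow> cmod (complex_of_real (cmod (exp (u x)) + cmod (exp (- u x)) + 2)) \<le> B"
    using compact_imp_bounded by (meson bounded_iff imageI)
  have "cmod (exp (u x)) + cmod (exp (- u x)) + 2 \<le> B" if "x \<in> {0..1}" for x
    using B[OF that] unfolding norm_of_real by linarith
  moreover have "0 \<le> B"
  proof -
    have "(0 :: real) \<in> {0..1}" by simp
    from calculation[OF this] show ?thesis
      using norm_ge_zero[of "exp (u 0)"] norm_ge_zero[of "exp (- u 0)"] by linarith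
  qed
  ultimately show ?thesis by (intro that)
qed

lemma gauge_potential_L2:
  assumes "uy \<in> L2" "ac2 u u'"
  shows "gauge_potential uy u' \<in> L2"
proof -
  have "(\<lambda>x. (1/4) * (\<i> * uy x - u' x)) \<in> L2"
    by (intro L2_cmult L2_diff assms ac2_L2[OF assms(2)])
  then show ?thesis by (simp add: gauge_potential_def[abs_def])
qed

lemma norm_zeta_of_ge:
  assumes "1 \<le> cmod s"
  shows "cmod s - 1 \<le> 4 * cmod (zeta_of s)"
proof -
  have "cmod s - cmod (inverse s) \<le> cmod (s + inverse s)"
    using norm_diff_ineq[of s "inverse s"] by simp
  moreover have "cmod (inverse s) \<le> 1" using assms by (simp add: norm_inverse inverse_le_1_iff)
  ultimately show ?thesis by (simp add: zeta_of_def norm_divide)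
qed

lemma norm_zeta_of_le:
  assumes "1 \<le> cmod s"
  shows "4 * cmod (zeta_of s) \<le> cmod s + 1"
proof -
  have "cmod (s + inverse s) \<le> cmod s + cmod (inverse s)" by (rule norm_triangle_ineq)
  moreover have "cmod (inverse s) \<le> 1" using assms by (simp add: norm_inverse inverse_le_1_iff)
  ultimately show ?thesis by (simp add: zeta_of_def norm_divide)
qed

lemma vacuum_close_uniform:
  assumes P: "(u, uy) \<in> Pot" and \<epsilon>: "0 < \<epsilon>"
  obtains R where "\<And>s. R \<le> cmod s \<Longrightarrow> vacuum_close u uy s \<epsilon>"
proof -
  obtain u' where u: "ac2 u u'" "uy \<in> L2" by (rule PotE[OF P])
  obtain B where B: "0 \<le> B" "\<And>x. x \<in> {0..1} \<Longrightarrow> cmod (exp (u x)) + cmod (exp (- u x)) + 2 \<le> B"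
    by (rule Pot_exp_bound[OF P]) (rule that)
  obtain R d where R: "0 < d" "\<And>\<zeta> r z w. akns (gauge_potential uy u') B \<zeta> r z w \<Longrightarrow> R \<le> cmod \<zeta> \<Longrightarrow> cmod r \<le> d \<Longrightarrow>
    total_deviation \<zeta> z w \<le> \<epsilon>"
    by (rule akns_uniform[OF gauge_potential_L2[OF u(2,1)] B(1) \<epsilon>]) (rule that)
  show ?thesis
  \<comment> \<open>The three entries guarantee |zeta| \<ge> R, |1/s| \<le> 1 and |1/s| \<le> d, in
    this order.\<close>
  proof (rule that[of "max (4 * R + 1) (max 1 (1 / d))"])
    fix s assume s: "max (4 * R + 1) (max 1 (1 / d)) \<le> cmod s"
    then have s1: "1 \<le> cmod s" and "s \<noteq> 0" by auto
    have i: "cmod (inverse s) \<le> 1" using s1 by (simp add: norm_inverse inverse_le_1_iff)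
    have "1 / d \<le> cmod s" using s by simp
    moreover have "0 < cmod s" using s1 by linarith
    ultimately have d: "cmod (inverse s) \<le> d" using R(1) unfolding norm_inverse by (simp add: field_simps)
    have "R \<le> cmod (zeta_of s)" using norm_zeta_of_ge[OF s1] s by simp
    then show "vacuum_close u uy s \<epsilon>"
      using d by (intro vacuum_close_if_akns[OF P u(1) \<open>s \<noteq> 0\<close> i B(2)] R(2))
  qed
qed

lemma summable_on_inverse_square_int: "(\<lambda>k :: int. 1 / (of_int k)\<^sup>2 :: real) summable_on {0<..}"
proof -
  have "(\<lambda>n :: nat. 1 / (of_nat n)\<^sup>2 :: real) summable_on UNIV"
    using inverse_power_summable[of 2, where ?'a = real]
    by (intro norm_summable_imp_summable_on) (simp add: inverse_eq_divide power_divide)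
  then have "(\<lambda>n :: nat. 1 / (of_nat n)\<^sup>2 :: real) summable_on {0<..}"
    by (rule summable_on_subset_banach) simp
  also have "?this \<longleftrightarrow> ?thesis"
    by (rule summable_on_reindex_bij_witness[of _ nat int]) auto
  finally show ?thesis .
qed

text \<open>The remainder 1/s is square summable as well: for zeta near k pi one has |s| \<ge> k. It
  is therefore merged with the oscillatory contribution into one sequence.\<close>

lemma vacuum_close_square_summable:
  assumes P: "(u, uy) \<in> Pot"
  obtains q :: "int \<Rightarrow> real" where "\<And>k. 0 \<le> q k" "(\<lambda>k. (q k)\<^sup>2) summable_on {0<..}"
    "\<And>k s. 0 < k \<Longrightarrow> 1 \<le> cmod s \<Longrightarrow> cmod (zeta_of s - of_int k * pi) \<le> 1 \<Longrightarrow> vacuum_close u uy s (q k)"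
proof -
  obtain u' where u: "ac2 u u'" "uy \<in> L2" by (rule PotE[OF P])
  obtain B where B: "0 \<le> B" "\<And>x. x \<in> {0..1} \<Longrightarrow> cmod (exp (u x)) + cmod (exp (- u x)) + 2 \<le> B"
    by (rule Pot_exp_bound[OF P]) (rule that)
  obtain q D where q: "\<And>k :: int. 0 \<le> q k" "q summable_on UNIV" "0 < D"
    and dev: "\<And>k \<zeta> r z w. akns (gauge_potential uy u') B \<zeta> r z w \<Longrightarrow> cmod (\<zeta> - of_int k * pi) \<le> 1 \<Longrightarrow>
      (total_deviation \<zeta> z w)\<^sup>2 \<le> q k + D * (cmod r)\<^sup>2"
    by (rule akns_strip[OF gauge_potential_L2[OF u(2,1)] B(1) zero_le_one]) (rule that)
  define p where "p k = sqrt (q k + D * (1 / (of_int k)\<^sup>2))" for k :: int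
  have p0: "0 \<le> q k + D * (1 / (of_int k)\<^sup>2)" for k using q(1)[of k] q(3) by simp
  show ?thesis
  proof (rule that[of p])
    show "0 \<le> p k" for k using p0[of k] by (simp add: p_def)
    have "(\<lambda>k. q k + D * (1 / (of_int k)\<^sup>2)) summable_on {0<..}"
      by (intro summable_on_add summable_on_cmult_right summable_on_inverse_square_int summable_on_subset_banach[OF q(2)]) auto
    then show "(\<lambda>k. (p k)\<^sup>2) summable_on {0<..}" using p0 by (simp add: p_def)
    fix k :: int and s assume k: "0 < k" and s1: "1 \<le> cmod s" and \<zeta>: "cmod (zeta_of s - of_int k * pi) \<le> 1"
    have "s \<noteq> 0" using s1 by auto
    have i: "cmod (inverse s) \<le> 1" using s1 by (simp add: norm_inverse inverse_le_1_iff)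
    have "of_int k * pi \<le> cmod (zeta_of s) + 1"
    proof -
      have "of_int k * pi = cmod (complex_of_real (of_int k * pi))" using k by (simp add: norm_mult)
      also have "\<dots> \<le> cmod (zeta_of s) + cmod (complex_of_real (of_int k * pi) - zeta_of s)" by (rule norm_triangle_sub)
      finally show ?thesis using \<zeta> by (simp add: norm_minus_commute)
    qed
    moreover have "of_int k * 3 \<le> of_int k * pi" using k pi_gt3 by (intro mult_left_mono) auto
    ultimately have "of_int k \<le> cmod s" using norm_zeta_of_le[OF s1] k by linarith
    moreover have "0 < cmod s" using s1 by linarith
    ultimately have "cmod (inverse s) \<le> 1 / of_int k" using k unfolding norm_inverse by (simp add: field_simps)
    then have r: "(cmod (inverse s))\<^sup>2 \<le> 1 / (of_int k)\<^sup>2"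
      using power_mono[of "cmod (inverse s)" "1 / of_int k" 2] by (simp add: power_divide)
    show "vacuum_close u uy s (p k)"
    proof (rule vacuum_close_if_akns[OF P u(1) \<open>s \<noteq> 0\<close> i B(2)])
      fix z w assume a: "akns (gauge_potential uy u') B (zeta_of s) (inverse s) z w"
      have "(total_deviation (zeta_of s) z w)\<^sup>2 \<le> q k + D * (cmod (inverse s))\<^sup>2" by (rule dev[OF a \<zeta>])
      also have "\<dots> \<le> q k + D * (1 / (of_int k)\<^sup>2)" using mult_left_mono[OF r, of D] q(3) by simp
      finally show "total_deviation (zeta_of s) z w \<le> p k"
        unfolding p_def by (rule real_le_rsqrt)
    qed
  qed
qed

section \<open>The symmetry exchanging zero and infinity\<close>

lemma Pot_uminus:
  assumes "(u, uy) \<in> Pot"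
  shows "(\<lambda>x. - u x, uy) \<in> Pot"
proof -
  obtain u' where u: "ac2 u u'" "uy \<in> L2" "u 0 = u 1" by (rule PotE[OF assms])
  have "ac2 (\<lambda>x. - u x) (\<lambda>x. - u' x)" using ac2_cmult[OF u(1), of "-1"] by simp
  then show ?thesis using u by (auto simp: Pot_def W12_def ac2_def)
qed

text \<open>Conjugation with diag (1, 1/l) carries the coefficient matrix of \<open>(u, uy)\<close>
  at \<open>l\<close> to that of \<open>(- u, uy)\<close> at \<open>inverse l\<close>.\<close>

lemma solves_uminus:
  assumes "solves u uy l y1 y2" "l \<noteq> 0"
  shows "solves (\<lambda>x. - u x) uy (inverse l) y1 (\<lambda>x. inverse l * y2 x)"
proof -
  have e: "alpha_upper (\<lambda>x. - u x) (inverse l) x = l * alpha_upper u l x"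
    "alpha_lower (\<lambda>x. - u x) (inverse l) x = inverse l * alpha_lower u l x" for x
    using assms(2) by (simp_all add: alpha_upper_def alpha_lower_def field_simps)
  show ?thesis
    unfolding solves_def
  proof
    show "ac2 y1 (\<lambda>x. alpha_diag uy x * y1 x + alpha_upper (\<lambda>x. - u x) (inverse l) x * (inverse l * y2 x))"
      by (rule ac2_cong[OF conjunct1[OF assms(1)[unfolded solves_def]]]) (use assms(2) in \<open>simp_all add: e\<close>)
    show "ac2 (\<lambda>x. inverse l * y2 x) (\<lambda>x. alpha_lower (\<lambda>x. - u x) (inverse l) x * y1 x - alpha_diag uy x * (inverse l * y2 x))"
      by (rule ac2_cong[OF ac2_cmult[OF conjunct2[OF assms(1)[unfolded solves_def]], of "inverse l"]])
         (simp_all add: e algebra_simps)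
  qed
qed

lemma monodromy_uminus:
  assumes P: "(u, uy) \<in> Pot" and l: "l \<noteq> 0"
  shows "monodromy (\<lambda>x. - u x) uy (inverse l) $ 1 $ 1 = monodromy u uy l $ 1 $ 1"
    "monodromy (\<lambda>x. - u x) uy (inverse l) $ 2 $ 2 = monodromy u uy l $ 2 $ 2"
    "monodromy (\<lambda>x. - u x) uy (inverse l) $ 2 $ 1 = inverse l * monodromy u uy l $ 2 $ 1"
    "monodromy (\<lambda>x. - u x) uy (inverse l) $ 1 $ 2 = l * monodromy u uy l $ 1 $ 2"
proof -
  obtain F where F: "\<And>l. l \<noteq> 0 \<Longrightarrow> is_frame u uy l (F l)" "\<And>l. l \<noteq> 0 \<Longrightarrow> monodromy u uy l = F l 1"
    by (rule monodromy_frame[OF P]) (rule that)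
  define G :: "real \<Rightarrow> complex^2^2" where
    "G x = vector [vector [F l x $ 1 $ 1, l * F l x $ 1 $ 2], vector [inverse l * F l x $ 2 $ 1, F l x $ 2 $ 2]]" for x
  have F0: "F l 0 = mat 1" and s: "\<And>j. solves u uy l (\<lambda>x. F l x $ 1 $ j) (\<lambda>x. F l x $ 2 $ j)"
    using F(1)[OF l] unfolding is_frame_iff[OF P] by auto
  have c1: "solves (\<lambda>x. - u x) uy (inverse l) (\<lambda>x. F l x $ 1 $ 1) (\<lambda>x. inverse l * F l x $ 2 $ 1)"
    by (rule solves_uminus[OF s l])
  have c2: "solves (\<lambda>x. - u x) uy (inverse l) (\<lambda>x. l * F l x $ 1 $ 2) (\<lambda>x. F l x $ 2 $ 2)"
    using solves_cmult[OF solves_uminus[OF s l], of l 2] l by (simp add: mult.assoc[symmetric])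
  have "is_frame (\<lambda>x. - u x) uy (inverse l) G"
    unfolding is_frame_iff[OF Pot_uminus[OF P]] forall_2
    using c1 c2 by (simp add: G_def F0 vec_eq_iff forall_2 mat_def)
  then have "monodromy (\<lambda>x. - u x) uy (inverse l) = G 1" by (rule monodromy_eq[OF Pot_uminus[OF P]])
  then show "monodromy (\<lambda>x. - u x) uy (inverse l) $ 1 $ 1 = monodromy u uy l $ 1 $ 1"
    "monodromy (\<lambda>x. - u x) uy (inverse l) $ 2 $ 2 = monodromy u uy l $ 2 $ 2"
    "monodromy (\<lambda>x. - u x) uy (inverse l) $ 2 $ 1 = inverse l * monodromy u uy l $ 2 $ 1"
    "monodromy (\<lambda>x. - u x) uy (inverse l) $ 1 $ 2 = l * monodromy u uy l $ 1 $ 2"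
    by (simp_all add: F(2)[OF l] G_def)
qed

section \<open>Lower bounds for the complex sine\<close>

lemma half_le_sin:
  fixes x :: real
  assumes "0 \<le> x" "x \<le> pi / 2"
  shows "x \<le> 2 * sin x"
proof -
  \<comment> \<open>At the half angle, sin x = 2 sin t cos t \<ge> 2 t (cos t)^2 \<ge> t, by t cos t
    \<le> sin t and (cos t)^2 \<ge> 1/2.\<close>
  define t where "t = x / 2"
  have t: "0 \<le> t" "t \<le> pi / 4" using assms by (auto simp: t_def)
  have "t * cos t \<le> sin t"
  proof -
    have "sin 0 - 0 * cos 0 \<le> sin t - t * cos t"
    proof (rule DERIV_nonneg_imp_nondecreasing[OF t(1)])
      fix y assume y: "0 \<le> y" "y \<le> t"
      have "((\<lambda>y. sin y - y * cos y) has_real_derivative y * sin y) (at y)"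
        by (auto intro!: derivative_eq_intros)
      moreover have "0 \<le> y * sin y" using y t by (intro mult_nonneg_nonneg sin_ge_zero) auto
      ultimately show "\<exists>d. ((\<lambda>y. sin y - y * cos y) has_real_derivative d) (at y) \<and> 0 \<le> d" by blast
    qed
    then show ?thesis by simp
  qed
  moreover have "0 \<le> cos t" using t by (intro cos_ge_zero) auto
  ultimately have "t * cos t * cos t \<le> sin t * cos t" by (intro mult_right_mono)
  moreover have "sin x = 2 * sin t * cos t" using sin_double[of t] by (simp add: t_def)
  moreover have "1 \<le> 2 * (cos t * cos t)"
  proof -
    have "0 \<le> cos x" using assms by (intro cos_ge_zero) auto
    moreover have "cos x = 2 * (cos t)\<^sup>2 - 1" using cos_double_cos[of t] by (simp add: t_def)
    ultimately show ?thesis by (simp add: power2_eq_square)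
  qed
  then have "t * 1 \<le> t * (2 * (cos t * cos t))" using t(1) by (intro mult_left_mono)
  ultimately show ?thesis by (simp add: t_def algebra_simps)
qed

text \<open>The right-hand side minus 2 is (2 sinh y)^2, and |sinh y| \<ge> |y|.\<close>

lemma cosh_ge_quadratic: "2 + 4 * y\<^sup>2 \<le> exp (2 * y) + inverse (exp (2 * y))" for y :: real
proof -
  have *: "2 + 4 * y\<^sup>2 \<le> exp (2 * y) + inverse (exp (2 * y))" if "0 \<le> y" for y :: real
  proof -
    define h where "h = exp y - inverse (exp y)"
    have "inverse (exp y) \<le> exp y" using that by (simp add: exp_minus[symmetric])
    then have "2 * y \<le> h" using real_le_abs_sinh[of y] that by (simp add: h_def)
    then have "(2 * y)\<^sup>2 \<le> h\<^sup>2" using that by (intro power_mono) auto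
    moreover have "h\<^sup>2 = exp (2 * y) + inverse (exp (2 * y)) - 2"
    proof -
      have e: "exp (2 * y) = exp y * exp y" by (simp add: exp_double power2_eq_square)
      show ?thesis unfolding h_def e by (simp add: power2_eq_square field_simps)
    qed
    ultimately show ?thesis by (simp add: power_mult_distrib)
  qed
  show ?thesis using *[of y] *[of "- y"] by (cases "0 \<le> y") (auto simp: exp_minus)
qed

text \<open>The square of |sin w| is the sum of squares of sin (Re w) and sinh (Im w); the first
  controls the real part of \<open>w\<close>, the second the imaginary part.\<close>

lemma norm_le_norm_sin:
  fixes w :: complex
  assumes "\<bar>Re w\<bar> \<le> pi / 2"
  shows "cmod w \<le> 2 * cmod (sin w)"
proof (rule power2_le_imp_le)
  have "\<bar>Re w\<bar> \<le> 2 * sin \<bar>Re w\<bar>" using assms by (intro half_le_sin) auto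
  also have "sin \<bar>Re w\<bar> \<le> \<bar>sin (Re w)\<bar>" by (cases "0 \<le> Re w") auto
  finally have "\<bar>Re w\<bar>\<^sup>2 \<le> (2 * \<bar>sin (Re w)\<bar>)\<^sup>2" by (intro power_mono) auto
  then have "(Re w)\<^sup>2 \<le> 4 * (sin (Re w))\<^sup>2" by (simp add: power_mult_distrib)
  moreover have "(2 * cmod (sin w))\<^sup>2 = exp (2 * Im w) + inverse (exp (2 * Im w)) - 2 + 4 * (sin (Re w))\<^sup>2"
    by (simp add: power_mult_distrib norm_sin_squared cos_double_sin)
  ultimately show "(cmod w)\<^sup>2 \<le> (2 * cmod (sin w))\<^sup>2"
    using cosh_ge_quadratic[of "Im w"] zero_le_power2[of "Im w"] unfolding cmod_power2[of w] by (smt (verit))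
qed simp

lemma norm_sin_ge_exp:
  fixes w :: complex
  assumes "1 \<le> \<bar>Im w\<bar>"
  shows "exp \<bar>Im w\<bar> \<le> 4 * cmod (sin w)"
proof (rule power2_le_imp_le)
  define E where "E = exp (2 * \<bar>Im w\<bar>)"
  have "1 + 2 * \<bar>Im w\<bar> \<le> E" unfolding E_def by (rule exp_ge_add_one_self)
  then have E3: "3 \<le> E" using assms by linarith
  have E: "exp (2 * Im w) + inverse (exp (2 * Im w)) = E + inverse E"
    by (cases "0 \<le> Im w") (auto simp: E_def exp_minus)
  have "(4 * cmod (sin w))\<^sup>2 = 4 * (E + inverse E - 2 * cos (2 * Re w))"
    by (simp add: power_mult_distrib norm_sin_squared E)
  moreover have "0 \<le> inverse E" using E3 by simp
  moreover have "cos (2 * Re w) \<le> 1" by simp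
  moreover have "(exp \<bar>Im w\<bar>)\<^sup>2 = E" by (simp add: E_def exp_double)
  ultimately show "(exp \<bar>Im w\<bar>)\<^sup>2 \<le> (4 * cmod (sin w))\<^sup>2" using E3 by (smt (verit))
qed simp

lemma exists_nearest_multiple_pi:
  fixes \<zeta> :: complex
  obtains k :: int where "\<bar>Re (\<zeta> - of_int k * pi)\<bar> \<le> pi / 2"
proof -
  define k where "k = round (Re \<zeta> / pi)"
  have "\<bar>of_int k - Re \<zeta> / pi\<bar> \<le> 1 / 2" unfolding k_def by (rule of_int_round_abs_le)
  then have "\<bar>of_int k - Re \<zeta> / pi\<bar> * pi \<le> 1 / 2 * pi" by (intro mult_right_mono) auto
  moreover have "of_int k * pi - Re \<zeta> = (of_int k - Re \<zeta> / pi) * pi" by (simp add: field_simps)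
  ultimately have "\<bar>of_int k * pi - Re \<zeta>\<bar> \<le> pi / 2" by (simp add: abs_mult)
  then show ?thesis by (intro that[of k]) (simp add: abs_minus_commute)
qed

lemma norm_sin_shift: "cmod (sin (\<zeta> - complex_of_real (of_int k * pi))) = cmod (sin \<zeta>)"
proof -
  have s: "sin (complex_of_real (of_int k * pi)) = 0" using sin_eq_0[of "complex_of_real (of_int k * pi)"] by auto
  then have "(cos (complex_of_real (of_int k * pi)))\<^sup>2 = 1"
    using sin_cos_squared_add[of "complex_of_real (of_int k * pi)"] by simp
  then have "cmod (cos (complex_of_real (of_int k * pi))) = 1"
    by (metis norm_power power2_eq_1_iff norm_one norm_minus_cancel)
  then show ?thesis using s by (simp add: sin_diff norm_mult)
qed

text \<open>Smallness relative to exp |Im zeta| first excludes |Im zeta| \<ge> 1, where |sin zeta|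
  is at least exp |Im zeta| / 4. Then the exponential is at most 3, and the factor 1/8 suffices
  because 2 * 3/8 < 1.\<close>

lemma small_sin_near_multiple_pi:
  fixes \<zeta> :: complex
  assumes \<eta>: "0 < \<eta>" "\<eta> \<le> 1" and small: "cmod (sin \<zeta>) < \<eta> / 8 * exp \<bar>Im \<zeta>\<bar>"
  obtains k :: int where "cmod (\<zeta> - of_int k * pi) < \<eta>" "cmod (\<zeta> - of_int k * pi) \<le> 2 * cmod (sin \<zeta>)"
proof -
  obtain k :: int where k: "\<bar>Re (\<zeta> - of_int k * pi)\<bar> \<le> pi / 2" by (rule exists_nearest_multiple_pi)
  from norm_le_norm_sin[OF this] have b: "cmod (\<zeta> - of_int k * pi) \<le> 2 * cmod (sin \<zeta>)"
    by (simp only: norm_sin_shift)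
  have "\<bar>Im \<zeta>\<bar> < 1"
  proof (rule ccontr)
    assume "\<not> \<bar>Im \<zeta>\<bar> < 1"
    then have "exp \<bar>Im \<zeta>\<bar> \<le> 4 * cmod (sin \<zeta>)" by (intro norm_sin_ge_exp) simp
    also have "\<dots> < 4 * (\<eta> / 8 * exp \<bar>Im \<zeta>\<bar>)" using small by simp
    also have "\<dots> \<le> exp \<bar>Im \<zeta>\<bar>" using \<eta> by simp
    finally show False by simp
  qed
  then have "exp \<bar>Im \<zeta>\<bar> \<le> exp 1" by simp
  also have "exp 1 \<le> (3 :: real)" by (rule exp_le)
  finally have "\<eta> / 8 * exp \<bar>Im \<zeta>\<bar> \<le> \<eta> / 8 * 3" using \<eta> by (intro mult_left_mono) auto
  then have "cmod (sin \<zeta>) < \<eta> / 8 * 3" using small by simp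
  then have "cmod (\<zeta> - of_int k * pi) < \<eta>" using b \<eta> by linarith
  with b show ?thesis by (rule that[rotated])
qed

lemma norm_sin_le_exp: "cmod (sin \<zeta>) \<le> exp \<bar>Im \<zeta>\<bar>" for \<zeta> :: complex
proof -
  have "cmod (sin \<zeta>) = cmod (exp (\<i> * \<zeta>) - exp (- (\<i> * \<zeta>))) / 2"
    unfolding sin_exp_eq by (simp add: norm_divide norm_mult)
  also have "\<dots> \<le> (cmod (exp (\<i> * \<zeta>)) + cmod (exp (- (\<i> * \<zeta>)))) / 2"
    by (intro divide_right_mono norm_triangle_ineq4) auto
  also have "\<dots> \<le> (exp \<bar>Im \<zeta>\<bar> + exp \<bar>Im \<zeta>\<bar>) / 2"
    by (intro divide_right_mono add_mono) (auto simp: norm_exp_eq_Re)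
  finally show ?thesis by simp
qed

text \<open>The lower left entry of the vacuum monodromy. It is independent of the branch of the
  root, because both factors change sign with s.\<close>

definition vacuum_c :: "complex \<Rightarrow> complex" where
  "vacuum_c l = csqrt l * sin (zeta_of (csqrt l))"

lemma zeta_of_minus: "zeta_of (- s) = - zeta_of s"
  by (simp add: zeta_of_def divide_simps)

lemma csqrt_square_cases: "csqrt (s\<^sup>2) = s \<or> csqrt (s\<^sup>2) = - s"
  using power2_eq_iff[of "csqrt (s\<^sup>2)" s] by simp

lemma vacuum_c_square: "vacuum_c (s\<^sup>2) = s * sin (zeta_of s)"
  using csqrt_square_cases[of s] by (auto simp: vacuum_c_def zeta_of_minus)

text \<open>Across the branch cut of \<open>csqrt\<close> the root i csqrt (- l), holomorphic off
  the nonnegative real axis, gives the same function.\<close>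

lemma vacuum_c_holomorphic: "vacuum_c holomorphic_on (- {0})"
proof -
  have hol: "(\<lambda>l. g l * sin (zeta_of (g l))) holomorphic_on A" if "g holomorphic_on A" "\<And>l. l \<in> A \<Longrightarrow> g l \<noteq> 0" for g A
    unfolding zeta_of_def using that by (intro holomorphic_intros) auto
  define B where "B = - (\<real>\<^sub>\<ge>\<^sub>0 :: complex set)"
  have oB: "open B" unfolding B_def by (simp add: open_Compl)
  have "vacuum_c holomorphic_on (- \<real>\<^sub>\<le>\<^sub>0)"
    unfolding vacuum_c_def[abs_def] by (rule hol) (auto intro!: holomorphic_intros)
  moreover have "vacuum_c holomorphic_on B"
  proof (rule holomorphic_transform)
    show "(\<lambda>l. (\<i> * csqrt (- l)) * sin (zeta_of (\<i> * csqrt (- l)))) holomorphic_on B"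
      by (rule hol) (auto intro!: holomorphic_intros simp: B_def)
    show "(\<i> * csqrt (- l)) * sin (zeta_of (\<i> * csqrt (- l))) = vacuum_c l" for l
      using vacuum_c_square[of "\<i> * csqrt (- l)"] by (simp add: power_mult_distrib)
  qed
  ultimately have "vacuum_c holomorphic_on (- \<real>\<^sub>\<le>\<^sub>0 \<union> B)" using oB by (intro holomorphic_on_Un) auto
  moreover have "- {0} \<subseteq> - \<real>\<^sub>\<le>\<^sub>0 \<union> B"
    by (auto simp: B_def complex_nonpos_Reals_iff complex_nonneg_Reals_iff complex_eq_iff)
  ultimately show ?thesis by (rule holomorphic_on_subset)
qed

text \<open>This is where the formula for \<open>lambda0 k\<close> comes from: t = 2 pi k + sqrt (4
  pi^2 k^2 - 1) solves t + 1/t = 4 pi k, and its square is \<open>lambda0 k\<close>. For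
  \<open>k = 0\<close> a root is i.\<close>

lemma lambda0_witness:
  obtains s where "s \<noteq> 0" "s\<^sup>2 = lambda0 k" "zeta_of s = complex_of_real (of_int k * pi)"
proof (cases "k = 0")
  case True
  show ?thesis by (rule that[of \<i>]) (simp_all add: True lambda0_def zeta_of_def)
next
  case False
  define w where "w = sqrt (4 * pi\<^sup>2 * (of_int k)\<^sup>2 - 1)"
  have "1 \<le> \<bar>k\<bar>" using False by linarith
  then have "1 \<le> \<bar>real_of_int k\<bar>" by linarith
  then have "1 \<le> (real_of_int k)\<^sup>2" using one_le_power[of "\<bar>real_of_int k\<bar>" 2] by simp
  moreover have "1 \<le> 4 * pi\<^sup>2" using pi_ge_two one_le_power[of pi 2] by linarith
  ultimately have "1 * 1 \<le> 4 * pi\<^sup>2 * (real_of_int k)\<^sup>2" by (intro mult_mono) auto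
  then have w2: "w\<^sup>2 = 4 * pi\<^sup>2 * (of_int k)\<^sup>2 - 1" unfolding w_def by simp
  define t where "t = 2 * pi * of_int k + w"
  have tt: "t * (4 * pi * of_int k - t) = 1"
    using w2 by (simp add: t_def algebra_simps power2_eq_square)
  then have t0: "t \<noteq> 0" by auto
  then have "inverse t = 4 * pi * of_int k - t" using tt by (simp add: field_simps)
  then have i: "t + inverse t = 4 * (of_int k * pi)" by simp
  show ?thesis
  proof (rule that[of "complex_of_real t"])
    show "complex_of_real t \<noteq> 0" using t0 by simp
    have "t\<^sup>2 = 8 * pi\<^sup>2 * (of_int k)\<^sup>2 + 4 * pi * of_int k * w - 1"
      using w2 by (simp add: t_def power2_sum power_mult_distrib)
    then show "(complex_of_real t)\<^sup>2 = lambda0 k"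
      unfolding lambda0_def of_real_power[symmetric] w_def by simp
    have "zeta_of (complex_of_real t) = complex_of_real ((t + inverse t) / 4)" by (simp add: zeta_of_def)
    then show "zeta_of (complex_of_real t) = complex_of_real (of_int k * pi)" unfolding i by simp
  qed
qed

lemma lambda0_nonzero: "lambda0 k \<noteq> 0"
  by (metis lambda0_witness zero_eq_power2)

text \<open>Passing from \<open>k\<close> to \<open>- k\<close> changes only the sign of the root
  term, and the product of the two values is A^2 - B^2 = 1.\<close>

lemma lambda0_uminus: "lambda0 (- k) = inverse (lambda0 k)"
proof (cases "k = 0")
  case False
  define w where "w = sqrt (4 * pi\<^sup>2 * (of_int k)\<^sup>2 - 1)"
  have "1 \<le> \<bar>k\<bar>" using False by linarith
  then have "1 \<le> \<bar>real_of_int k\<bar>" by linarith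
  then have "1 \<le> (real_of_int k)\<^sup>2" using one_le_power[of "\<bar>real_of_int k\<bar>" 2] by simp
  moreover have "1 \<le> 4 * pi\<^sup>2" using pi_ge_two one_le_power[of pi 2] by linarith
  ultimately have "1 * 1 \<le> 4 * pi\<^sup>2 * (real_of_int k)\<^sup>2" by (intro mult_mono) auto
  then have w2: "w\<^sup>2 = 4 * pi\<^sup>2 * (of_int k)\<^sup>2 - 1" unfolding w_def by simp
  define A where "A = 8 * pi\<^sup>2 * (of_int k)\<^sup>2 - 1"
  define B where "B = 4 * pi * of_int k * w"
  have "(A + B) * (A - B) = A\<^sup>2 - B\<^sup>2" by (simp add: algebra_simps power2_eq_square)
  also have "B\<^sup>2 = 16 * pi\<^sup>2 * (of_int k)\<^sup>2 * (4 * pi\<^sup>2 * (of_int k)\<^sup>2 - 1)"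
    by (simp add: B_def power_mult_distrib w2)
  also have "A\<^sup>2 - \<dots> = 1" by (simp add: A_def power2_eq_square algebra_simps)
  finally have "(A + B) * (A - B) = 1" .
  moreover have "lambda0 k = complex_of_real (A + B)" "lambda0 (- k) = complex_of_real (A - B)"
    unfolding lambda0_def A_def B_def w_def by (simp_all add: algebra_simps)
  ultimately have "lambda0 k * lambda0 (- k) = 1" by (metis of_real_1 of_real_mult)
  then show ?thesis by (rule inverse_unique[symmetric])
qed (simp add: lambda0_def)

text \<open>The value of \<open>zeta_of\<close> determines s up to inversion, and inversion of
  \<open>lambda0 k\<close> only replaces \<open>k\<close> by \<open>- k\<close>.\<close>

lemma vacuum_c_zero_iff:
  assumes l: "l \<noteq> 0"
  shows "vacuum_c l = 0 \<longleftrightarrow> (\<exists>k. l = lambda0 k)"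
proof
  assume "\<exists>k. l = lambda0 k"
  then obtain k where k: "l = lambda0 k" by blast
  obtain s where s: "s\<^sup>2 = lambda0 k" "zeta_of s = complex_of_real (of_int k * pi)" by (rule lambda0_witness)
  have "sin (complex_of_real (of_int k * pi)) = 0" using sin_eq_0[of "complex_of_real (of_int k * pi)"] by auto
  then show "vacuum_c l = 0" using vacuum_c_square[of s] by (simp add: k s)
next
  assume v: "vacuum_c l = 0"
  define s where "s = csqrt l"
  have s0: "s \<noteq> 0" and s2: "s\<^sup>2 = l" using l by (auto simp: s_def)
  have "sin (zeta_of s) = 0" using v l by (simp add: vacuum_c_def s_def)
  then obtain k :: int where k: "zeta_of s = complex_of_real (of_int k * pi)" unfolding sin_eq_0 by auto
  obtain t where t: "t \<noteq> 0" "t\<^sup>2 = lambda0 k" "zeta_of t = complex_of_real (of_int k * pi)" by (rule lambda0_witness)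
  have zeq: "a = b \<or> a = inverse b" if "zeta_of a = zeta_of b" "a \<noteq> 0" "b \<noteq> 0" for a b
  proof -
    have "a + inverse a = b + inverse b" using that(1) unfolding zeta_of_def divide_cancel_right by simp
    then have "(a - b) * (a * b - 1) = 0" using that(2,3) by (simp add: field_simps)
    then have "a = b \<or> a * b = 1" by simp
    then show ?thesis using that(3) by (auto simp: nonzero_eq_divide_eq inverse_eq_divide)
  qed
  have "s = t \<or> s = inverse t" by (rule zeq) (use k t s0 in auto)
  moreover have "inverse (lambda0 k) = lambda0 (- k)" by (rule lambda0_uminus[symmetric])
  ultimately have "l = lambda0 k \<or> l = lambda0 (- k)" using s2 t(2) by (auto simp: power_inverse)
  then show "\<exists>k. l = lambda0 k" by blast
qed

section \<open>Counting zeros in annuli\<close>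

lemma connected_punctured_plane: "connected (- {0 :: complex})"
  using connected_punctured_universe[of "0 :: complex"] by (simp add: Compl_eq_Diff_UNIV)

lemma frequently_nonzero_punctured:
  assumes "f holomorphic_on (- {0})" "w \<noteq> 0" "f w \<noteq> 0" "z \<noteq> 0"
  shows "eventually (\<lambda>w. f w \<noteq> 0) (at z)" "frequently (\<lambda>w. f w \<noteq> 0) (at z)"
proof -
  have "\<forall>\<^sub>F v in at z. f v \<noteq> 0 \<and> v \<in> - {0}"
    using assms connected_punctured_plane by (intro non_zero_neighbour_alt[where \<beta> = w]) (auto simp: open_Compl)
  then show "eventually (\<lambda>w. f w \<noteq> 0) (at z)" by (rule eventually_mono) simp
  then show "frequently (\<lambda>w. f w \<noteq> 0) (at z)" by (rule eventually_frequently[rotated]) simp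
qed

lemma analytic_at_punctured: "f holomorphic_on (- {0}) \<Longrightarrow> z \<noteq> 0 \<Longrightarrow> f analytic_on {z}"
  using analytic_at[of f z] by (metis Compl_iff open_Compl finite.emptyI finite_imp_closed finite_insert singletonD)

lemma prod_power_logderiv:
  assumes "finite Z" "\<And>p. p \<in> Z \<Longrightarrow> z \<noteq> p"
  shows "((\<lambda>z. \<Prod>p\<in>Z. (z - p) ^ m p) has_field_derivative
    (\<Prod>p\<in>Z. (z - p) ^ m p) * (\<Sum>p\<in>Z. of_nat (m p) * (1 / (z - p)))) (at (z :: complex))"
  using assms
proof (induction Z rule: finite_induct)
  case (insert p Z)
  have z: "z - p \<noteq> 0" using insert.prems by auto
  have "((\<lambda>z. (z - p) ^ m p) has_field_derivative (z - p) ^ m p * (of_nat (m p) * (1 / (z - p)))) (at z)"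
  proof (cases "m p")
    case (Suc n)
    show ?thesis unfolding Suc
      by (rule derivative_eq_intros refl)+ (use z in \<open>simp add: field_simps\<close>)
  qed simp
  from DERIV_mult[OF this insert.IH] insert show ?case
    by (simp add: algebra_simps)
qed simp

text \<open>The argument principle on an annulus. Dividing \<open>f\<close> by the polynomial with the same zeros there
  leaves a function without zeros, whose logarithmic derivative has the same integral over both
  boundary circles.\<close>

lemma annulus_argument_principle:
  assumes f: "f holomorphic_on (- {0})" and r: "0 < r" "r < R"
    and nz: "\<And>z. cmod z = r \<or> cmod z = R \<Longrightarrow> f z \<noteq> 0"
  defines "Z \<equiv> {z. r < cmod z \<and> cmod z < R \<and> f z = 0}"
  shows "finite Z"
    "contour_integral (circlepath 0 R) (\<lambda>z. deriv f z / f z) - contour_integral (circlepath 0 r) (\<lambda>z. deriv f z / f z)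
      = 2 * pi * \<i> * of_nat (\<Sum>p\<in>Z. nat (zorder f p))"
proof -
  have fR: "f (of_real R) \<noteq> 0" using r by (intro nz) simp
  have oC: "open (- {0 :: complex})" by (simp add: open_Compl)
  note ev = frequently_nonzero_punctured[OF f _ fR]
  have fin: "finite {z \<in> K. f z = 0}" if "compact K" "K \<subseteq> - {0}" for K
  proof (cases "f constant_on (- {0})")
    case True
    then have "f z \<noteq> 0" if "z \<noteq> 0" for z using fR r that unfolding constant_on_def
      by (metis Compl_iff empty_iff insert_iff of_real_eq_0_iff less_irrefl order_less_trans)
    then have "{z \<in> K. f z = 0} = {}" using that(2) by blast
    then show ?thesis by (simp only: finite.emptyI)
  next
    case False
    then show ?thesis using that by (intro holomorphic_compact_finite_zeros[OF f oC connected_punctured_plane]) auto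
  qed
  have "compact (cball 0 R - ball (0 :: complex) r)" by (intro compact_diff) auto
  from fin[OF this] have "finite {z \<in> cball 0 R - ball 0 r. f z = 0}" using r by auto
  then show finZ: "finite Z" by (rule rev_finite_subset) (auto simp: Z_def)
  \<comment> \<open>The zeros outside the annulus are cut out of the domain, so that on
    \<open>A\<close> the zeros of \<open>f\<close> are exactly those in \<open>Z\<close>. They are
    countable, being finite in each compact annulus, hence \<open>A\<close> remains
    connected.\<close>
  define W where "W = {z. z \<noteq> 0 \<and> f z = 0} - Z"
  define A where "A = - {0} - W"
  have A_eq: "A = {z \<in> - {0}. f z \<noteq> 0} \<union> {z. r < cmod z \<and> cmod z < R}"
    unfolding A_def W_def Z_def using r by auto
  have "open {z \<in> - {0}. f z \<noteq> 0}"
    using continuous_open_preimage[OF holomorphic_on_imp_continuous_on[OF f] oC, of "- {0}"]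
    by (simp add: open_Compl vimage_def Int_def)
  moreover have "open {z :: complex. r < cmod z \<and> cmod z < R}"
    by (intro open_Collect_conj open_Collect_less continuous_intros)
  ultimately have oA: "open A" unfolding A_eq by (rule open_Un)
  have cntW: "countable W"
  proof -
    have "W \<subseteq> (\<Union>n\<in>(UNIV :: nat set). {z \<in> cball 0 (of_nat n) - ball 0 (1 / of_nat (Suc n)). f z = 0})"
    proof
      fix z assume z: "z \<in> W"
      then have z0: "0 < cmod z" "f z = 0" by (auto simp: W_def)
      obtain n1 where n1: "cmod z \<le> of_nat n1" using real_arch_simple by blast
      obtain n2 where n2: "1 / cmod z \<le> of_nat n2" using real_arch_simple by blast
      have "1 / cmod z \<le> real (Suc (max n1 n2))" using n2 by simp
      then have "1 / real (Suc (max n1 n2)) \<le> cmod z" using z0(1) by (simp add: field_simps)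
      moreover have "cmod z \<le> real (max n1 n2)" using n1 by simp
      ultimately show "z \<in> (\<Union>n\<in>(UNIV :: nat set). {z \<in> cball 0 (of_nat n) - ball 0 (1 / of_nat (Suc n)). f z = 0})"
        using z0(2) by (intro UN_I[of "max n1 n2"]) auto
    qed
    moreover have "finite {z \<in> cball 0 (of_nat n) - ball 0 (1 / of_nat (Suc n)). f z = 0}" for n
    proof (rule fin)
      have "0 < 1 / real (Suc n)" by simp
      then have "(0 :: complex) \<in> ball 0 (1 / real (Suc n))" by (simp only: centre_in_ball)
      then show "cball 0 (of_nat n) - ball (0 :: complex) (1 / of_nat (Suc n)) \<subseteq> - {0}" by blast
    qed (intro compact_diff compact_cball open_ball)
    then have "countable (\<Union>n\<in>(UNIV :: nat set). {z \<in> cball 0 (of_nat n) - ball 0 (1 / of_nat (Suc n)). f z = 0})"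
      by (intro countable_UN[OF countableI_type] countable_finite)
    ultimately show ?thesis by (rule countable_subset)
  qed
  have cA: "connected A" unfolding A_def
    by (rule connected_open_diff_countable[OF _ oC connected_punctured_plane cntW]) simp
  have sub: "A \<subseteq> - {0}" by (auto simp: A_def)
  have fA: "f holomorphic_on A" by (rule holomorphic_on_subset[OF f sub])
  define m where "m p = nat (zorder f p)" for p
  define P where "P z = (\<Prod>p\<in>Z. (z - p) ^ m p)" for z
  have PA: "P holomorphic_on X" for X unfolding P_def by (intro holomorphic_intros)
  have m_pos: "zorder f p > 0" if "p \<in> Z" for p
    using that r by (subst zorder_pos_iff[OF f oC _ ev(2)]) (auto simp: Z_def)
  have P0: "P z = 0 \<longleftrightarrow> z \<in> Z" for z
    unfolding P_def using finZ m_pos by (auto simp: m_def)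
  have f0: "f z = 0 \<longleftrightarrow> z \<in> Z" if "z \<in> A" for z
    using that unfolding A_def W_def by (auto simp: Z_def)
  have ord: "zorder f z = zorder P z" if z: "z \<in> A" for z
  proof (cases "z \<in> Z")
    case False
    have "zorder f z = 0" using z sub False f0[OF z] by (intro zorder_eq_0I analytic_at_punctured[OF f]) auto
    moreover have "zorder P z = 0"
      using P0 False by (intro zorder_eq_0I) (auto simp: analytic_on_holomorphic intro!: exI[of _ UNIV] PA)
    ultimately show ?thesis by simp
  next
    case True
    have "zorder P z = zorder f z"
    proof (rule zorder_eqI[where S = UNIV and g = "\<lambda>w. \<Prod>p\<in>Z - {z}. (w - p) ^ m p"])
      show "(\<Prod>p\<in>Z - {z}. (z - p) ^ m p) \<noteq> 0" using finZ by auto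
      fix w :: complex assume "w \<noteq> z"
      have "P w = (w - z) ^ m z * (\<Prod>p\<in>Z - {z}. (w - p) ^ m p)"
        unfolding P_def using finZ True by (subst prod.remove[of Z z]) auto
      also have "(w - z) ^ m z = (w - z) powi zorder f z"
        using m_pos[OF True] by (simp add: m_def power_int_def)
      finally show "P w = (\<Prod>p\<in>Z - {z}. (w - p) ^ m p) * (w - z) powi zorder f z" by simp
    qed (auto intro!: holomorphic_intros)
    then show ?thesis by simp
  qed
  obtain h where h: "h holomorphic_on A" "\<And>z. z \<in> A \<Longrightarrow> h z \<noteq> 0" "\<And>z. z \<in> A \<Longrightarrow> f z = h z * P z"
    by (rule holomorphic_zorder_factorization[OF fA oA cA PA, of]) (use P0 f0 ord in auto)
  have hh: "(\<lambda>z. deriv h z / h z) holomorphic_on A"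
    using h by (intro holomorphic_on_divide holomorphic_deriv oA) auto
  have logd: "deriv f z / f z = (\<Sum>p\<in>Z. of_nat (m p) * (1 / (z - p))) + deriv h z / h z"
    if z: "z \<in> A" "z \<notin> Z" for z
  proof -
    have "(f has_field_derivative (deriv h z * P z + P z * (\<Sum>p\<in>Z. of_nat (m p) * (1 / (z - p))) * h z)) (at z)"
    proof (rule has_field_derivative_transform_within_open[OF _ oA z(1)])
      show "((\<lambda>z. h z * P z) has_field_derivative (deriv h z * P z + P z * (\<Sum>p\<in>Z. of_nat (m p) * (1 / (z - p))) * h z)) (at z)"
        unfolding P_def using z
        by (intro DERIV_mult holomorphic_derivI[OF h(1) oA] prod_power_logderiv finZ) auto
    qed (simp add: h(3))
    from DERIV_imp_deriv[OF this] show ?thesis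
      using h(2,3)[OF z(1)] P0[of z] z(2) by (simp add: field_simps)
  qed
  have circ: "contour_integral (circlepath 0 \<rho>) (\<lambda>z. deriv f z / f z) =
      (\<Sum>p\<in>Z. of_nat (m p) * (2 * pi * \<i> * winding_number (circlepath 0 \<rho>) p))
        + contour_integral (circlepath 0 \<rho>) (\<lambda>z. deriv h z / h z)"
    if \<rho>: "\<rho> = r \<or> \<rho> = R" for \<rho>
  proof -
    have \<rho>0: "0 < \<rho>" using \<rho> r by auto
    have im: "path_image (circlepath 0 \<rho>) = sphere 0 \<rho>" using \<rho>0 by simp
    have sA: "sphere 0 \<rho> \<subseteq> A" using nz \<rho> \<rho>0 by (auto simp: A_eq)
    have sZ: "sphere 0 \<rho> \<inter> Z = {}" using nz \<rho> by (auto simp: Z_def)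
    have "((\<lambda>z. (\<Sum>p\<in>Z. of_nat (m p) * (1 / (z - p))) + deriv h z / h z) has_contour_integral
      (\<Sum>p\<in>Z. of_nat (m p) * (2 * pi * \<i> * winding_number (circlepath 0 \<rho>) p))
        + contour_integral (circlepath 0 \<rho>) (\<lambda>z. deriv h z / h z)) (circlepath 0 \<rho>)"
    proof (intro has_contour_integral_add has_contour_integral_sum finZ has_contour_integral_lmul)
      show "((\<lambda>z. 1 / (z - p)) has_contour_integral 2 * pi * \<i> * winding_number (circlepath 0 \<rho>) p) (circlepath 0 \<rho>)"
        if "p \<in> Z" for p
        using sZ that im by (intro has_contour_integral_winding_number) auto
      have "(\<lambda>z. deriv h z / h z) contour_integrable_on (circlepath 0 \<rho>)"
        using sA im by (intro contour_integrable_holomorphic_simple[OF hh oA]) auto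
      then show "((\<lambda>z. deriv h z / h z) has_contour_integral contour_integral (circlepath 0 \<rho>) (\<lambda>z. deriv h z / h z)) (circlepath 0 \<rho>)"
        by (rule has_contour_integral_integral)
    qed
    then have "((\<lambda>z. deriv f z / f z) has_contour_integral
      (\<Sum>p\<in>Z. of_nat (m p) * (2 * pi * \<i> * winding_number (circlepath 0 \<rho>) p))
        + contour_integral (circlepath 0 \<rho>) (\<lambda>z. deriv h z / h z)) (circlepath 0 \<rho>)"
    proof (rule has_contour_integral_eq)
      fix z assume "z \<in> path_image (circlepath 0 \<rho>)"
      then have "z \<in> A" "z \<notin> Z" using sA sZ unfolding im by blast+
      from logd[OF this] show "(\<Sum>p\<in>Z. of_nat (m p) * (1 / (z - p))) + deriv h z / h z = deriv f z / f z"
        by (rule sym)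
    qed
    then show ?thesis by (rule contour_integral_unique)
  qed
  have wR: "winding_number (circlepath 0 R) p = 1" if "p \<in> Z" for p
    using that by (intro winding_number_circlepath) (auto simp: Z_def)
  have wr: "winding_number (circlepath 0 r) p = 0" if "p \<in> Z" for p
    using that r by (intro winding_number_zero_outside[of _ "cball 0 r"]) (auto simp: Z_def)
  \<comment> \<open>The radial homotopy sweeps the closed annulus, which lies in \<open>A\<close>:
    interior zeros belong to \<open>Z\<close>, and there are none on the two circles.\<close>
  have "homotopic_loops A (circlepath 0 R) (circlepath 0 r)"
  proof (rule homotopic_loops_linear)
    fix t :: real
    show "closed_segment (circlepath 0 R t) (circlepath 0 r t) \<subseteq> A"
    proof
      fix z assume "z \<in> closed_segment (circlepath 0 R t) (circlepath 0 r t)"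
      then obtain v where v: "0 \<le> v" "v \<le> 1" "z = (1 - v) *\<^sub>R circlepath 0 R t + v *\<^sub>R circlepath 0 r t"
        by (auto simp: closed_segment_def)
      have "z = of_real ((1 - v) * R + v * r) * exp (2 * of_real pi * \<i> * of_real t)"
        by (simp add: v(3) circlepath scaleR_conv_of_real algebra_simps)
      moreover have c: "r \<le> (1 - v) * R + v * r" "(1 - v) * R + v * r \<le> R"
        using v r mult_left_mono[of r R "1 - v"] mult_left_mono[of r R v] by (auto simp: algebra_simps)
      moreover have "cmod (exp (2 * of_real pi * \<i> * of_real t)) = 1" by (simp add: norm_exp_eq_Re)
      ultimately have nz': "cmod z = (1 - v) * R + v * r" using r by (simp only: norm_mult norm_of_real) simp
      then have "cmod z = r \<or> cmod z = R \<or> r < cmod z \<and> cmod z < R" using c by linarith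
      then show "z \<in> A" using nz[of z] r by (auto simp: A_eq)
    qed
  qed auto
  then have "contour_integral (circlepath 0 R) (\<lambda>z. deriv h z / h z) = contour_integral (circlepath 0 r) (\<lambda>z. deriv h z / h z)"
    by (intro Cauchy_theorem_homotopic_loops[OF _ oA hh]) auto
  then show "contour_integral (circlepath 0 R) (\<lambda>z. deriv f z / f z) - contour_integral (circlepath 0 r) (\<lambda>z. deriv f z / f z)
      = 2 * pi * \<i> * of_nat (\<Sum>p\<in>Z. nat (zorder f p))"
    using circ[of r] circ[of R] wR wr by (simp add: m_def sum_distrib_left mult_ac)
qed

text \<open>On the circle f / (kappa g) stays within distance 1 of 1, so its principal logarithm is
  a primitive of the difference of the integrands. The constant kappa disappears in the logarithmic
  derivatives.\<close>

lemma logderiv_integral_eq: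
  assumes f: "f holomorphic_on (- {0})" and g: "g holomorphic_on (- {0})" and \<rho>: "0 < \<rho>"
    and close: "\<And>z. cmod z = \<rho> \<Longrightarrow> cmod (f z - \<kappa> * g z) < cmod (\<kappa> * g z)"
  shows "contour_integral (circlepath 0 \<rho>) (\<lambda>z. deriv f z / f z) = contour_integral (circlepath 0 \<rho>) (\<lambda>z. deriv g z / g z)"
proof -
  have oC: "open (- {0 :: complex})" by (simp add: open_Compl)
  have im: "path_image (circlepath 0 \<rho>) = sphere 0 \<rho>" using \<rho> by simp
  have nz: "\<kappa> \<noteq> 0" "g z \<noteq> 0" "f z \<noteq> 0" "z \<noteq> 0" if "cmod z = \<rho>" for z
    using close[OF that] that \<rho> by auto
  have int: "(\<lambda>z. deriv F z / F z) contour_integrable_on (circlepath 0 \<rho>)"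
    if "F holomorphic_on (- {0})" "\<And>z. cmod z = \<rho> \<Longrightarrow> F z \<noteq> 0" for F
  proof (rule contour_integrable_continuous_circlepath)
    have "continuous_on (- {0}) F" "continuous_on (- {0}) (deriv F)"
      using that(1) by (auto intro!: holomorphic_on_imp_continuous_on holomorphic_deriv oC)
    moreover have "sphere 0 \<rho> \<subseteq> - {0 :: complex}" using \<rho> by auto
    ultimately show "continuous_on (path_image (circlepath 0 \<rho>)) (\<lambda>z. deriv F z / F z)"
      unfolding im using that(2) by (intro continuous_on_divide) (auto intro: continuous_on_subset)
  qed
  have "((\<lambda>z. deriv f z / f z - deriv g z / g z) has_contour_integral 0) (circlepath 0 \<rho>)"
  proof (rule Cauchy_theorem_primitive[where S = "sphere 0 \<rho>"])
    fix z assume "z \<in> sphere (0 :: complex) \<rho>"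
    then have z: "cmod z = \<rho>" by simp
    note n = nz[OF z]
    define q where "q z = f z / (\<kappa> * g z)" for z
    have "cmod (q z - 1) = cmod (f z - \<kappa> * g z) / cmod (\<kappa> * g z)"
      unfolding q_def norm_divide[symmetric] using n by (simp add: diff_divide_distrib)
    also have "\<dots> < 1" using close[OF z] n by (simp add: divide_less_eq)
    finally have q1: "cmod (q z - 1) < 1" .
    then have "0 < Re (q z)" using abs_Re_le_cmod[of "q z - 1"] by simp
    then have qn: "q z \<notin> \<real>\<^sub>\<le>\<^sub>0" by (auto simp: complex_nonpos_Reals_iff)
    have df: "(f has_field_derivative deriv f z) (at z)" "(g has_field_derivative deriv g z) (at z)"
      using n by (auto intro!: holomorphic_derivI[OF f oC] holomorphic_derivI[OF g oC])
    have "(q has_field_derivative (deriv f z * (\<kappa> * g z) - f z * (\<kappa> * deriv g z)) / ((\<kappa> * g z) * (\<kappa> * g z))) (at z)"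
      unfolding q_def[abs_def] using n by (intro DERIV_divide DERIV_cmult df) auto
    from DERIV_chain2[OF has_field_derivative_Ln[OF qn] this]
    have "((\<lambda>z. Ln (q z)) has_field_derivative inverse (q z) * ((deriv f z * (\<kappa> * g z) - f z * (\<kappa> * deriv g z)) / ((\<kappa> * g z) * (\<kappa> * g z)))) (at z)" .
    moreover have "inverse (q z) * ((deriv f z * (\<kappa> * g z) - f z * (\<kappa> * deriv g z)) / ((\<kappa> * g z) * (\<kappa> * g z)))
        = deriv f z / f z - deriv g z / g z"
      using n by (simp add: q_def field_simps)
    ultimately have "((\<lambda>z. Ln (q z)) has_field_derivative deriv f z / f z - deriv g z / g z) (at z)"
      by (simp only:)
    then show "((\<lambda>z. Ln (f z / (\<kappa> * g z))) has_field_derivative deriv f z / f z - deriv g z / g z) (at z within sphere 0 \<rho>)"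
      unfolding q_def by (rule has_field_derivative_at_within)
  qed (use \<rho> in auto)
  then have "contour_integral (circlepath 0 \<rho>) (\<lambda>z. deriv f z / f z - deriv g z / g z) = 0"
    by (rule contour_integral_unique)
  then show ?thesis
    using contour_integral_diff[OF int[OF f] int[OF g]] nz by simp
qed

text \<open>The two circles may use different constants. The lower left entry requires this, its
  factors being \<open>exp (- u 0 / 2)\<close> near infinity and \<open>exp (u 0 / 2)\<close> near
  the origin.\<close>

lemma annulus_zero_count:
  assumes f: "f holomorphic_on (- {0})" and g: "g holomorphic_on (- {0})" and r: "0 < r" "r < R"
    and R: "\<And>z. cmod z = R \<Longrightarrow> cmod (f z - \<kappa>1 * g z) < cmod (\<kappa>1 * g z)"
    and r': "\<And>z. cmod z = r \<Longrightarrow> cmod (f z - \<kappa>2 * g z) < cmod (\<kappa>2 * g z)"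
  shows "finite {z. r < cmod z \<and> cmod z < R \<and> f z = 0}"
    "(\<Sum>p\<in>{z. r < cmod z \<and> cmod z < R \<and> f z = 0}. nat (zorder f p))
      = (\<Sum>p\<in>{z. r < cmod z \<and> cmod z < R \<and> g z = 0}. nat (zorder g p))"
proof -
  have nf: "f z \<noteq> 0" and ng: "g z \<noteq> 0" if "cmod z = r \<or> cmod z = R" for z
    using that R[of z] r'[of z] by auto
  note F = annulus_argument_principle[OF f r nf] and G = annulus_argument_principle[OF g r ng]
  show "finite {z. r < cmod z \<and> cmod z < R \<and> f z = 0}" using F(1) .
  have "contour_integral (circlepath 0 R) (\<lambda>z. deriv f z / f z) = contour_integral (circlepath 0 R) (\<lambda>z. deriv g z / g z)"
    using r by (intro logderiv_integral_eq[OF f g _ R]) auto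
  moreover have "contour_integral (circlepath 0 r) (\<lambda>z. deriv f z / f z) = contour_integral (circlepath 0 r) (\<lambda>z. deriv g z / g z)"
    using r by (intro logderiv_integral_eq[OF f g _ r']) auto
  ultimately have "2 * pi * \<i> * of_nat (\<Sum>p\<in>{z. r < cmod z \<and> cmod z < R \<and> f z = 0}. nat (zorder f p))
    = 2 * pi * \<i> * of_nat (\<Sum>p\<in>{z. r < cmod z \<and> cmod z < R \<and> g z = 0}. nat (zorder g p))"
    using F(2) G(2) by simp
  then have "(of_nat (\<Sum>p\<in>{z. r < cmod z \<and> cmod z < R \<and> f z = 0}. nat (zorder f p)) :: complex)
    = of_nat (\<Sum>p\<in>{z. r < cmod z \<and> cmod z < R \<and> g z = 0}. nat (zorder g p))"
    unfolding mult_cancel_left by (simp del: of_nat_sum)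
  then show "(\<Sum>p\<in>{z. r < cmod z \<and> cmod z < R \<and> f z = 0}. nat (zorder f p))
      = (\<Sum>p\<in>{z. r < cmod z \<and> cmod z < R \<and> g z = 0}. nat (zorder g p))"
    unfolding of_nat_eq_iff .
qed

section \<open>The domains \<open>S k\<close>\<close>

lemma zeta_eq_zeta_of: "zeta l = zeta_of (csqrt l)"
  by (simp add: zeta_def zeta_of_def)

lemma zeta_of_square: "s \<noteq> 0 \<Longrightarrow> (zeta_of s)\<^sup>2 = (s\<^sup>2 + 2 + inverse (s\<^sup>2)) / 16"
  by (simp add: zeta_of_def power2_eq_square field_simps)

lemma zeta_square: "l \<noteq> 0 \<Longrightarrow> (zeta l)\<^sup>2 = (l + 2 + inverse l) / 16"
  unfolding zeta_eq_zeta_of by (subst zeta_of_square) auto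

lemma norm_zeta_inverse:
  assumes "l \<noteq> 0"
  shows "cmod (zeta (inverse l)) = cmod (zeta l)"
proof -
  have "(zeta (inverse l))\<^sup>2 = (zeta l)\<^sup>2" using assms by (simp add: zeta_square)
  then show ?thesis by (auto simp: power2_eq_iff)
qed

lemma Re_zeta_nonneg:
  assumes "l \<noteq> 0"
  shows "0 \<le> Re (zeta l)"
proof -
  have "0 \<le> Re (csqrt l)" using csqrt_principal[of l] by auto
  then show ?thesis by (simp add: zeta_def Re_complex_div_gt_0 inverse_eq_divide Re_divide)
qed

lemma norm_csqrt: "cmod (csqrt l) = sqrt (cmod l)"
proof -
  have "(cmod (csqrt l))\<^sup>2 = cmod l" by (simp flip: norm_power)
  then show ?thesis by (intro real_sqrt_unique[symmetric]) auto
qed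

lemma zeta_norm_one:
  assumes "cmod l = 1"
  shows "cmod (zeta l) \<le> pi / 2"
proof -
  have s: "cmod (csqrt l) = 1" using assms by (simp add: norm_csqrt)
  have "4 * cmod (zeta l) \<le> cmod (csqrt l) + 1"
    unfolding zeta_eq_zeta_of by (rule norm_zeta_of_le) (simp only: s order_refl)
  then show ?thesis using s pi_gt3 by linarith
qed

lemma S_inverse:
  assumes "l \<noteq> 0"
  shows "inverse l \<in> S k \<longleftrightarrow> l \<in> S (- k)"
proof -
  have n: "1 < cmod (inverse l) \<longleftrightarrow> cmod l < 1" "cmod (inverse l) < 1 \<longleftrightarrow> 1 < cmod l"
    using assms by (auto simp: norm_inverse one_less_inverse_iff inverse_less_1_iff)
  show ?thesis
    using assms by (auto simp: S_def norm_zeta_inverse n)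
qed

text \<open>Outside the unit circle, rounding |zeta| / pi gives the index, and inversion covers the
  inside. Points with |l| = 1 can only lie in \<open>S 0\<close>, and do so because |zeta| \<le> 1/2
  there.\<close>

lemma S_cover:
  assumes l: "l \<noteq> 0" and N: "0 \<le> N" and z: "cmod (zeta l) \<le> (of_int N + 1/2) * pi"
  shows "\<exists>k\<in>{-N..N}. l \<in> S k"
proof -
  have large: "\<exists>k\<in>{0..N}. l \<in> S k" if l: "l \<noteq> 0" "1 < cmod l" and z: "cmod (zeta l) \<le> (of_int N + 1/2) * pi" for l
  proof (cases "cmod (zeta l) \<le> pi / 2")
    case True
    then show ?thesis using l N by (intro bexI[of _ 0]) (auto simp: S_def)
  next
    case False
    define k where "k = \<lceil>cmod (zeta l) / pi - 1/2\<rceil>"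
    have "of_int k - 1 < cmod (zeta l) / pi - 1/2" "cmod (zeta l) / pi - 1/2 \<le> of_int k" unfolding k_def by linarith+
    then have "of_int k - 1/2 \<le> cmod (zeta l) / pi" "cmod (zeta l) / pi \<le> of_int k + 1/2" by linarith+
    then have b: "(of_int k - 1/2) * pi \<le> cmod (zeta l)" "cmod (zeta l) \<le> (of_int k + 1/2) * pi"
      by (simp_all add: pos_le_divide_eq pos_divide_le_eq)
    have "1/2 < cmod (zeta l) / pi" using False by (simp add: pos_less_divide_eq)
    then have "0 < k" unfolding k_def by linarith
    moreover have "cmod (zeta l) / pi \<le> of_int N + 1/2" using z by (simp add: pos_divide_le_eq)
    then have "k \<le> N" unfolding k_def by linarith
    moreover have "l \<in> S k" using b \<open>0 < k\<close> l by (simp add: S_def)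
    ultimately show ?thesis by auto
  qed
  consider "cmod l = 1" | "1 < cmod l" | "cmod l < 1" by linarith
  then show ?thesis
  proof cases
    case 1
    then show ?thesis using zeta_norm_one[OF 1] l N by (intro bexI[of _ 0]) (auto simp: S_def)
  next
    case 2
    from large[OF l this z] obtain k where "k \<in> {0..N}" "l \<in> S k" by blast
    then show ?thesis by (intro bexI[of _ k]) auto
  next
    case 3
    have "1 < cmod (inverse l)" using 3 l by (simp add: norm_inverse one_less_inverse_iff)
    with large[of "inverse l"] obtain k where "k \<in> {0..N}" "inverse l \<in> S k"
      using l z by (auto simp: norm_zeta_inverse)
    then show ?thesis using S_inverse[OF l, of k] by (intro bexI[of _ "- k"]) auto
  qed
qed

text \<open>The radius with |s| = 4 pi (n + 1/2), so that |zeta| is within 1/4 of (n + 1/2) pi.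
  These circles separate consecutive \<open>lambda0 k\<close> and replace the level curves of |zeta|
  that bound the domains \<open>S k\<close>.\<close>

definition rad :: "int \<Rightarrow> real" where
  "rad n = (4 * pi * (of_int n + 1/2))\<^sup>2"

lemma rad_mono: "0 \<le> m \<Longrightarrow> m < n \<Longrightarrow> rad m < rad n"
  unfolding rad_def by (intro power_strict_mono mult_strict_left_mono) auto

lemma rad_mono_le: "0 \<le> m \<Longrightarrow> m \<le> n \<Longrightarrow> rad m \<le> rad n"
  using rad_mono[of m n] by (cases "m = n") auto

lemma rad_ge:
  assumes "0 \<le> n"
  shows "36 * (of_int n + 1/2)\<^sup>2 \<le> rad n" "1 < rad n"
proof -
  have "(6 * (of_int n + 1/2))\<^sup>2 \<le> rad n"
    unfolding rad_def using assms pi_gt3 by (intro power_mono mult_right_mono) auto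
  then show a: "36 * (of_int n + 1/2)\<^sup>2 \<le> rad n" unfolding power_mult_distrib by simp
  have "(1/2)\<^sup>2 \<le> (real_of_int n + 1/2)\<^sup>2" using assms by (intro power_mono) auto
  then have "1/4 \<le> (real_of_int n + 1/2)\<^sup>2" by (simp add: power2_eq_square)
  then show "1 < rad n" using a by linarith
qed

text \<open>The circular counterpart of membership in \<open>S k\<close> for
  \<open>k \<noteq> 0\<close>. Points of the central annulus, between the radii
  \<open>1 / rad 0\<close> and \<open>rad 0\<close>, have no level.\<close>

definition level :: "complex \<Rightarrow> int \<Rightarrow> bool" where
  "level l k \<longleftrightarrow> 0 < k \<and> rad (k - 1) < cmod l \<and> cmod l < rad k
     \<or> k < 0 \<and> rad (- k - 1) < cmod (inverse l) \<and> cmod (inverse l) < rad (- k)"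

lemma level_inverse: "level (inverse l) k \<longleftrightarrow> level l (- k)"
  by (auto simp: level_def)

lemma level_unique_pos:
  assumes x: "rad (j - 1) < x" "x < rad j" "1 \<le> j" and N: "0 \<le> N"
  shows "x < rad N \<longleftrightarrow> j \<le> N" "rad N < x \<longleftrightarrow> N < j"
proof -
  have "rad N \<le> rad (j - 1)" if "N < j" using that N by (intro rad_mono_le) auto
  moreover have "rad j \<le> rad N" if "j \<le> N" using that x by (intro rad_mono_le) auto
  ultimately show "x < rad N \<longleftrightarrow> j \<le> N" "rad N < x \<longleftrightarrow> N < j" using x by force+
qed

lemma less_inverse_norm: "l \<noteq> 0 \<Longrightarrow> 0 < r \<Longrightarrow> cmod (inverse l) < r \<longleftrightarrow> 1 / r < cmod l"
  "l \<noteq> 0 \<Longrightarrow> 0 < r \<Longrightarrow> r < cmod (inverse l) \<longleftrightarrow> cmod l < 1 / r"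
  unfolding norm_inverse by (auto simp: field_simps)

lemma level_iff:
  assumes l: "l \<noteq> 0" and lev: "level l j"
  shows "0 \<le> N \<Longrightarrow> 1 / rad N < cmod l \<and> cmod l < rad N \<longleftrightarrow> \<bar>j\<bar> \<le> N"
    "1 \<le> k \<Longrightarrow> rad (k - 1) < cmod l \<and> cmod l < rad k \<longleftrightarrow> j = k"
    "1 \<le> k \<Longrightarrow> 1 / rad k < cmod l \<and> cmod l < 1 / rad (k - 1) \<longleftrightarrow> j = - k"
proof -
  have pos: "0 < rad n" if "0 \<le> n" for n using rad_ge(2)[OF that] by linarith
  have one: "1 / rad n < 1" if "0 \<le> n" for n using rad_ge(2)[OF that] by simp
  consider "1 \<le> j" "rad (j - 1) < cmod l" "cmod l < rad j" | "j \<le> -1" "rad (- j - 1) < cmod (inverse l)" "cmod (inverse l) < rad (- j)"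
    using lev unfolding level_def by force
  then have "(0 \<le> N \<longrightarrow> (1 / rad N < cmod l \<and> cmod l < rad N \<longleftrightarrow> \<bar>j\<bar> \<le> N)) \<and>
    (1 \<le> k \<longrightarrow> (rad (k - 1) < cmod l \<and> cmod l < rad k \<longleftrightarrow> j = k)) \<and>
    (1 \<le> k \<longrightarrow> (1 / rad k < cmod l \<and> cmod l < 1 / rad (k - 1) \<longleftrightarrow> j = - k))"
  proof cases
    case 1
    have l1: "1 < cmod l" using rad_ge(2)[of "j - 1"] 1 by linarith
    note u = level_unique_pos[OF 1(2,3,1)]
    show ?thesis
    proof (intro conjI impI)
      assume "0 \<le> N" then show "1 / rad N < cmod l \<and> cmod l < rad N \<longleftrightarrow> \<bar>j\<bar> \<le> N"
        using u(1)[of N] one[of N] l1 1(1) by auto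
    next
      assume "1 \<le> k" then show "rad (k - 1) < cmod l \<and> cmod l < rad k \<longleftrightarrow> j = k"
        using u(1)[of k] u(2)[of "k - 1"] by auto
    next
      assume "1 \<le> k" then show "1 / rad k < cmod l \<and> cmod l < 1 / rad (k - 1) \<longleftrightarrow> j = - k"
        using one[of "k - 1"] l1 1(1) by auto
    qed
  next
    case 2
    have l1: "1 < cmod (inverse l)" using rad_ge(2)[of "- j - 1"] 2 by linarith
    then have l2: "cmod l < 1" using l less_inverse_norm(2)[of l 1] by simp
    have "1 \<le> - j" using 2 by simp
    note u = level_unique_pos[OF 2(2,3) this]
    show ?thesis
    proof (intro conjI impI)
      assume "0 \<le> N" then show "1 / rad N < cmod l \<and> cmod l < rad N \<longleftrightarrow> \<bar>j\<bar> \<le> N"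
        using u(1)[of N] less_inverse_norm(1)[OF l pos[of N]] rad_ge(2)[of N] l2 2(1) by auto
    next
      assume "1 \<le> k" then show "rad (k - 1) < cmod l \<and> cmod l < rad k \<longleftrightarrow> j = k"
        using rad_ge(2)[of "k - 1"] l2 2(1) by auto
    next
      assume "1 \<le> k" then show "1 / rad k < cmod l \<and> cmod l < 1 / rad (k - 1) \<longleftrightarrow> j = - k"
        using u(1)[of k] u(2)[of "k - 1"] less_inverse_norm(1)[OF l pos[of k]] less_inverse_norm(2)[OF l pos[of "k - 1"]] by auto
    qed
  qed
  then show "0 \<le> N \<Longrightarrow> 1 / rad N < cmod l \<and> cmod l < rad N \<longleftrightarrow> \<bar>j\<bar> \<le> N"
    "1 \<le> k \<Longrightarrow> rad (k - 1) < cmod l \<and> cmod l < rad k \<longleftrightarrow> j = k"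
    "1 \<le> k \<Longrightarrow> 1 / rad k < cmod l \<and> cmod l < 1 / rad (k - 1) \<longleftrightarrow> j = - k"
    by auto
qed

text \<open>With x = 2 pi k the value lies between 4 x^2 - 2 x - 1 and 4 x^2 - 1, while the two
  radii are (2 x - 2 pi)^2 and (2 x + 2 pi)^2.\<close>

lemma lambda0_norm:
  assumes k: "1 \<le> k"
  shows "rad (k - 1) < cmod (lambda0 k)" "cmod (lambda0 k) < rad k"
proof -
  define x where "x = 2 * pi * of_int k"
  define w where "w = sqrt (x\<^sup>2 - 1)"
  have k1: "1 \<le> real_of_int k" using k by simp
  have x: "6 \<le> x" unfolding x_def using pi_gt3 mult_mono[of 3 pi 1 "real_of_int k"] k1 by simp
  have w1: "x - 1 \<le> w" unfolding w_def using x by (intro real_le_rsqrt) (simp add: power2_diff)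
  have w2: "w \<le> x" unfolding w_def using x by (intro real_le_lsqrt) auto
  have e: "lambda0 k = complex_of_real (2 * x\<^sup>2 + 2 * x * w - 1)"
    by (simp add: lambda0_def x_def w_def power_mult_distrib)
  have lo: "2 * x\<^sup>2 + 2 * x * (x - 1) - 1 \<le> 2 * x\<^sup>2 + 2 * x * w - 1"
    using w1 x by simp
  have hi: "2 * x\<^sup>2 + 2 * x * w - 1 \<le> 2 * x\<^sup>2 + 2 * x * x - 1"
    using w2 x by simp
  have pos: "0 \<le> 2 * x\<^sup>2 + 2 * x * (x - 1) - 1"
  proof -
    have "0 \<le> 2 * x * (x - 1)" using x by simp
    moreover have "36 \<le> x\<^sup>2" using power_mono[OF x, of 2] by simp
    ultimately show ?thesis by linarith
  qed
  have n: "cmod (lambda0 k) = 2 * x\<^sup>2 + 2 * x * w - 1" unfolding e norm_of_real using lo pos by simp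
  have r: "rad (k - 1) = (2 * x - 2 * pi)\<^sup>2" "rad k = (2 * x + 2 * pi)\<^sup>2"
    by (simp_all add: rad_def x_def algebra_simps)
  have "cmod (lambda0 k) \<le> (2 * x)\<^sup>2 - 1" using hi unfolding n by (simp add: power2_eq_square)
  also have "\<dots> < (2 * x)\<^sup>2" by simp
  also have "\<dots> \<le> (2 * x + 2 * pi)\<^sup>2" using x by (intro power_mono) auto
  finally show "cmod (lambda0 k) < rad k" unfolding r .
  have "(2 * x - 2 * pi)\<^sup>2 \<le> (2 * x - 6)\<^sup>2"
  proof (intro power_mono)
    have "2 * pi * 1 \<le> x" unfolding x_def using k1 by (intro mult_left_mono) auto
    then show "0 \<le> 2 * x - 2 * pi" using x by simp
  qed (use pi_gt3 in simp)
  also have "\<dots> < 2 * x\<^sup>2 + 2 * x * (x - 1) - 1" using x by (simp add: power2_eq_square algebra_simps)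
  also have "\<dots> \<le> cmod (lambda0 k)" using lo n by simp
  finally show "rad (k - 1) < cmod (lambda0 k)" unfolding r .
qed

lemma lambda0_level:
  assumes "k \<noteq> 0"
  shows "level (lambda0 k) k"
proof (cases "0 < k")
  case True
  then show ?thesis using lambda0_norm[of k] by (simp add: level_def)
next
  case False
  with assms have "1 \<le> - k" by simp
  then show ?thesis using lambda0_norm[of "- k"] lambda0_uminus[of k] by (simp add: level_def)
qed

lemma lambda0_0: "lambda0 0 = -1"
  by (simp add: lambda0_def)

lemma lambda0_annulus_iff:
  "0 \<le> N \<Longrightarrow> 1 / rad N < cmod (lambda0 j) \<and> cmod (lambda0 j) < rad N \<longleftrightarrow> \<bar>j\<bar> \<le> N"
  "1 \<le> k \<Longrightarrow> rad (k - 1) < cmod (lambda0 j) \<and> cmod (lambda0 j) < rad k \<longleftrightarrow> j = k"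
  "1 \<le> k \<Longrightarrow> 1 / rad k < cmod (lambda0 j) \<and> cmod (lambda0 j) < 1 / rad (k - 1) \<longleftrightarrow> j = - k"
proof -
  have *: "(0 \<le> N \<longrightarrow> (1 / rad N < cmod (lambda0 j) \<and> cmod (lambda0 j) < rad N \<longleftrightarrow> \<bar>j\<bar> \<le> N)) \<and>
    (1 \<le> k \<longrightarrow> (rad (k - 1) < cmod (lambda0 j) \<and> cmod (lambda0 j) < rad k \<longleftrightarrow> j = k)) \<and>
    (1 \<le> k \<longrightarrow> (1 / rad k < cmod (lambda0 j) \<and> cmod (lambda0 j) < 1 / rad (k - 1) \<longleftrightarrow> j = - k))"
  proof (cases "j = 0")
    case True
    have "0 \<le> n \<Longrightarrow> 1 / rad n < 1" for n using rad_ge(2)[of n] by simp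
    then show ?thesis using rad_ge(2)[of N] rad_ge(2)[of "k - 1"] by (force simp: True lambda0_0)
  next
    case False
    then show ?thesis using level_iff[OF lambda0_nonzero lambda0_level] by blast
  qed
  from * show "0 \<le> N \<Longrightarrow> 1 / rad N < cmod (lambda0 j) \<and> cmod (lambda0 j) < rad N \<longleftrightarrow> \<bar>j\<bar> \<le> N" by blast
  from * show "1 \<le> k \<Longrightarrow> rad (k - 1) < cmod (lambda0 j) \<and> cmod (lambda0 j) < rad k \<longleftrightarrow> j = k" by blast
  from * show "1 \<le> k \<Longrightarrow> 1 / rad k < cmod (lambda0 j) \<and> cmod (lambda0 j) < 1 / rad (k - 1) \<longleftrightarrow> j = - k" by blast
qed

lemma inj_lambda0: "inj lambda0"
proof (rule injI)
  fix j k assume e: "lambda0 j = lambda0 k"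
  consider "1 \<le> k" | "1 \<le> - k" | "k = 0" by linarith
  then show "j = k"
  proof cases
    case 1
    then show ?thesis using lambda0_annulus_iff(2)[OF 1, of j] lambda0_annulus_iff(2)[OF 1, of k] by (simp add: e)
  next
    case 2
    then show ?thesis using lambda0_annulus_iff(3)[OF 2, of j] lambda0_annulus_iff(3)[OF 2, of k] by (simp add: e)
  next
    case 3
    then show ?thesis using lambda0_annulus_iff(1)[of 0 j] lambda0_annulus_iff(1)[of 0 k] by (simp add: e)
  qed
qed

text \<open>The radius 1/2 fixes the index \<open>k\<close>, while \<open>q\<close> carries the
  quantitative information. Only the end at infinity is described; points near the origin are
  treated through their inverses.\<close>

definition near :: "complex \<Rightarrow> int \<Rightarrow> real \<Rightarrow> bool" where
  "near l k q \<longleftrightarrow> 0 < k \<and> 100 \<le> cmod l \<and> cmod (zeta l - of_int k * pi) < 1/2 \<and> cmod (zeta l - of_int k * pi) \<le> q"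

section \<open>Points near a vacuum zero\<close>

lemma zeta_bounds:
  assumes "100 \<le> cmod l"
  shows "sqrt (cmod l) - 1 \<le> 4 * cmod (zeta l)" "4 * cmod (zeta l) \<le> sqrt (cmod l) + 1"
proof -
  have "1 \<le> cmod (csqrt l)" using assms by (simp add: norm_csqrt)
  then show "sqrt (cmod l) - 1 \<le> 4 * cmod (zeta l)" "4 * cmod (zeta l) \<le> sqrt (cmod l) + 1"
    using norm_zeta_of_ge[of "csqrt l"] norm_zeta_of_le[of "csqrt l"] by (simp_all add: zeta_eq_zeta_of norm_csqrt)
qed

lemma near_norm_zeta:
  assumes "near l k q"
  shows "\<bar>cmod (zeta l) - of_int k * pi\<bar> < 1/2"
proof -
  have k: "0 < k" using assms by (simp add: near_def)
  have "cmod (complex_of_real (of_int k * pi)) = of_int k * pi" using k by (simp add: norm_mult)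
  moreover have "\<bar>cmod (zeta l) - cmod (complex_of_real (of_int k * pi))\<bar> \<le> cmod (zeta l - complex_of_real (of_int k * pi))"
    by (rule norm_triangle_ineq3)
  ultimately show ?thesis using assms by (simp add: near_def)
qed

lemma near_level:
  assumes n: "near l k q"
  shows "level l k"
proof -
  have k: "0 < k" and l: "100 \<le> cmod l" using n by (auto simp: near_def)
  define s where "s = sqrt (cmod l)"
  have s2: "s\<^sup>2 = cmod l" using l by (simp add: s_def)
  \<comment> \<open>The 3 is 4 * (1/2) + 1: the distance of |zeta| from k pi, and the difference of
    |s| and 4 |zeta|. Being below 2 pi, it keeps s between the radii of the two circles.\<close>
  have "\<bar>s - 4 * (of_int k * pi)\<bar> < 3" using near_norm_zeta[OF n] zeta_bounds[OF l] unfolding s_def by linarith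
  moreover have "3 < 2 * pi" using pi_gt3 by simp
  ultimately have b: "4 * pi * (of_int (k - 1) + 1/2) < s" "s < 4 * pi * (of_int k + 1/2)"
    by (simp_all add: algebra_simps abs_less_iff)
  have "0 \<le> s" unfolding s_def by simp
  have "0 \<le> 4 * pi * (of_int (k - 1) + 1/2)" using k by simp
  then have "rad (k - 1) < s\<^sup>2" unfolding rad_def using b by (intro power_strict_mono) auto
  moreover have "s\<^sup>2 < rad k" unfolding rad_def using b \<open>0 \<le> s\<close> by (intro power_strict_mono) auto
  ultimately show ?thesis using k by (simp add: level_def s2)
qed

text \<open>Neighbouring domains share boundary points, but |zeta| is within 1/2 of k pi and, on
  \<open>S j\<close>, within pi / 2 of j pi; so |j - k| < 1.\<close>

lemma near_S:
  assumes n: "near l k q"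
  shows "l \<in> S j \<longleftrightarrow> j = k"
proof
  have k: "0 < k" and l: "100 \<le> cmod l" using n by (auto simp: near_def)
  note z = near_norm_zeta[OF n]
  have p: "1/2 < pi / 2" using pi_gt3 by simp
  show "l \<in> S j" if "j = k"
  proof -
    have "l \<noteq> 0" using l by auto
    moreover have "(of_int k - 1/2) * pi \<le> cmod (zeta l)" "cmod (zeta l) \<le> (of_int k + 1/2) * pi"
      using z p unfolding left_diff_distrib distrib_right by linarith+
    ultimately show ?thesis using k l that by (simp add: S_def)
  qed
  assume j: "l \<in> S j"
  have "0 \<le> j" using j l by (auto simp: S_def split: if_splits)
  have "\<bar>cmod (zeta l) - of_int j * pi\<bar> \<le> pi / 2"
  proof (cases "j = 0")
    case True
    then show ?thesis using j by (simp add: S_def)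
  next
    case False
    with \<open>0 \<le> j\<close> j have "(of_int j - 1/2) * pi \<le> cmod (zeta l)" "cmod (zeta l) \<le> (of_int j + 1/2) * pi"
      by (auto simp: S_def)
    then show ?thesis unfolding left_diff_distrib distrib_right by linarith
  qed
  then have "\<bar>(of_int j - of_int k) * pi\<bar> < 1 * pi" using z p unfolding left_diff_distrib by linarith
  then have "\<bar>of_int j - of_int k\<bar> < (1 :: real)" by (simp add: abs_mult)
  then show "j = k" by linarith
qed

text \<open>Since 16 zeta^2 = l + 2 + 1/l, the difference of the squares of zeta gives (l - m0) (1 -
  1/(l m0)) = 16 epsilon (zeta + k pi). The second factor on the left is bounded below and zeta + k
  pi is O(k). For the inverses one divides by l m0, of size at least k^4.\<close>

lemma near_distance:
  assumes n: "near l k q"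
  shows "cmod (l - lambda0 k) \<le> 150 * of_int k * q" "cmod (inverse l - inverse (lambda0 k)) \<le> 150 * q / (of_int k) ^ 3"
proof -
  have k: "1 \<le> k" and l: "100 \<le> cmod l" using n by (auto simp: near_def)
  define m0 where "m0 = lambda0 k"
  obtain s where s: "s \<noteq> 0" "s\<^sup>2 = m0" "zeta_of s = complex_of_real (of_int k * pi)"
    unfolding m0_def by (rule lambda0_witness)
  have l0: "l \<noteq> 0" using l by auto
  have lam0: "m0 \<noteq> 0" using s by auto
  have k2: "(of_int k)\<^sup>2 \<le> rad (k - 1)"
  proof -
    have "(of_int k)\<^sup>2 \<le> (2 * (real_of_int (k - 1) + 1/2))\<^sup>2" using k by (intro power_mono) auto
    also have "\<dots> \<le> 36 * (real_of_int (k - 1) + 1/2)\<^sup>2" unfolding power_mult_distrib by simp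
    also have "\<dots> \<le> rad (k - 1)" using k by (intro rad_ge(1)) auto
    finally show ?thesis .
  qed
  have lk: "(of_int k)\<^sup>2 \<le> cmod l" using near_level[OF n] k k2 by (auto simp: level_def)
  have lamk: "(of_int k)\<^sup>2 \<le> cmod m0" using lambda0_norm(1)[OF k] k2 by (simp add: m0_def)
  have lam1: "1 \<le> cmod m0" using rad_ge(2)[of "k - 1"] lambda0_norm(1)[OF k] k unfolding m0_def by linarith
  define \<epsilon> where "\<epsilon> = zeta l - complex_of_real (of_int k * pi)"
  have e: "cmod \<epsilon> \<le> q" "cmod \<epsilon> < 1/2" using n by (auto simp: near_def \<epsilon>_def)
  have "(l + 2 + inverse l) / 16 - (m0 + 2 + inverse m0) / 16 = (zeta l)\<^sup>2 - (zeta_of s)\<^sup>2"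
    unfolding zeta_square[OF l0] zeta_of_square[OF s(1)] s(2) ..
  also have "\<dots> = \<epsilon> * (zeta l + complex_of_real (of_int k * pi))"
    by (simp add: s(3) \<epsilon>_def power2_eq_square algebra_simps)
  finally have z: "(l + 2 + inverse l) / 16 - (m0 + 2 + inverse m0) / 16 = \<epsilon> * (zeta l + complex_of_real (of_int k * pi))" .
  have "(l - m0) * (1 - inverse (l * m0)) = 16 * ((l + 2 + inverse l) / 16 - (m0 + 2 + inverse m0) / 16)"
    using l0 lam0 by (simp add: field_simps)
  then have "(l - m0) * (1 - inverse (l * m0)) = 16 * (\<epsilon> * (zeta l + complex_of_real (of_int k * pi)))"
    unfolding z .
  then have eq: "cmod (l - m0) * cmod (1 - inverse (l * m0)) = 16 * (cmod \<epsilon> * cmod (zeta l + complex_of_real (of_int k * pi)))"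
    by (metis norm_mult norm_numeral)
  have "100 * 1 \<le> cmod l * cmod m0" using l lam1 by (intro mult_mono) auto
  then have "cmod (inverse (l * m0)) \<le> 1 / 100" unfolding norm_inverse norm_mult by (simp add: field_simps)
  moreover have "1 - cmod (inverse (l * m0)) \<le> cmod (1 - inverse (l * m0))" using norm_triangle_ineq2[of 1 "inverse (l * m0)"] by simp
  ultimately have "9/10 \<le> cmod (1 - inverse (l * m0))" by linarith
  then have "cmod (l - m0) * (9/10) \<le> 16 * (cmod \<epsilon> * cmod (zeta l + complex_of_real (of_int k * pi)))"
    unfolding eq[symmetric] by (intro mult_left_mono) auto
  also have "cmod (zeta l + complex_of_real (of_int k * pi)) \<le> cmod (zeta l) + of_int k * pi"
    using norm_triangle_ineq[of "zeta l" "complex_of_real (of_int k * pi)"] k by (simp add: norm_mult)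
  also have "\<dots> \<le> 8 * of_int k"
  proof -
    have "of_int k * pi \<le> of_int k * (16/5)" using pi_approx k by (intro mult_left_mono) auto
    moreover have "1 \<le> real_of_int k" using k by simp
    ultimately show ?thesis using near_norm_zeta[OF n] by linarith
  qed
  finally have "cmod (l - m0) * (9/10) \<le> 16 * (cmod \<epsilon> * (8 * of_int k))" by (simp add: mult_left_mono)
  also have "\<dots> \<le> 16 * (q * (8 * of_int k))" using e k by (intro mult_left_mono mult_right_mono) auto
  also have "\<dots> = 128 * (q * of_int k)" by simp
  \<comment> \<open>Rounding 128 = 16 * 8 up to 135 = 150 * 9/10 lets the factor 9/10 on the left
    cancel.\<close>
  also have "\<dots> \<le> 135 * (q * of_int k)"
  proof -
    have "0 \<le> q" using e norm_ge_zero[of \<epsilon>] by linarith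
    then have "0 \<le> q * of_int k" using k by simp
    then show ?thesis by simp
  qed
  also have "\<dots> = (150 * of_int k * q) * (9/10)" by simp
  finally have "cmod (l - m0) * (9/10) \<le> (150 * of_int k * q) * (9/10)" .
  then have "cmod (l - m0) \<le> 150 * of_int k * q" by (rule mult_right_le_imp_le) simp
  then show d: "cmod (l - lambda0 k) \<le> 150 * of_int k * q" unfolding m0_def .
  have q0: "0 \<le> q" using e norm_ge_zero[of \<epsilon>] by linarith
  have "cmod (inverse l - inverse m0) = cmod (l - m0) / (cmod l * cmod m0)"
  proof -
    have "inverse l - inverse m0 = - (l - m0) / (l * m0)" using l0 lam0 by (simp add: field_simps)
    then show ?thesis by (simp only: norm_divide norm_minus_cancel norm_mult)
  qed
  also have "\<dots> \<le> (150 * of_int k * q) / ((of_int k)\<^sup>2 * (of_int k)\<^sup>2)"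
    using d k q0 lk lamk by (intro frac_le mult_mono mult_pos_pos) (auto simp: m0_def)
  also have "\<dots> = 150 * q / (of_int k) ^ 3" using k by (simp add: power2_eq_square power3_eq_cube)
  finally show "cmod (inverse l - inverse (lambda0 k)) \<le> 150 * q / (of_int k) ^ 3" by (simp add: m0_def)
qed

section \<open>Zeros of the monodromy\<close>

text \<open>The annulus count concerns circles. Since every zero far out, and every inverse of a
  zero near the origin, is \<open>near\<close> some \<open>lambda0 k\<close>, it lies in
  \<open>S k\<close> exactly if it lies in the corresponding circular annulus, so the counts carry
  over. The last conclusion excludes zeros on shared boundaries far out.\<close>

lemma zeros_located_and_counted:
  fixes F G :: "complex \<Rightarrow> complex" and m :: nat and q :: "int \<Rightarrow> real"
  assumes F: "F holomorphic_on (- {0})" and G: "G holomorphic_on (- {0})"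
    and G0: "\<And>l. l \<noteq> 0 \<Longrightarrow> G l = 0 \<longleftrightarrow> l \<in> range lambda0" and Gm: "\<And>k. zorder G (lambda0 k) = int m"
    and outer: "\<And>N l. N0 \<le> N \<Longrightarrow> cmod l = rad N \<Longrightarrow> cmod (F l - \<kappa>1 * G l) < cmod (\<kappa>1 * G l)"
    and inner: "\<And>N l. N0 \<le> N \<Longrightarrow> cmod (inverse l) = rad N \<Longrightarrow> cmod (F l - \<kappa>2 * G l) < cmod (\<kappa>2 * G l)"
    and loc: "\<And>l. R0 \<le> cmod l \<Longrightarrow> F l = 0 \<Longrightarrow> \<exists>k. near l k (q k)"
    and loc': "\<And>l. R0 \<le> cmod l \<Longrightarrow> F (inverse l) = 0 \<Longrightarrow> \<exists>k. near l k (q k)"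
  obtains N :: nat where
    "\<And>k. int N < \<bar>k\<bar> \<Longrightarrow> exactly m {z \<in> Cstar_zeros F. z \<in> S k} (zero_mult F)"
    "exactly (m * (2 * N + 1)) {z \<in> Cstar_zeros F. z \<in> (\<Union>k\<in>{- int N..int N}. S k)} (zero_mult F)"
    "\<And>l k. F l = 0 \<Longrightarrow> l \<noteq> 0 \<Longrightarrow> int N < \<bar>k\<bar> \<Longrightarrow> l \<in> S k \<Longrightarrow>
      0 < k \<and> near l k (q k) \<or> k < 0 \<and> near (inverse l) (- k) (q (- k))"
    "\<And>l j k. F l = 0 \<Longrightarrow> l \<noteq> 0 \<Longrightarrow> int N < \<bar>k\<bar> \<Longrightarrow> l \<in> S k \<Longrightarrow> l \<in> S j \<Longrightarrow> j = k"
proof -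
  define R1 where "R1 = max 100 R0"
  have R1: "100 \<le> R1" "R0 \<le> R1" by (auto simp: R1_def)
  \<comment> \<open>Beyond this index the circle estimates hold, and for \<open>k > N\<close> all
    points of \<open>S k\<close>, as well as the radius \<open>rad (k - 1)\<close>, exceed
    \<open>R1\<close>; hence the location hypotheses apply.\<close>
  define N where "N = nat \<lceil>max (of_int N0) R1\<rceil> + 1"
  have N: "N0 \<le> int N" "R1 \<le> real N" using R1 unfolding N_def by linarith+
  have sq: "x \<le> x\<^sup>2" if "1 \<le> x" for x :: real using mult_left_mono[of 1 x x] that by (simp add: power2_eq_square)
  have radN: "R1 < rad k" if "int N \<le> k" for k
  proof -
    have k: "R1 \<le> real_of_int k" using N that by linarith
    also have "\<dots> \<le> (real_of_int k)\<^sup>2" using k R1 by (intro sq) linarith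
    also have "\<dots> \<le> (real_of_int k + 1/2)\<^sup>2" using k R1 by (intro power_mono) linarith+
    also have "\<dots> < 36 * (real_of_int k + 1/2)\<^sup>2"
    proof -
      have "0 < (real_of_int k + 1/2)\<^sup>2" using k R1 by (intro zero_less_power) linarith
      then show ?thesis by linarith
    qed
    also have "\<dots> \<le> rad k" using that by (intro rad_ge) linarith
    finally show ?thesis .
  qed
  have large: "R1 \<le> cmod l" if l: "l \<in> S k" and k: "int N < k" for l k
  proof -
    have z: "(of_int k - 1/2) * pi \<le> cmod (zeta l)" and l1: "1 < cmod l" using l k by (auto simp: S_def)
    have Nk: "real N \<le> of_int k - 1/2" using k by linarith
    have "R1 * 1 \<le> (of_int k - 1/2) * pi" using Nk N R1 pi_gt3 by (intro mult_mono) linarith+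
    moreover have "4 * cmod (zeta l) \<le> sqrt (cmod l) + 1"
      using norm_zeta_of_le[of "csqrt l"] l1 by (simp add: zeta_eq_zeta_of norm_csqrt)
    ultimately have "R1 \<le> sqrt (cmod l)" using z R1 by linarith
    also have "\<dots> \<le> (sqrt (cmod l))\<^sup>2" using calculation R1 by (intro sq) linarith
    finally show ?thesis by simp
  qed
  have pos: "near l k (q k)" if h: "F l = 0" "l \<in> S k" "int N < k" for l k
  proof -
    have "R0 \<le> cmod l" using large[OF h(2,3)] R1 by linarith
    then obtain j where "near l j (q j)" using loc h by blast
    then show ?thesis using near_S[of l j "q j" k] h by simp
  qed
  have neg: "near (inverse l) (- k) (q (- k))" if h: "F l = 0" "l \<noteq> 0" "l \<in> S k" "int N < - k" for l k
  proof -
    have s: "inverse l \<in> S (- k)" using S_inverse[OF h(2), of "- k"] h by simp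
    have "R0 \<le> cmod (inverse l)" using large[OF s h(4)] R1 by linarith
    then obtain j where "near (inverse l) j (q j)" using loc'[of "inverse l"] h by auto
    then show ?thesis using near_S[of "inverse l" j "q j" "- k"] s by simp
  qed
  have inv_S: "l \<in> S j \<longleftrightarrow> j = - k" if "near (inverse l) k p" "l \<noteq> 0" for l j k p
    using near_S[OF that(1), of "- j"] S_inverse[OF that(2), of "- j"] by auto
  have inv_level: "level l (- k)" if "near (inverse l) k p" for l k p
    using near_level[OF that] by (simp add: level_inverse)
  have posR: "0 < rad k" if "0 \<le> k" for k using rad_ge(2)[OF that] by linarith
  have EP: "{z \<in> Cstar_zeros F. z \<in> S k} = {z. rad (k - 1) < cmod z \<and> cmod z < rad k \<and> F z = 0}" if k: "int N < k" for k
  proof (intro equalityI subsetI)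
    fix l assume "l \<in> {z \<in> Cstar_zeros F. z \<in> S k}"
    then have l: "l \<noteq> 0" "F l = 0" "l \<in> S k" by (auto simp: Cstar_zeros_def)
    from near_level[OF pos[OF l(2,3) k]] have "level l k" .
    then show "l \<in> {z. rad (k - 1) < cmod z \<and> cmod z < rad k \<and> F z = 0}" using l k by (auto simp: level_def)
  next
    fix l assume "l \<in> {z. rad (k - 1) < cmod z \<and> cmod z < rad k \<and> F z = 0}"
    then have l: "rad (k - 1) < cmod l" "cmod l < rad k" "F l = 0" by auto
    have "R1 < rad (k - 1)" using k by (intro radN) simp
    then have "R0 \<le> cmod l" and l0: "l \<noteq> 0" using l R1 by auto
    then obtain j where j: "near l j (q j)" using loc l by blast
    have "j = k" using level_iff(2)[OF l0 near_level[OF j], of k] l k by simp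
    then show "l \<in> {z \<in> Cstar_zeros F. z \<in> S k}" using near_S[OF j, of k] l l0 by (simp add: Cstar_zeros_def)
  qed
  have EN: "{z \<in> Cstar_zeros F. z \<in> S (- k)} = {z. 1 / rad k < cmod z \<and> cmod z < 1 / rad (k - 1) \<and> F z = 0}" if k: "int N < k" for k
  proof (intro equalityI subsetI)
    fix l assume "l \<in> {z \<in> Cstar_zeros F. z \<in> S (- k)}"
    then have l: "l \<noteq> 0" "F l = 0" "l \<in> S (- k)" by (auto simp: Cstar_zeros_def)
    from neg[OF l(2,1,3)] k have "near (inverse l) k (q k)" by simp
    from inv_level[OF this] have "level l (- k)" .
    then show "l \<in> {z. 1 / rad k < cmod z \<and> cmod z < 1 / rad (k - 1) \<and> F z = 0}"
      using level_iff(3)[OF l(1), of "- k" k] l k by simp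
  next
    fix l assume "l \<in> {z. 1 / rad k < cmod z \<and> cmod z < 1 / rad (k - 1) \<and> F z = 0}"
    then have l: "1 / rad k < cmod l" "cmod l < 1 / rad (k - 1)" "F l = 0" by auto
    have rk: "R1 < rad (k - 1)" using k by (intro radN) simp
    have "0 < 1 / rad k" using posR[of k] k by simp
    then have l0: "l \<noteq> 0" using l by auto
    have "rad (k - 1) < cmod (inverse l)" using less_inverse_norm(2)[OF l0 posR[of "k - 1"]] l k by simp
    then have "R0 \<le> cmod (inverse l)" using rk R1 by linarith
    then obtain j where j: "near (inverse l) j (q j)" using loc'[of "inverse l"] l by auto
    have "- j = - k" using level_iff(3)[OF l0 inv_level[OF j], of k] l k by simp
    then show "l \<in> {z \<in> Cstar_zeros F. z \<in> S (- k)}" using inv_S[OF j l0, of "- k"] l l0 by (simp add: Cstar_zeros_def)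
  qed
  \<comment> \<open>Either the zero or its inverse is large and has a definite index, or both have
    modulus below \<open>R1\<close>, and then the zero lies well inside both regions.\<close>
  have EU: "{z \<in> Cstar_zeros F. z \<in> (\<Union>k\<in>{- int N..int N}. S k)} = {z. 1 / rad (int N) < cmod z \<and> cmod z < rad (int N) \<and> F z = 0}"
  proof -
    have "l \<in> (\<Union>k\<in>{- int N..int N}. S k) \<longleftrightarrow> 1 / rad (int N) < cmod l \<and> cmod l < rad (int N)"
      if l: "l \<noteq> 0" "F l = 0" for l
    proof -
      consider "R0 \<le> cmod l" | "R0 \<le> cmod (inverse l)" | "cmod l < R1" "cmod (inverse l) < R1" using R1 by linarith
      then show ?thesis
      proof cases
        case 1
        then obtain j where j: "near l j (q j)" using loc l by blast
        show ?thesis using near_S[OF j] level_iff(1)[OF l(1) near_level[OF j], of "int N"] by auto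
      next
        case 2
        then obtain j where j: "near (inverse l) j (q j)" using loc'[of "inverse l"] l by auto
        show ?thesis using inv_S[OF j l(1)] level_iff(1)[OF l(1) inv_level[OF j], of "int N"] by auto
      next
        case 3
        have R: "R1 < rad (int N)" by (rule radN) simp
        have "cmod (inverse l) < rad (int N)" using 3 R by linarith
        then have in_ann: "1 / rad (int N) < cmod l \<and> cmod l < rad (int N)"
          using less_inverse_norm(1)[OF l(1) posR[of "int N"]] 3 R by simp
        have zb: "cmod (zeta z) \<le> (of_int (int N) + 1/2) * pi" if "1 \<le> cmod z" "cmod z < R1" for z
        proof -
          have "4 * cmod (zeta z) \<le> sqrt (cmod z) + 1"
            using norm_zeta_of_le[of "csqrt z"] that by (simp add: zeta_eq_zeta_of norm_csqrt)
          moreover have "sqrt (cmod z) \<le> cmod z" using sq[of "sqrt (cmod z)"] that by simp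
          ultimately have "cmod (zeta z) \<le> real N" using that N R1 by linarith
          also have "\<dots> \<le> (of_int (int N) + 1/2) * 1" by simp
          also have "\<dots> \<le> (of_int (int N) + 1/2) * pi" using pi_gt3 by (intro mult_left_mono) auto
          finally show ?thesis .
        qed
        have "cmod (zeta l) \<le> (of_int (int N) + 1/2) * pi"
        proof (cases "1 \<le> cmod l")
          case True
          then show ?thesis using zb[of l] 3 by simp
        next
          case False
          then have "1 \<le> cmod (inverse l)" using less_inverse_norm(1)[OF l(1), of 1] by fastforce
          then show ?thesis using zb[of "inverse l"] 3 by (simp add: norm_zeta_inverse[OF l(1)])
        qed
        then have "\<exists>k\<in>{- int N..int N}. l \<in> S k" by (intro S_cover[OF l(1)]) auto
        then show ?thesis using in_ann by blast
      qed
    qed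
    moreover have "z \<noteq> 0" if "1 / rad (int N) < cmod z" for z
      using that posR[of "int N"] by (auto simp: divide_less_0_iff)
    ultimately show ?thesis by (auto simp: Cstar_zeros_def)
  qed
  \<comment> \<open>The zeros of \<open>G\<close> between the circles are the
    \<open>lambda0 j\<close> with \<open>j \<in> K\<close>, pairwise distinct and each of order
    \<open>m\<close>.\<close>
  have count: "exactly (m * card K) {z. r < cmod z \<and> cmod z < R \<and> F z = 0} (zero_mult F)"
    if r: "0 < r" "r < R" and K: "\<And>j. r < cmod (lambda0 j) \<and> cmod (lambda0 j) < R \<longleftrightarrow> j \<in> K"
      and a: "\<And>l. cmod l = R \<Longrightarrow> cmod (F l - \<kappa>a * G l) < cmod (\<kappa>a * G l)"
      and b: "\<And>l. cmod l = r \<Longrightarrow> cmod (F l - \<kappa>b * G l) < cmod (\<kappa>b * G l)" for r R K \<kappa>a \<kappa>b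
  proof -
    have "{z. r < cmod z \<and> cmod z < R \<and> G z = 0} = lambda0 ` K"
    proof (intro equalityI subsetI)
      fix z assume z: "z \<in> {z. r < cmod z \<and> cmod z < R \<and> G z = 0}"
      then have "z \<noteq> 0" using r by auto
      with G0 z obtain j where "z = lambda0 j" by blast
      with z K show "z \<in> lambda0 ` K" by blast
    next
      fix z assume "z \<in> lambda0 ` K"
      then obtain j where "z = lambda0 j" "j \<in> K" by blast
      then show "z \<in> {z. r < cmod z \<and> cmod z < R \<and> G z = 0}"
        using K[of j] G0[OF lambda0_nonzero, of j] by simp
    qed
    then have "(\<Sum>p\<in>{z. r < cmod z \<and> cmod z < R \<and> G z = 0}. nat (zorder G p)) = (\<Sum>p\<in>lambda0 ` K. nat (zorder G p))" by simp
    also have "\<dots> = (\<Sum>j\<in>K. m)"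
      by (subst sum.reindex) (auto simp: Gm intro: inj_on_subset[OF inj_lambda0])
    finally show ?thesis
      using annulus_zero_count[OF F G r a b] by (simp add: exactly_def zero_mult_def mult.commute)
  qed
  have circ_in: "cmod (F l - \<kappa>2 * G l) < cmod (\<kappa>2 * G l)" if "cmod l = 1 / rad k" "int N \<le> k" for l k
  proof (rule inner[of k])
    have "cmod (inverse l) = 1 / cmod l" by (simp add: norm_inverse divide_inverse)
    then show "cmod (inverse l) = rad k" using that by simp
  qed (use that N in linarith)
  have circ_out: "cmod (F l - \<kappa>1 * G l) < cmod (\<kappa>1 * G l)" if "cmod l = rad k" "int N \<le> k" for l k
    using that N by (intro outer[of k]) linarith+
  have radlt: "rad (k - 1) < rad k" "0 < rad (k - 1)" "1 / rad k < 1 / rad (k - 1)" "0 < 1 / rad k" if "int N < k" for k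
  proof -
    show a: "rad (k - 1) < rad k" "0 < rad (k - 1)" using that by (auto intro!: rad_mono posR)
    then show "1 / rad k < 1 / rad (k - 1)" "0 < 1 / rad k" by (auto intro!: divide_strict_left_mono mult_pos_pos)
  qed
  show ?thesis
  proof (rule that[of N])
    fix k assume k: "int N < \<bar>k\<bar>"
    show "exactly m {z \<in> Cstar_zeros F. z \<in> S k} (zero_mult F)"
    proof (cases "0 < k")
      case True
      have kN: "int N < k" using k True by simp
      have "exactly (m * card {k}) {z. rad (k - 1) < cmod z \<and> cmod z < rad k \<and> F z = 0} (zero_mult F)"
      proof (rule count)
        show "rad (k - 1) < cmod (lambda0 j) \<and> cmod (lambda0 j) < rad k \<longleftrightarrow> j \<in> {k}" for j
          using lambda0_annulus_iff(2)[of k j] kN by simp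
      qed (use radlt[OF kN] kN circ_out[of _ k] circ_out[of _ "k - 1"] in auto)
      then show ?thesis by (simp add: EP[OF kN])
    next
      case False
      have kN: "int N < - k" using k False by simp
      have "exactly (m * card {k}) {z. 1 / rad (- k) < cmod z \<and> cmod z < 1 / rad (- k - 1) \<and> F z = 0} (zero_mult F)"
      proof (rule count)
        show "1 / rad (- k) < cmod (lambda0 j) \<and> cmod (lambda0 j) < 1 / rad (- k - 1) \<longleftrightarrow> j \<in> {k}" for j
          using lambda0_annulus_iff(3)[of "- k" j] kN by simp
      qed (use radlt[OF kN] kN circ_in[of _ "- k"] circ_in[of _ "- k - 1"] in auto)
      then show ?thesis using EN[OF kN] by simp
    qed
  next
    have "1 / rad (int N) < rad (int N)"
    proof -
      have "1 < rad (int N)" by (intro rad_ge) simp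
      then have "1 / rad (int N) < 1" by simp
      with \<open>1 < rad (int N)\<close> show ?thesis by linarith
    qed
    moreover have "0 < 1 / rad (int N)" using posR[of "int N"] by simp
    ultimately have "exactly (m * card {- int N..int N}) {z. 1 / rad (int N) < cmod z \<and> cmod z < rad (int N) \<and> F z = 0} (zero_mult F)"
      using circ_in[of _ "int N"] circ_out[of _ "int N"] lambda0_annulus_iff(1)[of "int N"]
      by (intro count) (auto simp: abs_le_iff)
    moreover have "card {- int N..int N} = 2 * N + 1" by simp
    ultimately show "exactly (m * (2 * N + 1)) {z \<in> Cstar_zeros F. z \<in> (\<Union>k\<in>{- int N..int N}. S k)} (zero_mult F)"
      unfolding EU by (simp only:)
  next
    fix l k assume l: "F l = 0" "l \<noteq> 0" "int N < \<bar>k\<bar>" "l \<in> S k"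
    show nk: "0 < k \<and> near l k (q k) \<or> k < 0 \<and> near (inverse l) (- k) (q (- k))"
      using pos[OF l(1,4)] neg[OF l(1,2,4)] l(3) by (cases "0 < k") auto
    fix j assume "l \<in> S j"
    then show "j = k" using nk near_S[of l k "q k" j] inv_S[of l "- k" "q (- k)" j] l(2) by auto
  qed
qed

lemma trace_2: "trace (A :: complex^2^2) = A $ 1 $ 1 + A $ 2 $ 2"
  by (simp add: trace_def sum_2)

definition discriminant :: "(real \<Rightarrow> complex) \<Rightarrow> (real \<Rightarrow> complex) \<Rightarrow> complex \<Rightarrow> complex" where
  "discriminant u uy l = (trace (monodromy u uy l))\<^sup>2 - 4"

lemma discriminant_holomorphic:
  assumes "(u, uy) \<in> Pot"
  shows "discriminant u uy holomorphic_on (- {0})"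
  unfolding discriminant_def[abs_def] trace_2
  by (intro holomorphic_intros monodromy_holomorphic[OF assms])

text \<open>The determinant turns the discriminant into terms that are products of two vacuum
  comparisons, so errors enter quadratically or multiplied by sin zeta.\<close>

lemma discriminant_eq:
  assumes "(u, uy) \<in> Pot" "l \<noteq> 0"
  shows "discriminant u uy l = (monodromy u uy l $ 1 $ 1 - monodromy u uy l $ 2 $ 2)\<^sup>2
    + 4 * (monodromy u uy l $ 1 $ 2 * monodromy u uy l $ 2 $ 1)"
proof -
  define a b c d where "a = monodromy u uy l $ 1 $ 1" and "b = monodromy u uy l $ 1 $ 2"
    and "c = monodromy u uy l $ 2 $ 1" and "d = monodromy u uy l $ 2 $ 2"
  have "a * d = 1 + b * c" using monodromy_det[OF assms] by (simp add: a_def b_def c_def d_def algebra_simps)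
  moreover have "(a + d)\<^sup>2 - 4 = (a - d)\<^sup>2 + 4 * (a * d) - 4" by (simp add: power2_eq_square algebra_simps)
  ultimately show ?thesis unfolding discriminant_def trace_2 a_def[symmetric] b_def[symmetric] c_def[symmetric] d_def[symmetric] by simp
qed

text \<open>The diagonal entries share the vacuum value cos zeta, so |a - d| \<le> 2 delta. For the
  rescaled off-diagonal entries, b c + sigma^2 = (b + sigma) (c - sigma) + sigma (b + sigma) - sigma
  (c - sigma).\<close>

lemma discriminant_close:
  assumes P: "(u, uy) \<in> Pot" and s: "s \<noteq> 0" and v: "vacuum_close u uy s e"
  defines "\<delta> \<equiv> e * exp \<bar>Im (zeta_of s)\<bar>" and "\<sigma> \<equiv> sin (zeta_of s)"
  shows "cmod (discriminant u uy (s\<^sup>2) + 4 * \<sigma>\<^sup>2) \<le> 8 * \<delta>\<^sup>2 + 8 * \<delta> * cmod \<sigma>"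
proof -
  define a b c d where "a = monodromy u uy (s\<^sup>2) $ 1 $ 1" and "b = s * exp (- u 0 / 2) * monodromy u uy (s\<^sup>2) $ 1 $ 2"
    and "c = exp (u 0 / 2) / s * monodromy u uy (s\<^sup>2) $ 2 $ 1" and "d = monodromy u uy (s\<^sup>2) $ 2 $ 2"
  have v': "cmod (a - cos (zeta_of s)) \<le> \<delta>" "cmod (d - cos (zeta_of s)) \<le> \<delta>" "cmod (c - \<sigma>) \<le> \<delta>" "cmod (b + \<sigma>) \<le> \<delta>"
    using v unfolding vacuum_close_def a_def b_def c_def d_def \<delta>_def \<sigma>_def by auto
  have \<delta>: "0 \<le> \<delta>" using v'(1) norm_ge_zero order_trans by blast
  have "exp (- u 0 / 2) * exp (u 0 / 2) = 1" by (simp add: exp_add[symmetric])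
  then have "b * c = monodromy u uy (s\<^sup>2) $ 1 $ 2 * monodromy u uy (s\<^sup>2) $ 2 $ 1"
    using s by (simp add: b_def c_def field_simps)
  then have f: "discriminant u uy (s\<^sup>2) = (a - d)\<^sup>2 + 4 * (b * c)"
    using discriminant_eq[OF P, of "s\<^sup>2"] s by (simp add: a_def d_def)
  have "cmod (a - d) \<le> 2 * \<delta>"
    using norm_triangle_ineq4[of "a - cos (zeta_of s)" "d - cos (zeta_of s)"] v' by simp
  then have "(cmod (a - d))\<^sup>2 \<le> (2 * \<delta>)\<^sup>2" by (intro power_mono) auto
  then have 1: "cmod ((a - d)\<^sup>2) \<le> 4 * \<delta>\<^sup>2" by (simp add: norm_power power_mult_distrib)
  have "b * c + \<sigma>\<^sup>2 = (b + \<sigma>) * (c - \<sigma>) + \<sigma> * (b + \<sigma>) - \<sigma> * (c - \<sigma>)" by (simp add: power2_eq_square algebra_simps)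
  also have "cmod \<dots> \<le> \<delta> * \<delta> + cmod \<sigma> * \<delta> + cmod \<sigma> * \<delta>"
    using v' \<delta> by (intro norm_triangle_le_diff norm_triangle_le add_mono) (auto simp: norm_mult intro!: mult_mono)
  finally have 2: "cmod (b * c + \<sigma>\<^sup>2) \<le> \<delta>\<^sup>2 + 2 * \<delta> * cmod \<sigma>" by (simp add: power2_eq_square algebra_simps)
  have "discriminant u uy (s\<^sup>2) + 4 * \<sigma>\<^sup>2 = (a - d)\<^sup>2 + 4 * (b * c + \<sigma>\<^sup>2)" by (simp add: f algebra_simps)
  also have "cmod \<dots> \<le> 4 * \<delta>\<^sup>2 + 4 * (\<delta>\<^sup>2 + 2 * \<delta> * cmod \<sigma>)"
  proof (intro norm_triangle_le add_mono 1)
    show "cmod (4 * (b * c + \<sigma>\<^sup>2)) \<le> 4 * (\<delta>\<^sup>2 + 2 * \<delta> * cmod \<sigma>)" unfolding norm_mult using 2 by simp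
  qed
  finally show ?thesis by (simp add: algebra_simps)
qed

text \<open>At a zero of the discriminant, 4 |sigma|^2 \<le> 8 delta^2 + 8 delta |sigma|, which is
  impossible for |sigma| > 4 delta. This linear bound is what keeps the double zeros square summably
  close.\<close>

lemma sin_small_at_zeros:
  assumes P: "(u, uy) \<in> Pot" and s: "s \<noteq> 0" and v: "vacuum_close u uy s e"
    and z: "monodromy u uy (s\<^sup>2) $ 2 $ 1 = 0 \<or> discriminant u uy (s\<^sup>2) = 0"
  shows "cmod (sin (zeta_of s)) \<le> 4 * (e * exp \<bar>Im (zeta_of s)\<bar>)"
proof -
  define \<delta> \<sigma> where "\<delta> = e * exp \<bar>Im (zeta_of s)\<bar>" and "\<sigma> = sin (zeta_of s)"
  have "cmod (monodromy u uy (s\<^sup>2) $ 1 $ 1 - cos (zeta_of s)) \<le> \<delta>" using v by (simp add: vacuum_close_def \<delta>_def)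
  then have \<delta>: "0 \<le> \<delta>" using norm_ge_zero order_trans by blast
  from z have "cmod \<sigma> \<le> 4 * \<delta>"
  proof
    assume "monodromy u uy (s\<^sup>2) $ 2 $ 1 = 0"
    then have "cmod \<sigma> \<le> \<delta>" using v by (simp add: vacuum_close_def \<delta>_def \<sigma>_def)
    then show ?thesis using \<delta> by simp
  next
    assume "discriminant u uy (s\<^sup>2) = 0"
    then have b: "4 * (cmod \<sigma>)\<^sup>2 \<le> 8 * \<delta>\<^sup>2 + 8 * \<delta> * cmod \<sigma>"
      using discriminant_close[OF P s v] by (simp add: \<delta>_def \<sigma>_def norm_mult norm_power)
    show ?thesis
    proof (rule ccontr)
      assume "\<not> ?thesis"
      then have l: "4 * \<delta> < cmod \<sigma>" by simp
      then have "4 * \<delta> * cmod \<sigma> < cmod \<sigma> * cmod \<sigma>" using \<delta> by (intro mult_strict_right_mono) auto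
      moreover have "\<delta> * (4 * \<delta>) \<le> \<delta> * cmod \<sigma>" using \<delta> l by (intro mult_left_mono) auto
      moreover have "0 \<le> cmod \<sigma> * cmod \<sigma>" by simp
      ultimately show False using b unfolding power2_eq_square mult.assoc mult.left_commute[of \<delta> 4] by linarith
    qed
  qed
  then show ?thesis by (simp add: \<delta>_def \<sigma>_def)
qed

section \<open>Localisation of the zeros far out\<close>

lemma cos_multiple_pi: "cos (complex_of_real (of_int k * pi)) = mu0 k"
proof -
  have "cos (real_of_int k * pi) = (if even k then 1 else -1)"
    using cos_int_times_real[of k pi] by (simp add: cos_npi_int mult.commute)
  then have "complex_of_real (cos (of_int k * pi)) = mu0 k" by (simp add: mu0_def power_int_minus_left)
  then show ?thesis unfolding cos_of_real .
qed

lemma norm_cos_diff_le: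
  fixes a b :: complex
  assumes "\<bar>Im a\<bar> \<le> 1" "\<bar>Im b\<bar> \<le> 1"
  shows "cmod (cos a - cos b) \<le> 3 * cmod (a - b)"
proof (rule field_differentiable_bound[where S = "{z. \<bar>Im z\<bar> \<le> 1}" and f' = "\<lambda>z. - sin z"])
  have "{z. \<bar>Im z\<bar> \<le> 1} = {z. Im z \<le> 1} \<inter> {z. -1 \<le> Im z}" by auto
  then show "convex {z. \<bar>Im z\<bar> \<le> 1}"
    by (simp add: convex_Int convex_halfspace_Im_le convex_halfspace_Im_ge)
  fix z assume "z \<in> {z. \<bar>Im z\<bar> \<le> 1}"
  then have "exp \<bar>Im z\<bar> \<le> exp 1" by simp
  also have "exp 1 \<le> (3 :: real)" by (rule exp_le)
  finally show "cmod (- sin z) \<le> 3" using norm_sin_le_exp[of z] by simp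
qed (use assms in \<open>auto intro!: derivative_eq_intros\<close>)

text \<open>A bootstrap: crude uniform closeness places zeta within 1/2 of some k pi, and with
  \<open>k\<close> known the square summable bound applies at the same point and sharpens the
  distance. The value of the upper left entry is recorded along the way for the eigenvalues.\<close>

lemma monodromy_zeros_near:
  assumes P: "(u, uy) \<in> Pot"
  obtains R0 and q :: "int \<Rightarrow> real" where "(\<lambda>k. (q k)\<^sup>2) summable_on {0<..}"
    "\<And>l. R0 \<le> cmod l \<Longrightarrow> monodromy u uy l $ 2 $ 1 = 0 \<or> discriminant u uy l = 0 \<Longrightarrow>
      \<exists>k. near l k (q k) \<and> cmod (monodromy u uy l $ 1 $ 1 - mu0 k) \<le> q k"
proof -
  obtain R where R: "\<And>s. R \<le> cmod s \<Longrightarrow> vacuum_close u uy s (1/100)"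
    by (rule vacuum_close_uniform[OF P, of "1/100"]) auto
  obtain q :: "int \<Rightarrow> real" where q: "\<And>k. 0 \<le> q k" "(\<lambda>k. (q k)\<^sup>2) summable_on {0<..}"
    "\<And>k s. 0 < k \<Longrightarrow> 1 \<le> cmod s \<Longrightarrow> cmod (zeta_of s - of_int k * pi) \<le> 1 \<Longrightarrow> vacuum_close u uy s (q k)"
    by (rule vacuum_close_square_summable[OF P]) (rule that)
  show ?thesis
  proof (rule that[of "\<lambda>k. 75 * q k" "max 100 (R\<^sup>2)"])
    show "(\<lambda>k. (75 * q k)\<^sup>2) summable_on {0<..}"
      unfolding power_mult_distrib by (intro summable_on_cmult_right q)
    fix l assume l: "max 100 (R\<^sup>2) \<le> cmod l" and z: "monodromy u uy l $ 2 $ 1 = 0 \<or> discriminant u uy l = 0"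
    define s where "s = csqrt l"
    have l100: "100 \<le> cmod l" using l by simp
    then have l0: "l \<noteq> 0" by auto
    have s2: "s\<^sup>2 = l" and s0: "s \<noteq> 0" using l0 by (auto simp: s_def)
    have ns: "cmod s = sqrt (cmod l)" by (simp add: s_def norm_csqrt)
    have "sqrt 100 \<le> cmod s" unfolding ns using l100 by (intro real_sqrt_le_mono)
    moreover have "sqrt 100 = (10 :: real)" by (intro real_sqrt_unique) auto
    ultimately have s10: "10 \<le> cmod s" by simp
    have "R \<le> cmod s" unfolding ns using l by (intro real_le_rsqrt) simp
    note v = R[OF this]
    define \<zeta> where "\<zeta> = zeta_of s"
    have zl: "zeta l = \<zeta>" by (simp add: \<zeta>_def s_def zeta_eq_zeta_of)
    have "cmod (sin \<zeta>) \<le> 4 * (1/100 * exp \<bar>Im \<zeta>\<bar>)"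
      unfolding \<zeta>_def using z s2 by (intro sin_small_at_zeros[OF P s0 v]) simp
    \<comment> \<open>The tolerance 1/100 was chosen because 4/100 < 1/16, the threshold for eta =
      1/2.\<close>
    also have "\<dots> < (1/2) / 8 * exp \<bar>Im \<zeta>\<bar>" by simp
    finally obtain k :: int where k: "cmod (\<zeta> - of_int k * pi) < 1/2" "cmod (\<zeta> - of_int k * pi) \<le> 2 * cmod (sin \<zeta>)"
      using small_sin_near_multiple_pi[of "1/2" \<zeta>] by auto
    have "\<bar>Re (\<zeta> - of_int k * pi)\<bar> < 1/2" "\<bar>Im (\<zeta> - of_int k * pi)\<bar> < 1/2"
      using abs_Re_le_cmod[of "\<zeta> - of_int k * pi"] abs_Im_le_cmod[of "\<zeta> - of_int k * pi"] k(1) by linarith+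
    then have re: "\<bar>Re \<zeta> - of_int k * pi\<bar> < 1/2" and im: "\<bar>Im \<zeta>\<bar> < 1/2" by simp_all
    \<comment> \<open>Negative \<open>k\<close> is excluded because the principal root gives zeta a
      nonnegative real part, and \<open>k = 0\<close> because |s| \<ge> 10 makes |zeta| \<ge>
      9/4.\<close>
    have "0 < k"
    proof (rule ccontr)
      assume "\<not> 0 < k"
      then consider "k = 0" | "k \<le> -1" by linarith
      then show False
      proof cases
        case 1
        then show False using k(1) norm_zeta_of_ge[of s] s10 by (simp add: \<zeta>_def)
      next
        case 2
        then have "of_int k * pi \<le> (-1) * pi" by (intro mult_right_mono) auto
        then show False using re Re_zeta_nonneg[OF l0] pi_gt3 unfolding zl by linarith
      qed
    qed
    have vk: "vacuum_close u uy s (q k)"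
      using s10 k(1) by (intro q(3)[OF \<open>0 < k\<close>]) (simp_all add: \<zeta>_def)
    have "exp \<bar>Im \<zeta>\<bar> \<le> exp 1" using im by simp
    also have "exp 1 \<le> (3 :: real)" by (rule exp_le)
    finally have E: "exp \<bar>Im \<zeta>\<bar> \<le> 3" .
    have "q k * exp \<bar>Im \<zeta>\<bar> \<le> q k * 3" using E q(1) by (intro mult_left_mono)
    then have qE: "q k * exp \<bar>Im \<zeta>\<bar> \<le> 3 * q k" by simp
    have "cmod (sin \<zeta>) \<le> 4 * (q k * exp \<bar>Im \<zeta>\<bar>)"
      unfolding \<zeta>_def using z s2 by (intro sin_small_at_zeros[OF P s0 vk]) simp
    \<comment> \<open>24 = 2 * 4 * 3: the inverse sine bound, \<open>sin_small_at_zeros\<close>, and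
      the bound 3 for the exponential. The 75 below is 3 + 3 * 24.\<close>
    then have dist: "cmod (\<zeta> - of_int k * pi) \<le> 24 * q k" using k(2) qE by linarith
    have "near l k (75 * q k)"
      using \<open>0 < k\<close> l100 k(1) dist q(1)[of k] by (simp add: near_def zl)
    moreover have "cmod (monodromy u uy l $ 1 $ 1 - mu0 k) \<le> 75 * q k"
    proof -
      have "cmod (monodromy u uy l $ 1 $ 1 - cos \<zeta>) \<le> 3 * q k"
        using vk qE unfolding vacuum_close_def s2 \<zeta>_def by linarith
      moreover have "cmod (cos \<zeta> - mu0 k) \<le> 3 * cmod (\<zeta> - complex_of_real (of_int k * pi))"
        unfolding cos_multiple_pi[symmetric] using im by (intro norm_cos_diff_le) auto
      moreover have "monodromy u uy l $ 1 $ 1 - mu0 k = (monodromy u uy l $ 1 $ 1 - cos \<zeta>) + (cos \<zeta> - mu0 k)" by simp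
      ultimately show ?thesis
        using dist norm_triangle_ineq[of "monodromy u uy l $ 1 $ 1 - cos \<zeta>" "cos \<zeta> - mu0 k"] by simp
    qed
    ultimately show "\<exists>k. near l k (75 * q k) \<and> cmod (monodromy u uy l $ 1 $ 1 - mu0 k) \<le> 75 * q k" by blast
  qed
qed

definition vacuum_discriminant :: "complex \<Rightarrow> complex" where
  "vacuum_discriminant l = - 4 * (vacuum_c l)\<^sup>2 / l"

lemma vacuum_discriminant_square: "s \<noteq> 0 \<Longrightarrow> vacuum_discriminant (s\<^sup>2) = - 4 * (sin (zeta_of s))\<^sup>2"
  by (simp add: vacuum_discriminant_def vacuum_c_square power_mult_distrib)

lemma vacuum_discriminant_holomorphic: "vacuum_discriminant holomorphic_on (- {0})"
  unfolding vacuum_discriminant_def[abs_def] by (intro holomorphic_intros vacuum_c_holomorphic) auto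

lemma vacuum_discriminant_zero_iff: "l \<noteq> 0 \<Longrightarrow> vacuum_discriminant l = 0 \<longleftrightarrow> vacuum_c l = 0"
  by (simp add: vacuum_discriminant_def)

lemma lambda0_neq_1: "lambda0 k \<noteq> 1"
proof (cases "k = 0")
  case False
  then show ?thesis using lambda0_level[of k] rad_ge(2)[of "k - 1"] rad_ge(2)[of "- k - 1"]
    by (auto simp: level_def)
qed (simp add: lambda0_0)

text \<open>Differentiating \<open>vacuum_c (s\<^sup>2) = s * sin (zeta_of s)\<close> in
  \<open>s\<close> avoids the root. At a zero the derivative is a nonzero multiple of cos zeta times
  1 - 1 / \<open>lambda0 k\<close>, and \<open>lambda0 k\<close> is never 1.\<close>

lemma zorder_vacuum_c: "zorder vacuum_c (lambda0 k) = 1"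
proof -
  obtain s where s: "s \<noteq> 0" "s\<^sup>2 = lambda0 k" "zeta_of s = complex_of_real (of_int k * pi)" by (rule lambda0_witness)
  have oC: "open (- {0 :: complex})" by (simp add: open_Compl)
  have "(vacuum_c has_field_derivative deriv vacuum_c (s\<^sup>2)) (at (s\<^sup>2))"
    using s by (intro holomorphic_derivI[OF vacuum_c_holomorphic oC]) auto
  moreover have "((\<lambda>s. s\<^sup>2) has_field_derivative 2 * s) (at s)" by (auto intro!: derivative_eq_intros)
  ultimately have d1: "((\<lambda>s. vacuum_c (s\<^sup>2)) has_field_derivative deriv vacuum_c (s\<^sup>2) * (2 * s)) (at s)"
    by (rule DERIV_chain2)
  have dz: "(zeta_of has_field_derivative (1 - inverse (s\<^sup>2)) / 4) (at s)"
    unfolding zeta_of_def[abs_def] using s(1)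
    by (auto intro!: derivative_eq_intros simp: power2_eq_square)
  have d2: "((\<lambda>s. s * sin (zeta_of s)) has_field_derivative
      1 * sin (zeta_of s) + cos (zeta_of s) * ((1 - inverse (s\<^sup>2)) / 4) * s) (at s)"
    by (rule DERIV_mult[OF DERIV_ident DERIV_chain2[OF DERIV_sin dz]])
  have sin0: "sin (zeta_of s) = 0" unfolding s(3) using sin_eq_0[of "complex_of_real (of_int k * pi)"] by auto
  have "deriv vacuum_c (s\<^sup>2) * (2 * s) = 1 * sin (zeta_of s) + cos (zeta_of s) * ((1 - inverse (s\<^sup>2)) / 4) * s"
    using DERIV_unique[OF d1[unfolded vacuum_c_square] d2] .
  then have e: "deriv vacuum_c (lambda0 k) * (2 * s) = cos (zeta_of s) * ((1 - inverse (lambda0 k)) / 4) * s"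
    by (simp add: sin0 s(2))
  have "(cos (zeta_of s))\<^sup>2 = 1" using sin_cos_squared_add[of "zeta_of s"] sin0 by simp
  then have c: "cos (zeta_of s) \<noteq> 0" by auto
  have "1 - inverse (lambda0 k) \<noteq> 0"
    using lambda0_neq_1[of k] by auto
  then have nz: "deriv vacuum_c (lambda0 k) \<noteq> 0" using e c s(1) by auto
  have "vacuum_c (lambda0 k) = 0" using vacuum_c_zero_iff[OF lambda0_nonzero] by blast
  then show ?thesis
    using nz lambda0_nonzero by (intro zorder_zero_eqI[OF vacuum_c_holomorphic oC]) auto
qed

lemma zorder_vacuum_discriminant: "zorder vacuum_discriminant (lambda0 k) = 2"
proof -
  note an = analytic_at_punctured[OF vacuum_c_holomorphic lambda0_nonzero[of k]]
  have nz: "vacuum_c 1 \<noteq> 0" using vacuum_c_zero_iff[of 1] lambda0_neq_1 by (metis one_neq_zero)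
  note ev = frequently_nonzero_punctured(1)[OF vacuum_c_holomorphic one_neq_zero nz lambda0_nonzero[of k]]
  have ev0: "\<forall>\<^sub>F z in at (lambda0 k). z \<noteq> 0"
    by (rule eventually_neq_at_within)
  have 1: "zorder (\<lambda>z. vacuum_c z * vacuum_c z) (lambda0 k) = 1 + 1"
  proof -
    have "\<forall>\<^sub>F z in at (lambda0 k). vacuum_c z * vacuum_c z \<noteq> 0" using ev by eventually_elim simp
    from zorder_times_analytic[OF an an this] show ?thesis by (simp add: zorder_vacuum_c)
  qed
  have an2: "(\<lambda>z. - 4 / z) analytic_on {lambda0 k}"
    using lambda0_nonzero[of k] by (auto intro!: analytic_intros)
  have "zorder (\<lambda>z. (vacuum_c z * vacuum_c z) * (- 4 / z)) (lambda0 k) = (1 + 1) + 0"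
  proof (subst zorder_times_analytic)
    show "(\<lambda>z. vacuum_c z * vacuum_c z) analytic_on {lambda0 k}" by (intro analytic_intros an)
    show "\<forall>\<^sub>F z in at (lambda0 k). vacuum_c z * vacuum_c z * (- 4 / z) \<noteq> 0"
      using ev ev0 by eventually_elim auto
    have "zorder (\<lambda>z. - 4 / z) (lambda0 k) = 0" using lambda0_nonzero[of k] by (intro zorder_eq_0I[OF an2]) auto
    then show "zorder (\<lambda>z. vacuum_c z * vacuum_c z) (lambda0 k) + zorder (\<lambda>z. - 4 / z) (lambda0 k) = (1 + 1) + 0"
      using 1 by simp
  qed (rule an2)
  moreover have "vacuum_discriminant = (\<lambda>z. (vacuum_c z * vacuum_c z) * (- 4 / z))"
    by (simp add: vacuum_discriminant_def fun_eq_iff power2_eq_square)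
  ultimately have "zorder vacuum_discriminant (lambda0 k) = 1 + 1 + 0" by (simp only:)
  then show ?thesis by simp
qed

text \<open>On this circle |zeta| is within 1/4 of (N + 1/2) pi. A small sine would put it within
  1/2 of a multiple of pi, but 1/4 + 1/2 is less than pi / 4.\<close>

lemma sin_large_on_circle:
  assumes N: "1 \<le> N" and l: "cmod l = rad N"
  shows "exp \<bar>Im (zeta l)\<bar> \<le> 16 * cmod (sin (zeta l))"
proof (rule ccontr)
  assume "\<not> ?thesis"
  then have "cmod (sin (zeta l)) < (1/2) / 8 * exp \<bar>Im (zeta l)\<bar>" by simp
  then obtain k :: int where k: "cmod (zeta l - of_int k * pi) < 1/2"
    using small_sin_near_multiple_pi[of "1/2" "zeta l"] by auto
  have N1: "1 \<le> real_of_int N" using N by simp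
  have rp: "0 \<le> 4 * pi * (of_int N + 1/2)" using N1 by simp
  have sq: "sqrt (cmod l) = 4 * pi * (of_int N + 1/2)" unfolding l rad_def using rp by (rule real_sqrt_abs[THEN trans, OF abs_of_nonneg])
  have "1 * 1 \<le> 4 * pi * (of_int N + 1/2)" using N1 pi_gt3 by (intro mult_mono) auto
  then have s1: "1 \<le> cmod (csqrt l)" by (simp add: norm_csqrt sq)
  define t where "t = pi * (of_int N + 1/2)"
  have "cmod (csqrt l) = 4 * t" by (simp add: norm_csqrt sq t_def)
  then have "\<bar>cmod (zeta l) - t\<bar> \<le> 1/4"
    using norm_zeta_of_ge[OF s1] norm_zeta_of_le[OF s1] unfolding zeta_eq_zeta_of by linarith
  then have z: "\<bar>cmod (zeta l) - pi * (of_int N + 1/2)\<bar> \<le> 1/4" by (simp only: t_def)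
  have "cmod (complex_of_real (of_int k * pi)) = \<bar>of_int k\<bar> * pi" by (simp add: norm_mult abs_mult)
  then have "\<bar>cmod (zeta l) - \<bar>of_int k\<bar> * pi\<bar> < 1/2"
    using norm_triangle_ineq3[of "zeta l" "complex_of_real (of_int k * pi)"] k by simp
  then have "\<bar>(of_int N + 1/2 - \<bar>of_int k\<bar>) * pi\<bar> < 3/4" using z by (simp add: algebra_simps abs_if split: if_splits)
  also have "(3/4 :: real) < 1/4 * pi" using pi_gt3 by simp
  finally have "\<bar>of_int N + 1/2 - \<bar>of_int k :: real\<bar>\<bar> < 1/4" by (simp add: abs_mult)
  moreover define m where "m = N - \<bar>k\<bar>"
  moreover have "real_of_int m = of_int N - \<bar>of_int k\<bar>" unfolding m_def by simp
  ultimately have "\<bar>of_int m + 1/2 :: real\<bar> < 1/4" by linarith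
  moreover have "0 \<le> real_of_int m" if "0 \<le> m" using that by simp
  moreover have "real_of_int m \<le> -1" if "\<not> 0 \<le> m"
  proof -
    have "m \<le> -1" using that by simp
    then show ?thesis by (metis of_int_le_iff of_int_minus of_int_1)
  qed
  ultimately show False by (cases "0 \<le> m") auto
qed

lemma monodromy_close_on_circles:
  assumes P: "(u, uy) \<in> Pot"
  obtains N0 :: int where "\<And>N l. N0 \<le> N \<Longrightarrow> cmod l = rad N \<Longrightarrow>
      cmod (monodromy u uy l $ 2 $ 1 - exp (- u 0 / 2) * vacuum_c l) < cmod (exp (- u 0 / 2) * vacuum_c l) \<and>
      cmod (discriminant u uy l - 1 * vacuum_discriminant l) < cmod (1 * vacuum_discriminant l)"
proof -
  \<comment> \<open>Since exp |Im zeta| \<le> 16 |sin zeta| on the circles, this error is at most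
    16/1000 of |sin zeta|, and 8 (16/1000)^2 + 8 (16/1000) < 4 leaves ample room for the
    discriminant.\<close>
  obtain R where R: "\<And>s. R \<le> cmod s \<Longrightarrow> vacuum_close u uy s (1/1000)"
    by (rule vacuum_close_uniform[OF P, of "1/1000"]) auto
  show ?thesis
  proof (rule that[of "max 1 \<lceil>R\<rceil>"])
    fix N l assume N: "max 1 \<lceil>R\<rceil> \<le> N" and l: "cmod l = rad N"
    define s where "s = csqrt l"
    have N1: "1 \<le> N" and NR: "R \<le> of_int N" using N by linarith+
    have l0: "l \<noteq> 0" using l rad_ge(2)[of N] N1 by auto
    have s2: "s\<^sup>2 = l" and s0: "s \<noteq> 0" using l0 by (auto simp: s_def)
    have rp: "0 \<le> 4 * pi * (of_int N + 1/2)" using N1 by simp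
    have ns: "cmod s = 4 * pi * (of_int N + 1/2)"
      unfolding s_def norm_csqrt l rad_def using rp by (rule real_sqrt_abs[THEN trans, OF abs_of_nonneg])
    have "1 * of_int N \<le> 4 * pi * (of_int N + 1/2)" using N1 pi_gt3 by (intro mult_mono) auto
    then have v: "vacuum_close u uy s (1/1000)" using NR by (intro R) (simp add: ns)
    define \<zeta> E \<sigma> where "\<zeta> = zeta_of s" and "E = exp \<bar>Im \<zeta>\<bar>" and "\<sigma> = sin \<zeta>"
    have "zeta l = \<zeta>" by (simp add: \<zeta>_def s_def zeta_eq_zeta_of)
    then have big: "E \<le> 16 * cmod \<sigma>" using sin_large_on_circle[OF N1 l] by (simp add: E_def \<sigma>_def)
    have E0: "0 < E" by (simp add: E_def)
    have \<sigma>0: "0 < cmod \<sigma>" using big E0 by linarith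
    have vc: "vacuum_c l = s * \<sigma>" using vacuum_c_square[of s] by (simp add: s2 \<sigma>_def \<zeta>_def)
    have vd: "vacuum_discriminant l = - 4 * \<sigma>\<^sup>2" using vacuum_discriminant_square[OF s0] by (simp add: s2 \<sigma>_def \<zeta>_def)
    show "cmod (monodromy u uy l $ 2 $ 1 - exp (- u 0 / 2) * vacuum_c l) < cmod (exp (- u 0 / 2) * vacuum_c l) \<and>
      cmod (discriminant u uy l - 1 * vacuum_discriminant l) < cmod (1 * vacuum_discriminant l)"
    proof
      have ex: "exp (- u 0 / 2) * exp (u 0 / 2) = 1" by (simp add: exp_add[symmetric])
      define k where "k = exp (- u 0 / 2) * s"
      have k0: "k \<noteq> 0" using s0 by (simp add: k_def)
      have m: "monodromy u uy l $ 2 $ 1 = k * (exp (u 0 / 2) / s * monodromy u uy l $ 2 $ 1)"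
        using s0 ex by (simp add: k_def field_simps)
      have "cmod (exp (u 0 / 2) / s * monodromy u uy l $ 2 $ 1 - \<sigma>) \<le> 1/1000 * E"
        using v unfolding vacuum_close_def s2 E_def \<sigma>_def \<zeta>_def by blast
      also have "\<dots> < cmod \<sigma>" using big \<sigma>0 by linarith
      finally have "cmod k * cmod (exp (u 0 / 2) / s * monodromy u uy l $ 2 $ 1 - \<sigma>) < cmod k * cmod \<sigma>"
        using k0 by (intro mult_strict_left_mono) auto
      moreover have "monodromy u uy l $ 2 $ 1 - exp (- u 0 / 2) * vacuum_c l = k * (exp (u 0 / 2) / s * monodromy u uy l $ 2 $ 1 - \<sigma>)"
        unfolding right_diff_distrib m[symmetric] by (simp add: k_def vc)
      moreover have "exp (- u 0 / 2) * vacuum_c l = k * \<sigma>" by (simp add: k_def vc)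
      ultimately show "cmod (monodromy u uy l $ 2 $ 1 - exp (- u 0 / 2) * vacuum_c l) < cmod (exp (- u 0 / 2) * vacuum_c l)"
        by (simp only: norm_mult)
      have "cmod (discriminant u uy l + 4 * \<sigma>\<^sup>2) \<le> 8 * (1/1000 * E)\<^sup>2 + 8 * (1/1000 * E) * cmod \<sigma>"
        using discriminant_close[OF P s0 v] unfolding s2 E_def \<sigma>_def \<zeta>_def .
      also have "\<dots> \<le> 8 * (1/1000 * (16 * cmod \<sigma>))\<^sup>2 + 8 * (1/1000 * (16 * cmod \<sigma>)) * cmod \<sigma>"
        using big E0 by (intro add_mono mult_left_mono mult_right_mono power_mono) auto
      also have "\<dots> = (8 * (16/1000)\<^sup>2 + 8 * (16/1000)) * (cmod \<sigma>)\<^sup>2" by (simp add: power2_eq_square algebra_simps)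
      also have "\<dots> < 4 * (cmod \<sigma>)\<^sup>2" using \<sigma>0 by (intro mult_strict_right_mono) (auto simp: power2_eq_square)
      finally show "cmod (discriminant u uy l - 1 * vacuum_discriminant l) < cmod (1 * vacuum_discriminant l)"
        by (simp add: vd norm_mult norm_power)
    qed
  qed
qed

section \<open>Transfer to the origin and enumerations\<close>

lemma vacuum_c_inverse: "l \<noteq> 0 \<Longrightarrow> vacuum_c (inverse l) = inverse l * vacuum_c l"
proof -
  assume l: "l \<noteq> 0"
  define s where "s = csqrt l"
  have s: "s \<noteq> 0" "l = s\<^sup>2" using l by (auto simp: s_def)
  have "zeta_of (inverse s) = zeta_of s" by (simp add: zeta_of_def add.commute)
  then have "vacuum_c ((inverse s)\<^sup>2) = inverse s * sin (zeta_of s)" by (simp only: vacuum_c_square)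
  moreover have "inverse l * vacuum_c l = inverse s * sin (zeta_of s)"
    using s(1) unfolding s(2) vacuum_c_square by (simp add: power2_eq_square field_simps)
  ultimately show ?thesis by (simp add: s(2) power_inverse)
qed

lemma vacuum_discriminant_inverse: "l \<noteq> 0 \<Longrightarrow> vacuum_discriminant (inverse l) = vacuum_discriminant l"
proof -
  assume l: "l \<noteq> 0"
  have "- 4 * (inverse l * v)\<^sup>2 / inverse l = - 4 * v\<^sup>2 / l" for v :: complex
    using l by (simp add: power_mult_distrib power2_eq_square divide_inverse)
  then show ?thesis unfolding vacuum_discriminant_def vacuum_c_inverse[OF l] .
qed

lemma discriminant_uminus:
  assumes "(u, uy) \<in> Pot" "l \<noteq> 0"
  shows "discriminant (\<lambda>x. - u x) uy (inverse l) = discriminant u uy l"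
  by (simp add: discriminant_def trace_2 monodromy_uminus[OF assms])

lemma near_mono: "near l k q \<Longrightarrow> q \<le> q' \<Longrightarrow> near l k q'"
  by (auto simp: near_def)

lemma near_nonneg: "near l k q \<Longrightarrow> 0 \<le> q"
  unfolding near_def by (metis norm_ge_zero order_trans)

text \<open>The statement near the origin is the one at infinity for \<open>(- u, uy)\<close>,
  pulled back by inversion; zeros and the upper left entry are preserved.\<close>

lemma monodromy_zeros_near_both:
  assumes P: "(u, uy) \<in> Pot"
  obtains R0 and q :: "int \<Rightarrow> real" where "(\<lambda>k. (q k)\<^sup>2) summable_on {0<..}"
    "\<And>l. R0 \<le> cmod l \<Longrightarrow> monodromy u uy l $ 2 $ 1 = 0 \<or> discriminant u uy l = 0 \<Longrightarrow>
      \<exists>k. near l k (q k) \<and> cmod (monodromy u uy l $ 1 $ 1 - mu0 k) \<le> q k"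
    "\<And>l. R0 \<le> cmod l \<Longrightarrow> monodromy u uy (inverse l) $ 2 $ 1 = 0 \<or> discriminant u uy (inverse l) = 0 \<Longrightarrow>
      \<exists>k. near l k (q k) \<and> cmod (monodromy u uy (inverse l) $ 1 $ 1 - mu0 k) \<le> q k"
proof -
  obtain R1 and q1 :: "int \<Rightarrow> real" where 1: "(\<lambda>k. (q1 k)\<^sup>2) summable_on {0<..}"
    "\<And>l. R1 \<le> cmod l \<Longrightarrow> monodromy u uy l $ 2 $ 1 = 0 \<or> discriminant u uy l = 0 \<Longrightarrow>
      \<exists>k. near l k (q1 k) \<and> cmod (monodromy u uy l $ 1 $ 1 - mu0 k) \<le> q1 k"
    by (rule monodromy_zeros_near[OF P]) (rule that)
  obtain R2 and q2 :: "int \<Rightarrow> real" where 2: "(\<lambda>k. (q2 k)\<^sup>2) summable_on {0<..}"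
    "\<And>l. R2 \<le> cmod l \<Longrightarrow> monodromy (\<lambda>x. - u x) uy l $ 2 $ 1 = 0 \<or> discriminant (\<lambda>x. - u x) uy l = 0 \<Longrightarrow>
      \<exists>k. near l k (q2 k) \<and> cmod (monodromy (\<lambda>x. - u x) uy l $ 1 $ 1 - mu0 k) \<le> q2 k"
    by (rule monodromy_zeros_near[OF Pot_uminus[OF P]]) (rule that)
  \<comment> \<open>A common majorant of both sequences whose square is still summable.\<close>
  define q where "q k = sqrt ((q1 k)\<^sup>2 + (q2 k)\<^sup>2)" for k
  have le: "q1 k \<le> q k" "q2 k \<le> q k" for k
    unfolding q_def by (auto intro!: real_le_rsqrt)
  show ?thesis
  proof (rule that[of q "max 1 (max R1 R2)"])
    show "(\<lambda>k. (q k)\<^sup>2) summable_on {0<..}"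
      using summable_on_add[OF 1(1) 2(1)] by (simp add: q_def)
  next
    fix l assume h: "max 1 (max R1 R2) \<le> cmod l" "monodromy u uy l $ 2 $ 1 = 0 \<or> discriminant u uy l = 0"
    then obtain k where "near l k (q1 k)" "cmod (monodromy u uy l $ 1 $ 1 - mu0 k) \<le> q1 k" using 1(2)[of l] by (metis max.bounded_iff)
    then show "\<exists>k. near l k (q k) \<and> cmod (monodromy u uy l $ 1 $ 1 - mu0 k) \<le> q k"
      using near_mono[OF _ le(1)[of k]] order_trans[OF _ le(1)[of k]] by blast
  next
    fix l assume h: "max 1 (max R1 R2) \<le> cmod l"
      "monodromy u uy (inverse l) $ 2 $ 1 = 0 \<or> discriminant u uy (inverse l) = 0"
    have l: "inverse l \<noteq> 0" using h(1) by auto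
    note m = monodromy_uminus[OF P l, unfolded inverse_inverse_eq] discriminant_uminus[OF P l, unfolded inverse_inverse_eq]
    have "monodromy (\<lambda>x. - u x) uy l $ 2 $ 1 = 0 \<or> discriminant (\<lambda>x. - u x) uy l = 0"
      using h(2) by (simp add: m)
    then obtain k where "near l k (q2 k)" "cmod (monodromy u uy (inverse l) $ 1 $ 1 - mu0 k) \<le> q2 k"
      using 2(2)[of l] h(1) unfolding m by (metis max.bounded_iff)
    then show "\<exists>k. near l k (q k) \<and> cmod (monodromy u uy (inverse l) $ 1 $ 1 - mu0 k) \<le> q k"
      using near_mono[OF _ le(2)[of k]] order_trans[OF _ le(2)[of k]] by blast
  qed
qed

lemma vacuum_zero_iff_lambda0:
  assumes "l \<noteq> 0"
  shows "vacuum_c l = 0 \<longleftrightarrow> l \<in> range lambda0" "vacuum_discriminant l = 0 \<longleftrightarrow> l \<in> range lambda0"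
  using assms by (auto simp: vacuum_discriminant_zero_iff vacuum_c_zero_iff)

text \<open>For \<open>u = 0\<close>, \<open>u\<^sub>y = 0\<close> all zeros sit at the points \<open>lambda0 k\<close>; Rouche's theorem on circles
  around the origin transfers the count. The circles near the origin are reached through the symmetry
  \<open>(u, \<lambda>) \<mapsto> (- u, inverse \<lambda>)\<close>.\<close>

lemma lower_left_zeros_counted:
  assumes P: "(u, uy) \<in> Pot"
  defines "F \<equiv> \<lambda>l. monodromy u uy l $ 2 $ 1"
  obtains N :: nat where
    "\<And>k. int N < \<bar>k\<bar> \<Longrightarrow> exactly 1 {z \<in> Cstar_zeros F. z \<in> S k} (zero_mult F)"
    "exactly (1 * (2 * N + 1)) {z \<in> Cstar_zeros F. z \<in> (\<Union>k\<in>{- int N..int N}. S k)} (zero_mult F)"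
    "\<And>l j k. F l = 0 \<Longrightarrow> l \<noteq> 0 \<Longrightarrow> int N < \<bar>k\<bar> \<Longrightarrow> l \<in> S k \<Longrightarrow> l \<in> S j \<Longrightarrow> j = k"
proof -
  obtain R0 and q :: "int \<Rightarrow> real" where n: "(\<lambda>k. (q k)\<^sup>2) summable_on {0<..}"
    "\<And>l. R0 \<le> cmod l \<Longrightarrow> monodromy u uy l $ 2 $ 1 = 0 \<or> discriminant u uy l = 0 \<Longrightarrow>
      \<exists>k. near l k (q k) \<and> cmod (monodromy u uy l $ 1 $ 1 - mu0 k) \<le> q k"
    "\<And>l. R0 \<le> cmod l \<Longrightarrow> monodromy u uy (inverse l) $ 2 $ 1 = 0 \<or> discriminant u uy (inverse l) = 0 \<Longrightarrow>
      \<exists>k. near l k (q k) \<and> cmod (monodromy u uy (inverse l) $ 1 $ 1 - mu0 k) \<le> q k"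
    by (rule monodromy_zeros_near_both[OF P]) (rule that)
  obtain N1 :: int where N1: "\<And>N l. N1 \<le> N \<Longrightarrow> cmod l = rad N \<Longrightarrow>
      cmod (monodromy u uy l $ 2 $ 1 - exp (- u 0 / 2) * vacuum_c l) < cmod (exp (- u 0 / 2) * vacuum_c l) \<and>
      cmod (discriminant u uy l - 1 * vacuum_discriminant l) < cmod (1 * vacuum_discriminant l)"
    by (rule monodromy_close_on_circles[OF P]) (rule that)
  obtain N2 :: int where N2: "\<And>N l. N2 \<le> N \<Longrightarrow> cmod l = rad N \<Longrightarrow>
      cmod (monodromy (\<lambda>x. - u x) uy l $ 2 $ 1 - exp (- (- u 0) / 2) * vacuum_c l) < cmod (exp (- (- u 0) / 2) * vacuum_c l) \<and>
      cmod (discriminant (\<lambda>x. - u x) uy l - 1 * vacuum_discriminant l) < cmod (1 * vacuum_discriminant l)"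
    by (rule monodromy_close_on_circles[OF Pot_uminus[OF P]]) (rule that)
  have inner: "cmod (F l - exp (u 0 / 2) * vacuum_c l) < cmod (exp (u 0 / 2) * vacuum_c l)"
    if h: "max N1 N2 \<le> N" "cmod (inverse l) = rad N" for N l
  proof -
    \<comment> \<open>Because \<open>inverse 0 = 0\<close>, the point 0 has to be ruled out
      formally: \<open>vacuum_c 0 = 0\<close> contradicts the strict inequality of
      \<open>N2\<close>.\<close>
    have l: "l \<noteq> 0"
    proof
      assume "l = 0"
      then show False using N2[of N l] h by (simp add: vacuum_c_def)
    qed
    have "cmod (inverse l * F l - exp (u 0 / 2) * (inverse l * vacuum_c l)) < cmod (exp (u 0 / 2) * (inverse l * vacuum_c l))"
      using conjunct1[OF N2[of N "inverse l"]] h unfolding monodromy_uminus[OF P l] vacuum_c_inverse[OF l] F_def by simp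
    moreover have "inverse l * F l - exp (u 0 / 2) * (inverse l * vacuum_c l) = inverse l * (F l - exp (u 0 / 2) * vacuum_c l)"
      "exp (u 0 / 2) * (inverse l * vacuum_c l) = inverse l * (exp (u 0 / 2) * vacuum_c l)"
      by (simp_all add: algebra_simps)
    ultimately have "cmod (inverse l) * cmod (F l - exp (u 0 / 2) * vacuum_c l) < cmod (inverse l) * cmod (exp (u 0 / 2) * vacuum_c l)"
      by (simp only: norm_mult)
    moreover have "0 < cmod (inverse l)" using l by simp
    ultimately show ?thesis using mult_less_cancel_left_pos by blast
  qed
  show ?thesis
  proof (rule zeros_located_and_counted[where F = F and G = vacuum_c and m = 1 and q = q and ?N0.0 = "max N1 N2"
        and ?\<kappa>1.0 = "exp (- u 0 / 2)" and ?\<kappa>2.0 = "exp (u 0 / 2)" and ?R0.0 = R0])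
    show "F holomorphic_on - {0}" unfolding F_def by (rule monodromy_holomorphic[OF P])
    show "vacuum_c holomorphic_on - {0}" by (rule vacuum_c_holomorphic)
    show "vacuum_c l = 0 \<longleftrightarrow> l \<in> range lambda0" if "l \<noteq> 0" for l by (rule vacuum_zero_iff_lambda0(1)[OF that])
    show "zorder vacuum_c (lambda0 k) = int 1" for k by (simp add: zorder_vacuum_c)
    show "\<exists>k. near l k (q k)" if "R0 \<le> cmod l" "F l = 0" for l using n(2)[of l] that unfolding F_def by blast
    show "\<exists>k. near l k (q k)" if "R0 \<le> cmod l" "F (inverse l) = 0" for l using n(3)[of l] that unfolding F_def by blast
  next
    fix N l assume "max N1 N2 \<le> N" "cmod l = rad N"
    then show "cmod (F l - exp (- u 0 / 2) * vacuum_c l) < cmod (exp (- u 0 / 2) * vacuum_c l)"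
      using conjunct1[OF N1[of N l]] unfolding F_def by simp
  qed (rule inner, assumption+, rule that)
qed

lemma discriminant_zeros_counted:
  assumes P: "(u, uy) \<in> Pot"
  defines "F \<equiv> discriminant u uy"
  obtains N :: nat where
    "\<And>k. int N < \<bar>k\<bar> \<Longrightarrow> exactly 2 {z \<in> Cstar_zeros F. z \<in> S k} (zero_mult F)"
    "exactly (2 * (2 * N + 1)) {z \<in> Cstar_zeros F. z \<in> (\<Union>k\<in>{- int N..int N}. S k)} (zero_mult F)"
    "\<And>l j k. F l = 0 \<Longrightarrow> l \<noteq> 0 \<Longrightarrow> int N < \<bar>k\<bar> \<Longrightarrow> l \<in> S k \<Longrightarrow> l \<in> S j \<Longrightarrow> j = k"
proof -
  obtain R0 and q :: "int \<Rightarrow> real" where n: "(\<lambda>k. (q k)\<^sup>2) summable_on {0<..}"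
    "\<And>l. R0 \<le> cmod l \<Longrightarrow> monodromy u uy l $ 2 $ 1 = 0 \<or> discriminant u uy l = 0 \<Longrightarrow>
      \<exists>k. near l k (q k) \<and> cmod (monodromy u uy l $ 1 $ 1 - mu0 k) \<le> q k"
    "\<And>l. R0 \<le> cmod l \<Longrightarrow> monodromy u uy (inverse l) $ 2 $ 1 = 0 \<or> discriminant u uy (inverse l) = 0 \<Longrightarrow>
      \<exists>k. near l k (q k) \<and> cmod (monodromy u uy (inverse l) $ 1 $ 1 - mu0 k) \<le> q k"
    by (rule monodromy_zeros_near_both[OF P]) (rule that)
  obtain N1 :: int where N1: "\<And>N l. N1 \<le> N \<Longrightarrow> cmod l = rad N \<Longrightarrow>
      cmod (monodromy u uy l $ 2 $ 1 - exp (- u 0 / 2) * vacuum_c l) < cmod (exp (- u 0 / 2) * vacuum_c l) \<and>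
      cmod (discriminant u uy l - 1 * vacuum_discriminant l) < cmod (1 * vacuum_discriminant l)"
    by (rule monodromy_close_on_circles[OF P]) (rule that)
  obtain N2 :: int where N2: "\<And>N l. N2 \<le> N \<Longrightarrow> cmod l = rad N \<Longrightarrow>
      cmod (monodromy (\<lambda>x. - u x) uy l $ 2 $ 1 - exp (- (- u 0) / 2) * vacuum_c l) < cmod (exp (- (- u 0) / 2) * vacuum_c l) \<and>
      cmod (discriminant (\<lambda>x. - u x) uy l - 1 * vacuum_discriminant l) < cmod (1 * vacuum_discriminant l)"
    by (rule monodromy_close_on_circles[OF Pot_uminus[OF P]]) (rule that)
  have inner: "cmod (F l - 1 * vacuum_discriminant l) < cmod (1 * vacuum_discriminant l)"
    if h: "max N1 N2 \<le> N" "cmod (inverse l) = rad N" for N l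
  proof -
    have l: "l \<noteq> 0"
    proof
      assume "l = 0"
      then show False using N2[of N l] h by (simp add: vacuum_discriminant_def)
    qed
    show ?thesis
      using conjunct2[OF N2[of N "inverse l"]] h
      unfolding discriminant_uminus[OF P l] vacuum_discriminant_inverse[OF l] F_def by simp
  qed
  show ?thesis
  proof (rule zeros_located_and_counted[where F = F and G = vacuum_discriminant and m = 2 and q = q and ?N0.0 = "max N1 N2"
        and ?\<kappa>1.0 = 1 and ?\<kappa>2.0 = 1 and ?R0.0 = R0])
    show "F holomorphic_on - {0}" unfolding F_def by (rule discriminant_holomorphic[OF P])
    show "vacuum_discriminant holomorphic_on - {0}" by (rule vacuum_discriminant_holomorphic)
    show "vacuum_discriminant l = 0 \<longleftrightarrow> l \<in> range lambda0" if "l \<noteq> 0" for l by (rule vacuum_zero_iff_lambda0(2)[OF that])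
    show "zorder vacuum_discriminant (lambda0 k) = int 2" for k by (simp add: zorder_vacuum_discriminant)
    show "\<exists>k. near l k (q k)" if "R0 \<le> cmod l" "F l = 0" for l using n(2)[of l] that unfolding F_def by blast
    show "\<exists>k. near l k (q k)" if "R0 \<le> cmod l" "F (inverse l) = 0" for l using n(3)[of l] that unfolding F_def by blast
  next
    fix N l assume "max N1 N2 \<le> N" "cmod l = rad N"
    then show "cmod (F l - 1 * vacuum_discriminant l) < cmod (1 * vacuum_discriminant l)"
      using conjunct2[OF N1[of N l]] unfolding F_def by simp
  qed (rule inner, assumption+, rule that)
qed

lemma monodromy_nonvanishing:
  assumes P: "(u, uy) \<in> Pot"
  obtains l where "l \<noteq> 0" "monodromy u uy l $ 2 $ 1 \<noteq> 0" "discriminant u uy l \<noteq> 0"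
proof -
  obtain N1 :: int where N1: "\<And>N l. N1 \<le> N \<Longrightarrow> cmod l = rad N \<Longrightarrow>
      cmod (monodromy u uy l $ 2 $ 1 - exp (- u 0 / 2) * vacuum_c l) < cmod (exp (- u 0 / 2) * vacuum_c l) \<and>
      cmod (discriminant u uy l - 1 * vacuum_discriminant l) < cmod (1 * vacuum_discriminant l)"
    by (rule monodromy_close_on_circles[OF P]) (rule that)
  define l where "l = complex_of_real (rad (max N1 0))"
  have r: "0 < rad (max N1 0)" by (simp add: rad_def)
  have "cmod l = rad (max N1 0)" using r by (simp add: l_def)
  from N1[OF _ this] have "monodromy u uy l $ 2 $ 1 \<noteq> 0" "discriminant u uy l \<noteq> 0" by auto
  moreover have "l \<noteq> 0" using r by (auto simp: l_def)
  ultimately show ?thesis using that by blast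
qed

lemma S_norm_ge:
  assumes l: "l \<in> S k" and k: "0 < k"
  shows "of_int k \<le> cmod l"
proof -
  have z: "(of_int k - 1/2) * pi \<le> cmod (zeta l)" and l1: "1 < cmod l" using l k by (auto simp: S_def)
  have k1: "1 \<le> real_of_int k" using k by linarith
  have "(of_int k - 1/2) * 3 \<le> (of_int k - 1/2) * pi" using k1 pi_gt3 by (intro mult_left_mono) linarith+
  moreover have "4 * cmod (zeta l) \<le> sqrt (cmod l) + 1"
    using norm_zeta_of_le[of "csqrt l"] l1 by (simp add: zeta_eq_zeta_of norm_csqrt)
  ultimately have s: "of_int k \<le> sqrt (cmod l)" using z k1 by argo
  also have "\<dots> \<le> sqrt (cmod l) * sqrt (cmod l)" using s k1 mult_left_mono[of 1 "sqrt (cmod l)" "sqrt (cmod l)"] by linarith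
  finally show ?thesis by simp
qed

text \<open>The two weights come from \<open>near_distance\<close>: the distance is at most 150 k q
  at infinity and 150 q / |k|^3 near the origin, so the weights \<open>k powi -1\<close> and
  \<open>k powi 3\<close> leave a square summable bound.\<close>

lemma monodromy_zero_bounds:
  assumes P: "(u, uy) \<in> Pot"
  obtains K :: nat and q :: "int \<Rightarrow> real" where "(\<lambda>k. (q k)\<^sup>2) summable_on {0<..}"
    "\<And>l k. int K < \<bar>k\<bar> \<Longrightarrow> l \<in> S k \<Longrightarrow> monodromy u uy l $ 2 $ 1 = 0 \<or> discriminant u uy l = 0 \<Longrightarrow>
      cmod (of_int k powi (if 0 < k then -1 else 3) * (l - lambda0 k)) \<le> q \<bar>k\<bar> \<and>
      cmod (monodromy u uy l $ 1 $ 1 - mu0 k) \<le> q \<bar>k\<bar>"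
proof -
  obtain R0 and q :: "int \<Rightarrow> real" where n: "(\<lambda>k. (q k)\<^sup>2) summable_on {0<..}"
    "\<And>l. R0 \<le> cmod l \<Longrightarrow> monodromy u uy l $ 2 $ 1 = 0 \<or> discriminant u uy l = 0 \<Longrightarrow>
      \<exists>k. near l k (q k) \<and> cmod (monodromy u uy l $ 1 $ 1 - mu0 k) \<le> q k"
    "\<And>l. R0 \<le> cmod l \<Longrightarrow> monodromy u uy (inverse l) $ 2 $ 1 = 0 \<or> discriminant u uy (inverse l) = 0 \<Longrightarrow>
      \<exists>k. near l k (q k) \<and> cmod (monodromy u uy (inverse l) $ 1 $ 1 - mu0 k) \<le> q k"
    by (rule monodromy_zeros_near_both[OF P]) (rule that)
  show ?thesis
  proof (rule that[of "\<lambda>k. 150 * q k" "nat \<lceil>R0\<rceil>"])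
    show "(\<lambda>k. (150 * q k)\<^sup>2) summable_on {0<..}"
      unfolding power_mult_distrib by (intro summable_on_cmult_right n)
  next
    fix l k
    assume k: "int (nat \<lceil>R0\<rceil>) < \<bar>k\<bar>" and l: "l \<in> S k" and z: "monodromy u uy l $ 2 $ 1 = 0 \<or> discriminant u uy l = 0"
    have R0: "R0 \<le> of_int \<bar>k\<bar>" using k by linarith
    consider "0 < k" | "k < 0" using k by linarith
    then show "cmod (of_int k powi (if 0 < k then -1 else 3) * (l - lambda0 k)) \<le> 150 * q \<bar>k\<bar> \<and>
      cmod (monodromy u uy l $ 1 $ 1 - mu0 k) \<le> 150 * q \<bar>k\<bar>"
    proof cases
      case 1
      have "R0 \<le> cmod l" using S_norm_ge[OF l 1] R0 1 by linarith
      then obtain j where j: "near l j (q j)" "cmod (monodromy u uy l $ 1 $ 1 - mu0 j) \<le> q j" using n(2) z by blast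
      then have jk: "j = k" using near_S[OF j(1)] l by simp
      have "cmod (l - lambda0 k) \<le> 150 * of_int k * q k" using near_distance(1)[OF j(1)] by (simp add: jk)
      then have "cmod (l - lambda0 k) / of_int k \<le> 150 * q k" using 1 by (simp add: field_simps)
      moreover have "cmod (of_int k powi (-1) * (l - lambda0 k)) = cmod (l - lambda0 k) / of_int k"
      proof -
        have "of_int k powi (-1) = inverse (of_int k :: complex)" by (simp add: power_int_minus)
        moreover have "cmod (of_int k) = of_int k" using 1 by simp
        ultimately show ?thesis by (simp only: norm_mult norm_inverse divide_inverse mult.commute)
      qed
      ultimately show ?thesis using j(2) near_nonneg[OF j(1)] 1 by (simp add: jk)
    next
      case 2
      have l0: "l \<noteq> 0" using l by (auto simp: S_def split: if_splits)
      have s: "inverse l \<in> S (- k)" using S_inverse[OF l0, of "- k"] l by simp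
      have "R0 \<le> cmod (inverse l)" using S_norm_ge[OF s] R0 2 by linarith
      then obtain j where j: "near (inverse l) j (q j)" "cmod (monodromy u uy l $ 1 $ 1 - mu0 j) \<le> q j"
        using n(3)[of "inverse l"] z by auto
      then have jk: "j = - k" using near_S[OF j(1)] s by simp
      have "cmod (l - lambda0 k) \<le> 150 * q (- k) / (of_int (- k)) ^ 3"
        using near_distance(2)[OF j(1)] by (simp add: jk lambda0_uminus)
      then have "(of_int (- k)) ^ 3 * cmod (l - lambda0 k) \<le> 150 * q (- k)"
        using 2 zero_less_power[of "of_int (- k) :: real" 3] by (simp add: field_simps)
      moreover have "cmod (of_int k powi 3 * (l - lambda0 k)) = (of_int (- k)) ^ 3 * cmod (l - lambda0 k)"
      proof -
        have "cmod (of_int k) = of_int (- k)" using 2 by simp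
        then show ?thesis by (simp only: norm_mult power_int_numeral norm_power)
      qed
      moreover have "mu0 (- k) = mu0 k" by (simp add: mu0_def power_int_minus power_int_def)
      ultimately show ?thesis using j(2) near_nonneg[OF j(1)] 2 by (simp add: jk)
    qed
  qed
qed

section \<open>Sequence spaces and enumerations\<close>

lemma ell2I:
  fixes q :: "int \<Rightarrow> real"
  assumes q: "(\<lambda>k. (q k)\<^sup>2) summable_on {0<..}"
    and b: "\<And>k. int K < \<bar>k\<bar> \<Longrightarrow> cmod (of_int k powi (if 0 < k then n else m) * a k) \<le> q \<bar>k\<bar>"
  shows "a \<in> ell2 n m"
proof -
  have q': "(\<lambda>k. (q (- k))\<^sup>2) summable_on {..<0}"
  proof -
    have "(\<lambda>k. (q k)\<^sup>2) summable_on uminus ` {..<0 :: int}" using q by simp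
    then show ?thesis by (subst (asm) summable_on_reindex) (auto simp: o_def)
  qed
  have sum: "f summable_on A" if s: "g summable_on A" and le: "\<And>k. k \<in> A \<Longrightarrow> int K < \<bar>k\<bar> \<Longrightarrow> f k \<le> g k"
    and nn: "\<And>k. 0 \<le> f k" for f g :: "int \<Rightarrow> real" and A
  proof -
    define B where "B = A \<inter> {k. int K < \<bar>k\<bar>}"
    have "g summable_on B" by (rule summable_on_subset_banach[OF s]) (auto simp: B_def)
    then have "f summable_on B" by (rule summable_on_comparison_test) (use le nn in \<open>auto simp: B_def\<close>)
    moreover have "finite (A - B)"
      by (rule finite_subset[of _ "{- int K..int K}"]) (auto simp: B_def)
    ultimately have "f summable_on (B \<union> (A - B))" by (intro summable_on_Un_disjoint) auto
    moreover have "B \<union> (A - B) = A" by (auto simp: B_def)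
    ultimately show ?thesis by simp
  qed
  show ?thesis
    unfolding ell2_def
  proof (intro CollectI conjI)
    show "(\<lambda>k. (cmod (of_int k powi m * a k))\<^sup>2) summable_on {..<0}"
    proof (rule sum[OF q'])
      fix k :: int assume "k \<in> {..<0}" "int K < \<bar>k\<bar>"
      then show "(cmod (of_int k powi m * a k))\<^sup>2 \<le> (q (- k))\<^sup>2" using b[of k] by (intro power_mono) auto
    qed simp
    show "(\<lambda>k. (cmod (of_int k powi n * a k))\<^sup>2) summable_on {0<..}"
    proof (rule sum[OF q])
      fix k :: int assume "k \<in> {0<..}" "int K < \<bar>k\<bar>"
      then show "(cmod (of_int k powi n * a k))\<^sup>2 \<le> (q k)\<^sup>2" using b[of k] by (intro power_mono) auto
    qed simp
  qed
qed

text \<open>Induction over the points: each takes as many of the remaining indices as its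
  multiplicity, and the equality of totals makes the indices run out exactly.\<close>

lemma enumerates_finite:
  assumes "finite Z" "finite I" "(\<Sum>z\<in>Z. mlt z) = card I"
  shows "\<exists>x. enumerates I x Z mlt"
  using assms
proof (induction Z arbitrary: I rule: finite_induct)
  case empty
  then show ?case by (simp add: enumerates_def)
next
  case (insert z Z)
  have "mlt z \<le> card I" using insert by simp
  then obtain A where A: "A \<subseteq> I" "card A = mlt z" "finite A" by (rule obtain_subset_with_card_n)
  have "card (I - A) = card I - card A" using A by (intro card_Diff_subset) auto
  then have "(\<Sum>z\<in>Z. mlt z) = card (I - A)" using insert A by simp
  then obtain x where x: "enumerates (I - A) x Z mlt" using insert.IH[of "I - A"] insert.prems by auto
  define y where "y i = (if i \<in> A then z else x i)" for i
  have xZ: "x i \<in> Z" if "i \<in> I" "i \<notin> A" for i using x that by (auto simp: enumerates_def)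
  have "{i \<in> I. y i = z} = A" using A xZ insert.hyps by (auto simp: y_def)
  moreover have "{i \<in> I. y i = w} = {i \<in> I - A. x i = w}" if "w \<in> Z" for w
    using that insert.hyps by (auto simp: y_def)
  ultimately have "enumerates I y (insert z Z) mlt"
    using x A xZ insert.hyps unfolding enumerates_def by (auto simp: y_def)
  then show ?case by blast
qed

text \<open>The indices and the points are grouped into one block for \<open>\<bar>k\<bar> \<le> N\<close> and one block for every
  other \<open>k\<close>; corresponding blocks have the same cardinality.\<close>

lemma enumeration_exists:
  fixes \<pi> :: "'i \<Rightarrow> int" and Z :: "'a set" and coord :: "'a \<Rightarrow> complex"
  assumes I: "\<And>k. finite {i \<in> I. \<pi> i = k}" "\<And>k. card {i \<in> I. \<pi> i = k} = m"
    and single: "\<And>k. int N < \<bar>k\<bar> \<Longrightarrow> exactly m {z \<in> Z. coord z \<in> S k} mlt"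
    and block: "exactly (m * (2 * N + 1)) {z \<in> Z. coord z \<in> (\<Union>k\<in>{- int N..int N}. S k)} mlt"
    and unique: "\<And>z j k. z \<in> Z \<Longrightarrow> int N < \<bar>k\<bar> \<Longrightarrow> coord z \<in> S k \<Longrightarrow> coord z \<in> S j \<Longrightarrow> j = k"
    and cover: "\<And>z. z \<in> Z \<Longrightarrow> \<exists>k. coord z \<in> S k"
  obtains x where "enumerates I x Z mlt" "\<And>i. i \<in> I \<Longrightarrow> int N < \<bar>\<pi> i\<bar> \<Longrightarrow> coord (x i) \<in> S (\<pi> i)"
proof -
  \<comment> \<open>The value 0 labels the whole central block; the labels b with 0 < |b| \<le> N
    stay empty.\<close>
  define blk where "blk k = (if int N < \<bar>k\<bar> then k else 0)" for k
  define J where "J b = {i \<in> I. blk (\<pi> i) = b}" for b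
  define W where "W b = {z \<in> Z. \<exists>k. blk k = b \<and> coord z \<in> S k}" for b
  have blk: "blk k = b \<longleftrightarrow> k = b" if "int N < \<bar>b\<bar>" for k b using that by (auto simp: blk_def)
  have blk0: "blk k = 0 \<longleftrightarrow> k \<in> {- int N..int N}" for k by (auto simp: blk_def)
  have ex: "\<exists>x. enumerates (J b) x (W b) mlt" for b
  proof -
    consider "int N < \<bar>b\<bar>" | "b = 0" | "\<forall>k. blk k \<noteq> b" unfolding blk_def by metis
    then show ?thesis
    proof cases
      case 1
      have "J b = {i \<in> I. \<pi> i = b}" "W b = {z \<in> Z. coord z \<in> S b}"
        by (auto simp: J_def W_def blk[OF 1])
      then show ?thesis using single[OF 1] I by (intro enumerates_finite) (auto simp: exactly_def)
    next
      case 2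
      have J: "J b = (\<Union>k\<in>{- int N..int N}. {i \<in> I. \<pi> i = k})" unfolding J_def 2 blk0 by auto
      have "card (J b) = (\<Sum>k\<in>{- int N..int N}. card {i \<in> I. \<pi> i = k})"
        unfolding J by (rule card_UN_disjoint) (use I(1) in auto)
      also have "\<dots> = m * (2 * N + 1)"
      proof -
        have "card {- int N..int N} = nat (int N - (- int N) + 1)" by (rule card_atLeastAtMost_int)
        then have "card {- int N..int N} = 2 * N + 1" by linarith
        then show ?thesis unfolding I(2) by (simp only: sum_constant of_nat_id mult.commute)
      qed
      finally have c: "card (J b) = m * (2 * N + 1)" .
      have "W b = {z \<in> Z. coord z \<in> (\<Union>k\<in>{- int N..int N}. S k)}" unfolding W_def 2 blk0 by auto
      moreover have "finite (J b)" unfolding J using I(1) by auto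
      ultimately show ?thesis using block c by (intro enumerates_finite) (auto simp: exactly_def)
    next
      case 3
      then have "J b = {}" "W b = {}" by (auto simp: J_def W_def)
      then show ?thesis by (simp add: enumerates_def)
    qed
  qed
  then obtain X where X: "\<And>b. enumerates (J b) (X b) (W b) mlt" by metis
  define x where "x i = X (blk (\<pi> i)) i" for i
  have xW: "x i \<in> W (blk (\<pi> i))" if "i \<in> I" for i
    using X[of "blk (\<pi> i)"] that by (auto simp: enumerates_def x_def J_def)
  have W_unique: "b = b'" if h: "z \<in> W b" "z \<in> W b'" for z b b'
  proof -
    obtain k k' where k: "z \<in> Z" "blk k = b" "coord z \<in> S k" "blk k' = b'" "coord z \<in> S k'" using h by (auto simp: W_def)
    then have "k = k' \<or> \<not> int N < \<bar>k\<bar> \<and> \<not> int N < \<bar>k'\<bar>" using unique by metis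
    then show ?thesis using k by (auto simp: blk_def)
  qed
  show ?thesis
  proof (rule that[of x])
    show "enumerates I x Z mlt"
      unfolding enumerates_def
    proof (intro conjI ballI)
      show "x ` I \<subseteq> Z" using xW by (auto simp: W_def)
      fix z assume z: "z \<in> Z"
      then obtain k where k: "coord z \<in> S k" using cover by blast
      define b where "b = blk k"
      have zb: "z \<in> W b" using z k by (auto simp: W_def b_def)
      have "{i \<in> I. x i = z} = {i \<in> J b. X b i = z}"
      proof (intro set_eqI iffI)
        fix i assume i: "i \<in> {i \<in> I. x i = z}"
        then have "blk (\<pi> i) = b" using W_unique[OF _ zb] xW[of i] by auto
        then show "i \<in> {i \<in> J b. X b i = z}" using i by (auto simp: x_def J_def)
      qed (auto simp: J_def x_def)
      then show "finite {i \<in> I. x i = z}" "card {i \<in> I. x i = z} = mlt z"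
        using X[of b] zb by (auto simp: enumerates_def)
    qed
    fix i assume i: "i \<in> I" "int N < \<bar>\<pi> i\<bar>"
    then show "coord (x i) \<in> S (\<pi> i)" using xW[OF i(1)] blk[OF i(2)] i(2) by (auto simp: W_def blk_def)
  qed
qed

lemma S_total: "l \<noteq> 0 \<Longrightarrow> \<exists>k. l \<in> S k"
proof -
  assume l: "l \<noteq> 0"
  define N where "N = \<lceil>cmod (zeta l)\<rceil>"
  have N: "0 \<le> N" "cmod (zeta l) \<le> of_int N" unfolding N_def using norm_ge_zero[of "zeta l"] by linarith+
  have "(of_int N + 1/2) * 1 \<le> (of_int N + 1/2) * pi" using N pi_gt3 by (intro mult_left_mono) auto
  then have "cmod (zeta l) \<le> (of_int N + 1/2) * pi" using N by argo
  then show ?thesis using S_cover[OF l N(1)] by blast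
qed

section \<open>Holomorphic functions of two variables\<close>

definition holomorphic2_at :: "(complex \<times> complex \<Rightarrow> complex) \<Rightarrow> complex \<times> complex \<Rightarrow> bool" where
  "holomorphic2_at g p \<longleftrightarrow> (\<exists>A B. (g has_derivative (\<lambda>(h, k). A * h + B * k)) (at p))"

lemma holomorphic2_at_fst:
  assumes "(f has_field_derivative D) (at (fst p))"
  shows "holomorphic2_at (\<lambda>q. f (fst q)) p"
proof -
  have "(fst has_derivative fst) (at p)" by (rule bounded_linear_imp_has_derivative[OF bounded_linear_fst])
  from has_derivative_compose[OF this assms[unfolded has_field_derivative_def]]
  have "((\<lambda>q. f (fst q)) has_derivative (\<lambda>q. D * fst q)) (at p)" .
  moreover have "(\<lambda>q. D * fst q) = (\<lambda>(h, k). D * h + 0 * k)" by (auto simp: fun_eq_iff)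
  ultimately show ?thesis unfolding holomorphic2_at_def by metis
qed

lemma holomorphic2_at_snd: "holomorphic2_at snd p"
proof -
  have "(snd has_derivative snd) (at p)" by (rule bounded_linear_imp_has_derivative[OF bounded_linear_snd])
  moreover have "snd = (\<lambda>(h, k). 0 * h + 1 * k :: complex)" by (auto simp: fun_eq_iff)
  ultimately show ?thesis unfolding holomorphic2_at_def by metis
qed

lemma holomorphic2_at_diff:
  assumes "holomorphic2_at f p" "holomorphic2_at g p"
  shows "holomorphic2_at (\<lambda>q. f q - g q) p"
proof -
  obtain A B A' B' where "(f has_derivative (\<lambda>(h, k). A * h + B * k)) (at p)"
    "(g has_derivative (\<lambda>(h, k). A' * h + B' * k)) (at p)" using assms unfolding holomorphic2_at_def by blast
  from has_derivative_diff[OF this]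
  have "((\<lambda>q. f q - g q) has_derivative (\<lambda>(h, k). (A - A') * h + (B - B') * k)) (at p)"
    by (rule has_derivative_eq_rhs) (auto simp: fun_eq_iff algebra_simps)
  then show ?thesis unfolding holomorphic2_at_def by blast
qed

lemma holomorphic2_at_divide:
  assumes "holomorphic2_at f p" "holomorphic2_at g p" "g p \<noteq> 0"
  shows "holomorphic2_at (\<lambda>q. f q / g q) p"
proof -
  obtain A B A' B' where "(f has_derivative (\<lambda>(h, k). A * h + B * k)) (at p)"
    "(g has_derivative (\<lambda>(h, k). A' * h + B' * k)) (at p)" using assms unfolding holomorphic2_at_def by blast
  from has_derivative_divide'[OF this assms(3)]
  have "((\<lambda>q. f q / g q) has_derivative (\<lambda>(h, k). (A * g p - f p * A') / (g p * g p) * h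
      + (B * g p - f p * B') / (g p * g p) * k)) (at p)"
    by (rule has_derivative_eq_rhs) (auto simp: fun_eq_iff add_divide_distrib[symmetric] algebra_simps)
  then show ?thesis unfolding holomorphic2_at_def by blast
qed

lemma holomorphic2_at_isCont: "holomorphic2_at g p \<Longrightarrow> isCont g p"
  unfolding holomorphic2_at_def using has_derivative_continuous by blast

lemma holomorphic2_at_slice:
  assumes "holomorphic2_at g (z, w)"
  shows "(\<lambda>w. g (z, w)) field_differentiable (at w)"
proof -
  obtain A B where g: "(g has_derivative (\<lambda>(h, k). A * h + B * k)) (at (z, w))"
    using assms unfolding holomorphic2_at_def by blast
  have "((\<lambda>w. (z, w)) has_derivative (\<lambda>k. (0, k))) (at w)"
    by (intro has_derivative_Pair has_derivative_const has_derivative_ident)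
  from has_derivative_compose[OF this g]
  have "((\<lambda>w. g (z, w)) has_derivative (*) B) (at w)" by (rule has_derivative_eq_rhs) (auto simp: fun_eq_iff)
  then show ?thesis unfolding field_differentiable_def has_field_derivative_def by blast
qed

text \<open>Cauchy's estimate on discs of radius r / 4, which stay in the large ball. The constant
  depends on \<open>C\<close> and \<open>r\<close> only, so it is uniform over the slices of a
  function of two variables.\<close>

lemma holomorphic_bounded_Lipschitz:
  fixes h :: "complex \<Rightarrow> complex"
  assumes h: "h holomorphic_on ball a r" and r: "0 < r" and C: "\<And>w. w \<in> ball a r \<Longrightarrow> cmod (h w) \<le> C"
    and w: "w1 \<in> ball a (r / 2)" "w2 \<in> ball a (r / 2)"
  shows "cmod (h w1 - h w2) \<le> (4 * C / r) * cmod (w1 - w2)"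
proof (rule field_differentiable_bound[OF convex_ball _ _ w, where f' = "deriv h"])
  fix v assume v: "v \<in> ball a (r / 2)"
  have va: "v \<in> ball a r" using v r by simp
  show "(h has_field_derivative deriv h v) (at v within ball a (r / 2))"
    by (rule has_field_derivative_at_within[OF holomorphic_derivI[OF h open_ball va]])
  have sub: "cball v (r / 4) \<subseteq> ball a r"
  proof
    fix x assume "x \<in> cball v (r / 4)"
    then show "x \<in> ball a r" using v dist_triangle[of a x v] r by (auto simp: dist_commute)
  qed
  have "cmod ((deriv ^^ 1) h v) \<le> fact 1 * C / (r / 4) ^ 1"
  proof (rule Cauchy_inequality)
    show "h holomorphic_on ball v (r / 4)" using sub by (intro holomorphic_on_subset[OF h]) auto
    show "continuous_on (cball v (r / 4)) h"
      by (rule holomorphic_on_imp_continuous_on[OF holomorphic_on_subset[OF h sub]])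
    fix x assume "cmod (v - x) = r / 4"
    then have "x \<in> cball v (r / 4)" by (simp add: dist_norm)
    then show "cmod (h x) \<le> C" using sub C by blast
  qed (use r in simp)
  then show "cmod (deriv h v) \<le> 4 * C / r" by (simp add: mult.commute)
qed

section \<open>Zeros and local sections\<close>

lemma zorder_ge_2_iff:
  assumes f: "f holomorphic_on (- {0})" and w: "w \<noteq> 0" "f w \<noteq> 0" and l: "l \<noteq> 0" "f l = 0"
  shows "2 \<le> zorder f l \<longleftrightarrow> deriv f l = 0"
proof
  have oC: "open (- {0 :: complex})" by (simp add: open_Compl)
  have lC: "l \<in> - {0}" using l by simp
  show "deriv f l = 0" if "2 \<le> zorder f l"
  proof (rule ccontr)
    assume "deriv f l \<noteq> 0"
    then have "zorder f l = 1" using l by (intro zorder_zero_eqI[OF f oC lC]) auto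
    then show False using that by simp
  qed
  assume d: "deriv f l = 0"
  obtain r where r: "0 < r" "cball l r \<subseteq> - {0}" "zor_poly f l holomorphic_on cball l r"
    "\<forall>w\<in>cball l r. f w = zor_poly f l w * (w - l) ^ nat (zorder f l) \<and> zor_poly f l w \<noteq> 0"
    and n: "0 < zorder f l"
    using zorder_exist_zero[OF f oC connected_punctured_plane lC] w l by (metis (no_types, lifting) ComplI singletonD)
  show "2 \<le> zorder f l"
  proof (rule ccontr)
    assume "\<not> ?thesis"
    then have n1: "zorder f l = 1" using n by simp
    define P where "P = zor_poly f l"
    have "P holomorphic_on ball l r" using r(3) unfolding P_def by (rule holomorphic_on_subset) auto
    from holomorphic_derivI[OF this open_ball, of l] have "(P has_field_derivative deriv P l) (at l)" using r by simp
    then have "((\<lambda>w. P w * (w - l)) has_field_derivative P l) (at l)"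
      by (auto intro!: derivative_eq_intros)
    moreover have "P w * (w - l) = f w" if "w \<in> ball l r" for w
      using r(4) that n1 by (auto simp: P_def)
    ultimately have "(f has_field_derivative P l) (at l)"
      using has_field_derivative_transform_within_open[OF _ open_ball, of "\<lambda>w. P w * (w - l)" "P l" l l r f] r(1) by simp
    then have "P l = 0" using d DERIV_imp_deriv by metis
    then show False using r by (auto simp: P_def)
  qed
qed

text \<open>Locally f is an even power of z - l times a function without zeros, and the latter has a
  holomorphic root on a ball.\<close>

lemma holomorphic_local_sqrt:
  assumes f: "f holomorphic_on (- {0})" and w: "w \<noteq> 0" "f w \<noteq> 0" and l: "l \<noteq> 0" and e: "even (zorder f l)"
  obtains r g where "0 < r" "ball l r \<subseteq> - {0}" "g holomorphic_on ball l r" "\<And>z. z \<in> ball l r \<Longrightarrow> f z = (g z)\<^sup>2"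
proof -
  have oC: "open (- {0 :: complex})" by (simp add: open_Compl)
  have lC: "l \<in> - {0}" using l by simp
  define P where "P = zor_poly f l"
  have ex: "\<exists>w\<in>- {0}. f w \<noteq> 0" using w by blast
  obtain r where r: "0 < r" "cball l r \<subseteq> - {0}" "P holomorphic_on cball l r"
    "\<forall>w\<in>cball l r. f w = P w * (w - l) ^ nat (zorder f l) \<and> P w \<noteq> 0"
    using conjunct2[OF zorder_exist_zero[OF f oC connected_punctured_plane lC ex]] unfolding P_def by blast
  have n: "0 \<le> zorder f l"
    using conjunct1[OF zorder_exist_zero[OF f oC connected_punctured_plane lC ex]] by (auto split: if_splits)
  obtain k where k: "nat (zorder f l) = 2 * k" using e n even_nat_iff by (metis evenE)
  have "P holomorphic_on ball l r" using r(3) by (rule holomorphic_on_subset) auto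
  moreover have "contractible (ball l r)" by (intro convex_imp_contractible convex_ball)
  ultimately obtain h where h: "h holomorphic_on ball l r" "\<And>z. z \<in> ball l r \<Longrightarrow> P z = (h z)\<^sup>2"
    using contractible_imp_holomorphic_sqrt[of P "ball l r"] r(4) by (metis mem_ball mem_cball less_imp_le)
  show ?thesis
  proof (rule that[of r "\<lambda>z. h z * (z - l) ^ k"])
    show "(\<lambda>z. h z * (z - l) ^ k) holomorphic_on ball l r" by (intro holomorphic_intros h)
    fix z assume "z \<in> ball l r"
    then show "f z = (h z * (z - l) ^ k)\<^sup>2" using r(4) h(2)[of z] k
      by (simp add: power_mult_distrib power_mult[symmetric] mult.commute)
  qed (use r in auto)
qed

lemma curve_discriminant: "(l, \<mu>) \<in> spectral_curve \<Delta> \<longleftrightarrow> l \<noteq> 0 \<and> (2 * \<mu> - \<Delta> l)\<^sup>2 = (\<Delta> l)\<^sup>2 - 4"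
proof -
  have "(2 * \<mu> - \<Delta> l)\<^sup>2 - ((\<Delta> l)\<^sup>2 - 4) = 4 * (\<mu>\<^sup>2 - \<Delta> l * \<mu> + 1)" by (simp add: power2_eq_square algebra_simps)
  then have "(2 * \<mu> - \<Delta> l)\<^sup>2 = (\<Delta> l)\<^sup>2 - 4 \<longleftrightarrow> \<mu>\<^sup>2 - \<Delta> l * \<mu> + 1 = 0"
    by (metis eq_iff_diff_eq_0 mult_eq_0_iff zero_neq_numeral)
  then show ?thesis by (simp add: spectral_curve_def)
qed

text \<open>The quadratic formula with a holomorphic root \<open>g\<close> of the discriminant. The
  sign \<open>s\<close> selects the sheet through the given point.\<close>

lemma curve_local_section:
  assumes D: "\<Delta> holomorphic_on (- {0})" and w: "w \<noteq> 0" "(\<Delta> w)\<^sup>2 - 4 \<noteq> 0"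
    and p: "(l, \<mu>) \<in> spectral_curve \<Delta>" and e: "even (zorder (\<lambda>l. (\<Delta> l)\<^sup>2 - 4) l)"
  obtains r m where "0 < r" "m holomorphic_on ball l r" "m l = \<mu>" "\<And>z. z \<in> ball l r \<Longrightarrow> (z, m z) \<in> spectral_curve \<Delta>"
proof -
  have f: "(\<lambda>l. (\<Delta> l)\<^sup>2 - 4) holomorphic_on (- {0})" by (intro holomorphic_intros D)
  have l: "l \<noteq> 0" "(2 * \<mu> - \<Delta> l)\<^sup>2 = (\<Delta> l)\<^sup>2 - 4" using p by (auto simp: curve_discriminant)
  obtain r g where g: "0 < r" "ball l r \<subseteq> - {0}" "g holomorphic_on ball l r"
    "\<And>z. z \<in> ball l r \<Longrightarrow> (\<Delta> z)\<^sup>2 - 4 = (g z)\<^sup>2"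
    by (rule holomorphic_local_sqrt[OF f w l(1) e]) (rule that)
  have "(2 * \<mu> - \<Delta> l)\<^sup>2 = (g l)\<^sup>2" using l(2) g by simp
  then obtain s :: complex where s: "s\<^sup>2 = 1" "2 * \<mu> - \<Delta> l = s * g l"
    unfolding power2_eq_iff by (metis mult_1 mult_minus1 power2_minus one_power2)
  show ?thesis
  proof (rule that[of r "\<lambda>z. (\<Delta> z + s * g z) / 2"])
    show "(\<lambda>z. (\<Delta> z + s * g z) / 2) holomorphic_on ball l r"
      by (intro holomorphic_intros g(3) holomorphic_on_subset[OF D g(2)]) simp
    show "(\<Delta> l + s * g l) / 2 = \<mu>" unfolding s(2)[symmetric] by simp
    fix z assume z: "z \<in> ball l r"
    then have "z \<noteq> 0" using g(2) by blast
    moreover have "2 * ((\<Delta> z + s * g z) / 2) - \<Delta> z = s * g z" by (simp add: field_simps)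
    then have "(2 * ((\<Delta> z + s * g z) / 2) - \<Delta> z)\<^sup>2 = s\<^sup>2 * (g z)\<^sup>2" by (simp only: power_mult_distrib)
    ultimately show "(z, (\<Delta> z + s * g z) / 2) \<in> spectral_curve \<Delta>"
      unfolding curve_discriminant using g(4)[OF z] s(1) by simp
  qed (rule g(1))
qed

text \<open>A section m through the point makes 2 m - Delta a holomorphic root of the discriminant,
  whose order is then even. Conversely an even order provides a section by
  \<open>curve_local_section\<close>.\<close>

lemma fst_branch_points:
  assumes D: "\<Delta> holomorphic_on (- {0})" and w: "w \<noteq> 0" "(\<Delta> w)\<^sup>2 - 4 \<noteq> 0"
  defines "f \<equiv> \<lambda>l. (\<Delta> l)\<^sup>2 - 4"
  shows "fst ` branch_points \<Delta> = {l \<in> Cstar_zeros f. odd (zorder f l)}"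
proof (intro set_eqI iffI)
  have f: "f holomorphic_on (- {0})" unfolding f_def by (intro holomorphic_intros D)
  fix l
  show "l \<in> {l \<in> Cstar_zeros f. odd (zorder f l)}" if b: "l \<in> fst ` branch_points \<Delta>"
  proof -
    obtain \<mu> where q: "(l, \<mu>) \<in> branch_points \<Delta>" using b by force
    then have p: "(l, \<mu>) \<in> spectral_curve \<Delta>"
      and n: "\<not> (\<exists>r m. 0 < r \<and> m holomorphic_on ball l r \<and> m l = \<mu> \<and> (\<forall>z\<in>ball l r. (z, m z) \<in> spectral_curve \<Delta>))"
      unfolding branch_points_def by blast+
    have l: "l \<noteq> 0" using p by (simp add: spectral_curve_def)
    have o: "odd (zorder f l)"
    proof
      assume "even (zorder f l)"
      then show False using curve_local_section[OF D w p] n unfolding f_def by metis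
    qed
    moreover have "f l = 0"
    proof (rule ccontr)
      assume "f l \<noteq> 0"
      then have "zorder f l = 0" using analytic_at_punctured[OF f l] by (intro zorder_eq_0I)
      then show False using o by simp
    qed
    ultimately show ?thesis using l by (simp add: Cstar_zeros_def)
  qed
  assume "l \<in> {l \<in> Cstar_zeros f. odd (zorder f l)}"
  then have l: "l \<noteq> 0" "f l = 0" "odd (zorder f l)" by (auto simp: Cstar_zeros_def)
  have fr: "\<exists>\<^sub>F w in at l. f w \<noteq> 0" using frequently_nonzero_punctured(2)[OF f w(1) _ l(1)] w(2) by (simp add: f_def)
  have "(l, \<Delta> l / 2) \<in> branch_points \<Delta>"
    unfolding branch_points_def
  proof (intro CollectI case_prodI conjI notI)
    show "(l, \<Delta> l / 2) \<in> spectral_curve \<Delta>" unfolding curve_discriminant using l by (simp add: f_def)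
    assume "\<exists>r m. 0 < r \<and> m holomorphic_on ball l r \<and> m l = \<Delta> l / 2 \<and> (\<forall>z\<in>ball l r. (z, m z) \<in> spectral_curve \<Delta>)"
    then obtain r m where m: "0 < r" "m holomorphic_on ball l r" "\<And>z. z \<in> ball l r \<Longrightarrow> (z, m z) \<in> spectral_curve \<Delta>"
      by blast
    define g where "g z = 2 * m z - \<Delta> z" for z
    have fg: "(g z) ^ 2 = f z" "z \<noteq> 0" if "z \<in> ball l r" for z
      using m(3)[OF that] unfolding curve_discriminant g_def f_def by auto
    have "ball l r \<subseteq> - {0}" using fg(2) by blast
    then have "g holomorphic_on ball l r"
      unfolding g_def[abs_def] using D by (intro holomorphic_intros m(2)) (rule holomorphic_on_subset)
    then have "g analytic_on {l}" unfolding analytic_at using m(1) by (intro exI[of _ "ball l r"]) auto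
    then have gm: "g meromorphic_on {l}" by (rule analytic_on_imp_meromorphic_on)
    have ev: "\<forall>\<^sub>F z in at l. (g z) ^ 2 = f z"
      using eventually_at_ball[OF m(1), of l UNIV] by eventually_elim (use fg(1) in auto)
    have "\<exists>\<^sub>F z in at l. g z \<noteq> 0" using frequently_eventually_conj[OF fr ev] by (rule frequently_elim1) auto
    from zorder_power[OF gm this, of 2] have "zorder (\<lambda>z. (g z) ^ 2) l = 2 * zorder g l" by simp
    moreover have "zorder (\<lambda>z. (g z) ^ 2) l = zorder f l" by (rule zorder_cong[OF ev refl])
    ultimately show False using l(3) by simp
  qed
  then show "l \<in> fst ` branch_points \<Delta>" by force
qed

lemma singular_points_iff:
  assumes D: "\<Delta> holomorphic_on (- {0})"
  shows "(l, \<mu>) \<in> singular_points \<Delta> \<longleftrightarrow> l \<noteq> 0 \<and> (\<Delta> l)\<^sup>2 = 4 \<and> 2 * \<mu> = \<Delta> l \<and> deriv \<Delta> l = 0"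
proof (cases "l = 0")
  case False
  have D': "(\<Delta> has_field_derivative deriv \<Delta> l) (at l)"
    using False by (intro holomorphic_derivI[OF D]) (auto simp: open_Compl)
  have "((\<lambda>z. \<mu>\<^sup>2 - \<Delta> z * \<mu> + 1) has_field_derivative - (deriv \<Delta> l * \<mu>)) (at l)"
    by (auto intro!: derivative_eq_intros D')
  then have 1: "deriv (\<lambda>z. \<mu>\<^sup>2 - \<Delta> z * \<mu> + 1) l = - (deriv \<Delta> l * \<mu>)" by (rule DERIV_imp_deriv)
  have "((\<lambda>w. w\<^sup>2 - \<Delta> l * w + 1) has_field_derivative 2 * \<mu> - \<Delta> l) (at \<mu>)"
    by (auto intro!: derivative_eq_intros)
  then have 2: "deriv (\<lambda>w. w\<^sup>2 - \<Delta> l * w + 1) \<mu> = 2 * \<mu> - \<Delta> l" by (rule DERIV_imp_deriv)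
  have "\<mu> \<noteq> 0" if "(\<Delta> l)\<^sup>2 = 4" "2 * \<mu> = \<Delta> l" using that by auto
  then show ?thesis
    unfolding singular_points_def mem_Collect_eq case_prod_conv curve_discriminant 1 2 using False by auto
qed (simp add: singular_points_def spectral_curve_def)

text \<open>The derivative of Delta^2 - 4 is 2 Delta Delta', and Delta = 2 or -2 at its zeros; so a
  multiple zero means Delta' = 0.\<close>

lemma fst_singular_points:
  assumes D: "\<Delta> holomorphic_on (- {0})" and w: "w \<noteq> 0" "(\<Delta> w)\<^sup>2 - 4 \<noteq> 0"
  defines "f \<equiv> \<lambda>l. (\<Delta> l)\<^sup>2 - 4"
  shows "fst ` singular_points \<Delta> = {l \<in> Cstar_zeros f. 2 \<le> zorder f l}"
proof -
  have f: "f holomorphic_on (- {0})" unfolding f_def by (intro holomorphic_intros D)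
  have d: "deriv f l = 0 \<longleftrightarrow> deriv \<Delta> l = 0" if "l \<noteq> 0" "(\<Delta> l)\<^sup>2 = 4" for l
  proof -
    have "(\<Delta> has_field_derivative deriv \<Delta> l) (at l)"
      using that by (intro holomorphic_derivI[OF D]) (auto simp: open_Compl)
    then have "(f has_field_derivative 2 * \<Delta> l * deriv \<Delta> l) (at l)"
      unfolding f_def by (auto intro!: derivative_eq_intros)
    then have "deriv f l = 2 * \<Delta> l * deriv \<Delta> l" by (rule DERIV_imp_deriv)
    moreover have "\<Delta> l \<noteq> 0" using that by auto
    ultimately show ?thesis by simp
  qed
  have "fst ` singular_points \<Delta> = {l. l \<noteq> 0 \<and> (\<Delta> l)\<^sup>2 = 4 \<and> deriv \<Delta> l = 0}"
  proof (intro set_eqI iffI)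
    fix l assume "l \<in> fst ` singular_points \<Delta>"
    then obtain \<mu> where "(l, \<mu>) \<in> singular_points \<Delta>" by force
    then show "l \<in> {l. l \<noteq> 0 \<and> (\<Delta> l)\<^sup>2 = 4 \<and> deriv \<Delta> l = 0}" unfolding singular_points_iff[OF D] by simp
  next
    fix l assume "l \<in> {l. l \<noteq> 0 \<and> (\<Delta> l)\<^sup>2 = 4 \<and> deriv \<Delta> l = 0}"
    then have "(l, \<Delta> l / 2) \<in> singular_points \<Delta>" unfolding singular_points_iff[OF D] by simp
    then show "l \<in> fst ` singular_points \<Delta>" by force
  qed
  also have "\<dots> = {l. l \<noteq> 0 \<and> f l = 0 \<and> 2 \<le> zorder f l}"
  proof -
    have w': "f w \<noteq> 0" using w(2) by (simp add: f_def)
    have f0: "f l = 0 \<longleftrightarrow> (\<Delta> l)\<^sup>2 = 4" for l by (simp add: f_def)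
    show ?thesis using zorder_ge_2_iff[OF f w(1) w'] d unfolding f0 by blast
  qed
  finally show ?thesis by (simp add: Cstar_zeros_def)
qed

lemma holomorphic_simple_zero:
  assumes g: "g holomorphic_on ball 0 r" and r: "0 < r" and z: "g 0 = 0" "deriv g 0 \<noteq> 0"
  shows "zorder g 0 = 1" "\<forall>\<^sub>F t in at 0. g t \<noteq> 0"
proof -
  have 0: "0 \<in> ball (0 :: complex) r" using r by simp
  show "zorder g 0 = 1" using z by (intro zorder_zero_eqI[OF g open_ball 0]) auto
  obtain s where s: "0 < s" "inj_on g (ball 0 s)"
    using has_complex_derivative_locally_injective[OF g 0 open_ball z(2)] by metis
  have "g t \<noteq> 0" if "t \<in> ball 0 s" "t \<noteq> 0" for t
    using inj_onD[OF s(2), of t 0] that z(1) s(1) by auto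
  then show "\<forall>\<^sub>F t in at 0. g t \<noteq> 0" unfolding eventually_at using s(1) by (intro exI[of _ s]) (auto simp: dist_norm)
qed

section \<open>The spectral divisor\<close>

text \<open>Collects the facts about the monodromy from which the divisor is computed. On the
  connected punctured plane the two nonvanishing conditions make the zeros of \<open>c\<close> and
  of the discriminant isolated.\<close>

locale holomorphic_SL2 =
  fixes M :: "complex \<Rightarrow> complex^2^2"
  assumes holomorphic: "\<And>i j. (\<lambda>l. M l $ i $ j) holomorphic_on (- {0})"
    and det_1: "\<And>l. l \<noteq> 0 \<Longrightarrow> M l $ 1 $ 1 * M l $ 2 $ 2 - M l $ 1 $ 2 * M l $ 2 $ 1 = 1"
    and nonvanishing: "\<exists>l. l \<noteq> 0 \<and> M l $ 2 $ 1 \<noteq> 0" "\<exists>l. l \<noteq> 0 \<and> (trace (M l))\<^sup>2 - 4 \<noteq> 0"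
begin

abbreviation "a l \<equiv> M l $ 1 $ 1"
abbreviation "b l \<equiv> M l $ 1 $ 2"
abbreviation "c l \<equiv> M l $ 2 $ 1"
abbreviation "d l \<equiv> M l $ 2 $ 2"
abbreviation "\<Delta> \<equiv> \<lambda>l. trace (M l)"

lemma trace_holomorphic: "\<Delta> holomorphic_on (- {0})"
  unfolding trace_2 by (intro holomorphic_intros holomorphic)

lemma entry_deriv: "l \<noteq> 0 \<Longrightarrow> ((\<lambda>l. M l $ i $ j) has_field_derivative deriv (\<lambda>l. M l $ i $ j) l) (at l)"
  by (intro holomorphic_derivI[OF holomorphic]) (auto simp: open_Compl)

lemma entry_holomorphic2: "fst q \<noteq> 0 \<Longrightarrow> holomorphic2_at (\<lambda>q. M (fst q) $ i $ j) q"
  by (rule holomorphic2_at_fst[OF entry_deriv])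

lemma entry_isCont: "l \<noteq> 0 \<Longrightarrow> isCont (\<lambda>l. M l $ i $ j) l"
  using entry_deriv DERIV_isCont by blast

lemma curve_iff: "(l, \<mu>) \<in> spectral_curve \<Delta> \<longleftrightarrow> l \<noteq> 0 \<and> (\<mu> - a l) * (\<mu> - d l) = b l * c l"
proof (cases "l = 0")
  case False
  have "\<mu>\<^sup>2 - (a l + d l) * \<mu> + 1 = (\<mu> - a l) * (\<mu> - d l) - b l * c l"
    using det_1[OF False] by (simp add: power2_eq_square algebra_simps)
  then show ?thesis by (simp add: spectral_curve_def trace_2)
qed (simp add: spectral_curve_def)

lemma discriminant_entries: "l \<noteq> 0 \<Longrightarrow> (\<Delta> l)\<^sup>2 - 4 = (a l - d l)\<^sup>2 + 4 * (b l * c l)"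
  using det_1[of l] by (simp add: trace_2 power2_eq_square algebra_simps)

lemma divisor_support_subset:
  assumes p: "(l, \<mu>) \<in> divisor_support M"
  shows "l \<noteq> 0 \<and> c l = 0 \<and> \<mu> = a l"
proof -
  have l: "l \<noteq> 0" using p by (auto simp: divisor_support_def spectral_curve_def)
  have no: False if U: "open U" "(l, \<mu>) \<in> U" "\<And>q. q \<in> U \<Longrightarrow> holomorphic2_at g q"
      "\<And>z w. (z, w) \<in> U \<Longrightarrow> (z, w) \<in> spectral_curve \<Delta> \<Longrightarrow> c z \<noteq> 0 \<Longrightarrow> g (z, w) = (w - d z) / c z" for U g
  proof -
    have "holomorphic2_on g U" unfolding holomorphic2_on_def using U(3)[unfolded holomorphic2_at_def] by (rule ballI)
    moreover have "\<forall>(z, w) \<in> U \<inter> spectral_curve \<Delta>. c z \<noteq> 0 \<longrightarrow> g (z, w) = eigen_quotient M (z, w)"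
      using U(4) by (auto simp: eigen_quotient_def)
    ultimately have "\<exists>U g. open U \<and> (l, \<mu>) \<in> U \<and> holomorphic2_on g U \<and>
        (\<forall>(z, w) \<in> U \<inter> spectral_curve \<Delta>. c z \<noteq> 0 \<longrightarrow> g (z, w) = eigen_quotient M (z, w))"
      using U(1,2) by (intro exI[of _ U] exI[of _ g] conjI)
    then show False using p unfolding divisor_support_def mem_Collect_eq by (elim conjE notE)
  qed
  have oC: "open (- {0 :: complex})" by (simp add: open_Compl)
  have cont: "continuous_on (- {0}) (\<lambda>l. M l $ i $ j)" for i j
    by (rule holomorphic_on_imp_continuous_on[OF holomorphic])
  have c: "c l = 0"
  proof (rule ccontr)
    assume cl: "c l \<noteq> 0"
    define V where "V = - {0} \<inter> c -` (- {0})"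
    have "open V" unfolding V_def by (rule continuous_open_preimage[OF cont oC oC])
    then have "open (V \<times> (UNIV :: complex set))" by (intro open_Times) auto
    have "(l, \<mu>) \<in> V \<times> UNIV" using l cl by (simp add: V_def)
    have "holomorphic2_at (\<lambda>q. (snd q - d (fst q)) / c (fst q)) q" if "q \<in> V \<times> UNIV" for q
      using that by (intro holomorphic2_at_divide holomorphic2_at_diff holomorphic2_at_snd entry_holomorphic2)
        (auto simp: V_def)
    show False
      by (rule no[of "V \<times> UNIV" "\<lambda>q. (snd q - d (fst q)) / c (fst q)"]) (fact | simp)+
  qed
  moreover have "\<mu> = a l"
  proof (rule ccontr)
    assume m: "\<mu> \<noteq> a l"
    define U where "U = ((- {0}) \<times> UNIV) \<inter> (\<lambda>q. snd q - a (fst q)) -` (- {0})"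
    have "continuous_on ((- {0}) \<times> UNIV) (\<lambda>q. a (fst q))"
      by (rule continuous_on_compose2[OF cont continuous_on_fst[OF continuous_on_id]]) auto
    then have "continuous_on ((- {0}) \<times> UNIV) (\<lambda>q :: complex \<times> complex. snd q - a (fst q))"
      by (intro continuous_on_diff continuous_on_snd continuous_on_id)
    then have "open U" unfolding U_def by (rule continuous_open_preimage) (auto intro!: open_Times oC)
    have "(l, \<mu>) \<in> U" using l m by (simp add: U_def)
    have "holomorphic2_at (\<lambda>q. b (fst q) / (snd q - a (fst q))) q" if "q \<in> U" for q
      using that by (intro holomorphic2_at_divide holomorphic2_at_diff holomorphic2_at_snd entry_holomorphic2)
        (auto simp: U_def)
    have "b z / (w - a z) = (w - d z) / c z"
      if h: "(z, w) \<in> U" "(z, w) \<in> spectral_curve \<Delta>" "c z \<noteq> 0" for z w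
    proof -
      have "w - a z \<noteq> 0" using h(1) by (simp add: U_def)
      moreover have "(w - a z) * (w - d z) = b z * c z" using h(2) curve_iff by blast
      ultimately show ?thesis using h(3) by (simp add: field_simps)
    qed
    show False
      by (rule no[of U "\<lambda>q. b (fst q) / (snd q - a (fst q))"]) (fact | simp only: fst_conv snd_conv)+
  qed
  ultimately show ?thesis using l by simp
qed

text \<open>The two eigenvalues satisfy (w1 - a) (w2 - a) = - b c, so one of the factors has modulus
  at most the root of |b c|.\<close>

lemma eigenvalue_near_diagonal:
  assumes "z \<noteq> 0"
  obtains w where "(z, w) \<in> spectral_curve \<Delta>" "cmod (w - a z) \<le> sqrt (cmod (b z * c z))"
proof -
  define s where "s = csqrt ((\<Delta> z)\<^sup>2 - 4)"
  define w1 w2 where "w1 = (\<Delta> z + s) / 2" and "w2 = (\<Delta> z - s) / 2"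
  have s2: "s\<^sup>2 = (\<Delta> z)\<^sup>2 - 4" by (simp add: s_def)
  have e: "2 * w1 - \<Delta> z = s" "2 * w2 - \<Delta> z = - s" by (simp_all add: w1_def w2_def field_simps)
  have cv: "(z, w1) \<in> spectral_curve \<Delta>" "(z, w2) \<in> spectral_curve \<Delta>"
    unfolding curve_discriminant e using s2 assms by simp_all
  have "w1 - d z = a z - w2" by (simp add: w1_def w2_def trace_2 field_simps)
  then have "(w1 - a z) * (w2 - a z) = - (b z * c z)" using cv(1) unfolding curve_iff
    by (metis minus_diff_eq mult_minus_right)
  then have m: "cmod (w1 - a z) * cmod (w2 - a z) = cmod (b z * c z)" by (metis norm_minus_cancel norm_mult)
  define S where "S = sqrt (cmod (b z * c z))"
  have "\<not> (S < cmod (w1 - a z) \<and> S < cmod (w2 - a z))"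
  proof
    assume h: "S < cmod (w1 - a z) \<and> S < cmod (w2 - a z)"
    have "S * S < cmod (w1 - a z) * cmod (w2 - a z)"
      using h by (intro mult_strict_mono') (auto simp: S_def)
    then show False using m by (simp add: S_def)
  qed
  then show ?thesis using that cv unfolding S_def by (meson not_le)
qed

text \<open>If the quotient extended to a holomorphic \<open>g\<close>, then \<open>\<mu> - d = g c\<close> would tend to \<open>0\<close> along
  eigenvalues tending to \<open>a l\<close>, so \<open>a l = d l\<close> and both eigenvalues \<open>\<mu>\<^sub>1, \<mu>\<^sub>2\<close> tend to \<open>a l\<close>. But
  \<open>g (z, \<mu>\<^sub>1) - g (z, \<mu>\<^sub>2) = (\<mu>\<^sub>1 - \<mu>\<^sub>2) / c z\<close> contradicts the Lipschitz continuity of \<open>g\<close>.\<close>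

lemma divisor_support_superset:
  assumes l: "l \<noteq> 0" and cl: "c l = 0"
  shows "(l, a l) \<in> divisor_support M"
proof (rule ccontr)
  assume n: "(l, a l) \<notin> divisor_support M"
  have "(l, a l) \<in> spectral_curve \<Delta>" using l cl by (simp add: curve_iff)
  then have "\<exists>U g. open U \<and> (l, a l) \<in> U \<and> holomorphic2_on g U \<and>
      (\<forall>(z, w) \<in> U \<inter> spectral_curve \<Delta>. c z \<noteq> 0 \<longrightarrow> g (z, w) = eigen_quotient M (z, w))"
    using n unfolding divisor_support_def mem_Collect_eq by (simp only: not_not simp_thms)
  then obtain U g where U: "open U" "(l, a l) \<in> U" and hol2: "holomorphic2_on g U"
    and eq: "\<forall>(z, w) \<in> U \<inter> spectral_curve \<Delta>. c z \<noteq> 0 \<longrightarrow> g (z, w) = eigen_quotient M (z, w)"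
    by (elim exE conjE) (rule that)
  have hol_at: "holomorphic2_at g q" if "q \<in> U" for q
    using hol2 that unfolding holomorphic2_on_def holomorphic2_at_def by (rule bspec)
  have quotient: "g (z, w) = (w - d z) / c z" if "(z, w) \<in> U" "(z, w) \<in> spectral_curve \<Delta>" "c z \<noteq> 0" for z w
    using bspec[OF eq, of "(z, w)"] that by (simp add: eigen_quotient_def)
  define C where "C = cmod (g (l, a l)) + 1"
  have C0: "0 < C" unfolding C_def by (simp add: add_nonneg_pos)
  have "\<forall>\<^sub>F q in nhds (l, a l). q \<in> U" using U(1,2) by (rule eventually_nhds_in_open)
  moreover have "\<forall>\<^sub>F q in nhds (l, a l). dist (g q) (g (l, a l)) < 1"
    using holomorphic2_at_isCont[OF hol_at[OF U(2)]] unfolding isCont_def tendsto_at_iff_tendsto_nhds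
    by (rule tendstoD) simp
  ultimately have "\<forall>\<^sub>F q in nhds l \<times>\<^sub>F nhds (a l). q \<in> U \<and> dist (g q) (g (l, a l)) < 1"
    unfolding nhds_prod[symmetric] by eventually_elim simp
  then obtain P Q where PQ: "eventually P (nhds l)" "eventually Q (nhds (a l))"
    "\<And>z w. P z \<Longrightarrow> Q w \<Longrightarrow> (z, w) \<in> U \<and> dist (g (z, w)) (g (l, a l)) < 1"
    unfolding eventually_prod_filter by blast
  obtain e where e: "0 < e" "\<And>w. dist w (a l) < e \<Longrightarrow> Q w"
    using PQ(2) unfolding eventually_nhds_metric by blast
  \<comment> \<open>A product neighbourhood, so that all slices \<open>g (z, -)\<close> share the
    radius \<open>e\<close> and the bound \<open>C\<close>, and hence one Lipschitz
    constant.\<close>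
  have box: "(z, w) \<in> U" "cmod (g (z, w)) \<le> C" if "P z" "dist w (a l) < e" for z w
  proof -
    have h: "(z, w) \<in> U" "dist (g (z, w)) (g (l, a l)) < 1" using PQ(3)[OF that(1) e(2)[OF that(2)]] by auto
    then show "(z, w) \<in> U" by simp
    show "cmod (g (z, w)) \<le> C"
      using norm_triangle_ineq2[of "g (z, w)" "g (l, a l)"] h(2) unfolding C_def dist_norm by linarith
  qed
  have evP: "eventually P (at l)" using PQ(1) unfolding eventually_at_filter by (rule eventually_mono) simp
  have ev0: "\<forall>\<^sub>F z in at l. z \<noteq> 0" by (rule eventually_neq_at_within)
  obtain w1 where "w1 \<noteq> 0" "c w1 \<noteq> 0" using nonvanishing(1) by blast
  from frequently_nonzero_punctured(1)[OF holomorphic this l] have evc: "\<forall>\<^sub>F z in at l. c z \<noteq> 0" .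
  have fh: "(\<lambda>l. (\<Delta> l)\<^sup>2 - 4) holomorphic_on (- {0})" by (intro holomorphic_intros trace_holomorphic)
  obtain w2 where "w2 \<noteq> 0" "(\<Delta> w2)\<^sup>2 - 4 \<noteq> 0" using nonvanishing(2) by blast
  from frequently_nonzero_punctured(1)[OF fh this l] have evf: "\<forall>\<^sub>F z in at l. (\<Delta> z)\<^sup>2 - 4 \<noteq> 0" .
  have tend: "((\<lambda>z. M z $ i $ j) \<longlongrightarrow> M l $ i $ j) (at l)" for i j
    using entry_isCont[OF l] by (simp add: isCont_def)
  have "((\<lambda>z. sqrt (cmod (b z * c z)) + cmod (a z - a l)) \<longlongrightarrow> sqrt (cmod (b l * c l)) + cmod (a l - a l)) (at l)"
    by (intro tendsto_intros tend)
  then have t1: "((\<lambda>z. sqrt (cmod (b z * c z)) + cmod (a z - a l)) \<longlongrightarrow> 0) (at l)" by (simp add: cl)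
  have ev1: "\<forall>\<^sub>F z in at l. sqrt (cmod (b z * c z)) + cmod (a z - a l) < e" by (rule order_tendstoD(2)[OF t1 e(1)])
  \<comment> \<open>The three errors between \<open>a l\<close> and \<open>d l\<close>: from
    \<open>a l\<close> to the eigenvalue, from there to \<open>d z\<close>, and from
    \<open>d z\<close> to \<open>d l\<close>. All tend to 0 because \<open>c l = 0\<close>.\<close>
  define H where "H z = (sqrt (cmod (b z * c z)) + cmod (a z - a l)) + C * cmod (c z) + cmod (d z - d l)" for z
  have "\<forall>\<^sub>F z in at l. cmod (a l - d l) \<le> H z"
    using evP ev0 evc ev1
  proof eventually_elim
    case (elim z)
    obtain w where w: "(z, w) \<in> spectral_curve \<Delta>" "cmod (w - a z) \<le> sqrt (cmod (b z * c z))"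
      by (rule eigenvalue_near_diagonal[OF elim(2)])
    have dw: "cmod (w - a l) \<le> sqrt (cmod (b z * c z)) + cmod (a z - a l)"
      using norm_triangle_ineq[of "w - a z" "a z - a l"] w(2) by simp
    then have "dist w (a l) < e" using elim(4) by (simp add: dist_norm)
    note bx = box[OF elim(1) this]
    have "w - d z = g (z, w) * c z" using quotient[OF bx(1) w(1) elim(3)] elim(3) by simp
    then have "cmod (w - d z) \<le> C * cmod (c z)" using bx(2) by (simp add: norm_mult mult_right_mono)
    moreover have "cmod (a l - d l) \<le> cmod (w - a l) + cmod (w - d z) + cmod (d z - d l)"
      using norm_triangle_ineq[of "- (w - a l)" "w - d z + (d z - d l)"] norm_triangle_ineq[of "w - d z" "d z - d l"]
      by (simp add: norm_minus_commute)
    ultimately show ?case using dw unfolding H_def by linarith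
  qed
  moreover have "(H \<longlongrightarrow> 0 + C * cmod (c l) + cmod (d l - d l)) (at l)"
    unfolding H_def[abs_def] by (intro tendsto_intros t1 tend)
  ultimately have "cmod (a l - d l) \<le> 0 + C * cmod (c l) + cmod (d l - d l)"
    by (intro tendsto_lowerbound) auto
  then have ad: "d l = a l" by (simp add: cl)
  define s where "s z = csqrt ((\<Delta> z)\<^sup>2 - 4)" for z
  have ns: "cmod (s z) = sqrt (cmod ((\<Delta> z)\<^sup>2 - 4))" for z by (simp add: s_def norm_csqrt)
  have D: "(\<Delta> \<longlongrightarrow> \<Delta> l) (at l)" unfolding trace_2 by (intro tendsto_intros tend)
  have "((\<lambda>z. sqrt (cmod ((\<Delta> z)\<^sup>2 - 4)) / 2 + cmod (\<Delta> z / 2 - a l)) \<longlongrightarrow>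
      sqrt (cmod ((\<Delta> l)\<^sup>2 - 4)) / 2 + cmod (\<Delta> l / 2 - a l)) (at l)"
    by (intro tendsto_intros D) simp_all
  moreover have "(\<Delta> l)\<^sup>2 - 4 = 0" using discriminant_entries[OF l] cl ad by simp
  moreover have "\<Delta> l / 2 - a l = 0" by (simp add: trace_2 ad)
  ultimately have t2: "((\<lambda>z. sqrt (cmod ((\<Delta> z)\<^sup>2 - 4)) / 2 + cmod (\<Delta> z / 2 - a l)) \<longlongrightarrow> 0) (at l)"
    by (simp only: norm_zero real_sqrt_zero) simp
  have ev2: "\<forall>\<^sub>F z in at l. sqrt (cmod ((\<Delta> z)\<^sup>2 - 4)) / 2 + cmod (\<Delta> z / 2 - a l) < e / 2"
    by (rule order_tendstoD(2)[OF t2]) (use e in simp)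
  have "\<forall>\<^sub>F z in at l. 1 \<le> (4 * C / e) * cmod (c z)"
    using evP ev0 evc evf ev2
  proof eventually_elim
    case (elim z)
    define w1 w2 where "w1 = (\<Delta> z + s z) / 2" and "w2 = (\<Delta> z - s z) / 2"
    have s2: "(s z)\<^sup>2 = (\<Delta> z)\<^sup>2 - 4" by (simp add: s_def)
    have eq: "2 * w1 - \<Delta> z = s z" "2 * w2 - \<Delta> z = - s z" by (simp_all add: w1_def w2_def field_simps)
    have cv: "(z, w1) \<in> spectral_curve \<Delta>" "(z, w2) \<in> spectral_curve \<Delta>"
      unfolding curve_discriminant eq using s2 elim(2) by simp_all
    have "w1 - a l = s z / 2 + (\<Delta> z / 2 - a l)" "w2 - a l = - (s z / 2) + (\<Delta> z / 2 - a l)"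
      by (simp_all add: w1_def w2_def add_divide_distrib diff_divide_distrib)
    then have w12a: "cmod (w1 - a l) = cmod (s z / 2 + (\<Delta> z / 2 - a l))"
      "cmod (w2 - a l) = cmod (- (s z / 2) + (\<Delta> z / 2 - a l))" by (simp_all only:)
    have "cmod (w1 - a l) \<le> cmod (s z) / 2 + cmod (\<Delta> z / 2 - a l)"
      "cmod (w2 - a l) \<le> cmod (s z) / 2 + cmod (\<Delta> z / 2 - a l)"
      using norm_triangle_ineq[of "s z / 2" "\<Delta> z / 2 - a l"] norm_triangle_ineq[of "- (s z / 2)" "\<Delta> z / 2 - a l"]
      unfolding w12a by (simp_all only: norm_minus_cancel norm_divide norm_numeral)
    then have wb: "w1 \<in> ball (a l) (e / 2)" "w2 \<in> ball (a l) (e / 2)"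
      using elim(5) ns[of z] by (simp_all add: dist_norm norm_minus_commute)
    have wd: "dist w1 (a l) < e" "dist w2 (a l) < e" using wb e(1) by (simp_all add: dist_commute)
    have "cmod (g (z, w1) - g (z, w2)) \<le> (4 * C / e) * cmod (w1 - w2)"
    proof (rule holomorphic_bounded_Lipschitz[OF _ e(1) _ wb])
      show "(\<lambda>w. g (z, w)) holomorphic_on ball (a l) e"
        unfolding holomorphic_on_def
      proof
        fix w assume "w \<in> ball (a l) e"
        then have "(z, w) \<in> U" using box(1)[OF elim(1), of w] by (simp add: dist_commute)
        then show "(\<lambda>w. g (z, w)) field_differentiable at w within ball (a l) e"
          by (rule field_differentiable_at_within[OF holomorphic2_at_slice[OF hol_at]])
      qed
      show "cmod (g (z, w)) \<le> C" if "w \<in> ball (a l) e" for w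
        using box(2)[OF elim(1), of w] that by (simp add: dist_commute)
    qed
    moreover have "g (z, w1) - g (z, w2) = (w1 - w2) / c z"
      unfolding quotient[OF box(1)[OF elim(1) wd(1)] cv(1) elim(3)] quotient[OF box(1)[OF elim(1) wd(2)] cv(2) elim(3)]
      by (simp add: diff_divide_distrib[symmetric])
    moreover have w12: "w1 - w2 = s z" by (simp add: w1_def w2_def field_simps)
    ultimately have "cmod (s z) / cmod (c z) \<le> (4 * C / e) * cmod (s z)" by (simp only: norm_divide)
    moreover have "0 < cmod (s z)" using elim(4) s2 by auto
    moreover have "0 < cmod (c z)" using elim(3) by simp
    ultimately have "cmod (s z) \<le> ((4 * C / e) * cmod (s z)) * cmod (c z)"
      using pos_divide_le_eq by blast
    then have "cmod (s z) * 1 \<le> cmod (s z) * ((4 * C / e) * cmod (c z))"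
      by (simp only: mult_1_right mult.assoc mult.left_commute)
    then show ?case using \<open>0 < cmod (s z)\<close> mult_le_cancel_left_pos by blast
  qed
  moreover have "((\<lambda>z. (4 * C / e) * cmod (c z)) \<longlongrightarrow> (4 * C / e) * cmod (c l)) (at l)"
    by (intro tendsto_intros tend)
  ultimately have "1 \<le> (4 * C / e) * cmod (c l)" by (intro tendsto_lowerbound) auto
  then show False by (simp add: cl)
qed

lemma divisor_support_eq: "divisor_support M = (\<lambda>l. (l, a l)) ` Cstar_zeros c"
  using divisor_support_subset divisor_support_superset by (fastforce simp: Cstar_zeros_def)

text \<open>If \<open>a l \<noteq> d l\<close>, the curve is parametrised by l and the numerator of
  (mu - d) / c is nonzero, so the pole has the order of the zero of \<open>c\<close>. If
  \<open>a l = d l\<close>, regularity forces Delta' \<noteq> 0: the curve is parametrised by mu,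
  \<open>c\<close> has a simple zero, \<open>b\<close> is nonzero, and b / (mu - a) has a simple
  pole.\<close>

lemma eigen_quotient_zorder:
  assumes l: "l \<noteq> 0" and cl: "c l = 0" and reg: "(l, a l) \<notin> singular_points \<Delta>"
    and r: "0 < r" and h: "\<phi> holomorphic_on ball 0 r" "\<psi> holomorphic_on ball 0 r"
    and 0: "\<phi> 0 = l" "\<psi> 0 = a l" and cv: "\<And>t. t \<in> ball 0 r \<Longrightarrow> (\<phi> t, \<psi> t) \<in> spectral_curve \<Delta>"
    and nd: "deriv \<phi> 0 \<noteq> 0 \<or> deriv \<psi> 0 \<noteq> 0"
  shows "zorder (\<lambda>t. eigen_quotient M (\<phi> t, \<psi> t)) 0 = - zorder c l"
proof -
  have b0: "0 \<in> ball (0 :: complex) r" using r by simp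
  have an: "f analytic_on {0}" if "f holomorphic_on ball 0 r" for f
    unfolding analytic_at using that b0 by (intro exI[of _ "ball 0 r"]) auto
  have evb: "\<forall>\<^sub>F t in at 0. t \<in> ball (0 :: complex) r"
    unfolding eventually_at using r by (intro exI[of _ r]) (auto simp: dist_commute)
  have phi: "\<phi> t \<in> - {0}" if "t \<in> ball 0 r" for t using cv[OF that] by (simp add: spectral_curve_def)
  have comp: "(\<lambda>t. M (\<phi> t) $ i $ j) holomorphic_on ball 0 r" for i j
  proof -
    have "\<phi> ` ball 0 r \<subseteq> - {0}" using phi by (rule image_subsetI)
    from holomorphic_on_compose_gen[OF h(1) holomorphic this, of i j] show ?thesis by (simp add: o_def)
  qed
  have dphi: "(\<phi> has_field_derivative deriv \<phi> 0) (at 0)" by (rule holomorphic_derivI[OF h(1) open_ball b0])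
  have dpsi: "(\<psi> has_field_derivative deriv \<psi> 0) (at 0)" by (rule holomorphic_derivI[OF h(2) open_ball b0])
  have dcomp: "((\<lambda>t. M (\<phi> t) $ i $ j) has_field_derivative deriv (\<lambda>l. M l $ i $ j) l * deriv \<phi> 0) (at 0)" for i j
    using DERIV_chain2[OF entry_deriv dphi, of i j] l 0(1) by simp
  define A D where "A t = \<psi> t - a (\<phi> t)" and "D t = \<psi> t - d (\<phi> t)" for t
  have AD: "A t * D t = b (\<phi> t) * c (\<phi> t)" if "t \<in> ball 0 r" for t
    using cv[OF that] by (simp add: curve_iff A_def D_def)
  have hA: "A holomorphic_on ball 0 r" and hD: "D holomorphic_on ball 0 r"
    unfolding A_def[abs_def] D_def[abs_def] by (intro holomorphic_intros h comp)+
  have q: "eigen_quotient M (\<phi> t, \<psi> t) = D t / c (\<phi> t)" for t by (simp add: eigen_quotient_def D_def)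
  have mer: "f meromorphic_on {0}" if "f holomorphic_on ball 0 r" for f
    by (rule analytic_on_imp_meromorphic_on[OF an[OF that]])
  define \<alpha>' \<delta>' where "\<alpha>' = deriv a l" and "\<delta>' = deriv d l"
  have dA: "(A has_field_derivative deriv \<psi> 0 - \<alpha>' * deriv \<phi> 0) (at 0)"
    and dD: "(D has_field_derivative deriv \<psi> 0 - \<delta>' * deriv \<phi> 0) (at 0)"
    unfolding A_def[abs_def] D_def[abs_def] \<alpha>'_def \<delta>'_def by (intro DERIV_diff dpsi dcomp)+
  obtain w1 where "w1 \<noteq> 0" "c w1 \<noteq> 0" using nonvanishing(1) by blast
  from frequently_nonzero_punctured(1)[OF holomorphic this l] have evc: "\<forall>\<^sub>F z in at l. c z \<noteq> 0" .
  \<comment> \<open>The curve equation differentiated at t = 0, where mu - a and c vanish. It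
    decides which of the two coordinates is a local parameter.\<close>
  have dcurve: "(deriv \<psi> 0 - \<alpha>' * deriv \<phi> 0) * (a l - d l) = deriv c l * deriv \<phi> 0 * b l"
  proof -
    have "((\<lambda>t. A t * D t) has_field_derivative
        (deriv \<psi> 0 - \<alpha>' * deriv \<phi> 0) * D 0 + (deriv \<psi> 0 - \<delta>' * deriv \<phi> 0) * A 0) (at 0)"
      by (rule DERIV_mult[OF dA dD])
    then have 1: "((\<lambda>t. b (\<phi> t) * c (\<phi> t)) has_field_derivative
        (deriv \<psi> 0 - \<alpha>' * deriv \<phi> 0) * D 0 + (deriv \<psi> 0 - \<delta>' * deriv \<phi> 0) * A 0) (at 0)"
      by (rule has_field_derivative_transform_within_open[OF _ open_ball b0]) (rule AD)
    have 2: "((\<lambda>t. b (\<phi> t) * c (\<phi> t)) has_field_derivative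
        (deriv b l * deriv \<phi> 0) * c (\<phi> 0) + (deriv c l * deriv \<phi> 0) * b (\<phi> 0)) (at 0)"
      by (rule DERIV_mult[OF dcomp dcomp])
    show ?thesis using DERIV_unique[OF 1 2] 0 by (simp add: cl A_def D_def)
  qed
  show ?thesis
  proof (cases "a l = d l")
    case False
    have phi': "deriv \<phi> 0 \<noteq> 0"
    proof
      assume z: "deriv \<phi> 0 = 0"
      then have "deriv \<psi> 0 = 0" using dcurve False by simp
      then show False using nd z by simp
    qed
    have hp: "(\<lambda>t. \<phi> t - \<phi> 0) holomorphic_on ball 0 r" by (intro holomorphic_intros h)
    have "deriv (\<lambda>t. \<phi> t - \<phi> 0) 0 = deriv \<phi> 0"
      by (rule DERIV_imp_deriv) (auto intro!: derivative_eq_intros dphi)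
    then have sz: "zorder (\<lambda>t. \<phi> t - \<phi> 0) 0 = 1" "\<forall>\<^sub>F t in at 0. \<phi> t - \<phi> 0 \<noteq> 0"
      using holomorphic_simple_zero[OF hp r] phi' by auto
    have evp: "\<forall>\<^sub>F t in at 0. \<phi> t \<noteq> \<phi> 0" using sz(2) by eventually_elim simp
    have can: "c analytic_on {l}" by (rule analytic_at_punctured[OF holomorphic l])
    have zc: "zorder (c \<circ> \<phi>) 0 = zorder c (\<phi> 0) * zorder (\<lambda>t. \<phi> t - \<phi> 0) 0"
      using isolated_singularity_at_analytic[OF can] not_essential_analytic[OF can] evc evp an[OF h(1)]
      by (intro zorder_compose') (simp_all add: 0)
    have "isCont \<phi> 0" using dphi by (rule DERIV_isCont)
    then have "filterlim \<phi> (at l) (at 0)"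
      unfolding filterlim_at isCont_def using evp by (simp add: 0)
    then have evcp: "\<forall>\<^sub>F t in at 0. c (\<phi> t) \<noteq> 0" using evc by (rule eventually_compose_filterlim[rotated])
    have D0: "D 0 \<noteq> 0" using False by (simp add: D_def 0)
    have "isCont D 0" using dD by (rule DERIV_isCont)
    then have evD: "\<forall>\<^sub>F t in at 0. D t \<noteq> 0" unfolding isCont_def using D0 by (rule tendsto_imp_eventually_ne)
    have "zorder (\<lambda>t. D t / c (\<phi> t)) 0 = zorder D 0 - zorder (\<lambda>t. c (\<phi> t)) 0"
      by (rule zorder_divide[OF mer[OF hD] _ mer[OF comp]]) (use evD evcp in \<open>auto intro: eventually_frequently\<close>)
    also have "zorder D 0 = 0" using an[OF hD] D0 by (rule zorder_eq_0I)
    also have "zorder (\<lambda>t. c (\<phi> t)) 0 = zorder c l" using zc sz(1) by (simp add: o_def 0)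
    finally show ?thesis by (simp add: q)
  next
    case True
    have ad1: "a l * a l = 1" using det_1[OF l] cl True by simp
    have Dl: "\<Delta> l = 2 * a l" by (simp add: trace_2 True)
    have "(\<Delta> l)\<^sup>2 = 4" using ad1 by (simp add: Dl power2_eq_square)
    then have D': "deriv \<Delta> l \<noteq> 0" using reg l Dl by (simp add: singular_points_iff[OF trace_holomorphic])
    have dD': "(\<Delta> has_field_derivative deriv \<Delta> l) (at l)"
      using l by (intro holomorphic_derivI[OF trace_holomorphic]) (auto simp: open_Compl)
    have ea: "(a has_field_derivative \<alpha>') (at l)" "(d has_field_derivative \<delta>') (at l)"
      unfolding \<alpha>'_def \<delta>'_def by (intro entry_deriv l)+
    \<comment> \<open>Differentiating Delta^2 - 4 = (a - d)^2 + 4 b c at l leaves 2 Delta Delta' = 4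
      b c', and the left-hand side is nonzero.\<close>
    have bc: "b l \<noteq> 0 \<and> deriv c l \<noteq> 0"
    proof -
      have "((\<lambda>l. (\<Delta> l)\<^sup>2 - 4) has_field_derivative 2 * \<Delta> l * deriv \<Delta> l) (at l)"
        by (auto intro!: derivative_eq_intros dD')
      then have 1: "((\<lambda>l. (a l - d l)\<^sup>2 + 4 * (b l * c l)) has_field_derivative 2 * \<Delta> l * deriv \<Delta> l) (at l)"
        by (rule has_field_derivative_transform_within_open[where S = "- {0}"])
           (use l in \<open>auto simp: open_Compl discriminant_entries\<close>)
      have "((\<lambda>l. (a l - d l)\<^sup>2 + 4 * (b l * c l)) has_field_derivative
          2 * (a l - d l) * (\<alpha>' - \<delta>') + 4 * (deriv b l * c l + deriv c l * b l)) (at l)"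
        by (auto intro!: derivative_eq_intros ea entry_deriv l)
      from DERIV_unique[OF 1 this] have "2 * \<Delta> l * deriv \<Delta> l = 4 * (deriv c l * b l)" by (simp add: True cl)
      moreover have "\<Delta> l \<noteq> 0" using ad1 by (auto simp: Dl)
      ultimately show ?thesis using D' by auto
    qed
    have zc: "zorder c l = 1"
      using bc cl l by (intro zorder_zero_eqI[OF holomorphic]) (auto simp: open_Compl)
    have phi': "deriv \<phi> 0 = 0" using dcurve bc True by simp
    then have psi': "deriv \<psi> 0 \<noteq> 0" using nd by simp
    have "deriv A 0 = deriv \<psi> 0" "deriv D 0 = deriv \<psi> 0"
      using DERIV_imp_deriv[OF dA] DERIV_imp_deriv[OF dD] phi' by simp_all
    moreover have "A 0 = 0" "D 0 = 0" by (simp_all add: A_def D_def 0 True)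
    ultimately have zA: "zorder A 0 = 1" "\<forall>\<^sub>F t in at 0. A t \<noteq> 0" and evD: "\<forall>\<^sub>F t in at 0. D t \<noteq> 0"
      using holomorphic_simple_zero[OF hA r] holomorphic_simple_zero[OF hD r] psi' by simp_all
    have "isCont (\<lambda>t. b (\<phi> t)) 0" using dcomp by (rule DERIV_isCont)
    then have evb': "\<forall>\<^sub>F t in at 0. b (\<phi> t) \<noteq> 0"
      unfolding isCont_def by (rule tendsto_imp_eventually_ne) (use bc in \<open>simp add: 0\<close>)
    have "\<forall>\<^sub>F t in at 0. D t / c (\<phi> t) = b (\<phi> t) / A t"
      using evb zA(2) evD evb'
    proof eventually_elim
      case (elim t)
      have "c (\<phi> t) \<noteq> 0" using AD[OF elim(1)] elim by auto
      then show ?case using AD[OF elim(1)] elim by (simp add: frac_eq_eq mult.commute)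
    qed
    then have "zorder (\<lambda>t. D t / c (\<phi> t)) 0 = zorder (\<lambda>t. b (\<phi> t) / A t) 0" by (rule zorder_cong) simp
    also have "\<dots> = zorder (\<lambda>t. b (\<phi> t)) 0 - zorder A 0"
      by (rule zorder_divide[OF mer[OF comp] _ mer[OF hA]]) (use evb' zA in \<open>auto intro: eventually_frequently\<close>)
    also have "zorder (\<lambda>t. b (\<phi> t)) 0 = 0" using an[OF comp] by (rule zorder_eq_0I) (use bc in \<open>simp add: 0\<close>)
    finally show ?thesis by (simp add: q zA zc)
  qed
qed

text \<open>Over an unramified point a local section serves. At a ramified regular point mu is the
  parameter, and l is recovered from Delta(l) = mu + 1/mu by the local inverse of Delta.\<close>

lemma regular_parametrisation:
  assumes l: "l \<noteq> 0" and cl: "c l = 0" and reg: "(l, a l) \<notin> singular_points \<Delta>"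
  obtains r \<phi> \<psi> where "0 < r" "\<phi> holomorphic_on ball 0 r" "\<psi> holomorphic_on ball 0 r" "\<phi> 0 = l" "\<psi> 0 = a l"
    "\<And>t. t \<in> ball 0 r \<Longrightarrow> (\<phi> t, \<psi> t) \<in> spectral_curve \<Delta>" "deriv \<phi> 0 \<noteq> 0 \<or> deriv \<psi> 0 \<noteq> 0"
proof (cases "a l = d l")
  case False
  obtain w where w: "w \<noteq> 0" "(\<Delta> w)\<^sup>2 - 4 \<noteq> 0" using nonvanishing(2) by blast
  have f: "(\<lambda>l. (\<Delta> l)\<^sup>2 - 4) holomorphic_on (- {0})" by (intro holomorphic_intros trace_holomorphic)
  have "zorder (\<lambda>l. (\<Delta> l)\<^sup>2 - 4) l = 0"
    using analytic_at_punctured[OF f l] by (rule zorder_eq_0I) (use False cl in \<open>simp add: discriminant_entries[OF l]\<close>)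
  then have e: "even (zorder (\<lambda>l. (\<Delta> l)\<^sup>2 - 4) l)" by simp
  have p: "(l, a l) \<in> spectral_curve \<Delta>" using l cl by (simp add: curve_iff)
  obtain r m where m: "0 < r" "m holomorphic_on ball l r" "m l = a l" "\<And>z. z \<in> ball l r \<Longrightarrow> (z, m z) \<in> spectral_curve \<Delta>"
    by (rule curve_local_section[OF trace_holomorphic w p e]) (rule that)
  have lt: "l + t \<in> ball l r" if "t \<in> ball 0 r" for t using that by (simp add: dist_norm)
  show ?thesis
  proof (rule that[of r "\<lambda>t. l + t" "\<lambda>t. m (l + t)"])
    show "(\<lambda>t. m (l + t)) holomorphic_on ball 0 r"
    proof -
      have "(\<lambda>t. l + t) holomorphic_on ball 0 r" by (intro holomorphic_intros)
      from holomorphic_on_compose_gen[OF this m(2)] show ?thesis using lt by (auto simp: o_def)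
    qed
    have "((\<lambda>t. l + t) has_field_derivative 1) (at 0)" by (auto intro!: derivative_eq_intros)
    then have "deriv (\<lambda>t. l + t) 0 = 1" by (rule DERIV_imp_deriv)
    then show "deriv (\<lambda>t. l + t) 0 \<noteq> 0 \<or> deriv (\<lambda>t. m (l + t)) 0 \<noteq> 0" by simp
  qed (use m lt in \<open>auto intro!: holomorphic_intros\<close>)
next
  case True
  have ad1: "a l * a l = 1" using det_1[OF l] cl True by simp
  have a0: "a l \<noteq> 0" using ad1 by auto
  have Dl: "\<Delta> l = 2 * a l" by (simp add: trace_2 True)
  have "(\<Delta> l)\<^sup>2 = 4" using ad1 by (simp add: Dl power2_eq_square)
  then have D': "deriv \<Delta> l \<noteq> 0" using reg l Dl by (simp add: singular_points_iff[OF trace_holomorphic])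
  obtain r where r: "0 < r" "ball l r \<subseteq> - {0}" "open (\<Delta> ` ball l r)" "inj_on \<Delta> (ball l r)"
    by (rule has_complex_derivative_locally_invertible[OF trace_holomorphic _ _ D']) (use l in \<open>auto simp: open_Compl\<close>)
  have hD: "\<Delta> holomorphic_on ball l r" by (rule holomorphic_on_subset[OF trace_holomorphic r(2)])
  obtain g where g: "g holomorphic_on \<Delta> ` ball l r" "\<And>z. z \<in> ball l r \<Longrightarrow> g (\<Delta> z) = z"
    by (rule holomorphic_has_inverse[OF hD open_ball r(4)]) (rule that)
  define \<kappa> where "\<kappa> t = (a l + t) + inverse (a l + t)" for t :: complex
  define B where "B = ball (0 :: complex) (cmod (a l))"
  have nz: "a l + t \<noteq> 0" if "t \<in> B" for t
    using that by (auto simp: B_def add_eq_0_iff2 dest!: arg_cong[where f = cmod])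
  have hk: "\<kappa> holomorphic_on B" unfolding \<kappa>_def[abs_def] using nz by (intro holomorphic_intros) auto
  have k0: "\<kappa> 0 = \<Delta> l" using ad1 a0 by (simp add: \<kappa>_def Dl field_simps)
  have "open (B \<inter> \<kappa> -` (\<Delta> ` ball l r))"
    by (rule continuous_open_preimage[OF holomorphic_on_imp_continuous_on[OF hk] _ r(3)]) (simp add: B_def)
  moreover have "0 \<in> B \<inter> \<kappa> -` (\<Delta> ` ball l r)" using k0 a0 r(1) by (auto simp: B_def)
  ultimately obtain s where s: "0 < s" "ball 0 s \<subseteq> B \<inter> \<kappa> -` (\<Delta> ` ball l r)" by (rule openE)
  show ?thesis
  proof (rule that[of s "\<lambda>t. g (\<kappa> t)" "\<lambda>t. a l + t"])
    show "(\<lambda>t. g (\<kappa> t)) holomorphic_on ball 0 s"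
      using holomorphic_on_compose_gen[OF holomorphic_on_subset[OF hk] g(1), of "ball 0 s"] s(2) by (auto simp: o_def)
    show "g (\<kappa> 0) = l" unfolding k0 using r(1) by (intro g(2)) simp
    have "((\<lambda>t :: complex. a l + t) has_field_derivative 1) (at 0)" by (auto intro!: derivative_eq_intros)
    then have "deriv (\<lambda>t :: complex. a l + t) 0 = 1" by (rule DERIV_imp_deriv)
    then show "deriv (\<lambda>t. g (\<kappa> t)) 0 \<noteq> 0 \<or> deriv (\<lambda>t :: complex. a l + t) 0 \<noteq> 0" by simp
    fix t :: complex assume t: "t \<in> ball 0 s"
    then obtain z where z: "z \<in> ball l r" "\<kappa> t = \<Delta> z" using s(2) by blast
    have "a l + t \<noteq> 0" using nz t s(2) by blast
    then have "(a l + t)\<^sup>2 - \<kappa> t * (a l + t) + 1 = 0" by (simp add: \<kappa>_def power2_eq_square field_simps)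
    then show "(g (\<kappa> t), a l + t) \<in> spectral_curve \<Delta>"
      using z g(2)[OF z(1)] r(2) by (auto simp: spectral_curve_def)
  qed (use s in \<open>auto intro!: holomorphic_intros\<close>)
qed

text \<open>The pole order is the same in all admissible parametrisations and at least one exists,
  so the definite description is meaningful at regular points.\<close>

lemma divisor_mult_eq:
  assumes l: "l \<in> Cstar_zeros c" and reg: "(l, a l) \<notin> singular_points \<Delta>"
  shows "divisor_mult M (l, a l) = zero_mult c l"
proof -
  have l': "l \<noteq> 0" "c l = 0" using l by (auto simp: Cstar_zeros_def)
  have order: "zorder (\<lambda>t. eigen_quotient M (\<phi> t, \<psi> t)) 0 = - zorder c l"
    if "0 < r" "\<phi> holomorphic_on ball 0 r" "\<psi> holomorphic_on ball 0 r" "(\<phi> 0, \<psi> 0) = (l, a l)"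
      "\<forall>t\<in>ball 0 r. (\<phi> t, \<psi> t) \<in> spectral_curve \<Delta>" "deriv \<phi> 0 \<noteq> 0 \<or> deriv \<psi> 0 \<noteq> 0" for r \<phi> \<psi>
    using that by (intro eigen_quotient_zorder[OF l' reg, of r]) auto
  show ?thesis
    unfolding divisor_mult_def
  proof (rule the_equality)
    obtain r \<phi> \<psi> where p: "0 < r" "\<phi> holomorphic_on ball 0 r" "\<psi> holomorphic_on ball 0 r" "\<phi> 0 = l" "\<psi> 0 = a l"
      "\<And>t. t \<in> ball 0 r \<Longrightarrow> (\<phi> t, \<psi> t) \<in> spectral_curve \<Delta>" "deriv \<phi> 0 \<noteq> 0 \<or> deriv \<psi> 0 \<noteq> 0"
      by (rule regular_parametrisation[OF l' reg]) (rule that)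
    show "\<exists>r \<phi> \<psi>. 0 < r \<and> \<phi> holomorphic_on ball 0 r \<and> \<psi> holomorphic_on ball 0 r \<and> (\<phi> 0, \<psi> 0) = (l, a l) \<and>
       (\<forall>t\<in>ball 0 r. (\<phi> t, \<psi> t) \<in> spectral_curve \<Delta>) \<and> (deriv \<phi> 0 \<noteq> 0 \<or> deriv \<psi> 0 \<noteq> 0) \<and>
       zero_mult c l = nat (- zorder (\<lambda>t. eigen_quotient M (\<phi> t, \<psi> t)) 0)"
      using p order[of r \<phi> \<psi>] unfolding zero_mult_def by (intro exI[of _ r] exI[of _ \<phi>] exI[of _ \<psi>]) simp
  next
    fix n
    assume "\<exists>r \<phi> \<psi>. 0 < r \<and> \<phi> holomorphic_on ball 0 r \<and> \<psi> holomorphic_on ball 0 r \<and> (\<phi> 0, \<psi> 0) = (l, a l) \<and>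
       (\<forall>t\<in>ball 0 r. (\<phi> t, \<psi> t) \<in> spectral_curve \<Delta>) \<and> (deriv \<phi> 0 \<noteq> 0 \<or> deriv \<psi> 0 \<noteq> 0) \<and>
       n = nat (- zorder (\<lambda>t. eigen_quotient M (\<phi> t, \<psi> t)) 0)"
    then show "n = zero_mult c l" unfolding zero_mult_def using order by force
  qed
qed

end

section \<open>The asymptotics of the spectral data\<close>

lemma monodromy_holomorphic_SL2:
  assumes P: "(u, uy) \<in> Pot"
  shows "holomorphic_SL2 (monodromy u uy)"
proof
  obtain l where "l \<noteq> 0" "monodromy u uy l $ 2 $ 1 \<noteq> 0" "discriminant u uy l \<noteq> 0"
    by (rule monodromy_nonvanishing[OF P])
  then show "\<exists>l. l \<noteq> 0 \<and> monodromy u uy l $ 2 $ 1 \<noteq> 0" "\<exists>l. l \<noteq> 0 \<and> (trace (monodromy u uy l))\<^sup>2 - 4 \<noteq> 0"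
    unfolding discriminant_def by blast+
qed (use monodromy_holomorphic[OF P] monodromy_det[OF P] in auto)

lemma zero_mult_conditions:
  assumes f: "f holomorphic_on (- {0})" and w: "w \<noteq> 0" "f w \<noteq> 0"
  shows "{l \<in> Cstar_zeros f. odd (zorder f l)} = {l \<in> Cstar_zeros f. odd (zero_mult f l)}"
    "{l \<in> Cstar_zeros f. 2 \<le> zorder f l} = {l \<in> Cstar_zeros f. 2 \<le> zero_mult f l}"
    "Cstar_zeros f = {l \<in> Cstar_zeros f. odd (zero_mult f l)} \<union> {l \<in> Cstar_zeros f. 2 \<le> zero_mult f l}"
proof -
  have n: "zorder f l = int (zero_mult f l) \<and> 0 < zero_mult f l" if "l \<in> Cstar_zeros f" for l
  proof -
    have l: "l \<noteq> 0" "f l = 0" using that by (auto simp: Cstar_zeros_def)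
    have "0 < zorder f l"
      using zorder_pos_iff'[OF analytic_at_punctured[OF f l(1)] frequently_nonzero_punctured(2)[OF f w l(1)]] l(2) by blast
    then show ?thesis by (simp add: zero_mult_def)
  qed
  have 1: "odd (zorder f l) \<longleftrightarrow> odd (zero_mult f l)" if "l \<in> Cstar_zeros f" for l
    using n[OF that] by (metis even_of_nat_iff)
  have 2: "2 \<le> zorder f l \<longleftrightarrow> 2 \<le> zero_mult f l" if "l \<in> Cstar_zeros f" for l
    using n[OF that] by linarith
  have 3: "odd (zero_mult f l) \<or> 2 \<le> zero_mult f l" if "l \<in> Cstar_zeros f" for l
  proof (cases "zero_mult f l = 1")
    case False
    then show ?thesis using n[OF that] by linarith
  qed simp
  show "{l \<in> Cstar_zeros f. odd (zorder f l)} = {l \<in> Cstar_zeros f. odd (zero_mult f l)}"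
    by (rule Collect_cong) (use 1 in blast)
  show "{l \<in> Cstar_zeros f. 2 \<le> zorder f l} = {l \<in> Cstar_zeros f. 2 \<le> zero_mult f l}"
    by (rule Collect_cong) (use 2 in blast)
  show "Cstar_zeros f = {l \<in> Cstar_zeros f. odd (zero_mult f l)} \<union> {l \<in> Cstar_zeros f. 2 \<le> zero_mult f l}"
    using 3 by blast
qed

text \<open>The asymptotics hold for every admissible enumeration, because the bound far out
  concerns each zero in \<open>S k\<close>, whichever index carries it.\<close>

lemma discriminant_part:
  assumes P: "(u, uy) \<in> Pot"
  defines "f \<equiv> discriminant u uy" and "\<Delta> \<equiv> \<lambda>l. trace (monodromy u uy l)"
  shows "asymptotically_and_totally 2 (Cstar_zeros f) (zero_mult f) (\<lambda>l. l)"
    and "Cstar_zeros f = fst ` branch_points \<Delta> \<union> fst ` singular_points \<Delta>"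
    and "fst ` branch_points \<Delta> = {l \<in> Cstar_zeros f. odd (zero_mult f l)}"
    and "fst ` singular_points \<Delta> = {l \<in> Cstar_zeros f. zero_mult f l \<ge> 2}"
    and "\<exists>\<kappa>. zeros_enumeration f \<kappa>"
    and "\<And>\<kappa> \<nu>. zeros_enumeration f \<kappa> \<Longrightarrow> \<nu> \<in> {1, 2} \<Longrightarrow> (\<lambda>k. \<kappa> k \<nu> - lambda0 k) \<in> ell2 (-1) 3"
proof -
  obtain N :: nat where N:
    "\<And>k. int N < \<bar>k\<bar> \<Longrightarrow> exactly 2 {z \<in> Cstar_zeros f. z \<in> S k} (zero_mult f)"
    "exactly (2 * (2 * N + 1)) {z \<in> Cstar_zeros f. z \<in> (\<Union>k\<in>{- int N..int N}. S k)} (zero_mult f)"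
    "\<And>l j k. f l = 0 \<Longrightarrow> l \<noteq> 0 \<Longrightarrow> int N < \<bar>k\<bar> \<Longrightarrow> l \<in> S k \<Longrightarrow> l \<in> S j \<Longrightarrow> j = k"
    by (rule discriminant_zeros_counted[OF P, folded f_def]) (rule that)
  show "asymptotically_and_totally 2 (Cstar_zeros f) (zero_mult f) (\<lambda>l. l)"
    unfolding asymptotically_and_totally_def using N(1,2) by blast
  have hol: "f holomorphic_on (- {0})" unfolding f_def by (rule discriminant_holomorphic[OF P])
  have holD: "\<Delta> holomorphic_on (- {0})" unfolding \<Delta>_def trace_2
    by (intro holomorphic_intros monodromy_holomorphic[OF P])
  obtain w where w: "w \<noteq> 0" "f w \<noteq> 0" by (rule monodromy_nonvanishing[OF P, folded f_def]) (rule that)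
  have fD: "f = (\<lambda>l. (\<Delta> l)\<^sup>2 - 4)" by (simp add: f_def discriminant_def[abs_def] \<Delta>_def)
  have w': "(\<Delta> w)\<^sup>2 - 4 \<noteq> 0" using w(2) unfolding fD .
  note zm = zero_mult_conditions[OF hol w]
  show B: "fst ` branch_points \<Delta> = {l \<in> Cstar_zeros f. odd (zero_mult f l)}"
    using fst_branch_points[OF holD w(1) w', folded fD] zm(1) by (rule trans)
  show Sg: "fst ` singular_points \<Delta> = {l \<in> Cstar_zeros f. zero_mult f l \<ge> 2}"
    using fst_singular_points[OF holD w(1) w', folded fD] zm(2) by (rule trans)
  show "Cstar_zeros f = fst ` branch_points \<Delta> \<union> fst ` singular_points \<Delta>"
    unfolding B Sg by (rule zm(3))
  show "\<exists>\<kappa>. zeros_enumeration f \<kappa>"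
  proof -
    have e: "{i \<in> UNIV \<times> {1, 2 :: nat}. fst i = k} = {(k, 1), (k, 2)}" for k :: int by auto
    have I: "finite {i \<in> UNIV \<times> {1, 2 :: nat}. fst i = k}" "card {i \<in> UNIV \<times> {1, 2 :: nat}. fst i = k} = 2" for k :: int
      unfolding e by simp_all
    have cover: "\<exists>k. z \<in> S k" if "z \<in> Cstar_zeros f" for z using that by (auto simp: Cstar_zeros_def intro: S_total)
    have unique: "j = k" if "z \<in> Cstar_zeros f" "int N < \<bar>k\<bar>" "z \<in> S k" "z \<in> S j" for z j k
      using N(3)[of z k j] that by (simp add: Cstar_zeros_def)
    obtain x :: "int \<times> nat \<Rightarrow> complex" where x: "enumerates (UNIV \<times> {1, 2}) x (Cstar_zeros f) (zero_mult f)"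
      "\<And>i. i \<in> UNIV \<times> {1, 2} \<Longrightarrow> int N < \<bar>fst i\<bar> \<Longrightarrow> x i \<in> S (fst i)"
      by (rule enumeration_exists[where coord = "\<lambda>l. l", OF I N(1,2) unique cover]; (assumption | rule that))
    have "zeros_enumeration f (\<lambda>k \<nu>. x (k, \<nu>))"
      unfolding zeros_enumeration_def
    proof (intro conjI exI[of _ N] allI impI ballI)
      show "enumerates (UNIV \<times> {1, 2}) (\<lambda>(k, \<nu>). x (k, \<nu>)) (Cstar_zeros f) (zero_mult f)" using x(1) by simp
      show "x (k, \<nu>) \<in> S k" if "int N < \<bar>k\<bar>" "\<nu> \<in> {1, 2}" for k \<nu> using x(2)[of "(k, \<nu>)"] that by simp
    qed
    then show ?thesis by blast
  qed
  obtain K :: nat and q :: "int \<Rightarrow> real" where q: "(\<lambda>k. (q k)\<^sup>2) summable_on {0<..}"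
    "\<And>l k. int K < \<bar>k\<bar> \<Longrightarrow> l \<in> S k \<Longrightarrow> monodromy u uy l $ 2 $ 1 = 0 \<or> discriminant u uy l = 0 \<Longrightarrow>
      cmod (of_int k powi (if 0 < k then -1 else 3) * (l - lambda0 k)) \<le> q \<bar>k\<bar> \<and>
      cmod (monodromy u uy l $ 1 $ 1 - mu0 k) \<le> q \<bar>k\<bar>"
    by (rule monodromy_zero_bounds[OF P]) (rule that)
  show "(\<lambda>k. \<kappa> k \<nu> - lambda0 k) \<in> ell2 (-1) 3" if e: "zeros_enumeration f \<kappa>" "\<nu> \<in> {1, 2}" for \<kappa> \<nu>
  proof -
    obtain K' :: nat where K': "\<And>k. int K' < \<bar>k\<bar> \<Longrightarrow> \<kappa> k \<nu> \<in> S k" using e unfolding zeros_enumeration_def by blast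
    have sub: "(\<lambda>(k, \<nu>). \<kappa> k \<nu>) ` (UNIV \<times> {1, 2}) \<subseteq> Cstar_zeros f"
      using e(1) unfolding zeros_enumeration_def enumerates_def by (elim conjE)
    have "\<kappa> k \<nu> \<in> Cstar_zeros f" for k
      using subsetD[OF sub imageI, of "(k, \<nu>)"] e(2) by simp
    then have z: "discriminant u uy (\<kappa> k \<nu>) = 0" for k by (simp add: Cstar_zeros_def f_def)
    show ?thesis
    proof (rule ell2I[OF q(1), of "max K K'"])
      fix k :: int assume "int (max K K') < \<bar>k\<bar>"
      then show "cmod (of_int k powi (if 0 < k then -1 else 3) * (\<kappa> k \<nu> - lambda0 k)) \<le> q \<bar>k\<bar>"
        using conjunct1[OF q(2)[OF _ K' disjI2[OF z]], of k] by simp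
    qed
  qed
qed

text \<open>The support is the graph of \<open>a\<close> over the zeros of \<open>c\<close>, and
  regularity makes the multiplicities agree. The eigenvalue is therefore \<open>a\<close> at the
  zero, whose distance to \<open>mu0 k\<close> was bounded together with the location.\<close>

lemma divisor_part:
  assumes P: "(u, uy) \<in> Pot"
  defines "M \<equiv> monodromy u uy"
  assumes reg: "divisor_support M \<inter> singular_points (\<lambda>l. trace (M l)) = {}"
  shows "asymptotically_and_totally 1 (divisor_support M) (divisor_mult M) fst"
    and "\<exists>p. divisor_enumeration M p"
    and "\<And>p. divisor_enumeration M p \<Longrightarrow> (\<lambda>k. fst (p k) - lambda0 k) \<in> ell2 (-1) 3 \<and> (\<lambda>k. snd (p k) - mu0 k) \<in> ell2 0 0"
proof -
  interpret holomorphic_SL2 M unfolding M_def by (rule monodromy_holomorphic_SL2[OF P])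
  obtain N :: nat where N:
    "\<And>k. int N < \<bar>k\<bar> \<Longrightarrow> exactly 1 {z \<in> Cstar_zeros c. z \<in> S k} (zero_mult c)"
    "exactly (1 * (2 * N + 1)) {z \<in> Cstar_zeros c. z \<in> (\<Union>k\<in>{- int N..int N}. S k)} (zero_mult c)"
    "\<And>l j k. c l = 0 \<Longrightarrow> l \<noteq> 0 \<Longrightarrow> int N < \<bar>k\<bar> \<Longrightarrow> l \<in> S k \<Longrightarrow> l \<in> S j \<Longrightarrow> j = k"
    by (rule lower_left_zeros_counted[OF P, folded M_def]) (rule that)
  have mult: "divisor_mult M (l, a l) = zero_mult c l" if "l \<in> Cstar_zeros c" for l
    using reg that by (intro divisor_mult_eq) (auto simp: divisor_support_eq)
  have ex: "exactly m {z \<in> divisor_support M. fst z \<in> A} (divisor_mult M)"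
    if "exactly m {z \<in> Cstar_zeros c. z \<in> A} (zero_mult c)" for m A
  proof -
    have e: "{z \<in> divisor_support M. fst z \<in> A} = (\<lambda>l. (l, a l)) ` {z \<in> Cstar_zeros c. z \<in> A}"
      unfolding divisor_support_eq by auto
    have "inj_on (\<lambda>l. (l, a l)) X" for X by (auto intro: inj_onI)
    then have "(\<Sum>z\<in>{z \<in> divisor_support M. fst z \<in> A}. divisor_mult M z) = (\<Sum>l | l \<in> Cstar_zeros c \<and> l \<in> A. zero_mult c l)"
      unfolding e by (subst sum.reindex) (auto simp: mult)
    then show ?thesis using that unfolding exactly_def by (simp add: e)
  qed
  show "asymptotically_and_totally 1 (divisor_support M) (divisor_mult M) fst"
    unfolding asymptotically_and_totally_def using ex[OF N(1)] ex[OF N(2)] by blast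
  show "\<exists>p. divisor_enumeration M p"
  proof -
    obtain x where x: "enumerates UNIV x (divisor_support M) (divisor_mult M)"
      "\<And>i. i \<in> UNIV \<Longrightarrow> int N < \<bar>i\<bar> \<Longrightarrow> fst (x i) \<in> S i"
    proof (rule enumeration_exists[where I = "UNIV :: int set" and \<pi> = "\<lambda>i. i" and m = 1 and coord = fst])
      show "\<exists>k. fst z \<in> S k" if "z \<in> divisor_support M" for z
        using that unfolding divisor_support_eq by (auto simp: Cstar_zeros_def intro: S_total)
      show "j = k" if "z \<in> divisor_support M" "int N < \<bar>k\<bar>" "fst z \<in> S k" "fst z \<in> S j" for z j k
        using N(3)[of "fst z" k j] that unfolding divisor_support_eq by (auto simp: Cstar_zeros_def)
    qed (use ex[OF N(1)] ex[OF N(2)] in auto)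
    have "divisor_enumeration M x"
      unfolding divisor_enumeration_def using x by blast
    then show ?thesis by blast
  qed
  obtain K :: nat and q :: "int \<Rightarrow> real" where q: "(\<lambda>k. (q k)\<^sup>2) summable_on {0<..}"
    "\<And>l k. int K < \<bar>k\<bar> \<Longrightarrow> l \<in> S k \<Longrightarrow> monodromy u uy l $ 2 $ 1 = 0 \<or> discriminant u uy l = 0 \<Longrightarrow>
      cmod (of_int k powi (if 0 < k then -1 else 3) * (l - lambda0 k)) \<le> q \<bar>k\<bar> \<and>
      cmod (monodromy u uy l $ 1 $ 1 - mu0 k) \<le> q \<bar>k\<bar>"
    by (rule monodromy_zero_bounds[OF P]) (rule that)
  show "(\<lambda>k. fst (p k) - lambda0 k) \<in> ell2 (-1) 3 \<and> (\<lambda>k. snd (p k) - mu0 k) \<in> ell2 0 0"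
    if e: "divisor_enumeration M p" for p
  proof -
    obtain K' :: nat where K': "\<And>k. int K' < \<bar>k\<bar> \<Longrightarrow> fst (p k) \<in> S k" using e unfolding divisor_enumeration_def by blast
    have memb: "p k \<in> divisor_support M" for k
      using e unfolding divisor_enumeration_def enumerates_def by (elim conjE) (erule subsetD, simp)
    have "fst (p k) \<in> Cstar_zeros c \<and> snd (p k) = a (fst (p k))" for k
    proof -
      obtain l where "l \<in> Cstar_zeros c" "p k = (l, a l)" using memb[of k] unfolding divisor_support_eq by blast
      then show ?thesis by simp
    qed
    then have z: "monodromy u uy (fst (p k)) $ 2 $ 1 = 0" and sp: "snd (p k) = monodromy u uy (fst (p k)) $ 1 $ 1" for k
      by (auto simp: Cstar_zeros_def M_def)
    have bd: "cmod (of_int k powi (if 0 < k then -1 else 3) * (fst (p k) - lambda0 k)) \<le> q \<bar>k\<bar> \<and>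
        cmod (snd (p k) - mu0 k) \<le> q \<bar>k\<bar>" if "int (max K K') < \<bar>k\<bar>" for k
      using q(2)[OF _ K' disjI1[OF z], of k] that by (simp add: sp)
    show ?thesis
    proof
      show "(\<lambda>k. fst (p k) - lambda0 k) \<in> ell2 (-1) 3"
        by (rule ell2I[OF q(1), of "max K K'"]) (use bd in blast)
      show "(\<lambda>k. snd (p k) - mu0 k) \<in> ell2 0 0"
      proof (rule ell2I[OF q(1), of "max K K'"])
        fix k :: int assume "int (max K K') < \<bar>k\<bar>"
        then show "cmod (of_int k powi (if 0 < k then 0 else 0) * (snd (p k) - mu0 k)) \<le> q \<bar>k\<bar>"
          using bd[of k] by simp
      qed
    qed
  qed
qed

theorem theorem3p2:
  fixes u uy :: "real \<Rightarrow> complex"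
    and M :: "complex \<Rightarrow> complex^2^2"
    and \<Delta> f :: "complex \<Rightarrow> complex"
  assumes "(u, uy) \<in> Pot"
    and "M = monodromy u uy"
    and "\<Delta> = (\<lambda>l. trace (M l))"
    and "f = (\<lambda>l. (\<Delta> l)\<^sup>2 - 4)"
    and "divisor_support M \<inter> singular_points \<Delta> = {}"
  shows "(asymptotically_and_totally 2 (Cstar_zeros f) (zero_mult f) (\<lambda>l. l) \<and>
          Cstar_zeros f = fst ` branch_points \<Delta> \<union> fst ` singular_points \<Delta> \<and>
          fst ` branch_points \<Delta> = {l \<in> Cstar_zeros f. odd (zero_mult f l)} \<and>
          fst ` singular_points \<Delta> = {l \<in> Cstar_zeros f. zero_mult f l \<ge> 2} \<and>
          (\<exists>\<kappa>. zeros_enumeration f \<kappa>) \<and>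
          (\<forall>\<kappa>. zeros_enumeration f \<kappa> \<longrightarrow>
             (\<forall>\<nu>\<in>{1, 2}. (\<lambda>k. \<kappa> k \<nu> - lambda0 k) \<in> ell2 (-1) 3)))
       \<and> (asymptotically_and_totally 1 (divisor_support M) (divisor_mult M) fst \<and>
          (\<exists>p. divisor_enumeration M p) \<and>
          (\<forall>p. divisor_enumeration M p \<longrightarrow>
             (\<lambda>k. fst (p k) - lambda0 k) \<in> ell2 (-1) 3 \<and>
             (\<lambda>k. snd (p k) - mu0 k) \<in> ell2 0 0))"
proof -
  have f: "f = discriminant u uy" by (simp add: assms(2-4) discriminant_def[abs_def])
  have D: "\<Delta> = (\<lambda>l. trace (monodromy u uy l))" by (simp add: assms(2,3))
  have reg: "divisor_support (monodromy u uy) \<inter> singular_points (\<lambda>l. trace (monodromy u uy l)) = {}"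
    using assms(5) by (simp add: assms(2) D)
  show ?thesis
    unfolding assms(2) f D
    by (intro conjI allI impI ballI discriminant_part[OF assms(1)] divisor_part[OF assms(1) reg]
        conjunct1[OF divisor_part(3)[OF assms(1) reg]] conjunct2[OF divisor_part(3)[OF assms(1) reg]])
qed

end
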